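(* Let $Y=y-y_I$ and $\eta=u-U$ be as in the context. Then \[ \mathcal{I}\bigl(\langle Y',\mathcal{I}^{1-\alpha}Y'\rangle\bigr)(T)+\mathcal{I}\bigl(\langle\mathcal{A}Y,\mathcal{I}^\alpha\mathcal{A}Y'\rangle\bigr)(T)\le C\tau^{1+\alpha}\|\eta\|_{L^2(J)}^2. \]
   Context: $\Omega\subset\mathbb{R}^d$ ($d\le3$) convex polyhedron, $0<\alpha<1$, $\kappa\in W^{1,\infty}(\Omega)$, $\kappa\ge\kappa_{\min}>0$, $\mathcal{A}w=-\nabla\cdot(\kappa\nabla w)$ with homogeneous Dirichlet conditions. $\mathcal{I}g(t)=\int_0^tg(s)\,ds$, $\omega_\beta(t)=t^{\beta-1}/\Gamma(\beta)$, $\mathcal{I}^\beta v(t)=\int_0^t\omega_\beta(t-s)v(s)\,ds$, $(\mathcal{J}_T^\beta w)(t)=\int_t^T\omega_\beta(s-t)w(s)\,ds$, $\partial_t^\alpha v=\mathcal{I}^{1-\alpha}v'$. $\langle\cdot,\cdot\rangle$, $\|\cdot\|$: $L^2(\Omega)$ inner product and norm; $J=(0,T)$, $\|w\|_{L^2(J)}^2=\int_0^T\|w\|^2dt$. $u$ solves $\partial_t^\alpha u+\mathcal{A}u=f$ on $\Omega\times(0,T]$, $u=0$ on $\partial\Omega$, $u(0)=u_0$. Time mesh $t_n=(n\tau)^\gamma$, $0\le n\le N$, $\tau=T^{1/\gamma}/N$, $\gamma\ge1$, $\tau_n=t_n-t_{n-1}$, $I_n=(t_{n-1},t_n)$. $U$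 is continuous, linear in $t$ on each $\overline{I_n}$, $U(0)=u_0$, with $\frac{1}{\tau_n}\int_{I_n}\partial_t^\alpha U\,dt+\mathcal{A}\tfrac12(U(t_n)+U(t_{n-1}))=\tau_n^{-1}\int_{I_n}f\,dt$; $\eta=u-U$. $\varphi$ solves $-(\mathcal{J}_T^{1-\alpha}\varphi)'+\mathcal{A}\varphi=\eta$ on $(0,T)$, $\varphi(T)=0$, with homogeneous Dirichlet conditions; $y(t)=\varphi(0)+\int_0^t\varphi(s)ds$, $y_I$ is the continuous piecewise-linear interpolant of $y$ at the nodes $t_j$, $Y=y-y_I$. $C$ is a generic constant bounded for $0<\alpha\le1$, independent of $N,\tau$. *)

theory Defs
  imports "HOL-Analysis.Analysis"
begin

definition L2 :: "'d::euclidean_space set \<Rightarrow> ('d \<Rightarrow> real) \<Rightarrow> bool" where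
  "L2 \<Omega> v \<longleftrightarrow> set_borel_measurable lebesgue \<Omega> v \<and>
     set_integrable lebesgue \<Omega> (\<lambda>x. (v x)\<^sup>2)"

definition l2_inner :: "'d::euclidean_space set \<Rightarrow> ('d \<Rightarrow> real) \<Rightarrow> ('d \<Rightarrow> real) \<Rightarrow> real" where
  "l2_inner \<Omega> v w = (LINT x:\<Omega>|lebesgue. v x * w x)"

definition l2_norm :: "'d::euclidean_space set \<Rightarrow> ('d \<Rightarrow> real) \<Rightarrow> real" where
  "l2_norm \<Omega> v = sqrt (LINT x:\<Omega>|lebesgue. (v x)\<^sup>2)"

definition Linf :: "'d::euclidean_space set \<Rightarrow> ('d \<Rightarrow> real) \<Rightarrow> bool" where
  "Linf \<Omega> v \<longleftrightarrow> set_borel_measurable lebesgue \<Omega> v \<and>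
     (\<exists>B. AE x in lebesgue. x \<in> \<Omega> \<longrightarrow> \<bar>v x\<bar> \<le> B)"

definition test_fun :: "'d::euclidean_space set \<Rightarrow> ('d \<Rightarrow> real) \<Rightarrow> ('d \<Rightarrow> 'd) \<Rightarrow> bool" where
  "test_fun \<Omega> \<psi> D\<psi> \<longleftrightarrow>
     (\<forall>x. (\<psi> has_derivative (\<lambda>h. D\<psi> x \<bullet> h)) (at x)) \<and> continuous_on UNIV D\<psi> \<and>
     compact (closure {x. \<psi> x \<noteq> 0}) \<and> closure {x. \<psi> x \<noteq> 0} \<subseteq> \<Omega>"

definition loc_int :: "'d::euclidean_space set \<Rightarrow> ('d \<Rightarrow> 'b::{banach,second_countable_topology}) \<Rightarrow> bool" where
  "loc_int \<Omega> w \<longleftrightarrow> (\<forall>K. compact K \<and> K \<subseteq> \<Omega> \<longrightarrow> set_integrable lebesgue K w)"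

definition weak_grad :: "'d::euclidean_space set \<Rightarrow> ('d \<Rightarrow> real) \<Rightarrow> ('d \<Rightarrow> 'd) \<Rightarrow> bool" where
  "weak_grad \<Omega> w G \<longleftrightarrow> loc_int \<Omega> w \<and> loc_int \<Omega> G \<and>
     (\<forall>\<psi> D\<psi>. test_fun \<Omega> \<psi> D\<psi> \<longrightarrow>
        (LINT x:\<Omega>|lebesgue. w x *\<^sub>R D\<psi> x) = - (LINT x:\<Omega>|lebesgue. \<psi> x *\<^sub>R G x))"

definition weak_div :: "'d::euclidean_space set \<Rightarrow> ('d \<Rightarrow> 'd) \<Rightarrow> ('d \<Rightarrow> real) \<Rightarrow> bool" where
  "weak_div \<Omega> F g \<longleftrightarrow> loc_int \<Omega> F \<and> loc_int \<Omega> g \<and>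
     (\<forall>\<psi> D\<psi>. test_fun \<Omega> \<psi> D\<psi> \<longrightarrow>
        (LINT x:\<Omega>|lebesgue. F x \<bullet> D\<psi> x) = - (LINT x:\<Omega>|lebesgue. \<psi> x * g x))"

definition W1inf :: "'d::euclidean_space set \<Rightarrow> ('d \<Rightarrow> real) \<Rightarrow> bool" where
  "W1inf \<Omega> w \<longleftrightarrow> Linf \<Omega> w \<and>
     (\<exists>G. weak_grad \<Omega> w G \<and> (\<forall>i\<in>Basis. Linf \<Omega> (\<lambda>x. G x \<bullet> i)))"

definition H10 :: "'d::euclidean_space set \<Rightarrow> ('d \<Rightarrow> real) \<Rightarrow> bool" where
  "H10 \<Omega> w \<longleftrightarrow> L2 \<Omega> w \<and>
     (\<exists>G. weak_grad \<Omega> w G \<and> (\<forall>i\<in>Basis. L2 \<Omega> (\<lambda>x. G x \<bullet> i)) \<and>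
        (\<exists>\<psi>s D\<psi>s. (\<forall>k::nat. test_fun \<Omega> (\<psi>s k) (D\<psi>s k)) \<and>
           ((\<lambda>k. (LINT x:\<Omega>|lebesgue. (\<psi>s k x - w x)\<^sup>2)
                + (LINT x:\<Omega>|lebesgue. (norm (D\<psi>s k x - G x))\<^sup>2)) \<longlonglongrightarrow> 0)))"

(* opA Omega kappa w g  :<=>  w \<in> D(A) and A w = g, where A w = - div (kappa grad w)
   with homogeneous Dirichlet conditions (w \<in> H^1_0, A w \<in> L^2) *)
definition opA :: "'d::euclidean_space set \<Rightarrow> ('d \<Rightarrow> real) \<Rightarrow> ('d \<Rightarrow> real) \<Rightarrow> ('d \<Rightarrow> real) \<Rightarrow> bool" where
  "opA \<Omega> \<kappa> w g \<longleftrightarrow> H10 \<Omega> w \<and> L2 \<Omega> g \<and>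
     (\<exists>G. weak_grad \<Omega> w G \<and> weak_div \<Omega> (\<lambda>x. \<kappa> x *\<^sub>R G x) (\<lambda>x. - g x))"

definition ae_eq :: "'d::euclidean_space set \<Rightarrow> ('d \<Rightarrow> real) \<Rightarrow> ('d \<Rightarrow> real) \<Rightarrow> bool" where
  "ae_eq \<Omega> v w \<longleftrightarrow> (AE x in lebesgue. x \<in> \<Omega> \<longrightarrow> v x = w x)"

definition omega :: "real \<Rightarrow> real \<Rightarrow> real" where
  "omega \<beta> t = t powr (\<beta> - 1) / Gamma \<beta>"

definition frac_I :: "real \<Rightarrow> (real \<Rightarrow> 'd \<Rightarrow> real) \<Rightarrow> real \<Rightarrow> 'd \<Rightarrow> real" where
  "frac_I \<beta> v t = (\<lambda>x. LINT s:{0..t}|lborel. omega \<beta> (t - s) * v s x)"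

definition frac_J :: "real \<Rightarrow> real \<Rightarrow> (real \<Rightarrow> 'd \<Rightarrow> real) \<Rightarrow> real \<Rightarrow> 'd \<Rightarrow> real" where
  "frac_J T \<beta> w t = (\<lambda>x. LINT s:{t..T}|lborel. omega \<beta> (s - t) * w s x)"

definition int0 :: "(real \<Rightarrow> real) \<Rightarrow> real \<Rightarrow> real" where
  "int0 g t = (LINT s:{0..t}|lborel. g s)"

definition has_l2_deriv :: "'d::euclidean_space set \<Rightarrow> real set \<Rightarrow> (real \<Rightarrow> 'd \<Rightarrow> real) \<Rightarrow> ('d \<Rightarrow> real) \<Rightarrow> real \<Rightarrow> bool" where
  "has_l2_deriv \<Omega> D v dv t \<longleftrightarrow> L2 \<Omega> dv \<and>
     (\<forall>\<^sub>F h in at 0 within {h. t + h \<in> D}. L2 \<Omega> (\<lambda>x. (v (t + h) x - v t x) / h)) \<and>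
     ((\<lambda>h. l2_norm \<Omega> (\<lambda>x. (v (t + h) x - v t x) / h - dv x)) \<longlongrightarrow> 0)
        (at 0 within {h. t + h \<in> D})"

definition l2_cont_on :: "'d::euclidean_space set \<Rightarrow> real set \<Rightarrow> (real \<Rightarrow> 'd \<Rightarrow> real) \<Rightarrow> bool" where
  "l2_cont_on \<Omega> D v \<longleftrightarrow> (\<forall>t\<in>D. L2 \<Omega> (v t) \<and>
     ((\<lambda>s. l2_norm \<Omega> (\<lambda>x. v s x - v t x)) \<longlongrightarrow> 0) (at t within D))"

definition st_meas :: "(real \<Rightarrow> 'd::euclidean_space \<Rightarrow> real) \<Rightarrow> bool" where
  "st_meas v \<longleftrightarrow> (\<lambda>p. v (fst p) (snd p)) \<in> borel_measurable borel"

definition mesh_tau :: "real \<Rightarrow> real \<Rightarrow> nat \<Rightarrow> real" where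
  "mesh_tau T \<gamma> N = T powr (1 / \<gamma>) / real N"

definition tnode :: "real \<Rightarrow> real \<Rightarrow> nat \<Rightarrow> nat \<Rightarrow> real" where
  "tnode T \<gamma> N n = (real n * mesh_tau T \<gamma> N) powr \<gamma>"

definition interp :: "real \<Rightarrow> real \<Rightarrow> nat \<Rightarrow> (real \<Rightarrow> 'd \<Rightarrow> real) \<Rightarrow> real \<Rightarrow> 'd \<Rightarrow> real" where
  "interp T \<gamma> N v t = (\<lambda>x.
     (let n = (LEAST n. 1 \<le> n \<and> t \<le> tnode T \<gamma> N n);
          a = tnode T \<gamma> N (n - 1); b = tnode T \<gamma> N n
      in ((b - t) * v a x + (t - a) * v b x) / (b - a)))"

end

theory Submission
  imports Defs
begin

text \<open>
  All estimates take place on the time axis, pointwise in the space variable, except for one stability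
  bound. Let \<open>k\<close> be the mesh width. On each mesh interval \<open>Y'\<close> is \<open>\<phi>\<close> minus its mean, so \<open>Y'\<close> and
  \<open>\<A> Y'\<close> have vanishing means. For such a function \<open>v\<close> the kernel of \<open>\<I>\<^sup>\<beta>\<close> may be replaced by
  its differences with the values at left endpoints, and Young's inequality gives
  \<open>\<parallel>\<I>\<^sup>\<beta> v\<parallel> \<le> m\<^sub>\<beta> \<parallel>v\<parallel>\<close> with \<open>m\<^sub>\<beta> = 2 k\<^sup>\<beta> / \<Gamma>(\<beta> + 1)\<close>. The dual equation reads
  \<open>\<phi> = \<J>\<^sub>T\<^sup>\<alpha> \<psi>\<close> with \<open>\<psi> = \<eta> - \<A> \<phi>\<close>, hence \<open>\<parallel>Y'\<parallel>\<^sup>2 = \<langle>\<phi>, Y'\<rangle> = \<langle>\<psi>, \<I>\<^sup>\<alpha> Y'\<rangle>\<close>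
  and \<open>\<parallel>Y'\<parallel> \<le> m\<^sub>\<alpha> \<parallel>\<psi>\<parallel>\<close>; so the first term is at most \<open>m\<close> at \<open>1 - \<alpha>\<close> times
  \<open>m\<^sub>\<alpha>\<^sup>2 \<parallel>\<psi>\<parallel>\<^sup>2\<close>. As \<open>Y\<close> vanishes at the nodes, \<open>\<parallel>\<A> Y\<parallel> \<le> k \<parallel>\<A> Y'\<parallel>\<close>, and the second term
  is at most \<open>k m\<^sub>\<alpha> \<parallel>\<A> \<phi>\<parallel>\<^sup>2\<close>. Both constants are of order \<open>k\<^sup>1\<^sup>+\<^sup>\<alpha>\<close>. The stability bound
  \<open>\<parallel>\<A> \<phi>\<parallel> \<le> \<parallel>\<eta>\<parallel>\<close> is an energy argument for the increments of \<open>z(t) = \<integral>\<^sub>0\<^sup>t \<phi>\<close>: since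
  the fractional kernel is decreasing, testing the increment of the equation with \<open>\<A>\<close> applied to the
  increment of \<open>z\<close> leaves a nonnegative term, and one lets the increment tend to zero.
\<close>

section \<open>Square-integrable functions\<close>

text \<open>The hypotheses describe the operator separately at each time, as a relation between
  functions: measurability in time of \<open>A \<phi>\<close>, closedness or an inverse of
  \<open>A\<close>, and a time derivative of \<phi> are not at hand. This shapes the argument. The
  operator enters only through linearity, symmetry, nonnegativity and density of its domain, and an
  identity A v = f is obtained by testing with elements of the domain. The dual equation is used in
  integrated form: \<open>F + E\<close>, with \<open>F\<close> the backward fractional integral of
  \<phi> and \<open>E\<close> the primitive of \<eta>, is A z up to a constant in time, and its
  increments replace derivatives. Freezing the space variable requires jointly measurable
  representatives; hence \<open>A \<phi>\<close> is replaced by a function assembled from A Y' and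
  means over mesh intervals. Uniformity in \<alpha> comes from integrating the kernel: the factor
  1/\<beta> is absorbed into Gamma(\<beta> + 1), so Gamma is evaluated only at \<alpha> + 1 and 2 -
  \<alpha>, both in [1,2].\<close>

definition sq_int :: "'a measure \<Rightarrow> ('a \<Rightarrow> real) \<Rightarrow> bool" where
  "sq_int M v \<longleftrightarrow> v \<in> borel_measurable M \<and> integrable M (\<lambda>x. (v x)\<^sup>2)"

lemma sq_int_integrable: "sq_int M v \<Longrightarrow> integrable M (\<lambda>x. (v x)\<^sup>2)"
  by (simp add: sq_int_def)

lemma sq_int_iff_nn:
  "sq_int M v \<longleftrightarrow> v \<in> borel_measurable M \<and> (\<integral>\<^sup>+x. ennreal ((v x)\<^sup>2) \<partial>M) < \<infinity>"
  by (auto simp: sq_int_def integrable_iff_bounded)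

lemma nn_integral_sq_int:
  "sq_int M v \<Longrightarrow> (\<integral>\<^sup>+x. ennreal ((v x)\<^sup>2) \<partial>M) = ennreal (\<integral>x. (v x)\<^sup>2 \<partial>M)"
  by (intro nn_integral_eq_integral) (auto simp: sq_int_def)

lemma sq_int_mult:
  assumes "sq_int M v" "sq_int M w"
  shows "integrable M (\<lambda>x. v x * w x)"
proof (rule Bochner_Integration.integrable_bound[where f="\<lambda>x. (v x)\<^sup>2 + (w x)\<^sup>2"])
  show "integrable M (\<lambda>x. (v x)\<^sup>2 + (w x)\<^sup>2)" "(\<lambda>x. v x * w x) \<in> borel_measurable M"
    using assms by (auto simp: sq_int_def)
  have "\<bar>v x * w x\<bar> \<le> (v x)\<^sup>2 + (w x)\<^sup>2" for x
    using sum_squares_bound[of "\<bar>v x\<bar>" "\<bar>w x\<bar>"] mult_nonneg_nonneg[of "\<bar>v x\<bar>" "\<bar>w x\<bar>"]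
    unfolding abs_mult power2_abs by linarith
  then show "AE x in M. norm (v x * w x) \<le> norm ((v x)\<^sup>2 + (w x)\<^sup>2)"
    by auto
qed

lemma sq_int_scale:
  assumes "sq_int M v" shows "sq_int M (\<lambda>x. c * v x)"
  using assms by (auto simp: sq_int_def power_mult_distrib)

lemma sq_int_add:
  assumes "sq_int M v" "sq_int M w"
  shows "sq_int M (\<lambda>x. v x + w x)"
proof -
  have "(\<lambda>x. (v x + w x)\<^sup>2) = (\<lambda>x. (v x)\<^sup>2 + 2 * (v x * w x) + (w x)\<^sup>2)"
    by (auto simp: power2_eq_square algebra_simps)
  then show ?thesis
    using assms sq_int_mult[OF assms] by (auto simp: sq_int_def)
qed

lemma sq_int_diff:
  assumes "sq_int M v" "sq_int M w"
  shows "sq_int M (\<lambda>x. v x - w x)"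
  using sq_int_add[OF assms(1) sq_int_scale[OF assms(2), of "-1"]] by simp

lemma sq_int_zero [simp]: "sq_int M (\<lambda>x. 0)"
  by (simp add: sq_int_def)

lemma sq_int_cong_AE:
  assumes "sq_int M v" "w \<in> borel_measurable M" "AE x in M. v x = w x"
  shows "sq_int M w"
proof -
  have "integrable M (\<lambda>x. (w x)\<^sup>2)"
    using assms by (subst integrable_cong_AE[where g="\<lambda>x. (v x)\<^sup>2"]) (auto simp: sq_int_def)
  then show ?thesis using assms by (simp add: sq_int_def)
qed

lemma nn_Cauchy_Schwarz:
  assumes [measurable]: "f \<in> borel_measurable M" "g \<in> borel_measurable M"
  shows "(\<integral>\<^sup>+x. ennreal \<bar>f x * g x\<bar> \<partial>M)\<^sup>2
    \<le> (\<integral>\<^sup>+x. ennreal ((f x)\<^sup>2) \<partial>M) * (\<integral>\<^sup>+x. ennreal ((g x)\<^sup>2) \<partial>M)"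
  using Cauchy_Schwarz_nn_integral[of "\<lambda>x. ennreal \<bar>f x\<bar>" M "\<lambda>x. ennreal \<bar>g x\<bar>"]
  by (simp add: abs_mult ennreal_mult ennreal_power)

lemma sq_int_Cauchy_Schwarz:
  assumes "sq_int M v" "sq_int M w"
  shows "(\<integral>x. v x * w x \<partial>M)\<^sup>2 \<le> (\<integral>x. (v x)\<^sup>2 \<partial>M) * (\<integral>x. (w x)\<^sup>2 \<partial>M)"
proof -
  have "ennreal \<bar>\<integral>x. v x * w x \<partial>M\<bar> \<le> (\<integral>\<^sup>+x. ennreal \<bar>v x * w x\<bar> \<partial>M)"
    using integral_norm_bound_ennreal[OF sq_int_mult[OF assms]] by simp
  then have "(ennreal \<bar>\<integral>x. v x * w x \<partial>M\<bar>)\<^sup>2 \<le> (\<integral>\<^sup>+x. ennreal \<bar>v x * w x\<bar> \<partial>M)\<^sup>2"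
    by (intro power_mono) auto
  also have "\<dots> \<le> (\<integral>\<^sup>+x. ennreal ((v x)\<^sup>2) \<partial>M) * (\<integral>\<^sup>+x. ennreal ((w x)\<^sup>2) \<partial>M)"
    using assms by (intro nn_Cauchy_Schwarz) (auto simp: sq_int_def)
  also have "\<dots> = ennreal ((\<integral>x. (v x)\<^sup>2 \<partial>M) * (\<integral>x. (w x)\<^sup>2 \<partial>M))"
    by (simp add: nn_integral_sq_int assms ennreal_mult)
  finally show ?thesis
    by (simp add: ennreal_power)
qed

text \<open>Cauchy-Schwarz for the splitting of |k v| into sqrt |k| and sqrt |k| |v|, so that only
  the mass of the weight \<open>k\<close> and not its square enters; the fractional kernel need not
  be square integrable.\<close>

lemma square_integral_weight_le:
  fixes k v :: "real \<Rightarrow> real"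
  assumes [measurable]: "k \<in> borel_measurable M" "v \<in> borel_measurable M"
  shows "(\<integral>\<^sup>+s. ennreal \<bar>k s * v s\<bar> \<partial>M)\<^sup>2
    \<le> (\<integral>\<^sup>+s. ennreal \<bar>k s\<bar> \<partial>M) * (\<integral>\<^sup>+s. ennreal (\<bar>k s\<bar> * (v s)\<^sup>2) \<partial>M)"
  using nn_Cauchy_Schwarz[of "\<lambda>s. sqrt \<bar>k s\<bar>" M "\<lambda>s. sqrt \<bar>k s\<bar> * v s"]
  by (simp add: power_mult_distrib abs_mult mult.assoc[symmetric])

lemma nn_integral_shift:
  assumes "f \<in> borel_measurable borel"
  shows "(\<integral>\<^sup>+x. f (x - c) \<partial>lborel) = (\<integral>\<^sup>+x. f x \<partial>(lborel :: real measure))"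
  using nn_integral_real_affine[of f 1 "- c"] assms by simp

text \<open>Young's inequality for L1 * L2: the weighted Cauchy-Schwarz inequality at each
  \<open>t\<close>, then Tonelli. With nonnegative integrals no convergence has to be checked
  beforehand.\<close>

lemma Young_L2:
  fixes k v :: "real \<Rightarrow> real"
  assumes [measurable]: "k \<in> borel_measurable borel" "v \<in> borel_measurable borel"
  shows "(\<integral>\<^sup>+t. (\<integral>\<^sup>+s. ennreal \<bar>k (t - s) * v s\<bar> \<partial>lborel)\<^sup>2 \<partial>lborel)
    \<le> (\<integral>\<^sup>+r. ennreal \<bar>k r\<bar> \<partial>lborel)\<^sup>2 * (\<integral>\<^sup>+s. ennreal ((v s)\<^sup>2) \<partial>lborel)"
proof -
  let ?K = "\<integral>\<^sup>+r. ennreal \<bar>k r\<bar> \<partial>lborel"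
  have refl: "(\<integral>\<^sup>+s. ennreal \<bar>k (t - s)\<bar> \<partial>lborel) = ?K" for t
    using nn_integral_real_affine[of "\<lambda>r. ennreal \<bar>k r\<bar>" "-1" t] by simp
  have "(\<integral>\<^sup>+t. (\<integral>\<^sup>+s. ennreal \<bar>k (t - s) * v s\<bar> \<partial>lborel)\<^sup>2 \<partial>lborel)
    \<le> (\<integral>\<^sup>+t. ?K * (\<integral>\<^sup>+s. ennreal (\<bar>k (t - s)\<bar> * (v s)\<^sup>2) \<partial>lborel) \<partial>lborel)"
  proof (intro nn_integral_mono)
    fix t :: real
    show "(\<integral>\<^sup>+s. ennreal \<bar>k (t - s) * v s\<bar> \<partial>lborel)\<^sup>2
      \<le> ?K * (\<integral>\<^sup>+s. ennreal (\<bar>k (t - s)\<bar> * (v s)\<^sup>2) \<partial>lborel)"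
      using square_integral_weight_le[of "\<lambda>s. k (t - s)" lborel v] by (simp add: refl)
  qed
  also have "\<dots> = ?K * (\<integral>\<^sup>+t. (\<integral>\<^sup>+s. ennreal (\<bar>k (t - s)\<bar> * (v s)\<^sup>2) \<partial>lborel) \<partial>lborel)"
    by (intro nn_integral_cmult) measurable
  also have "(\<integral>\<^sup>+t. (\<integral>\<^sup>+s. ennreal (\<bar>k (t - s)\<bar> * (v s)\<^sup>2) \<partial>lborel) \<partial>lborel)
     = (\<integral>\<^sup>+s. (\<integral>\<^sup>+t. ennreal (\<bar>k (t - s)\<bar> * (v s)\<^sup>2) \<partial>lborel) \<partial>lborel)"
    by (rule lborel_pair.Fubini') measurable
  also have "\<dots> = (\<integral>\<^sup>+s. ?K * ennreal ((v s)\<^sup>2) \<partial>lborel)"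
  proof (intro nn_integral_cong)
    fix s :: real
    have "(\<integral>\<^sup>+t. ennreal (\<bar>k (t - s)\<bar> * (v s)\<^sup>2) \<partial>lborel)
       = (\<integral>\<^sup>+t. ennreal \<bar>k (t - s)\<bar> \<partial>lborel) * ennreal ((v s)\<^sup>2)"
      by (subst nn_integral_multc[symmetric]) (auto simp: ennreal_mult)
    then show "(\<integral>\<^sup>+t. ennreal (\<bar>k (t - s)\<bar> * (v s)\<^sup>2) \<partial>lborel) = ?K * ennreal ((v s)\<^sup>2)"
      by (simp add: nn_integral_shift[of "\<lambda>r. ennreal \<bar>k r\<bar>"])
  qed
  also have "\<dots> = ?K * (\<integral>\<^sup>+s. ennreal ((v s)\<^sup>2) \<partial>lborel)"
    by (intro nn_integral_cmult) measurable
  finally show ?thesis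
    by (simp add: power2_eq_square mult.assoc)
qed

section \<open>The kernel of the fractional integral\<close>

text \<open>Setting the kernel to zero for r \<le> 0 turns both the forward and the backward
  fractional integral into convolutions over the whole line, where translation invariance and Fubini
  apply directly.\<close>

definition fker :: "real \<Rightarrow> real \<Rightarrow> real" where
  "fker \<beta> r = (if 0 < r then omega \<beta> r else 0)"

lemma fker_measurable [measurable]: "fker \<beta> \<in> borel_measurable borel"
  unfolding fker_def omega_def by measurable

lemma fker_nonneg: "0 < \<beta> \<Longrightarrow> 0 \<le> fker \<beta> r"
  by (simp add: fker_def omega_def Gamma_real_pos less_imp_le)

lemma fker_antimono:
  assumes "0 < \<beta>" "\<beta> < 1" "0 < r" "r \<le> s"
  shows "fker \<beta> s \<le> fker \<beta> r"
  using assms by (auto simp: fker_def omega_def Gamma_real_pos intro!: divide_right_mono powr_mono2' less_imp_le[OF Gamma_real_pos])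

text \<open>The fractional integral of the constant 1, that is, the primitive of the kernel
  vanishing at 0.\<close>

definition fker_int :: "real \<Rightarrow> real \<Rightarrow> real" where
  "fker_int \<beta> r = r powr \<beta> / Gamma (\<beta> + 1)"

lemma fker_has_integral:
  assumes "0 < \<beta>" "0 \<le> r"
  shows "has_bochner_integral lborel (\<lambda>s. fker \<beta> s * indicator {..r} s) (fker_int \<beta> r)"
proof -
  have G: "Gamma \<beta> > 0" using assms by (simp add: Gamma_real_pos)
  have "((\<lambda>x. x powr (\<beta> - 1)) has_integral (r powr (\<beta> - 1 + 1) / (\<beta> - 1 + 1))) {0..r}"
    using assms by (intro has_integral_powr_from_0) auto
  then have "((\<lambda>x. x powr (\<beta> - 1) / Gamma \<beta>) has_integral (r powr \<beta> / \<beta> / Gamma \<beta>)) {0..r}"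
    using has_integral_divide[of "\<lambda>x. x powr (\<beta> - 1)" "r powr \<beta> / \<beta>" _ "Gamma \<beta>"] by simp
  moreover have "Gamma (\<beta> + 1) = \<beta> * Gamma \<beta>"
    using assms by (intro Gamma_plus1) (auto elim!: nonpos_Ints_cases)
  ultimately have I: "((\<lambda>x. x powr (\<beta> - 1) / Gamma \<beta>) has_integral fker_int \<beta> r) {0..r}"
    by (simp add: fker_int_def)
  have "(\<integral>\<^sup>+x. ennreal (x powr (\<beta> - 1) / Gamma \<beta> * indicator {0..r} x) \<partial>lborel)
     = (\<integral>\<^sup>+x. ennreal (x powr (\<beta> - 1) / Gamma \<beta>) * indicator {0..r} x \<partial>lborel)"
    by (intro nn_integral_cong) (auto simp: indicator_def)
  also have "\<dots> = ennreal (fker_int \<beta> r)"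
    using nn_integral_has_integral_lebesgue'[OF _ I] G by (simp add: nn_integral_completion)
  finally have "(\<integral>\<^sup>+x. ennreal (x powr (\<beta> - 1) / Gamma \<beta> * indicator {0..r} x) \<partial>lborel) = ennreal (fker_int \<beta> r)" .
  moreover have "x powr (\<beta> - 1) / Gamma \<beta> * indicator {0..r} x = fker \<beta> x * indicator {..r} x" for x
    by (auto simp: fker_def omega_def indicator_def)
  ultimately have "(\<integral>\<^sup>+x. ennreal (fker \<beta> x * indicator {..r} x) \<partial>lborel) = ennreal (fker_int \<beta> r)"
    by (simp only:)
  moreover have "0 \<le> fker_int \<beta> r"
    unfolding fker_int_def using assms by (intro divide_nonneg_pos Gamma_real_pos) auto
  ultimately show ?thesis
    using fker_nonneg assms by (intro has_bochner_integral_nn_integral) auto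
qed

lemma fker_int_nonneg: "0 < \<beta> \<Longrightarrow> 0 \<le> fker_int \<beta> r"
  unfolding fker_int_def by (intro divide_nonneg_pos Gamma_real_pos) auto

lemma fker_int_mono: "0 < \<beta> \<Longrightarrow> 0 \<le> r \<Longrightarrow> r \<le> s \<Longrightarrow> fker_int \<beta> r \<le> fker_int \<beta> s"
  unfolding fker_int_def by (intro divide_right_mono powr_mono2 less_imp_le[OF Gamma_real_pos]) auto

text \<open>Sublinear growth of r powr \<beta> for \<beta> < 1; this is what keeps the mass of the
  oscillation kernel at the order of a single mesh width.\<close>

lemma fker_int_double:
  assumes "0 < \<beta>" "\<beta> < 1" "0 \<le> r"
  shows "fker_int \<beta> (2 * r) \<le> 2 * fker_int \<beta> r"
proof -
  have "2 powr \<beta> \<le> 2 powr (1::real)"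
    using assms by (intro powr_mono) auto
  then have "(2 * r) powr \<beta> \<le> 2 * r powr \<beta>"
    using assms by (simp add: powr_mult mult_right_mono)
  then show ?thesis
    using divide_right_mono[of "(2 * r) powr \<beta>" "2 * r powr \<beta>" "Gamma (\<beta> + 1)"] assms
      Gamma_real_pos[of "\<beta> + 1"] by (simp add: fker_int_def)
qed

lemma fker_has_integral_Ioc:
  assumes "0 < \<beta>" "0 \<le> a" "a \<le> b"
  shows "has_bochner_integral lborel (\<lambda>s. fker \<beta> s * indicator {a<..b} s) (fker_int \<beta> b - fker_int \<beta> a)"
proof -
  have "(\<lambda>s. fker \<beta> s * indicator {a<..b} s) = (\<lambda>s. fker \<beta> s * indicator {..b} s - fker \<beta> s * indicator {..a} s)"
    using assms by (auto simp: indicator_def)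
  then show ?thesis
    using has_bochner_integral_diff[OF fker_has_integral[of \<beta> b] fker_has_integral[of \<beta> a]] assms by simp
qed

text \<open>A majorant of the kernel seen by functions whose mean vanishes on each interval of a mesh of width \<open>k\<close>.\<close>

definition fker_osc :: "real \<Rightarrow> real \<Rightarrow> real \<Rightarrow> real \<Rightarrow> real" where
  "fker_osc \<beta> k R r =
     fker \<beta> r * indicator {..k} r + (fker \<beta> r - fker \<beta> (r + k)) * indicator {k<..R} r"

lemma fker_osc_measurable [measurable]: "fker_osc \<beta> k R \<in> borel_measurable borel"
  unfolding fker_osc_def by measurable

lemma fker_osc_nonneg: "0 < \<beta> \<Longrightarrow> \<beta> < 1 \<Longrightarrow> 0 < k \<Longrightarrow> 0 \<le> fker_osc \<beta> k R r"
  using fker_nonneg[of \<beta> r] fker_antimono[of \<beta> r "r + k"] by (auto simp: fker_osc_def indicator_def)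

text \<open>With K = \<open>fker_int \<beta>\<close> the differences telescope: the integral is K(R)
  - K(R + k) + K(2 k), at most K(2 k) and hence at most 2 K(k). The bound does not depend on the
  range \<open>R\<close>.\<close>

lemma fker_osc_nn_integral:
  assumes "0 < \<beta>" "\<beta> < 1" "0 < k" "k \<le> R"
  shows "(\<integral>\<^sup>+r. ennreal \<bar>fker_osc \<beta> k R r\<bar> \<partial>lborel) \<le> ennreal (2 * fker_int \<beta> k)"
proof -
  have 1: "has_bochner_integral lborel (\<lambda>s. fker \<beta> s * indicator {k<..R} s) (fker_int \<beta> R - fker_int \<beta> k)"
    using assms by (intro fker_has_integral_Ioc) auto
  have "has_bochner_integral lborel (\<lambda>s. fker \<beta> s * indicator {2*k<..R+k} s) (fker_int \<beta> (R+k) - fker_int \<beta> (2*k))"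
    using assms by (intro fker_has_integral_Ioc) auto
  then have "has_bochner_integral lborel (\<lambda>s. fker \<beta> (k + s) * indicator {2*k<..R+k} (k + s)) (fker_int \<beta> (R+k) - fker_int \<beta> (2*k))"
    using lborel_has_bochner_integral_real_affine_iff[of 1 "\<lambda>s. fker \<beta> s * indicator {2*k<..R+k} s" _ k] by simp
  then have 2: "has_bochner_integral lborel (\<lambda>s. fker \<beta> (s + k) * indicator {k<..R} s) (fker_int \<beta> (R+k) - fker_int \<beta> (2*k))"
    by (rule has_bochner_integral_cong[THEN iffD1, rotated -1]) (auto simp: indicator_def add.commute)
  have 3: "has_bochner_integral lborel (\<lambda>s. fker \<beta> s * indicator {..k} s) (fker_int \<beta> k)"
    using assms by (intro fker_has_integral) auto
  have "has_bochner_integral lborel (fker_osc \<beta> k R)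
    (fker_int \<beta> k + ((fker_int \<beta> R - fker_int \<beta> k) - (fker_int \<beta> (R+k) - fker_int \<beta> (2*k))))"
    unfolding fker_osc_def[abs_def] left_diff_distrib
    by (intro has_bochner_integral_add has_bochner_integral_diff 1 2 3)
  then have "(\<integral>\<^sup>+r. ennreal \<bar>fker_osc \<beta> k R r\<bar> \<partial>lborel)
     = ennreal (fker_int \<beta> k + ((fker_int \<beta> R - fker_int \<beta> k) - (fker_int \<beta> (R+k) - fker_int \<beta> (2*k))))"
    using nn_integral_eq_integral[of lborel "fker_osc \<beta> k R"] fker_osc_nonneg[of \<beta> k R] assms
    by (auto simp: has_bochner_integral_iff)
  also have "\<dots> \<le> ennreal (2 * fker_int \<beta> k)"
    using fker_int_mono[of \<beta> R "R+k"] fker_int_double[of \<beta> k] assms by (intro ennreal_leI) auto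
  finally show ?thesis .
qed

section \<open>Functions with vanishing mean on the intervals of a mesh\<close>

text \<open>The grading of the mesh matters only through the upper bound \<open>k\<close> on the
  interval lengths.\<close>

locale time_mesh =
  fixes tn :: "nat \<Rightarrow> real" and N :: nat and k T :: real
  assumes tn_0: "tn 0 = 0" and tn_N: "tn N = T"
    and tn_less: "n < N \<Longrightarrow> tn n < tn (Suc n)"
    and tn_width: "n < N \<Longrightarrow> tn (Suc n) - tn n \<le> k"
    and N_pos: "0 < N"
begin

lemma tn_mono: "i \<le> j \<Longrightarrow> j \<le> N \<Longrightarrow> tn i \<le> tn j"
proof (induction j)
  case (Suc j)
  then show ?case using tn_less[of j] by (cases "i = Suc j") auto
qed simp

lemma tn_nonneg: "i \<le> N \<Longrightarrow> 0 \<le> tn i" and tn_le_T: "i \<le> N \<Longrightarrow> tn i \<le> T"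
  using tn_mono[of 0 i] tn_mono[of i N] by (auto simp: tn_0 tn_N)

lemma T_pos: "0 < T"
  using tn_less[of 0] tn_le_T[of 1] N_pos by (simp add: tn_0)

lemma k_pos: "0 < k"
  using tn_less[of 0] tn_width[of 0] N_pos by simp

lemma mesh_cover_upto: "0 \<le> t \<Longrightarrow> t < tn m \<Longrightarrow> m \<le> N \<Longrightarrow> \<exists>n<m. tn n \<le> t \<and> t < tn (Suc n)"
proof (induction m)
  case (Suc m)
  then show ?case by (cases "t < tn m") (auto intro: less_SucI)
qed (simp add: tn_0)

lemma mesh_cover: "0 \<le> t \<Longrightarrow> t < T \<Longrightarrow> \<exists>n<N. tn n \<le> t \<and> t < tn (Suc n)"
  using mesh_cover_upto[of t N] by (simp add: tn_N)

text \<open>The variant with intervals closed on the right includes t = T and puts \<open>t\<close>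
  strictly after the left node, so that the kernel is never evaluated at its singularity in a left
  endpoint.\<close>

lemma mesh_cover_Ioc:
  assumes "0 < t" "t \<le> T"
  shows "\<exists>n<N. tn n < t \<and> t \<le> tn (Suc n)"
proof -
  have "\<exists>n<m. tn n < t \<and> t \<le> tn (Suc n)" if "t \<le> tn m" "m \<le> N" for m
    using that assms
  proof (induction m)
    case (Suc m)
    then show ?case by (cases "t \<le> tn m") (auto intro: less_SucI)
  qed (simp add: tn_0)
  then show ?thesis using assms by (auto simp: tn_N)
qed

lemma mesh_disjoint:
  assumes "tn i \<le> t" "t < tn (Suc i)" "tn j \<le> t" "t < tn (Suc j)" "i < N" "j < N"
  shows "i = j"
proof (rule ccontr)
  assume "i \<noteq> j"
  then consider "Suc i \<le> j" | "Suc j \<le> i" by linarith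
  then show False using assms tn_mono[of "Suc i" j] tn_mono[of "Suc j" i] by cases auto
qed

text \<open>Subtracting from the kernel on each full interval before \<open>t\<close> its value at the left endpoint
  does not change the integral.\<close>

lemma fractional_integral_mean_zero_le:
  fixes v :: "real \<Rightarrow> real"
  assumes \<beta>: "0 < \<beta>" "\<beta> < 1" and v: "integrable lborel v"
    and supp: "\<And>t. t \<notin> {0..T} \<Longrightarrow> v t = 0"
    and mean: "\<And>n. n < N \<Longrightarrow> (\<integral>s. v s * indicator {tn n..<tn (Suc n)} s \<partial>lborel) = 0"
    and t: "t \<in> {0<..T}"
  shows "ennreal \<bar>\<integral>s. fker \<beta> (t - s) * v s \<partial>lborel\<bar>
    \<le> (\<integral>\<^sup>+s. ennreal \<bar>fker_osc \<beta> k (T + k) (t - s) * v s\<bar> \<partial>lborel)"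
proof (cases "integrable lborel (\<lambda>s. fker \<beta> (t - s) * v s)")
  case True
  have [measurable]: "v \<in> borel_measurable borel" using borel_measurable_integrable[OF v] by simp
  obtain n where n: "n < N" "tn n < t" "t \<le> tn (Suc n)"
    using mesh_cover_Ioc[of t] t by auto
  \<comment> \<open>The subtracted function is constant on each full interval before
    \<open>t\<close>, so it is annihilated by \<open>v\<close>; on the interval containing
    \<open>t\<close> nothing is subtracted.\<close>
  define c where "c s = (\<Sum>j<n. fker \<beta> (t - tn j) * indicator {tn j..<tn (Suc j)} s)" for s
  have ind: "integrable lborel (\<lambda>s. v s * indicator {tn j..<tn (Suc j)} s)" for j
    using integrable_real_mult_indicator[OF _ v] by simp
  have cv: "c s * v s = (\<Sum>j<n. fker \<beta> (t - tn j) * (v s * indicator {tn j..<tn (Suc j)} s))" for s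
    unfolding c_def sum_distrib_right by (intro sum.cong refl) (simp add: mult.assoc mult.commute[of "v s"])
  have ci: "integrable lborel (\<lambda>s. c s * v s)"
    unfolding cv by (intro Bochner_Integration.integrable_sum integrable_mult_right ind)
  have "(\<integral>s. c s * v s \<partial>lborel) = (\<Sum>j<n. fker \<beta> (t - tn j) * (\<integral>s. v s * indicator {tn j..<tn (Suc j)} s \<partial>lborel))"
    unfolding cv by (simp add: ind)
  also have "\<dots> = 0" using mean n by (intro sum.neutral) auto
  finally have c0: "(\<integral>s. c s * v s \<partial>lborel) = 0" .
  have "(\<integral>s. fker \<beta> (t - s) * v s \<partial>lborel) = (\<integral>s. fker \<beta> (t - s) * v s - c s * v s \<partial>lborel)"
    using True ci c0 by simp
  then have "ennreal \<bar>\<integral>s. fker \<beta> (t - s) * v s \<partial>lborel\<bar>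
    \<le> (\<integral>\<^sup>+s. ennreal \<bar>fker \<beta> (t - s) * v s - c s * v s\<bar> \<partial>lborel)"
    using integral_norm_bound_ennreal[OF Bochner_Integration.integrable_diff[OF True ci]] by simp
  also have "\<dots> \<le> (\<integral>\<^sup>+s. ennreal \<bar>fker_osc \<beta> k (T + k) (t - s) * v s\<bar> \<partial>lborel)"
  proof (intro nn_integral_mono ennreal_leI)
    fix s
    \<comment> \<open>In the interval of \<open>t\<close> the lag is at most \<open>k\<close> and
      the full kernel remains. Earlier, the left endpoint gives a lag between t - s and t - s + k,
      so monotonicity bounds the difference by the kernel minus its shift by
      \<open>k\<close>.\<close>
    have "\<bar>fker \<beta> (t - s) - c s\<bar> \<le> fker_osc \<beta> k (T + k) (t - s)" if s: "s \<in> {0..T}"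
    proof (cases "tn n \<le> s")
      case True
      have "c s = 0" unfolding c_def
        proof (intro sum.neutral ballI)
        fix j assume "j \<in> {..<n}"
        then have "tn (Suc j) \<le> s" using True n tn_mono[of "Suc j" n] by simp
        then show "fker \<beta> (t - tn j) * indicator {tn j..<tn (Suc j)} s = 0" by simp
      qed
      moreover have "t - s \<le> k" using True n tn_width[of n] by auto
      ultimately show ?thesis using fker_nonneg[of \<beta> "t - s"] \<beta> by (simp add: fker_osc_def)
    next
      case False
      then obtain j where j: "j < n" "tn j \<le> s" "s < tn (Suc j)"
        using mesh_cover_upto[of s n] s n by auto
      have "c s = (\<Sum>i<n. if i = j then fker \<beta> (t - tn j) else 0)"
        unfolding c_def
      proof (intro sum.cong refl)
        fix i assume "i \<in> {..<n}"
        then have "i = j" if "tn i \<le> s" "s < tn (Suc i)"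
          using mesh_disjoint[OF that j(2,3)] j n by simp
        then show "fker \<beta> (t - tn i) * indicator {tn i..<tn (Suc i)} s = (if i = j then fker \<beta> (t - tn j) else 0)"
          using j by (cases "i = j") (auto simp: indicator_def)
      qed
      then have c: "c s = fker \<beta> (t - tn j)" using j by simp
      have st: "s < t" using False n by simp
      have "fker \<beta> (t - tn j) \<le> fker \<beta> (t - s)"
        using j st \<beta> by (intro fker_antimono) auto
      moreover have "fker \<beta> (t - s + k) \<le> fker \<beta> (t - tn j)"
        using j n st \<beta> tn_width[of j] by (intro fker_antimono) auto
      moreover have "0 \<le> fker \<beta> (t - tn j)" using fker_nonneg \<beta> by simp
      moreover have "t - s \<le> T + k" using s t k_pos by auto
      ultimately show ?thesis unfolding c fker_osc_def by (auto simp: indicator_def)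
    qed
    then have "\<bar>fker \<beta> (t - s) - c s\<bar> * \<bar>v s\<bar> \<le> fker_osc \<beta> k (T + k) (t - s) * \<bar>v s\<bar>"
      using supp[of s] by (cases "s \<in> {0..T}") (auto intro: mult_right_mono)
    then show "\<bar>fker \<beta> (t - s) * v s - c s * v s\<bar> \<le> \<bar>fker_osc \<beta> k (T + k) (t - s) * v s\<bar>"
      using fker_osc_nonneg[of \<beta> k "T + k" "t - s"] \<beta> k_pos
      by (simp add: abs_mult left_diff_distrib[symmetric])
  qed
  finally show ?thesis .
next
  \<comment> \<open>A Bochner integral that does not converge has the value 0, for which the bound
    is trivial.\<close>
  case False
  then show ?thesis by (simp add: not_integrable_integral_eq)
qed

lemma integrable_of_sq_int_supp:
  assumes "sq_int lborel v" "\<And>t. t \<notin> {0..T} \<Longrightarrow> v t = 0"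
  shows "integrable lborel (v :: real \<Rightarrow> real)"
proof -
  have "sq_int lborel (indicator {0..T} :: real \<Rightarrow> real)"
    by (auto simp: sq_int_def power2_eq_square indicator_inter_arith[symmetric] emeasure_lborel_Icc_eq intro!: integrable_real_indicator)
  from sq_int_mult[OF assms(1) this] show ?thesis
  proof -
    have "(\<lambda>x. v x * indicator {0..T} x) = v" using assms(2) by (auto simp: indicator_def fun_eq_iff)
    then show "integrable lborel (\<lambda>x. v x * indicator {0..T} x) \<Longrightarrow> integrable lborel v" by simp
  qed
qed

text \<open>Young's inequality with the oscillation kernel instead of the full one: vanishing means
  gain the factor \<open>k\<close> powr \<beta>.\<close>

lemma fractional_integral_mean_zero:
  fixes v :: "real \<Rightarrow> real"
  assumes \<beta>: "0 < \<beta>" "\<beta> < 1" and v: "sq_int lborel v"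
    and supp: "\<And>t. t \<notin> {0..T} \<Longrightarrow> v t = 0"
    and mean: "\<And>n. n < N \<Longrightarrow> (\<integral>s. v s * indicator {tn n..<tn (Suc n)} s \<partial>lborel) = 0"
  shows "(\<integral>\<^sup>+t. ennreal ((indicator {0..T} t * (\<integral>s. fker \<beta> (t - s) * v s \<partial>lborel))\<^sup>2) \<partial>lborel)
    \<le> ennreal ((2 * fker_int \<beta> k)\<^sup>2) * (\<integral>\<^sup>+s. ennreal ((v s)\<^sup>2) \<partial>lborel)"
proof -
  have vi: "integrable lborel v" by (rule integrable_of_sq_int_supp[OF v supp])
  have [measurable]: "v \<in> borel_measurable borel" using borel_measurable_integrable[OF vi] by simp
  have "(\<integral>\<^sup>+t. ennreal ((indicator {0..T} t * (\<integral>s. fker \<beta> (t - s) * v s \<partial>lborel))\<^sup>2) \<partial>lborel)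
    \<le> (\<integral>\<^sup>+t. (\<integral>\<^sup>+s. ennreal \<bar>fker_osc \<beta> k (T + k) (t - s) * v s\<bar> \<partial>lborel)\<^sup>2 \<partial>lborel)"
  proof (intro nn_integral_mono_AE)
    have "AE t in lborel. (t::real) \<noteq> 0" by (rule AE_lborel_singleton)
    then show "AE t in lborel. ennreal ((indicator {0..T} t * (\<integral>s. fker \<beta> (t - s) * v s \<partial>lborel))\<^sup>2)
      \<le> (\<integral>\<^sup>+s. ennreal \<bar>fker_osc \<beta> k (T + k) (t - s) * v s\<bar> \<partial>lborel)\<^sup>2"
    proof eventually_elim
      case (elim t)
      show ?case
      proof (cases "t \<in> {0..T}")
        case True
        then have "ennreal \<bar>\<integral>s. fker \<beta> (t - s) * v s \<partial>lborel\<bar>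
           \<le> (\<integral>\<^sup>+s. ennreal \<bar>fker_osc \<beta> k (T + k) (t - s) * v s\<bar> \<partial>lborel)"
          using elim by (intro fractional_integral_mean_zero_le[OF \<beta> vi supp mean]) auto
        then have "(ennreal \<bar>\<integral>s. fker \<beta> (t - s) * v s \<partial>lborel\<bar>)\<^sup>2
           \<le> (\<integral>\<^sup>+s. ennreal \<bar>fker_osc \<beta> k (T + k) (t - s) * v s\<bar> \<partial>lborel)\<^sup>2"
          by (intro power_mono) auto
        then show ?thesis using True by (simp add: ennreal_power)
      qed simp
    qed
  qed
  also have "\<dots> \<le> (\<integral>\<^sup>+r. ennreal \<bar>fker_osc \<beta> k (T + k) r\<bar> \<partial>lborel)\<^sup>2 * (\<integral>\<^sup>+s. ennreal ((v s)\<^sup>2) \<partial>lborel)"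
    by (rule Young_L2) measurable
  \<comment> \<open>The range T + k, rather than T, is taken because \<open>k\<close> is only an
    upper bound on the widths and may exceed \<open>T\<close>, whereas the mass bound asks for k
    \<le> R.\<close>
  also have "\<dots> \<le> (ennreal (2 * fker_int \<beta> k))\<^sup>2 * (\<integral>\<^sup>+s. ennreal ((v s)\<^sup>2) \<partial>lborel)"
    using fker_osc_nn_integral[of \<beta> k "T + k"] \<beta> k_pos T_pos by (intro mult_right_mono power_mono) auto
  finally show ?thesis
    using fker_int_nonneg[of \<beta> k] \<beta> by (simp add: ennreal_power)
qed

end

section \<open>Inversion of the Abel integral\<close>

lemma Beta_half_sum: "0 < \<alpha> \<Longrightarrow> \<alpha> < 1 \<Longrightarrow> Beta \<alpha> (1 - \<alpha>) = Gamma \<alpha> * Gamma (1 - \<alpha> :: real)"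
  by (simp add: Beta_def)

text \<open>The kernels of orders \<alpha> and 1 - \<alpha> convolve to the kernel of order 1. The
  substitution r = t + (s - t) x leaves the Beta integral, and the powers of s - t cancel against
  the Jacobian.\<close>

lemma fker_convolution:
  assumes \<alpha>: "0 < \<alpha>" "\<alpha> < 1" and ts: "t < s"
  shows "has_bochner_integral lborel (\<lambda>r. fker \<alpha> (r - t) * fker (1 - \<alpha>) (s - r)) 1"
proof -
  let ?g = "\<lambda>x::real. x powr (\<alpha> - 1) * (1 - x) powr (1 - \<alpha> - 1)"
  let ?G = "Gamma \<alpha> * Gamma (1 - \<alpha>)"
  have G: "?G > 0" using \<alpha> by (simp add: Gamma_real_pos)
  have "(?g has_integral Beta \<alpha> (1 - \<alpha>)) {0..1}"
    using \<alpha> by (intro has_integral_Beta_real) auto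
  then have I: "(?g has_integral ?G) {0..1}" using \<alpha> by (simp add: Beta_half_sum)
  have "(\<integral>\<^sup>+x. ennreal (indicator {0..1} x * ?g x) \<partial>lborel) = (\<integral>\<^sup>+x. ennreal (?g x) * indicator {0..1} x \<partial>lborel)"
    by (intro nn_integral_cong) (auto simp: indicator_def)
  also have "\<dots> = ennreal ?G"
    using nn_integral_has_integral_lebesgue'[OF _ I] by (simp add: nn_integral_completion)
  finally have "(\<integral>\<^sup>+x. ennreal (indicator {0..1} x * ?g x) \<partial>lborel) = ennreal ?G" .
  then have "has_bochner_integral lborel (\<lambda>x. indicator {0..1} x * ?g x) ?G"
    using G by (intro has_bochner_integral_nn_integral) auto
  then have "has_bochner_integral lborel (\<lambda>x. inverse ((s - t) * ?G) * (indicator {0..1} x * ?g x))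
      (inverse ((s - t) * ?G) * ?G)"
    by (rule has_bochner_integral_mult_right)
  also have "inverse ((s - t) * ?G) * ?G = 1 /\<^sub>R \<bar>s - t\<bar>"
    using less_imp_neq[OF G] ts by (simp add: field_simps)
  also have "(\<lambda>x. inverse ((s - t) * ?G) * (indicator {0..1} x * ?g x))
    = (\<lambda>x. fker \<alpha> ((t + (s - t) * x) - t) * fker (1 - \<alpha>) (s - (t + (s - t) * x)))"
  proof
    fix x :: real
    have e: "s - (t + (s - t) * x) = (s - t) * (1 - x)" by (simp add: algebra_simps)
    show "inverse ((s - t) * ?G) * (indicator {0..1} x * ?g x)
      = fker \<alpha> ((t + (s - t) * x) - t) * fker (1 - \<alpha>) (s - (t + (s - t) * x))"
    proof (cases "0 < x \<and> x < 1")
      case True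
      then have "((s - t) * x) powr (\<alpha> - 1) * ((s - t) * (1 - x)) powr (1 - \<alpha> - 1)
        = ((s - t) powr (\<alpha> - 1) * (s - t) powr (1 - \<alpha> - 1)) * ?g x"
        using ts by (simp add: powr_mult)
      also have "(s - t) powr (\<alpha> - 1) * (s - t) powr (1 - \<alpha> - 1) = inverse (s - t)"
        using ts by (subst powr_add[symmetric]) (simp add: powr_minus)
      finally show ?thesis
        using True ts unfolding e by (simp add: fker_def omega_def divide_simps)
    next
      case False
      then show ?thesis
        using ts unfolding e
        by (auto simp: fker_def omega_def indicator_def zero_less_mult_iff not_less)
    qed
  qed
  finally show ?thesis
    using lborel_has_bochner_integral_real_affine_iff[of "s - t" "\<lambda>r. fker \<alpha> (r - t) * fker (1 - \<alpha>) (s - r)" 1 t] ts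
    by simp
qed

text \<open>The positive and negative parts of f - g are densities of two finite measures that agree
  on all half-lines, hence everywhere.\<close>

lemma AE_eq_of_integral_greaterThan:
  fixes f g :: "real \<Rightarrow> real"
  assumes f: "integrable lborel f" and g: "integrable lborel g"
    and eq: "\<And>t. (\<integral>s. f s * indicator {t<..} s \<partial>lborel) = (\<integral>s. g s * indicator {t<..} s \<partial>lborel)"
  shows "AE t in lborel. f t = g t"
proof -
  have [measurable]: "f \<in> borel_measurable borel" "g \<in> borel_measurable borel"
    using borel_measurable_integrable[OF f] borel_measurable_integrable[OF g] by auto
  let ?p = "\<lambda>t. max 0 (f t - g t)" and ?n = "\<lambda>t. max 0 (g t - f t)"
  have ip: "integrable lborel (\<lambda>s. ?p s * indicator {t<..} s)"
    and in': "integrable lborel (\<lambda>s. ?n s * indicator {t<..} s)" for t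
    using f g by (auto intro!: integrable_real_mult_indicator integrable_max Bochner_Integration.integrable_diff)
  have em: "emeasure (density lborel (\<lambda>t. ennreal (?p t))) {t<..} = ennreal (\<integral>s. ?p s * indicator {t<..} s \<partial>lborel)"
    "emeasure (density lborel (\<lambda>t. ennreal (?n t))) {t<..} = ennreal (\<integral>s. ?n s * indicator {t<..} s \<partial>lborel)" for t
    using nn_integral_eq_integral[OF ip[of t]] nn_integral_eq_integral[OF in'[of t]]
    by (simp_all add: emeasure_density ennreal_mult' ennreal_indicator)
  have "density lborel (\<lambda>t. ennreal (?p t)) = density lborel (\<lambda>t. ennreal (?n t))"
  proof (rule measure_eqI_lessThan)
    fix t
    have "(\<integral>s. ?p s * indicator {t<..} s \<partial>lborel) - (\<integral>s. ?n s * indicator {t<..} s \<partial>lborel)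
       = (\<integral>s. f s * indicator {t<..} s - g s * indicator {t<..} s \<partial>lborel)"
      unfolding Bochner_Integration.integral_diff[OF ip[of t] in'[of t], symmetric]
      by (intro Bochner_Integration.integral_cong) (auto simp: max_def indicator_def)
    also have "\<dots> = 0"
      using f g eq[of t] by (subst Bochner_Integration.integral_diff) (auto intro!: integrable_real_mult_indicator)
    finally show "emeasure (density lborel (\<lambda>t. ennreal (?p t))) {t<..} = emeasure (density lborel (\<lambda>t. ennreal (?n t))) {t<..}"
      by (simp add: em)
    show "emeasure (density lborel (\<lambda>t. ennreal (?p t))) {t<..} < \<infinity>"
      by (simp add: em)
  qed auto
  then have "AE t in lborel. ennreal (?p t) = ennreal (?n t)"
    by (intro sigma_finite_measure.density_unique[OF sigma_finite_lborel]) auto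
  then show ?thesis
    by eventually_elim (auto simp: max_def split: if_splits)
qed

lemma integral_swap:
  fixes f :: "real \<Rightarrow> real \<Rightarrow> real"
  assumes [measurable]: "(\<lambda>p. f (fst p) (snd p)) \<in> borel_measurable (borel \<Otimes>\<^sub>M borel)"
    and fin: "(\<integral>\<^sup>+s. (\<integral>\<^sup>+r. ennreal \<bar>f r s\<bar> \<partial>lborel) \<partial>lborel) < \<infinity>"
  shows "(\<integral>r. (\<integral>s. f r s \<partial>lborel) \<partial>lborel) = (\<integral>s. (\<integral>r. f r s \<partial>lborel) \<partial>lborel)"
    and "integrable lborel (\<lambda>r. \<integral>s. f r s \<partial>lborel)"
proof -
  have m: "(\<lambda>p. f (fst p) (snd p)) \<in> borel_measurable (lborel \<Otimes>\<^sub>M lborel)" by simp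
  have "(\<integral>\<^sup>+p. ennreal (norm (f (fst p) (snd p))) \<partial>(lborel \<Otimes>\<^sub>M lborel))
      = (\<integral>\<^sup>+s. (\<integral>\<^sup>+r. ennreal \<bar>f r s\<bar> \<partial>lborel) \<partial>lborel)"
    by (subst lborel_pair.nn_integral_snd[symmetric]) auto
  then have i: "integrable (lborel \<Otimes>\<^sub>M lborel) (\<lambda>p. f (fst p) (snd p))"
    using fin by (intro integrableI_bounded) auto
  then show "(\<integral>r. (\<integral>s. f r s \<partial>lborel) \<partial>lborel) = (\<integral>s. (\<integral>r. f r s \<partial>lborel) \<partial>lborel)"
    using lborel_pair.Fubini_integral[of f] by (simp add: case_prod_unfold)
  show "integrable lborel (\<lambda>r. \<integral>s. f r s \<partial>lborel)"
    using lborel_pair.integrable_fst[of f] i by (simp add: case_prod_unfold)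
qed

text \<open>Apply the backward integral of order \<alpha> to both sides. On the left the orders add
  up to 1 and give the tail integral of \<phi>; on the right the order-\<alpha> integral commutes
  with the tail integral. So \<phi> and the order-\<alpha> integral of \<psi> have the same tails,
  and no singular integral is differentiated.\<close>

lemma Abel_inversion:
  fixes \<phi> \<psi> :: "real \<Rightarrow> real"
  assumes \<alpha>: "0 < \<alpha>" "\<alpha> < 1" and T: "0 \<le> T"
    and \<phi>: "integrable lborel \<phi>" and \<psi>: "integrable lborel \<psi>"
    and supp: "\<And>t. t \<notin> {0..T} \<Longrightarrow> \<phi> t = 0" "\<And>t. t \<notin> {0..T} \<Longrightarrow> \<psi> t = 0"
    and eq: "AE r in lborel. r \<in> {0..T} \<longrightarrow>
      (\<integral>s. fker (1 - \<alpha>) (s - r) * \<phi> s \<partial>lborel) = (\<integral>s. \<psi> s * indicator {r<..} s \<partial>lborel)"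
  shows "AE t in lborel. t \<in> {0..T} \<longrightarrow> \<phi> t = (\<integral>s. fker \<alpha> (s - t) * \<psi> s \<partial>lborel)"
proof -
  have [measurable]: "\<phi> \<in> borel_measurable borel" "\<psi> \<in> borel_measurable borel"
    using borel_measurable_integrable[OF \<phi>] borel_measurable_integrable[OF \<psi>] by auto
  have \<phi>fin: "(\<integral>\<^sup>+s. ennreal \<bar>\<phi> s\<bar> \<partial>lborel) < \<infinity>" and \<psi>fin: "(\<integral>\<^sup>+s. ennreal \<bar>\<psi> s\<bar> \<partial>lborel) < \<infinity>"
    using \<phi> \<psi> by (simp_all add: integrable_iff_bounded)
  define c where "c t = (\<integral>s. fker \<alpha> (s - t) * \<psi> s \<partial>lborel)" for t
  have [measurable]: "c \<in> borel_measurable borel" unfolding c_def by measurable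
  note nonneg = fker_nonneg[OF \<alpha>(1)]
  \<comment> \<open>Measurability in the moving endpoint of a half-line becomes visible once its
    indicator is written as a comparison of \<open>r\<close> and \<open>s\<close>.\<close>
  have "(\<lambda>r. \<integral>s. \<psi> s * (if r < s then 1 else 0) \<partial>lborel) \<in> borel_measurable borel"
    by measurable
  then have [measurable]: "(\<lambda>r. \<integral>s. \<psi> s * indicator {r<..} s \<partial>lborel) \<in> borel_measurable borel"
    by (simp add: indicator_def of_bool_def)
  have [measurable]: "(\<lambda>r. indicator {r<..} s :: real) \<in> borel_measurable borel" for s :: real
    unfolding indicator_def greaterThan_iff by measurable
  have [measurable]: "(\<lambda>p. indicator {fst p<..} (snd p) :: real) \<in> borel_measurable (borel \<Otimes>\<^sub>M (borel :: real measure))"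
    unfolding indicator_def greaterThan_iff by measurable
  \<comment> \<open>Both integrals equal (s - t) powr \<alpha> / Gamma(\<alpha> + 1): this is the
    commutation of the order-\<alpha> and order-1 integrals at the level of kernels.\<close>
  have q: "has_bochner_integral lborel (\<lambda>r. fker \<alpha> (s - r) * indicator {t<..} r) (if t < s then fker_int \<alpha> (s - t) else 0)"
    "has_bochner_integral lborel (\<lambda>r. fker \<alpha> (r - t) * indicator {r<..} s) (if t < s then fker_int \<alpha> (s - t) else 0)" for s t
  proof -
    have "has_bochner_integral lborel (\<lambda>r. fker \<alpha> r * indicator {..<s - t} r) (if t < s then fker_int \<alpha> (s - t) else 0)"
    proof (cases "t < s")
      case True
      have "AE r in lborel. r \<noteq> s - t" by (rule AE_lborel_singleton)
      then have "AE r in lborel. fker \<alpha> r * indicator {..s - t} r = fker \<alpha> r * indicator {..<s - t} r"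
        by eventually_elim (auto simp: indicator_def)
      then show ?thesis
        using fker_has_integral[OF \<alpha>(1), of "s - t"] True
        by (subst has_bochner_integral_cong_AE[where g="\<lambda>r. fker \<alpha> r * indicator {..s - t} r"]) auto
    next
      case False
      then have "(\<lambda>r. fker \<alpha> r * indicator {..<s - t} r) = (\<lambda>r. 0)"
        by (auto simp: fker_def indicator_def)
      then show ?thesis using False by (simp add: has_bochner_integral_zero)
    qed
    note * = this
    have "(\<lambda>r. fker \<alpha> (s - r) * indicator {t<..} r) = (\<lambda>r. fker \<alpha> (s + -1 * r) * indicator {..<s - t} (s + -1 * r))"
      by (auto simp: indicator_def)
    then show "has_bochner_integral lborel (\<lambda>r. fker \<alpha> (s - r) * indicator {t<..} r) (if t < s then fker_int \<alpha> (s - t) else 0)"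
      using * lborel_has_bochner_integral_real_affine_iff[of "-1" "\<lambda>r. fker \<alpha> r * indicator {..<s - t} r" _ s] by simp
    have "(\<lambda>r. fker \<alpha> (r - t) * indicator {r<..} s) = (\<lambda>r. fker \<alpha> (- t + 1 * r) * indicator {..<s - t} (- t + 1 * r))"
      by (auto simp: indicator_def)
    then show "has_bochner_integral lborel (\<lambda>r. fker \<alpha> (r - t) * indicator {r<..} s) (if t < s then fker_int \<alpha> (s - t) else 0)"
      using * lborel_has_bochner_integral_real_affine_iff[of 1 "\<lambda>r. fker \<alpha> r * indicator {..<s - t} r" _ "-t"] by simp
  qed
  have qn: "(\<integral>\<^sup>+r. ennreal (fker \<alpha> (s - r) * indicator {t<..} r) \<partial>lborel) \<le> ennreal (fker_int \<alpha> T)"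
    "(\<integral>\<^sup>+r. ennreal (fker \<alpha> (r - t) * indicator {r<..} s) \<partial>lborel) \<le> ennreal (fker_int \<alpha> T)"
    if "0 \<le> t" "s \<le> T" for s t
    using q(1)[of s t] q(2)[of t s] nonneg fker_int_mono[OF \<alpha>(1), of "s - t" T] fker_int_nonneg[OF \<alpha>(1), of T] that
    by (simp_all add: nn_integral_eq_integral has_bochner_integral_iff split: if_splits)
  have swap1: "(\<integral>r. (\<integral>s. indicator {t<..} r * (fker \<alpha> (s - r) * \<psi> s) \<partial>lborel) \<partial>lborel)
      = (\<integral>s. (\<integral>r. indicator {t<..} r * (fker \<alpha> (s - r) * \<psi> s) \<partial>lborel) \<partial>lborel)"
    "integrable lborel (\<lambda>r. \<integral>s. indicator {t<..} r * (fker \<alpha> (s - r) * \<psi> s) \<partial>lborel)" if t: "0 \<le> t" for t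
  proof -
    have "(\<integral>\<^sup>+r. ennreal \<bar>indicator {t<..} r * (fker \<alpha> (s - r) * \<psi> s)\<bar> \<partial>lborel) \<le> ennreal (fker_int \<alpha> T) * ennreal \<bar>\<psi> s\<bar>" for s
    proof -
      have "(\<integral>\<^sup>+r. ennreal \<bar>indicator {t<..} r * (fker \<alpha> (s - r) * \<psi> s)\<bar> \<partial>lborel)
        = (\<integral>\<^sup>+r. ennreal (fker \<alpha> (s - r) * indicator {t<..} r) * ennreal \<bar>\<psi> s\<bar> \<partial>lborel)"
        using nonneg by (intro nn_integral_cong) (simp add: abs_mult ennreal_mult' mult_ac)
      also have "\<dots> = (\<integral>\<^sup>+r. ennreal (fker \<alpha> (s - r) * indicator {t<..} r) \<partial>lborel) * ennreal \<bar>\<psi> s\<bar>"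
        by (intro nn_integral_multc) measurable
      also have "\<dots> \<le> ennreal (fker_int \<alpha> T) * ennreal \<bar>\<psi> s\<bar>"
        using qn(1)[of t s] t supp(2)[of s] by (cases "s \<le> T") (auto intro: mult_right_mono)
      finally show ?thesis .
    qed
    then have "(\<integral>\<^sup>+s. (\<integral>\<^sup>+r. ennreal \<bar>indicator {t<..} r * (fker \<alpha> (s - r) * \<psi> s)\<bar> \<partial>lborel) \<partial>lborel)
       \<le> (\<integral>\<^sup>+s. ennreal (fker_int \<alpha> T) * ennreal \<bar>\<psi> s\<bar> \<partial>lborel)" by (rule nn_integral_mono)
    also have "\<dots> < \<infinity>" using \<psi>fin by (simp add: nn_integral_cmult ennreal_mult_less_top)
    finally have fin: "(\<integral>\<^sup>+s. (\<integral>\<^sup>+r. ennreal \<bar>indicator {t<..} r * (fker \<alpha> (s - r) * \<psi> s)\<bar> \<partial>lborel) \<partial>lborel) < \<infinity>" .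
    show "(\<integral>r. (\<integral>s. indicator {t<..} r * (fker \<alpha> (s - r) * \<psi> s) \<partial>lborel) \<partial>lborel)
      = (\<integral>s. (\<integral>r. indicator {t<..} r * (fker \<alpha> (s - r) * \<psi> s) \<partial>lborel) \<partial>lborel)"
      by (intro integral_swap(1) fin) measurable
    show "integrable lborel (\<lambda>r. \<integral>s. indicator {t<..} r * (fker \<alpha> (s - r) * \<psi> s) \<partial>lborel)"
      by (intro integral_swap(2) fin) measurable
  qed
  have prim: "(\<integral>r. c r * indicator {t<..} r \<partial>lborel) = (\<integral>s. \<phi> s * indicator {t<..} s \<partial>lborel)" if t: "0 \<le> t" for t
  proof -
    have "(\<integral>r. c r * indicator {t<..} r \<partial>lborel) = (\<integral>r. (\<integral>s. indicator {t<..} r * (fker \<alpha> (s - r) * \<psi> s) \<partial>lborel) \<partial>lborel)"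
      by (simp add: c_def mult.commute)
    also have "\<dots> = (\<integral>s. (\<integral>r. indicator {t<..} r * (fker \<alpha> (s - r) * \<psi> s) \<partial>lborel) \<partial>lborel)"
      by (rule swap1(1)[OF t])
    also have "\<dots> = (\<integral>s. (\<integral>r. \<psi> s * (fker \<alpha> (s - r) * indicator {t<..} r) \<partial>lborel) \<partial>lborel)"
      by (simp add: mult_ac)
    also have "\<dots> = (\<integral>s. (\<integral>r. \<psi> s * (fker \<alpha> (r - t) * indicator {r<..} s) \<partial>lborel) \<partial>lborel)"
      unfolding integral_mult_right_zero using q by (simp add: has_bochner_integral_iff)
    also have "\<dots> = (\<integral>r. (\<integral>s. \<psi> s * (fker \<alpha> (r - t) * indicator {r<..} s) \<partial>lborel) \<partial>lborel)"
    proof (rule integral_swap(1)[symmetric])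
      have "(\<integral>\<^sup>+r. ennreal \<bar>\<psi> s * (fker \<alpha> (r - t) * indicator {r<..} s)\<bar> \<partial>lborel) \<le> ennreal (fker_int \<alpha> T) * ennreal \<bar>\<psi> s\<bar>" for s
      proof -
        have "(\<integral>\<^sup>+r. ennreal \<bar>\<psi> s * (fker \<alpha> (r - t) * indicator {r<..} s)\<bar> \<partial>lborel)
          = (\<integral>\<^sup>+r. ennreal (fker \<alpha> (r - t) * indicator {r<..} s) * ennreal \<bar>\<psi> s\<bar> \<partial>lborel)"
          using nonneg by (intro nn_integral_cong) (simp add: abs_mult ennreal_mult' mult_ac)
        also have "\<dots> = (\<integral>\<^sup>+r. ennreal (fker \<alpha> (r - t) * indicator {r<..} s) \<partial>lborel) * ennreal \<bar>\<psi> s\<bar>"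
          by (intro nn_integral_multc) measurable
        also have "\<dots> \<le> ennreal (fker_int \<alpha> T) * ennreal \<bar>\<psi> s\<bar>"
          using qn(2)[of t s] t supp(2)[of s] by (cases "s \<le> T") (auto intro: mult_right_mono)
        finally show ?thesis .
      qed
      then have "(\<integral>\<^sup>+s. (\<integral>\<^sup>+r. ennreal \<bar>\<psi> s * (fker \<alpha> (r - t) * indicator {r<..} s)\<bar> \<partial>lborel) \<partial>lborel)
         \<le> (\<integral>\<^sup>+s. ennreal (fker_int \<alpha> T) * ennreal \<bar>\<psi> s\<bar> \<partial>lborel)" by (rule nn_integral_mono)
      also have "\<dots> < \<infinity>" using \<psi>fin by (simp add: nn_integral_cmult ennreal_mult_less_top)
      finally show "(\<integral>\<^sup>+s. (\<integral>\<^sup>+r. ennreal \<bar>\<psi> s * (fker \<alpha> (r - t) * indicator {r<..} s)\<bar> \<partial>lborel) \<partial>lborel) < \<infinity>" .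
    qed measurable
    also have "\<dots> = (\<integral>r. fker \<alpha> (r - t) * (\<integral>s. \<psi> s * indicator {r<..} s \<partial>lborel) \<partial>lborel)"
      unfolding mult.left_commute[of "\<psi> _" "fker _ _"] by simp
    also have "\<dots> = (\<integral>r. fker \<alpha> (r - t) * (\<integral>s. fker (1 - \<alpha>) (s - r) * \<phi> s \<partial>lborel) \<partial>lborel)"
    proof (intro integral_cong_AE)
      show "AE r in lborel. fker \<alpha> (r - t) * (\<integral>s. \<psi> s * indicator {r<..} s \<partial>lborel)
        = fker \<alpha> (r - t) * (\<integral>s. fker (1 - \<alpha>) (s - r) * \<phi> s \<partial>lborel)"
        using eq
      proof eventually_elim
        case (elim r)
        consider "r \<in> {0..T}" | "r < 0" | "T < r" by force
        then show ?case
        proof cases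
          case 3
          then have "(\<lambda>s. \<psi> s * indicator {r<..} s) = (\<lambda>s. 0)" "(\<lambda>s. fker (1 - \<alpha>) (s - r) * \<phi> s) = (\<lambda>s. 0)"
            using supp by (auto simp: indicator_def fker_def fun_eq_iff)
          then show ?thesis by simp
        qed (use elim t in \<open>auto simp: fker_def\<close>)
      qed
    qed measurable
    also have "\<dots> = (\<integral>r. (\<integral>s. fker \<alpha> (r - t) * (fker (1 - \<alpha>) (s - r) * \<phi> s) \<partial>lborel) \<partial>lborel)"
      by simp
    also have "\<dots> = (\<integral>s. (\<integral>r. fker \<alpha> (r - t) * (fker (1 - \<alpha>) (s - r) * \<phi> s) \<partial>lborel) \<partial>lborel)"
    proof (rule integral_swap(1))
      have n: "(\<integral>\<^sup>+r. ennreal (fker \<alpha> (r - t) * fker (1 - \<alpha>) (s - r)) \<partial>lborel) \<le> 1" for s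
      proof (cases "t < s")
        case True
        then show ?thesis
          using fker_convolution[OF \<alpha> True] nonneg fker_nonneg[of "1 - \<alpha>"] \<alpha>
          by (simp add: nn_integral_eq_integral has_bochner_integral_iff)
      next
        case False
        then have *: "fker \<alpha> (r - t) * fker (1 - \<alpha>) (s - r) = 0" for r by (simp add: fker_def)
        show ?thesis unfolding * by simp
      qed
      have "(\<integral>\<^sup>+r. ennreal \<bar>fker \<alpha> (r - t) * (fker (1 - \<alpha>) (s - r) * \<phi> s)\<bar> \<partial>lborel) \<le> ennreal \<bar>\<phi> s\<bar>" for s
      proof -
        have "(\<integral>\<^sup>+r. ennreal \<bar>fker \<alpha> (r - t) * (fker (1 - \<alpha>) (s - r) * \<phi> s)\<bar> \<partial>lborel)
          = (\<integral>\<^sup>+r. ennreal (fker \<alpha> (r - t) * fker (1 - \<alpha>) (s - r)) * ennreal \<bar>\<phi> s\<bar> \<partial>lborel)"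
          using nonneg fker_nonneg[of "1 - \<alpha>"] \<alpha> by (intro nn_integral_cong) (simp add: abs_mult ennreal_mult' mult_ac)
        also have "\<dots> = (\<integral>\<^sup>+r. ennreal (fker \<alpha> (r - t) * fker (1 - \<alpha>) (s - r)) \<partial>lborel) * ennreal \<bar>\<phi> s\<bar>"
          by (intro nn_integral_multc) measurable
        also have "\<dots> \<le> 1 * ennreal \<bar>\<phi> s\<bar>"
          by (intro mult_right_mono n) auto
        finally show ?thesis by simp
      qed
      then have "(\<integral>\<^sup>+s. (\<integral>\<^sup>+r. ennreal \<bar>fker \<alpha> (r - t) * (fker (1 - \<alpha>) (s - r) * \<phi> s)\<bar> \<partial>lborel) \<partial>lborel)
         \<le> (\<integral>\<^sup>+s. ennreal \<bar>\<phi> s\<bar> \<partial>lborel)" by (rule nn_integral_mono)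
      then show "(\<integral>\<^sup>+s. (\<integral>\<^sup>+r. ennreal \<bar>fker \<alpha> (r - t) * (fker (1 - \<alpha>) (s - r) * \<phi> s)\<bar> \<partial>lborel) \<partial>lborel) < \<infinity>"
        using \<phi>fin by (rule le_less_trans)
    qed measurable
    also have "\<dots> = (\<integral>s. \<phi> s * indicator {t<..} s \<partial>lborel)"
    proof (intro Bochner_Integration.integral_cong refl)
      fix s
      have "(\<integral>r. fker \<alpha> (r - t) * (fker (1 - \<alpha>) (s - r) * \<phi> s) \<partial>lborel)
        = (\<integral>r. fker \<alpha> (r - t) * fker (1 - \<alpha>) (s - r) \<partial>lborel) * \<phi> s"
        by (simp add: mult.assoc[symmetric])
      moreover have "(\<integral>r. fker \<alpha> (r - t) * fker (1 - \<alpha>) (s - r) \<partial>lborel) = 1" if "t < s"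
        using fker_convolution[OF \<alpha> that] by (simp add: has_bochner_integral_iff)
      moreover have "(\<integral>r. fker \<alpha> (r - t) * fker (1 - \<alpha>) (s - r) \<partial>lborel) = 0" if "\<not> t < s"
      proof -
        have *: "fker \<alpha> (r - t) * fker (1 - \<alpha>) (s - r) = 0" for r using that by (simp add: fker_def)
        show ?thesis unfolding * by simp
      qed
      ultimately show "(\<integral>r. fker \<alpha> (r - t) * (fker (1 - \<alpha>) (s - r) * \<phi> s) \<partial>lborel) = \<phi> s * indicator {t<..} s"
        by (cases "t < s") auto
    qed
    finally show ?thesis .
  qed
  \<comment> \<open>For negative times \<phi> vanishes but \<open>c\<close> need not, so
    \<open>c\<close> is cut off before the tails are compared.\<close>
  have ci: "integrable lborel (\<lambda>r. c r * indicator {0<..} r)"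
    using swap1(2)[of 0] by (simp add: c_def mult.commute)
  have "AE t in lborel. \<phi> t = c t * indicator {0<..} t"
  proof (rule AE_eq_of_integral_greaterThan[OF \<phi> ci])
    fix t :: real
    have "AE s in lborel. (s::real) \<noteq> 0" by (rule AE_lborel_singleton)
    then have "AE s in lborel. \<phi> s * indicator {t<..} s = \<phi> s * indicator {max t 0<..} s"
      by eventually_elim (auto simp: indicator_def supp)
    then have "(\<integral>s. \<phi> s * indicator {t<..} s \<partial>lborel) = (\<integral>s. \<phi> s * indicator {max t 0<..} s \<partial>lborel)"
      by (intro integral_cong_AE) auto
    also have "\<dots> = (\<integral>s. c s * indicator {max t 0<..} s \<partial>lborel)"
      by (simp add: prim)
    also have "\<dots> = (\<integral>s. c s * indicator {0<..} s * indicator {t<..} s \<partial>lborel)"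
      by (intro Bochner_Integration.integral_cong) (auto simp: indicator_def)
    finally show "(\<integral>s. \<phi> s * indicator {t<..} s \<partial>lborel) = (\<integral>s. c s * indicator {0<..} s * indicator {t<..} s \<partial>lborel)" .
  qed
  moreover have "AE s in lborel. (s::real) \<noteq> 0" by (rule AE_lborel_singleton)
  ultimately show ?thesis
    by eventually_elim (auto simp: c_def indicator_def)
qed

text \<open>Absolute convergence of the bilinear form with kernel \<open>k\<close>, by
  Cauchy-Schwarz and Young; it licenses moving a fractional integral from one factor to the
  other.\<close>

lemma integrable_pair_convolution:
  fixes k v w :: "real \<Rightarrow> real"
  assumes [measurable]: "k \<in> borel_measurable borel" and k: "(\<integral>\<^sup>+r. ennreal \<bar>k r\<bar> \<partial>lborel) < \<infinity>"
    and v: "sq_int lborel v" and w: "sq_int lborel w"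
  shows "(\<integral>\<^sup>+t. (\<integral>\<^sup>+s. ennreal \<bar>k (t - s) * v s * w t\<bar> \<partial>lborel) \<partial>lborel) < \<infinity>"
proof -
  have [measurable]: "v \<in> borel_measurable borel" "w \<in> borel_measurable borel"
    using v w by (auto simp: sq_int_def)
  let ?I = "\<lambda>t. \<integral>\<^sup>+s. ennreal \<bar>k (t - s) * v s\<bar> \<partial>lborel"
  have eq: "(\<integral>\<^sup>+t. (\<integral>\<^sup>+s. ennreal \<bar>k (t - s) * v s * w t\<bar> \<partial>lborel) \<partial>lborel) = (\<integral>\<^sup>+t. ?I t * ennreal \<bar>w t\<bar> \<partial>lborel)"
    by (intro nn_integral_cong, subst nn_integral_multc[symmetric]) (auto simp: abs_mult ennreal_mult)
  have "(\<integral>\<^sup>+t. ?I t * ennreal \<bar>w t\<bar> \<partial>lborel)\<^sup>2 \<le> (\<integral>\<^sup>+t. (?I t)\<^sup>2 \<partial>lborel) * (\<integral>\<^sup>+t. (ennreal \<bar>w t\<bar>)\<^sup>2 \<partial>lborel)"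
    by (rule Cauchy_Schwarz_nn_integral) measurable
  also have "\<dots> \<le> ((\<integral>\<^sup>+r. ennreal \<bar>k r\<bar> \<partial>lborel)\<^sup>2 * (\<integral>\<^sup>+s. ennreal ((v s)\<^sup>2) \<partial>lborel)) * (\<integral>\<^sup>+t. (ennreal \<bar>w t\<bar>)\<^sup>2 \<partial>lborel)"
    by (intro mult_right_mono Young_L2) auto
  also have "\<dots> < \<infinity>"
    using k v w by (auto simp: sq_int_iff_nn ennreal_power ennreal_mult_less_top power2_eq_square ennreal_mult[symmetric])
  finally show ?thesis
    unfolding eq by (cases "(\<integral>\<^sup>+t. ?I t * ennreal \<bar>w t\<bar> \<partial>lborel) = top") (auto simp: top.not_eq_extremum)
qed

section \<open>Projection and interpolation errors on a mesh\<close>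

context time_mesh
begin

lemma integral_mult_mean_zero:
  fixes u v :: "real \<Rightarrow> real"
  assumes v: "sq_int lborel v" and supp: "\<And>t. t \<notin> {0..T} \<Longrightarrow> v t = 0"
    and mean: "\<And>n. n < N \<Longrightarrow> (\<integral>s. v s * indicator {tn n..<tn (Suc n)} s \<partial>lborel) = 0"
  shows "(\<integral>t. (\<Sum>n<N. a n * indicator {tn n..<tn (Suc n)} t) * v t \<partial>lborel) = 0"
    and "integrable lborel (\<lambda>t. (\<Sum>n<N. a n * indicator {tn n..<tn (Suc n)} t) * v t)"
proof -
  have vi: "integrable lborel v" by (rule integrable_of_sq_int_supp[OF v supp])
  have ind: "integrable lborel (\<lambda>s. v s * indicator {tn j..<tn (Suc j)} s)" for j
    using integrable_real_mult_indicator[OF _ vi] by simp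
  have cv: "(\<Sum>n<N. a n * indicator {tn n..<tn (Suc n)} t) * v t
      = (\<Sum>n<N. a n * (v t * indicator {tn n..<tn (Suc n)} t))" for t
    unfolding sum_distrib_right by (intro sum.cong refl) simp
  show "integrable lborel (\<lambda>t. (\<Sum>n<N. a n * indicator {tn n..<tn (Suc n)} t) * v t)"
    unfolding cv by (intro Bochner_Integration.integrable_sum integrable_mult_right ind)
  show "(\<integral>t. (\<Sum>n<N. a n * indicator {tn n..<tn (Suc n)} t) * v t \<partial>lborel) = 0"
    unfolding cv by (simp add: ind mean)
qed

lemma mesh_sum_indicator:
  assumes "n < N" "tn n \<le> t" "t < tn (Suc n)"
  shows "(\<Sum>j<N. a j * indicator {tn j..<tn (Suc j)} t) = (a n :: real)"
proof -
  have "(\<Sum>j<N. a j * indicator {tn j..<tn (Suc j)} t) = (\<Sum>j<N. if j = n then a n else 0)"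
  proof (intro sum.cong refl)
    fix j assume "j \<in> {..<N}"
    then have "j = n" if "tn j \<le> t" "t < tn (Suc j)"
      using mesh_disjoint[OF that assms(2,3)] assms(1) by simp
    then show "a j * indicator {tn j..<tn (Suc j)} t = (if j = n then a n else 0)"
      using assms by (cases "j = n") (auto simp: indicator_def)
  qed
  then show ?thesis using assms by simp
qed

text \<open>Duality: with \<open>\<phi>\<close> the backward fractional integral of \<open>\<psi>\<close>, the squared norm of \<open>v\<close> is
  \<open>\<langle>\<phi>, v\<rangle>\<close>, which equals \<open>\<psi>\<close> tested against the forward fractional integral of \<open>v\<close>.\<close>

lemma projection_error_le:
  fixes \<phi> \<psi> v :: "real \<Rightarrow> real"
  assumes \<alpha>: "0 < \<alpha>" "\<alpha> < 1"
    and \<phi>: "sq_int lborel \<phi>" and \<psi>: "sq_int lborel \<psi>" and v: "sq_int lborel v"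
    and supp: "\<And>t. t \<notin> {0..T} \<Longrightarrow> \<phi> t = 0" "\<And>t. t \<notin> {0..T} \<Longrightarrow> \<psi> t = 0" "\<And>t. t \<notin> {0..T} \<Longrightarrow> v t = 0"
    and eq: "AE r in lborel. r \<in> {0..T} \<longrightarrow>
      (\<integral>s. fker (1 - \<alpha>) (s - r) * \<phi> s \<partial>lborel) = (\<integral>s. \<psi> s * indicator {r<..} s \<partial>lborel)"
    and proj: "\<And>n. n < N \<Longrightarrow> AE t in lborel. t \<in> {tn n..<tn (Suc n)} \<longrightarrow> v t = \<phi> t - a n"
    and mean: "\<And>n. n < N \<Longrightarrow> (\<integral>s. v s * indicator {tn n..<tn (Suc n)} s \<partial>lborel) = 0"
  shows "(\<integral>\<^sup>+t. ennreal ((v t)\<^sup>2) \<partial>lborel) \<le> ennreal ((2 * fker_int \<alpha> k)\<^sup>2) * (\<integral>\<^sup>+t. ennreal ((\<psi> t)\<^sup>2) \<partial>lborel)"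
proof -
  have [measurable]: "v \<in> borel_measurable borel" "\<phi> \<in> borel_measurable borel" "\<psi> \<in> borel_measurable borel"
    using v \<phi> \<psi> by (auto simp: sq_int_def)
  define I where "I s = indicator {0..T} s * (\<integral>t. fker \<alpha> (s - t) * v t \<partial>lborel)" for s
  have [measurable]: "I \<in> borel_measurable borel" unfolding I_def by measurable
  have Ile: "(\<integral>\<^sup>+t. ennreal ((I t)\<^sup>2) \<partial>lborel) \<le> ennreal ((2 * fker_int \<alpha> k)\<^sup>2) * (\<integral>\<^sup>+t. ennreal ((v t)\<^sup>2) \<partial>lborel)"
    unfolding I_def by (rule fractional_integral_mean_zero[OF \<alpha> v supp(3) mean])
  have vv: "(\<integral>\<^sup>+t. ennreal ((v t)\<^sup>2) \<partial>lborel) < \<infinity>" using v by (simp add: sq_int_iff_nn)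
  then have Isq: "sq_int lborel I"
    using Ile by (auto simp: sq_int_iff_nn intro!: le_less_trans[OF Ile] ennreal_mult_less_top[THEN iffD2])
  \<comment> \<open>Truncation at lag \<open>T\<close> makes the kernel integrable on the line and
    changes nothing where both \<open>v\<close> and \<psi> live.\<close>
  define k' where "k' r = fker \<alpha> r * indicator {..T} r" for r
  have [measurable]: "k' \<in> borel_measurable borel" unfolding k'_def by measurable
  have "has_bochner_integral lborel k' (fker_int \<alpha> T)"
    unfolding k'_def using fker_has_integral[OF \<alpha>(1), of T] T_pos by simp
  then have k'fin: "(\<integral>\<^sup>+r. ennreal \<bar>k' r\<bar> \<partial>lborel) < \<infinity>"
    by (auto simp: has_bochner_integral_iff integrable_iff_bounded)
  have k': "k' (s - t) * v t * \<psi> s = fker \<alpha> (s - t) * v t * \<psi> s" for s t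
    using supp(3)[of t] supp(2)[of s] by (cases "t \<in> {0..T} \<and> s \<in> {0..T}") (auto simp: k'_def indicator_def)
  have fin: "(\<integral>\<^sup>+s. (\<integral>\<^sup>+t. ennreal \<bar>fker \<alpha> (s - t) * v t * \<psi> s\<bar> \<partial>lborel) \<partial>lborel) < \<infinity>"
    using integrable_pair_convolution[OF _ k'fin v \<psi>] unfolding k' by simp
  have "AE t in lborel. t \<in> {0..T} \<longrightarrow> \<phi> t = (\<integral>s. fker \<alpha> (s - t) * \<psi> s \<partial>lborel)"
    using Abel_inversion[OF \<alpha> _ integrable_of_sq_int_supp[OF \<phi> supp(1)] integrable_of_sq_int_supp[OF \<psi> supp(2)] supp(1,2) eq] T_pos
    by auto
  then have "(\<integral>t. \<phi> t * v t \<partial>lborel) = (\<integral>t. (\<integral>s. fker \<alpha> (s - t) * v t * \<psi> s \<partial>lborel) \<partial>lborel)"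
  proof (intro integral_cong_AE, goal_cases)
    case 3
    then show ?case
    proof eventually_elim
      case (elim t)
      have "(\<integral>s. fker \<alpha> (s - t) * v t * \<psi> s \<partial>lborel) = (\<integral>s. v t * (fker \<alpha> (s - t) * \<psi> s) \<partial>lborel)"
        by (simp add: mult_ac)
      then show ?case using elim supp(3)[of t] by (cases "t \<in> {0..T}") auto
    qed
  qed measurable
  also have "\<dots> = (\<integral>s. (\<integral>t. fker \<alpha> (s - t) * v t * \<psi> s \<partial>lborel) \<partial>lborel)"
    by (intro integral_swap(1) fin) measurable
  also have "\<dots> = (\<integral>s. \<psi> s * I s \<partial>lborel)"
  proof (intro Bochner_Integration.integral_cong refl)
    fix s show "(\<integral>t. fker \<alpha> (s - t) * v t * \<psi> s \<partial>lborel) = \<psi> s * I s"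
      using supp(2)[of s] by (cases "s \<in> {0..T}") (auto simp: I_def)
  qed
  finally have dual: "(\<integral>t. \<phi> t * v t \<partial>lborel) = (\<integral>s. \<psi> s * I s \<partial>lborel)" .
  have "AE t in lborel. \<forall>n\<in>{..<N}. t \<in> {tn n..<tn (Suc n)} \<longrightarrow> v t = \<phi> t - a n"
    using proj by (intro AE_finite_allI) auto
  moreover have "AE t in lborel. t \<noteq> T" by (rule AE_lborel_singleton)
  \<comment> \<open>\<phi> - v is a step function on the mesh, and step functions are orthogonal to
    \<open>v\<close>; hence the squared norm of \<open>v\<close> is its inner product with
    \<phi>.\<close>
  ultimately have "AE t in lborel. (v t)\<^sup>2 = \<phi> t * v t - (\<Sum>n<N. a n * indicator {tn n..<tn (Suc n)} t) * v t"
  proof eventually_elim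
    case (elim t)
    show ?case
    proof (cases "t \<in> {0..T}")
      case True
      then obtain n where n: "n < N" "tn n \<le> t" "t < tn (Suc n)"
        using mesh_cover[of t] elim by auto
      then have "v t = \<phi> t - a n" using elim by auto
      then show ?thesis using mesh_sum_indicator[OF n, of a] by (simp add: power2_eq_square left_diff_distrib)
    qed (simp add: supp)
  qed
  then have "(\<integral>t. (v t)\<^sup>2 \<partial>lborel) = (\<integral>t. \<phi> t * v t - (\<Sum>n<N. a n * indicator {tn n..<tn (Suc n)} t) * v t \<partial>lborel)"
    by (intro integral_cong_AE) measurable
  also have "\<dots> = (\<integral>t. \<phi> t * v t \<partial>lborel)"
    using integral_mult_mean_zero[OF v supp(3) mean, of a] sq_int_mult[OF \<phi> v]
    by (subst Bochner_Integration.integral_diff) auto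
  finally have "(\<integral>t. (v t)\<^sup>2 \<partial>lborel)\<^sup>2 = (\<integral>s. \<psi> s * I s \<partial>lborel)\<^sup>2" by (simp add: dual)
  also have "\<dots> \<le> (\<integral>s. (\<psi> s)\<^sup>2 \<partial>lborel) * (\<integral>s. (I s)\<^sup>2 \<partial>lborel)"
    by (rule sq_int_Cauchy_Schwarz[OF \<psi> Isq])
  also have "\<dots> \<le> (\<integral>s. (\<psi> s)\<^sup>2 \<partial>lborel) * ((2 * fker_int \<alpha> k)\<^sup>2 * (\<integral>s. (v s)\<^sup>2 \<partial>lborel))"
    using Ile by (intro mult_left_mono) (simp_all add: nn_integral_sq_int v Isq ennreal_mult'[symmetric])
  finally have *: "(\<integral>t. (v t)\<^sup>2 \<partial>lborel) * (\<integral>t. (v t)\<^sup>2 \<partial>lborel)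
    \<le> ((2 * fker_int \<alpha> k)\<^sup>2 * (\<integral>s. (\<psi> s)\<^sup>2 \<partial>lborel)) * (\<integral>s. (v s)\<^sup>2 \<partial>lborel)"
    by (simp add: power2_eq_square mult_ac)
  have "(\<integral>t. (v t)\<^sup>2 \<partial>lborel) \<le> (2 * fker_int \<alpha> k)\<^sup>2 * (\<integral>s. (\<psi> s)\<^sup>2 \<partial>lborel)"
  \<comment> \<open>Cauchy-Schwarz leaves the squared norm of \<open>v\<close> as a factor on both
    sides; it is cancelled unless it is zero.\<close>
  proof (cases "(\<integral>t. (v t)\<^sup>2 \<partial>lborel) = 0")
    case True
    then show ?thesis by simp
  next
    case False
    moreover have "(\<integral>t. (v t)\<^sup>2 \<partial>lborel) \<ge> 0" by simp
    ultimately have "(\<integral>t. (v t)\<^sup>2 \<partial>lborel) > 0" by linarith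
    then show ?thesis using * by (simp only: mult_le_cancel_right_pos)
  qed
  then show ?thesis
    by (simp add: nn_integral_sq_int v \<psi> ennreal_mult'[symmetric])
qed

text \<open>A primitive started at the left node looks back over a distance at most
  \<open>k\<close>, so it is dominated by the convolution of |v| with the indicator of [0,k], whose
  mass is \<open>k\<close>.\<close>

lemma primitive_mean_zero_le:
  fixes v w :: "real \<Rightarrow> real"
  assumes v: "sq_int lborel v" and supp: "\<And>t. t \<notin> {0..T} \<Longrightarrow> v t = 0" "\<And>t. t \<notin> {0..T} \<Longrightarrow> w t = 0"
    and [measurable]: "w \<in> borel_measurable borel"
    and prim: "\<And>n. n < N \<Longrightarrow> AE t in lborel. t \<in> {tn n..<tn (Suc n)} \<longrightarrow>
      w t = (\<integral>s. v s * indicator {tn n..t} s \<partial>lborel)"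
  shows "(\<integral>\<^sup>+t. ennreal ((w t)\<^sup>2) \<partial>lborel) \<le> ennreal (k\<^sup>2) * (\<integral>\<^sup>+t. ennreal ((v t)\<^sup>2) \<partial>lborel)"
proof -
  have [measurable]: "v \<in> borel_measurable borel" using v by (auto simp: sq_int_def)
  let ?h = "indicator {0..k} :: real \<Rightarrow> real"
  have vi: "integrable lborel v" by (rule integrable_of_sq_int_supp[OF v supp(1)])
  have "AE t in lborel. \<forall>n\<in>{..<N}. t \<in> {tn n..<tn (Suc n)} \<longrightarrow> w t = (\<integral>s. v s * indicator {tn n..t} s \<partial>lborel)"
    using prim by (intro AE_finite_allI) auto
  moreover have "AE t in lborel. t \<noteq> T" by (rule AE_lborel_singleton)
  ultimately have "AE t in lborel. ennreal ((w t)\<^sup>2) \<le> (\<integral>\<^sup>+s. ennreal \<bar>?h (t - s) * v s\<bar> \<partial>lborel)\<^sup>2"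
  proof eventually_elim
    case (elim t)
    show ?case
    proof (cases "t \<in> {0..T}")
      case True
      then obtain n where n: "n < N" "tn n \<le> t" "t < tn (Suc n)"
        using mesh_cover[of t] elim by auto
      have i: "integrable lborel (\<lambda>s. v s * indicator {tn n..t} s)"
        using integrable_real_mult_indicator[OF _ vi] by simp
      have "w t = (\<integral>s. v s * indicator {tn n..t} s \<partial>lborel)" using elim n by auto
      then have "ennreal \<bar>w t\<bar> \<le> (\<integral>\<^sup>+s. ennreal \<bar>v s * indicator {tn n..t} s\<bar> \<partial>lborel)"
        using integral_norm_bound_ennreal[OF i] by simp
      also have "\<dots> \<le> (\<integral>\<^sup>+s. ennreal \<bar>?h (t - s) * v s\<bar> \<partial>lborel)"
        using n tn_width[of n] by (intro nn_integral_mono ennreal_leI) (auto simp: indicator_def)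
      finally have "(ennreal \<bar>w t\<bar>)\<^sup>2 \<le> (\<integral>\<^sup>+s. ennreal \<bar>?h (t - s) * v s\<bar> \<partial>lborel)\<^sup>2"
        by (intro power_mono) auto
      then show ?thesis by (simp add: ennreal_power)
    qed (simp add: supp)
  qed
  then have "(\<integral>\<^sup>+t. ennreal ((w t)\<^sup>2) \<partial>lborel) \<le> (\<integral>\<^sup>+t. (\<integral>\<^sup>+s. ennreal \<bar>?h (t - s) * v s\<bar> \<partial>lborel)\<^sup>2 \<partial>lborel)"
    by (rule nn_integral_mono_AE)
  also have "\<dots> \<le> (\<integral>\<^sup>+r. ennreal \<bar>?h r\<bar> \<partial>lborel)\<^sup>2 * (\<integral>\<^sup>+t. ennreal ((v t)\<^sup>2) \<partial>lborel)"
    by (rule Young_L2) measurable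
  also have "(\<integral>\<^sup>+r. ennreal \<bar>?h r\<bar> \<partial>lborel) = ennreal k"
    using k_pos by (simp add: ennreal_indicator)
  finally show ?thesis using k_pos by (simp add: ennreal_power)
qed

end

section \<open>Elementary inequalities and limits for square-integrable functions\<close>

lemma abs_integral_mult_le:
  assumes "sq_int M v" "sq_int M w"
  shows "\<bar>\<integral>x. v x * w x \<partial>M\<bar> \<le> (\<integral>x. (v x)\<^sup>2 \<partial>M) + (\<integral>x. (w x)\<^sup>2 \<partial>M)"
proof -
  have "\<bar>\<integral>x. v x * w x \<partial>M\<bar> \<le> (\<integral>x. (v x)\<^sup>2 + (w x)\<^sup>2 \<partial>M)"
  proof (rule integral_abs_bound[THEN order_trans], rule integral_mono)
    show "integrable M (\<lambda>x. \<bar>v x * w x\<bar>)" "integrable M (\<lambda>x. (v x)\<^sup>2 + (w x)\<^sup>2)"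
      using assms sq_int_mult[OF assms] by (auto simp: sq_int_def)
    show "\<bar>v x * w x\<bar> \<le> (v x)\<^sup>2 + (w x)\<^sup>2" for x
      using sum_squares_bound[of "\<bar>v x\<bar>" "\<bar>w x\<bar>"] mult_nonneg_nonneg[of "\<bar>v x\<bar>" "\<bar>w x\<bar>"]
      unfolding abs_mult power2_abs by linarith
  qed
  then show ?thesis using assms by (simp add: sq_int_def)
qed

text \<open>The form of Young's product inequality used to absorb an inner product into two squared
  norms with constant exactly 1.\<close>

lemma integral_mult_le_half:
  assumes "sq_int M v" "sq_int M w"
  shows "2 * (\<integral>x. v x * w x \<partial>M) \<le> (\<integral>x. (v x)\<^sup>2 \<partial>M) + (\<integral>x. (w x)\<^sup>2 \<partial>M)"
proof -
  have "(\<integral>x. 2 * (v x * w x) \<partial>M) \<le> (\<integral>x. (v x)\<^sup>2 + (w x)\<^sup>2 \<partial>M)"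
    using assms sq_int_mult[OF assms] sum_squares_bound[of "v _" "w _"]
    by (intro integral_mono) (auto simp: sq_int_def mult.assoc)
  then show ?thesis using assms by (simp add: sq_int_def)
qed

lemma sq_int_square_diff_le:
  assumes "sq_int M v" "sq_int M w"
  shows "(\<integral>x. (v x - w x)\<^sup>2 \<partial>M) \<le> 2 * (\<integral>x. (v x)\<^sup>2 \<partial>M) + 2 * (\<integral>x. (w x)\<^sup>2 \<partial>M)"
proof -
  have "(\<integral>x. (v x - w x)\<^sup>2 \<partial>M) \<le> (\<integral>x. 2 * (v x)\<^sup>2 + 2 * (w x)\<^sup>2 \<partial>M)"
  proof (rule integral_mono)
    show "integrable M (\<lambda>x. (v x - w x)\<^sup>2)" "integrable M (\<lambda>x. 2 * (v x)\<^sup>2 + 2 * (w x)\<^sup>2)"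
      using assms sq_int_diff[OF assms] by (auto simp: sq_int_def)
    have "(a - b)\<^sup>2 + (a + b)\<^sup>2 = 2 * a\<^sup>2 + 2 * b\<^sup>2" for a b :: real
      by (simp add: power2_eq_square algebra_simps)
    then show "(v x - w x)\<^sup>2 \<le> 2 * (v x)\<^sup>2 + 2 * (w x)\<^sup>2" for x
      by (metis le_add_same_cancel1 zero_le_power2)
  qed
  then show ?thesis using assms by (simp add: sq_int_def)
qed

lemma sq_int_tendsto_inner:
  assumes v: "\<And>i. sq_int M (v i)" and w: "sq_int M w" and u: "sq_int M u"
    and lim: "((\<lambda>i. \<integral>x. (v i x - w x)\<^sup>2 \<partial>M) \<longlongrightarrow> 0) F"
  shows "((\<lambda>i. \<integral>x. v i x * u x \<partial>M) \<longlongrightarrow> (\<integral>x. w x * u x \<partial>M)) F"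
proof -
  have d: "sq_int M (\<lambda>x. v i x - w x)" for i by (rule sq_int_diff[OF v w])
  define S where "S i = sqrt ((\<integral>x. (v i x - w x)\<^sup>2 \<partial>M) * (\<integral>x. (u x)\<^sup>2 \<partial>M))" for i
  have "((\<lambda>i. sqrt ((\<integral>x. (v i x - w x)\<^sup>2 \<partial>M) * (\<integral>x. (u x)\<^sup>2 \<partial>M))) \<longlongrightarrow> sqrt (0 * (\<integral>x. (u x)\<^sup>2 \<partial>M))) F"
    by (intro tendsto_real_sqrt tendsto_mult lim tendsto_const)
  then have S: "(S \<longlongrightarrow> 0) F"
    unfolding S_def[abs_def] mult_zero_left real_sqrt_zero .
  have le: "norm ((\<integral>x. v i x * u x \<partial>M) - (\<integral>x. w x * u x \<partial>M)) \<le> S i" for i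
  proof -
    have eq: "(\<integral>x. (v i x - w x) * u x \<partial>M) = (\<integral>x. v i x * u x \<partial>M) - (\<integral>x. w x * u x \<partial>M)"
      unfolding left_diff_distrib
      by (rule Bochner_Integration.integral_diff[OF sq_int_mult[OF v u] sq_int_mult[OF w u]])
    show ?thesis
      using real_sqrt_le_mono[OF sq_int_Cauchy_Schwarz[OF d[of i] u]] unfolding eq S_def real_sqrt_abs real_norm_def .
  qed
  have "((\<lambda>i. (\<integral>x. v i x * u x \<partial>M) - (\<integral>x. w x * u x \<partial>M)) \<longlongrightarrow> 0) F"
    by (rule Lim_null_comparison[OF always_eventually S]) (use le in blast)
  then show ?thesis by (rule LIM_zero_cancel)
qed

text \<open>Expand the square of v around \<open>w\<close>: the squared norm of v is that of v - w,
  plus twice the inner product with \<open>w\<close>, minus the squared norm of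
  \<open>w\<close>.\<close>

lemma sq_int_tendsto_norm:
  assumes v: "\<And>i. sq_int M (v i)" and w: "sq_int M w"
    and lim: "((\<lambda>i. \<integral>x. (v i x - w x)\<^sup>2 \<partial>M) \<longlongrightarrow> 0) F"
  shows "((\<lambda>i. \<integral>x. (v i x)\<^sup>2 \<partial>M) \<longlongrightarrow> (\<integral>x. (w x)\<^sup>2 \<partial>M)) F"
proof -
  have d: "sq_int M (\<lambda>x. v i x - w x)" for i by (rule sq_int_diff[OF v w])
  have "(\<integral>x. (v i x)\<^sup>2 \<partial>M) = (\<integral>x. (v i x - w x)\<^sup>2 \<partial>M) + 2 * (\<integral>x. v i x * w x \<partial>M) - (\<integral>x. (w x)\<^sup>2 \<partial>M)" for i
  proof -
    have "(\<integral>x. (v i x)\<^sup>2 \<partial>M) = (\<integral>x. (v i x - w x)\<^sup>2 + 2 * (v i x * w x) - (w x)\<^sup>2 \<partial>M)"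
      by (intro Bochner_Integration.integral_cong refl) (simp add: power2_eq_square algebra_simps)
    then show ?thesis
      using d[of i] w by (simp add: sq_int_integrable sq_int_mult[OF v[of i] w])
  qed
  moreover have "((\<lambda>i. (\<integral>x. (v i x - w x)\<^sup>2 \<partial>M) + 2 * (\<integral>x. v i x * w x \<partial>M) - (\<integral>x. (w x)\<^sup>2 \<partial>M))
      \<longlongrightarrow> 0 + 2 * (\<integral>x. w x * w x \<partial>M) - (\<integral>x. (w x)\<^sup>2 \<partial>M)) F"
    by (intro tendsto_intros lim sq_int_tendsto_inner[OF v w w lim])
  ultimately show ?thesis by (simp add: power2_eq_square)
qed

section \<open>Weighted means of square-integrable functions\<close>

context sigma_finite_measure
begin

text \<open>Takes the place of a Bochner integral with values in L2: the time integral is taken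
  pointwise in \<open>x\<close>, Cauchy-Schwarz with weight |k| and Tonelli bound its norm, and
  Fubini interchanges it with inner products.\<close>

lemma weighted_mean:
  fixes v :: "real \<Rightarrow> 'a \<Rightarrow> real" and k :: "real \<Rightarrow> real"
  assumes [measurable]: "case_prod v \<in> borel_measurable (borel \<Otimes>\<^sub>M M)" "k \<in> borel_measurable borel"
    and k: "(\<integral>\<^sup>+s. ennreal \<bar>k s\<bar> \<partial>lborel) < \<infinity>"
    and kv: "(\<integral>\<^sup>+s. ennreal \<bar>k s\<bar> * (\<integral>\<^sup>+x. ennreal ((v s x)\<^sup>2) \<partial>M) \<partial>lborel) < \<infinity>"
  shows "sq_int M (\<lambda>x. \<integral>s. k s * v s x \<partial>lborel)"
    and "(\<integral>\<^sup>+x. ennreal ((\<integral>s. k s * v s x \<partial>lborel)\<^sup>2) \<partial>M)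
      \<le> (\<integral>\<^sup>+s. ennreal \<bar>k s\<bar> \<partial>lborel) * (\<integral>\<^sup>+s. ennreal \<bar>k s\<bar> * (\<integral>\<^sup>+x. ennreal ((v s x)\<^sup>2) \<partial>M) \<partial>lborel)"
    and "sq_int M w \<Longrightarrow>
      (\<integral>x. (\<integral>s. k s * v s x \<partial>lborel) * w x \<partial>M) = (\<integral>s. k s * (\<integral>x. v s x * w x \<partial>M) \<partial>lborel)"
    and "sq_int M w \<Longrightarrow> integrable lborel (\<lambda>s. k s * (\<integral>x. v s x * w x \<partial>M))"
    and "AE x in M. integrable lborel (\<lambda>s. k s * v s x)"
proof -
  interpret P: pair_sigma_finite lborel M ..
  have tonelli: "(\<integral>\<^sup>+x. (\<integral>\<^sup>+s. ennreal (\<bar>k s\<bar> * (v s x)\<^sup>2) \<partial>lborel) \<partial>M)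
     = (\<integral>\<^sup>+s. ennreal \<bar>k s\<bar> * (\<integral>\<^sup>+x. ennreal ((v s x)\<^sup>2) \<partial>M) \<partial>lborel)"
    by (subst P.Fubini') (auto simp: ennreal_mult' nn_integral_cmult)
  have pw: "(ennreal \<bar>\<integral>s. k s * v s x \<partial>lborel\<bar>)\<^sup>2
     \<le> (\<integral>\<^sup>+s. ennreal \<bar>k s\<bar> \<partial>lborel) * (\<integral>\<^sup>+s. ennreal (\<bar>k s\<bar> * (v s x)\<^sup>2) \<partial>lborel)"
    if [measurable]: "x \<in> space M" for x
  proof -
    have "ennreal \<bar>\<integral>s. k s * v s x \<partial>lborel\<bar> \<le> (\<integral>\<^sup>+s. ennreal \<bar>k s * v s x\<bar> \<partial>lborel)"
      using integral_norm_bound_ennreal[of lborel "\<lambda>s. k s * v s x"]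
      by (cases "integrable lborel (\<lambda>s. k s * v s x)") (auto simp: not_integrable_integral_eq)
    then have "(ennreal \<bar>\<integral>s. k s * v s x \<partial>lborel\<bar>)\<^sup>2 \<le> (\<integral>\<^sup>+s. ennreal \<bar>k s * v s x\<bar> \<partial>lborel)\<^sup>2"
      by (intro power_mono) auto
    also have "\<dots> \<le> (\<integral>\<^sup>+s. ennreal \<bar>k s\<bar> \<partial>lborel) * (\<integral>\<^sup>+s. ennreal (\<bar>k s\<bar> * (v s x)\<^sup>2) \<partial>lborel)"
      by (rule square_integral_weight_le) measurable
    finally show ?thesis .
  qed
  have "(\<integral>\<^sup>+x. ennreal ((\<integral>s. k s * v s x \<partial>lborel)\<^sup>2) \<partial>M)
      \<le> (\<integral>\<^sup>+x. (\<integral>\<^sup>+s. ennreal \<bar>k s\<bar> \<partial>lborel) * (\<integral>\<^sup>+s. ennreal (\<bar>k s\<bar> * (v s x)\<^sup>2) \<partial>lborel) \<partial>M)"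
    using pw by (intro nn_integral_mono) (simp add: ennreal_power)
  also have "\<dots> = (\<integral>\<^sup>+s. ennreal \<bar>k s\<bar> \<partial>lborel) * (\<integral>\<^sup>+s. ennreal \<bar>k s\<bar> * (\<integral>\<^sup>+x. ennreal ((v s x)\<^sup>2) \<partial>M) \<partial>lborel)"
    by (subst nn_integral_cmult) (auto simp: tonelli)
  finally show le: "(\<integral>\<^sup>+x. ennreal ((\<integral>s. k s * v s x \<partial>lborel)\<^sup>2) \<partial>M)
      \<le> (\<integral>\<^sup>+s. ennreal \<bar>k s\<bar> \<partial>lborel) * (\<integral>\<^sup>+s. ennreal \<bar>k s\<bar> * (\<integral>\<^sup>+x. ennreal ((v s x)\<^sup>2) \<partial>M) \<partial>lborel)" .
  then show "sq_int M (\<lambda>x. \<integral>s. k s * v s x \<partial>lborel)"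
    unfolding sq_int_iff_nn using k kv by (auto intro!: le_less_trans[OF le] simp: ennreal_mult_less_top)
  have "(\<integral>\<^sup>+x. (\<integral>\<^sup>+s. ennreal (\<bar>k s\<bar> * (v s x)\<^sup>2) \<partial>lborel) \<partial>M) < \<infinity>"
    using kv by (simp add: tonelli)
  then have "AE x in M. (\<integral>\<^sup>+s. ennreal (\<bar>k s\<bar> * (v s x)\<^sup>2) \<partial>lborel) \<noteq> \<infinity>"
    by (intro nn_integral_PInf_AE) auto
  then show "AE x in M. integrable lborel (\<lambda>s. k s * v s x)"
  proof (rule AE_mp, intro AE_I2 impI)
    fix x assume [measurable]: "x \<in> space M" and fin: "(\<integral>\<^sup>+s. ennreal (\<bar>k s\<bar> * (v s x)\<^sup>2) \<partial>lborel) \<noteq> \<infinity>"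
    have "(\<integral>\<^sup>+s. ennreal \<bar>k s * v s x\<bar> \<partial>lborel)\<^sup>2 \<le> (\<integral>\<^sup>+s. ennreal \<bar>k s\<bar> \<partial>lborel) * (\<integral>\<^sup>+s. ennreal (\<bar>k s\<bar> * (v s x)\<^sup>2) \<partial>lborel)"
      by (rule square_integral_weight_le) measurable
    also have "\<dots> < \<infinity>" using fin k by (simp add: ennreal_mult_less_top top.not_eq_extremum)
    finally have "(\<integral>\<^sup>+s. ennreal \<bar>k s * v s x\<bar> \<partial>lborel) < \<infinity>"
      by (cases "(\<integral>\<^sup>+s. ennreal \<bar>k s * v s x\<bar> \<partial>lborel) = top") (auto simp: top.not_eq_extremum)
    then show "integrable lborel (\<lambda>s. k s * v s x)"
      by (intro integrableI_bounded) auto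
  qed
  assume w: "sq_int M w"
  then have [measurable]: "w \<in> borel_measurable M" by (simp add: sq_int_def)
  have "(\<integral>\<^sup>+s. (\<integral>\<^sup>+x. ennreal \<bar>k s * (v s x * w x)\<bar> \<partial>M) \<partial>lborel)
     \<le> (\<integral>\<^sup>+s. ennreal \<bar>k s\<bar> * (\<integral>\<^sup>+x. ennreal ((v s x)\<^sup>2) \<partial>M) + ennreal \<bar>k s\<bar> * (\<integral>\<^sup>+x. ennreal ((w x)\<^sup>2) \<partial>M) \<partial>lborel)"
  proof (intro nn_integral_mono)
    fix s :: real
    have "(\<integral>\<^sup>+x. ennreal \<bar>k s * (v s x * w x)\<bar> \<partial>M) \<le> (\<integral>\<^sup>+x. ennreal \<bar>k s\<bar> * (ennreal ((v s x)\<^sup>2) + ennreal ((w x)\<^sup>2)) \<partial>M)"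
    proof (intro nn_integral_mono)
      fix x
      have "\<bar>v s x * w x\<bar> \<le> (v s x)\<^sup>2 + (w x)\<^sup>2"
        using sum_squares_bound[of "\<bar>v s x\<bar>" "\<bar>w x\<bar>"] mult_nonneg_nonneg[of "\<bar>v s x\<bar>" "\<bar>w x\<bar>"]
        unfolding abs_mult power2_abs by linarith
      then have "\<bar>k s * (v s x * w x)\<bar> \<le> \<bar>k s\<bar> * ((v s x)\<^sup>2 + (w x)\<^sup>2)"
        unfolding abs_mult[of "k s"] by (intro mult_left_mono) auto
      then have "ennreal \<bar>k s * (v s x * w x)\<bar> \<le> ennreal (\<bar>k s\<bar> * ((v s x)\<^sup>2 + (w x)\<^sup>2))"
        by (rule ennreal_leI)
      then show "ennreal \<bar>k s * (v s x * w x)\<bar> \<le> ennreal \<bar>k s\<bar> * (ennreal ((v s x)\<^sup>2) + ennreal ((w x)\<^sup>2))"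
        by (simp add: ennreal_mult')
    qed
    also have "\<dots> = ennreal \<bar>k s\<bar> * (\<integral>\<^sup>+x. ennreal ((v s x)\<^sup>2) \<partial>M) + ennreal \<bar>k s\<bar> * (\<integral>\<^sup>+x. ennreal ((w x)\<^sup>2) \<partial>M)"
      by (subst nn_integral_cmult, measurable, subst nn_integral_add) (auto simp: distrib_left)
    finally show "(\<integral>\<^sup>+x. ennreal \<bar>k s * (v s x * w x)\<bar> \<partial>M)
       \<le> ennreal \<bar>k s\<bar> * (\<integral>\<^sup>+x. ennreal ((v s x)\<^sup>2) \<partial>M) + ennreal \<bar>k s\<bar> * (\<integral>\<^sup>+x. ennreal ((w x)\<^sup>2) \<partial>M)" .
  qed
  also have "\<dots> = (\<integral>\<^sup>+s. ennreal \<bar>k s\<bar> * (\<integral>\<^sup>+x. ennreal ((v s x)\<^sup>2) \<partial>M) \<partial>lborel)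
     + (\<integral>\<^sup>+s. ennreal \<bar>k s\<bar> \<partial>lborel) * (\<integral>\<^sup>+x. ennreal ((w x)\<^sup>2) \<partial>M)"
    by (subst nn_integral_add) (auto simp: nn_integral_multc)
  also have "\<dots> < \<infinity>"
    using k kv w by (auto simp: sq_int_iff_nn ennreal_mult_less_top)
  finally have fin: "(\<integral>\<^sup>+s. (\<integral>\<^sup>+x. ennreal \<bar>k s * (v s x * w x)\<bar> \<partial>M) \<partial>lborel) < \<infinity>" .
  have "integrable (lborel \<Otimes>\<^sub>M M) (\<lambda>(s, x). k s * (v s x * w x))"
  proof (rule integrableI_bounded)
    show "(\<lambda>(s, x). k s * (v s x * w x)) \<in> borel_measurable (lborel \<Otimes>\<^sub>M M)" by measurable
    show "(\<integral>\<^sup>+p. ennreal (norm (case p of (s, x) \<Rightarrow> k s * (v s x * w x))) \<partial>(lborel \<Otimes>\<^sub>M M)) < \<infinity>"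
      using fin by (subst nn_integral_fst[symmetric]) auto
  qed
  from P.Fubini_integral[OF this] P.integrable_fst[OF this]
  show "(\<integral>x. (\<integral>s. k s * v s x \<partial>lborel) * w x \<partial>M) = (\<integral>s. k s * (\<integral>x. v s x * w x \<partial>M) \<partial>lborel)"
    "integrable lborel (\<lambda>s. k s * (\<integral>x. v s x * w x \<partial>M))"
    by (simp_all add: mult.assoc[symmetric] flip: integral_mult_left_zero)
       (simp_all add: mult.assoc)
qed

end

section \<open>Positivity of decreasing kernels\<close>

text \<open>Layer-cake form of the second mean value theorem: a nonnegative decreasing kernel is a
  superposition of indicators of initial intervals, and against each of these the integral of
  \<Theta> is nonnegative by hypothesis.\<close>

lemma fker_trunc_integral_nonneg:
  fixes \<Theta> :: "real \<Rightarrow> real"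
  assumes \<beta>: "0 < \<beta>" "\<beta> < 1" and T: "0 \<le> T" and [measurable]: "\<Theta> \<in> borel_measurable borel"
    and bd: "\<And>r. 0 < r \<Longrightarrow> \<bar>\<Theta> r\<bar> \<le> C"
    and prim: "\<And>\<rho>. 0 \<le> \<rho> \<Longrightarrow> \<rho> \<le> T \<Longrightarrow> 0 \<le> (\<integral>r. indicator {0..\<rho>} r * \<Theta> r \<partial>lborel)"
  shows "0 \<le> (\<integral>r. fker \<beta> r * indicator {..T} r * \<Theta> r \<partial>lborel)"
proof -
  define k where "k r = fker \<beta> r * indicator {..T} r" for r
  have [measurable]: "k \<in> borel_measurable borel" unfolding k_def by measurable
  have k0: "0 \<le> k r" for r using fker_nonneg[OF \<beta>(1)] by (simp add: k_def)
  have kfin: "(\<integral>\<^sup>+r. ennreal (k r) \<partial>lborel) < \<infinity>"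
    using fker_has_integral[OF \<beta>(1) T] k0 by (simp add: k_def nn_integral_eq_integral has_bochner_integral_iff)
  \<comment> \<open>Integrating over the level \<open>l\<close> recovers the kernel; integrating
    over \<open>r\<close> first gives a primitive of \<Theta>.\<close>
  define f where "f r l = indicator {0<..} l * (if l < k r then 1 else 0) * \<Theta> r" for r l :: real
  have [measurable]: "case_prod f \<in> borel_measurable (borel \<Otimes>\<^sub>M borel)" unfolding f_def by measurable
  have "(\<integral>\<^sup>+l. (\<integral>\<^sup>+r. ennreal \<bar>f r l\<bar> \<partial>lborel) \<partial>lborel) = (\<integral>\<^sup>+r. (\<integral>\<^sup>+l. ennreal \<bar>f r l\<bar> \<partial>lborel) \<partial>lborel)"
    by (rule lborel_pair.Fubini') measurable
  also have "\<dots> = (\<integral>\<^sup>+r. ennreal (k r) * ennreal \<bar>\<Theta> r\<bar> \<partial>lborel)"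
  proof (intro nn_integral_cong)
    fix r
    have "(\<integral>\<^sup>+l. ennreal \<bar>f r l\<bar> \<partial>lborel) = (\<integral>\<^sup>+l. indicator {0<..<k r} l * ennreal \<bar>\<Theta> r\<bar> \<partial>lborel)"
      by (intro nn_integral_cong) (auto simp: f_def indicator_def)
    then show "(\<integral>\<^sup>+l. ennreal \<bar>f r l\<bar> \<partial>lborel) = ennreal (k r) * ennreal \<bar>\<Theta> r\<bar>"
      by (simp add: nn_integral_multc k0)
  qed
  also have "\<dots> \<le> (\<integral>\<^sup>+r. ennreal (k r) * ennreal C \<partial>lborel)"
  proof (intro nn_integral_mono)
    fix r show "ennreal (k r) * ennreal \<bar>\<Theta> r\<bar> \<le> ennreal (k r) * ennreal C"
      using bd[of r] by (cases "0 < r") (auto intro!: mult_left_mono ennreal_leI simp: k_def fker_def)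
  qed
  also have "\<dots> < \<infinity>" using kfin by (simp add: nn_integral_multc ennreal_mult_less_top)
  finally have fin: "(\<integral>\<^sup>+l. (\<integral>\<^sup>+r. ennreal \<bar>f r l\<bar> \<partial>lborel) \<partial>lborel) < \<infinity>" .
  have "(\<integral>r. k r * \<Theta> r \<partial>lborel) = (\<integral>r. (\<integral>l. f r l \<partial>lborel) \<partial>lborel)"
  proof (intro Bochner_Integration.integral_cong refl)
    fix r
    have "f r l = indicator {0<..<k r} l * \<Theta> r" for l by (auto simp: f_def indicator_def)
    then show "k r * \<Theta> r = (\<integral>l. f r l \<partial>lborel)" using k0[of r] by simp
  qed
  also have "\<dots> = (\<integral>l. (\<integral>r. f r l \<partial>lborel) \<partial>lborel)"
    by (rule integral_swap(1)[OF _ fin]) measurable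
  also have "\<dots> \<ge> 0"
  proof (rule Bochner_Integration.integral_nonneg)
    fix l
    define S where "S = {r. l < k r}"
    show "0 \<le> (\<integral>r. f r l \<partial>lborel)"
    proof (cases "0 < l \<and> S \<noteq> {}")
      case False
      then have "f r l = 0" for r by (auto simp: f_def S_def indicator_def)
      then show ?thesis by simp
    next
      case True
      have S: "S \<subseteq> {0<..T}" using True by (auto simp: S_def k_def fker_def indicator_def split: if_splits)
      have down: "r \<in> S" if "s \<in> S" "0 < r" "r \<le> s" for r s
        using that S fker_antimono[OF \<beta> that(2,3)] by (auto simp: S_def k_def indicator_def split: if_splits)
      \<comment> \<open>A superlevel set of the kernel is downward closed among positive lags, so it
        is the interval from 0 to its supremum up to endpoints.\<close>
      define \<rho> where "\<rho> = Sup S"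
      have bdd: "bdd_above S" using S by (auto intro: bdd_above_mono[of "{0<..T}"])
      obtain s0 where s0: "s0 \<in> S" using True by auto
      have "s0 \<le> \<rho>" unfolding \<rho>_def by (rule cSup_upper[OF s0 bdd])
      moreover have "\<rho> \<le> T" unfolding \<rho>_def using S s0 by (intro cSup_least) auto
      ultimately have \<rho>: "0 \<le> \<rho>" "\<rho> \<le> T" using S s0 by auto
      have 1: "{0<..<\<rho>} \<subseteq> S"
      proof
        fix r assume "r \<in> {0<..<\<rho>}"
        then obtain s where "s \<in> S" "r < s" unfolding \<rho>_def using less_cSup_iff[of S r] bdd s0 by auto
        then show "r \<in> S" using down[of s r] \<open>r \<in> {0<..<\<rho>}\<close> by auto
      qed
      have 2: "S \<subseteq> {0<..\<rho>}" using S cSup_upper[OF _ bdd] by (auto simp: \<rho>_def)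
      have "AE r in lborel. r \<noteq> 0" "AE r in lborel. r \<noteq> \<rho>" by (rule AE_lborel_singleton)+
      then have "AE r in lborel. f r l = indicator {0..\<rho>} r * \<Theta> r"
      proof eventually_elim
        case (elim r)
        have "r \<in> S \<longleftrightarrow> r \<in> {0..\<rho>}" using 1 2 elim by force
        then show ?case using True by (auto simp: f_def S_def indicator_def)
      qed
      then have "(\<integral>r. f r l \<partial>lborel) = (\<integral>r. indicator {0..\<rho>} r * \<Theta> r \<partial>lborel)"
        by (intro integral_cong_AE) measurable
      then show ?thesis using prim[OF \<rho>] by simp
    qed
  qed
  finally show ?thesis by (simp add: k_def)
qed

section \<open>Symmetric nonnegative operators\<close>

text \<open>A relation is used because the image is determined only up to null sets.
  \<open>A_dense\<close> states density of the domain through its orthogonal complement; it is the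
  source of all uniqueness arguments.\<close>

locale symmetric_operator = sigma_finite_measure M for M :: "'a measure" +
  fixes A :: "('a \<Rightarrow> real) \<Rightarrow> ('a \<Rightarrow> real) \<Rightarrow> bool"
  assumes A_sq_int: "A v g \<Longrightarrow> sq_int M v \<and> sq_int M g"
    and A_lin: "A v g \<Longrightarrow> A w h \<Longrightarrow> A (\<lambda>x. a * v x + b * w x) (\<lambda>x. a * g x + b * h x)"
    and A_sym: "A v g \<Longrightarrow> A w h \<Longrightarrow> (\<integral>x. g x * w x \<partial>M) = (\<integral>x. v x * h x \<partial>M)"
    and A_nonneg: "A v g \<Longrightarrow> 0 \<le> (\<integral>x. g x * v x \<partial>M)"
    and A_dense: "sq_int M r \<Longrightarrow> (\<And>v g. A v g \<Longrightarrow> (\<integral>x. r x * v x \<partial>M) = 0) \<Longrightarrow> AE x in M. r x = 0"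
    and A_cong: "A v g \<Longrightarrow> AE x in M. v x = v' x \<Longrightarrow> AE x in M. g x = g' x \<Longrightarrow>
      v' \<in> borel_measurable M \<Longrightarrow> g' \<in> borel_measurable M \<Longrightarrow> A v' g'"
begin

abbreviation ip :: "('a \<Rightarrow> real) \<Rightarrow> ('a \<Rightarrow> real) \<Rightarrow> real" where
  "ip v w \<equiv> \<integral>x. v x * w x \<partial>M"

lemma ip_commute: "ip v w = ip w v"
  by (simp add: mult.commute)

lemma ip_diff_left: "sq_int M u \<Longrightarrow> sq_int M v \<Longrightarrow> sq_int M w \<Longrightarrow> ip (\<lambda>x. u x - v x) w = ip u w - ip v w"
  by (simp add: left_diff_distrib sq_int_mult)

lemma ip_add_left: "sq_int M u \<Longrightarrow> sq_int M v \<Longrightarrow> sq_int M w \<Longrightarrow> ip (\<lambda>x. u x + v x) w = ip u w + ip v w"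
  by (simp add: distrib_right sq_int_mult)

lemma A_diff: "A v g \<Longrightarrow> A w h \<Longrightarrow> A (\<lambda>x. v x - w x) (\<lambda>x. g x - h x)"
  using A_lin[of v g w h 1 "-1"] by simp

lemma AE_eq_of_inner_eq:
  assumes r: "sq_int M r" "sq_int M s" and eq: "\<And>v g. A v g \<Longrightarrow> ip r v = ip s v"
  shows "AE x in M. r x = s x"
proof -
  have "AE x in M. r x - s x = 0"
    using r eq A_sq_int by (intro A_dense[OF sq_int_diff[OF r]]) (auto simp: ip_diff_left)
  then show ?thesis by simp
qed

text \<open>For \<open>v\<close> in the domain, symmetry turns the weak identity into equality of
  the inner products of \<open>g\<close> and \<open>f\<close> with the whole domain, and density
  concludes. Images under \<open>A\<close> are identified this way throughout.\<close>

lemma A_unique_weak: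
  assumes "A v g" "sq_int M f" "\<And>w h. A w h \<Longrightarrow> ip v h = ip f w"
  shows "AE x in M. g x = f x"
  using assms A_sq_int A_sym by (intro AE_eq_of_inner_eq) auto

end

lemma sq_int_square_add_le:
  assumes "sq_int M v" "sq_int M w"
  shows "(\<integral>x. (v x + w x)\<^sup>2 \<partial>M) \<le> 2 * (\<integral>x. (v x)\<^sup>2 \<partial>M) + 2 * (\<integral>x. (w x)\<^sup>2 \<partial>M)"
  using sq_int_square_diff_le[OF assms(1) sq_int_scale[OF assms(2), of "-1"]] by simp

section \<open>Convolutions, primitives and bounded means in time\<close>

lemma integrable_indicator_Icc_mult:
  fixes f :: "real \<Rightarrow> real"
  assumes [measurable]: "f \<in> borel_measurable borel" and bd: "\<And>t. a \<le> t \<Longrightarrow> t \<le> b \<Longrightarrow> \<bar>f t\<bar> \<le> C"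
  shows "integrable lborel (\<lambda>t. indicator {a..b} t * f t)"
proof (rule Bochner_Integration.integrable_bound[where f="\<lambda>t. C * indicator {a..b} t"])
  show "integrable lborel (\<lambda>t. C * indicator {a..b} t :: real)"
    by (intro integrable_mult_right integrable_real_indicator) (auto simp: emeasure_lborel_Icc_eq)
  show "AE t in lborel. norm (indicator {a..b} t * f t) \<le> norm (C * indicator {a..b} t)"
    using bd by (intro AE_I2) (auto simp: indicator_def abs_mult intro: order_trans[OF _ abs_ge_self])
qed measurable

lemma lborel_integral_shift:
  fixes f :: "real \<Rightarrow> real"
  shows "(\<integral>s. f (s + c) \<partial>lborel) = (\<integral>s. f s \<partial>lborel)"
  using lborel_integral_real_affine[of 1 f c] by (simp add: add.commute)

text \<open>Dominated convergence. Since the kernel vanishes for r \<le> 0, a base time t \<ge> 0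
  only looks forward, so continuity of \<open>p\<close> on the half-line is enough.\<close>

lemma continuous_on_convolution:
  fixes k p :: "real \<Rightarrow> real"
  assumes k: "integrable lborel k" and k0: "\<And>r. r \<le> 0 \<Longrightarrow> k r = 0"
    and [measurable]: "p \<in> borel_measurable borel" and bd: "\<And>t. \<bar>p t\<bar> \<le> C"
    and cont: "continuous_on {0..} p"
  shows "continuous_on {0..} (\<lambda>t. \<integral>r. k r * p (t + r) \<partial>lborel)"
  unfolding continuous_on_sequentially
proof (intro allI ballI impI)
  have [measurable]: "k \<in> borel_measurable borel" using borel_measurable_integrable[OF k] by simp
  fix u and a :: real assume u: "a \<in> {0..}" "(\<forall>n. u n \<in> {0..}) \<and> u \<longlonglongrightarrow> a"
  have "(\<lambda>n. \<integral>r. k r * p (u n + r) \<partial>lborel) \<longlonglongrightarrow> (\<integral>r. k r * p (a + r) \<partial>lborel)"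
  proof (rule integral_dominated_convergence[where w="\<lambda>r. \<bar>k r\<bar> * C"])
    show "integrable lborel (\<lambda>r. \<bar>k r\<bar> * C)" using k by auto
    show "AE r in lborel. norm (k r * p (u n + r)) \<le> \<bar>k r\<bar> * C" for n
      using bd by (intro AE_I2) (auto simp: abs_mult intro!: mult_left_mono)
    show "AE r in lborel. (\<lambda>n. k r * p (u n + r)) \<longlonglongrightarrow> k r * p (a + r)"
    proof (intro AE_I2)
      fix r show "(\<lambda>n. k r * p (u n + r)) \<longlonglongrightarrow> k r * p (a + r)"
      proof (cases "r \<le> 0")
        case False
        have "(\<lambda>n. u n + r) \<longlonglongrightarrow> a + r" using u by (intro tendsto_intros) auto
        then have "(\<lambda>n. p (u n + r)) \<longlonglongrightarrow> p (a + r)"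
          using cont u False
          by (intro continuous_on_tendsto_compose[OF cont]) (auto intro!: always_eventually add_nonneg_nonneg)
        then show ?thesis by (intro tendsto_intros)
      qed (simp add: k0)
    qed
  qed measurable
  then show "((\<lambda>t. \<integral>r. k r * p (t + r) \<partial>lborel) \<circ> u) \<longlonglongrightarrow> (\<integral>r. k r * p (a + r) \<partial>lborel)"
    by (simp add: comp_def)
qed

lemma indefinite_integral_continuous:
  fixes c :: "real \<Rightarrow> real"
  assumes c: "continuous_on {0..T} c"
  shows "continuous_on {0..T} (\<lambda>t. \<integral>s. indicator {0..t} s * c s \<partial>lborel)"
    and "0 < t \<Longrightarrow> t < T \<Longrightarrow> ((\<lambda>t. \<integral>s. indicator {0..t} s * c s \<partial>lborel) has_real_derivative c t) (at t)"
proof -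
  have eq: "(\<integral>s. indicator {0..t} s * c s \<partial>lborel) = integral {0..t} c" if "t \<in> {0..T}" for t
  proof -
    have "set_integrable lborel {0..t} c"
      using that by (intro borel_integrable_atLeastAtMost' continuous_on_subset[OF c]) auto
    from set_borel_integral_eq_integral(2)[OF this] show ?thesis
      by (simp add: set_lebesgue_integral_def)
  qed
  have "continuous_on {0..T} (\<lambda>t. integral {0..t} c)"
    by (intro indefinite_integral_continuous_1 integrable_continuous_real c)
  then show "continuous_on {0..T} (\<lambda>t. \<integral>s. indicator {0..t} s * c s \<partial>lborel)"
    by (rule continuous_on_cong[THEN iffD1, rotated -1]) (auto simp: eq)
  assume t: "0 < t" "t < T"
  then have "((\<lambda>t. integral {0..t} c) has_real_derivative c t) (at t within {0..T})"
    using c by (intro integral_has_real_derivative) auto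
  then have "((\<lambda>t. integral {0..t} c) has_real_derivative c t) (at t)"
    using t by (simp add: at_within_Icc_at)
  then show "((\<lambda>t. \<integral>s. indicator {0..t} s * c s \<partial>lborel) has_real_derivative c t) (at t)"
  proof (rule has_field_derivative_transform_within_open[where S="{0<..<T}"])
    show "integral {0..s} c = (\<integral>r. indicator {0..s} r * c r \<partial>lborel)" if "s \<in> {0<..<T}" for s
      using that by (intro eq[symmetric]) auto
  qed (use t in auto)
qed

context sigma_finite_measure
begin

text \<open>The weighted mean with quantitative data. The norm bound is demanded only where the
  weight is nonzero, which allows it to be small near one point when averages over shrinking
  intervals are taken.\<close>

lemma
  fixes v :: "real \<Rightarrow> 'a \<Rightarrow> real" and k :: "real \<Rightarrow> real"
  assumes [measurable]: "case_prod v \<in> borel_measurable (borel \<Otimes>\<^sub>M M)" "k \<in> borel_measurable borel"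
    and K: "(\<integral>\<^sup>+s. ennreal \<bar>k s\<bar> \<partial>lborel) \<le> ennreal K" "0 \<le> K"
    and v: "\<And>s. sq_int M (v s)" and B: "\<And>s. k s \<noteq> 0 \<Longrightarrow> (\<integral>x. (v s x)\<^sup>2 \<partial>M) \<le> B" "0 \<le> B"
  shows weighted_mean_bounded_sq_int: "sq_int M (\<lambda>x. \<integral>s. k s * v s x \<partial>lborel)"
    and weighted_mean_bounded_le: "(\<integral>x. (\<integral>s. k s * v s x \<partial>lborel)\<^sup>2 \<partial>M) \<le> K\<^sup>2 * B"
    and weighted_mean_bounded_inner: "sq_int M w \<Longrightarrow>
      (\<integral>x. (\<integral>s. k s * v s x \<partial>lborel) * w x \<partial>M) = (\<integral>s. k s * (\<integral>x. v s x * w x \<partial>M) \<partial>lborel)"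
    and weighted_mean_bounded_inner_integrable:
      "sq_int M w \<Longrightarrow> integrable lborel (\<lambda>s. k s * (\<integral>x. v s x * w x \<partial>M))"
    and weighted_mean_bounded_AE_integrable: "AE x in M. integrable lborel (\<lambda>s. k s * v s x)"
proof -
  have kfin: "(\<integral>\<^sup>+s. ennreal \<bar>k s\<bar> \<partial>lborel) < \<infinity>" using K(1) by (rule le_less_trans) simp
  have "(\<integral>\<^sup>+s. ennreal \<bar>k s\<bar> * (\<integral>\<^sup>+x. ennreal ((v s x)\<^sup>2) \<partial>M) \<partial>lborel) \<le> (\<integral>\<^sup>+s. ennreal \<bar>k s\<bar> * ennreal B \<partial>lborel)"
  proof (intro nn_integral_mono)
    fix s show "ennreal \<bar>k s\<bar> * (\<integral>\<^sup>+x. ennreal ((v s x)\<^sup>2) \<partial>M) \<le> ennreal \<bar>k s\<bar> * ennreal B"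
      using B(1)[of s] by (cases "k s = 0") (auto simp: nn_integral_sq_int[OF v] intro!: mult_left_mono ennreal_leI)
  qed
  also have "\<dots> = (\<integral>\<^sup>+s. ennreal \<bar>k s\<bar> \<partial>lborel) * ennreal B"
    by (intro nn_integral_multc) measurable
  also have "\<dots> \<le> ennreal K * ennreal B" by (intro mult_right_mono K) auto
  finally have kB: "(\<integral>\<^sup>+s. ennreal \<bar>k s\<bar> * (\<integral>\<^sup>+x. ennreal ((v s x)\<^sup>2) \<partial>M) \<partial>lborel) \<le> ennreal K * ennreal B" .
  then have kvfin: "(\<integral>\<^sup>+s. ennreal \<bar>k s\<bar> * (\<integral>\<^sup>+x. ennreal ((v s x)\<^sup>2) \<partial>M) \<partial>lborel) < \<infinity>"
    by (rule le_less_trans) (simp add: ennreal_mult_less_top)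
  note wm = weighted_mean[OF assms(1,2) kfin kvfin]
  show sq: "sq_int M (\<lambda>x. \<integral>s. k s * v s x \<partial>lborel)" by (rule wm(1))
  have "(\<integral>\<^sup>+x. ennreal ((\<integral>s. k s * v s x \<partial>lborel)\<^sup>2) \<partial>M) \<le> ennreal K * (ennreal K * ennreal B)"
    using wm(2) by (rule order_trans) (intro mult_mono K kB, auto)
  also have "\<dots> = ennreal (K\<^sup>2 * B)"
    using K B by (simp add: ennreal_mult power2_eq_square mult.assoc)
  finally show "(\<integral>x. (\<integral>s. k s * v s x \<partial>lborel)\<^sup>2 \<partial>M) \<le> K\<^sup>2 * B"
    using B by (simp add: nn_integral_sq_int[OF sq])
  show "sq_int M w \<Longrightarrow>
      (\<integral>x. (\<integral>s. k s * v s x \<partial>lborel) * w x \<partial>M) = (\<integral>s. k s * (\<integral>x. v s x * w x \<partial>M) \<partial>lborel)"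
    "sq_int M w \<Longrightarrow> integrable lborel (\<lambda>s. k s * (\<integral>x. v s x * w x \<partial>M))"
    "AE x in M. integrable lborel (\<lambda>s. k s * v s x)"
    using wm(3,4,5) by auto
qed

end

section \<open>Stability of the dual problem\<close>

text \<open>\<phi> and \<eta> are extended by zero outside [0,T]; weak continuity of \<phi> on all
  of [0,\<infinity>) thus carries the end condition \<phi>(T) = 0. \<open>G t\<close> stands for
  \<open>A\<close> applied to \<phi>(t), chosen time by time. \<open>F_deriv\<close> is the dual
  equation, as a strong limit of difference quotients.\<close>

locale dual_problem = symmetric_operator M A for M :: "'a measure" and A +
  fixes \<alpha> T B :: real and \<phi> \<eta> G z E F :: "real \<Rightarrow> 'a \<Rightarrow> real"
  defines z_def: "z t x \<equiv> \<integral>s. indicator {0..t} s * \<phi> s x \<partial>lborel"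
    and E_def: "E t x \<equiv> \<integral>s. indicator {0..t} s * \<eta> s x \<partial>lborel"
    and F_def: "F t x \<equiv> \<integral>s. fker (1 - \<alpha>) (s - t) * \<phi> s x \<partial>lborel"
  assumes \<alpha>: "0 < \<alpha>" "\<alpha> < 1" and T: "0 < T" and B: "0 \<le> B"
    and \<phi>_meas [measurable]: "case_prod \<phi> \<in> borel_measurable (borel \<Otimes>\<^sub>M M)"
    and \<eta>_meas [measurable]: "case_prod \<eta> \<in> borel_measurable (borel \<Otimes>\<^sub>M M)"
    and \<phi>_sq: "sq_int M (\<phi> t)" and \<eta>_sq: "sq_int M (\<eta> t)"
    and \<phi>_supp: "t \<notin> {0..T} \<Longrightarrow> \<phi> t x = 0" and \<eta>_supp: "t \<notin> {0..T} \<Longrightarrow> \<eta> t x = 0"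
    and \<phi>_bd: "(\<integral>x. (\<phi> t x)\<^sup>2 \<partial>M) \<le> B" and \<eta>_bd: "(\<integral>x. (\<eta> t x)\<^sup>2 \<partial>M) \<le> B"
    and \<phi>_cont: "sq_int M w \<Longrightarrow> continuous_on {0..} (\<lambda>t. \<integral>x. \<phi> t x * w x \<partial>M)"
    and \<eta>_cont: "t \<in> {0..T} \<Longrightarrow> ((\<lambda>s. \<integral>x. (\<eta> s x - \<eta> t x)\<^sup>2 \<partial>M) \<longlongrightarrow> 0) (at t within {0..T})"
    and z_dom: "s \<in> {0..T} \<Longrightarrow> t \<in> {0..T} \<Longrightarrow> \<exists>g. A (\<lambda>x. z t x - z s x) g"
    and \<phi>_A: "0 < t \<Longrightarrow> t < T \<Longrightarrow> A (\<phi> t) (G t)"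
    and F_deriv: "0 < t \<Longrightarrow> t < T \<Longrightarrow>
      ((\<lambda>h. \<integral>x. ((F (t + h) x - F t x) / h - (G t x - \<eta> t x))\<^sup>2 \<partial>M) \<longlongrightarrow> 0) (at 0)"
begin

lemma z_meas [measurable]: "case_prod z \<in> borel_measurable (borel \<Otimes>\<^sub>M M)"
  and E_meas [measurable]: "case_prod E \<in> borel_measurable (borel \<Otimes>\<^sub>M M)"
  and F_meas [measurable]: "case_prod F \<in> borel_measurable (borel \<Otimes>\<^sub>M M)"
proof -
  have "case_prod (\<lambda>t x. \<integral>s. (if 0 \<le> s \<and> s \<le> t then 1 else 0) * v s x \<partial>lborel) \<in> borel_measurable (borel \<Otimes>\<^sub>M M)"
    if [measurable]: "case_prod v \<in> borel_measurable (borel \<Otimes>\<^sub>M M)" for v :: "real \<Rightarrow> 'a \<Rightarrow> real"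
    by measurable
  moreover have "indicator {0..t} s = (if 0 \<le> s \<and> s \<le> t then 1 else 0 :: real)" for s t :: real
    by (simp add: indicator_def)
  ultimately show "case_prod z \<in> borel_measurable (borel \<Otimes>\<^sub>M M)" "case_prod E \<in> borel_measurable (borel \<Otimes>\<^sub>M M)"
    unfolding z_def[abs_def] E_def[abs_def] by simp_all
  show "case_prod F \<in> borel_measurable (borel \<Otimes>\<^sub>M M)"
    unfolding F_def[abs_def] by measurable
qed

text \<open>Only lags up to \<open>T\<close> are seen from a nonnegative time, because \<phi>
  vanishes after \<open>T\<close>; the truncated kernel is integrable.\<close>

definition kT :: "real \<Rightarrow> real" where
  "kT r = fker (1 - \<alpha>) r * indicator {..T} r"

lemma kT_meas [measurable]: "kT \<in> borel_measurable borel"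
  unfolding kT_def by measurable

lemma kT_nonneg: "0 \<le> kT r"
  using fker_nonneg[of "1 - \<alpha>" r] \<alpha> by (simp add: kT_def)

lemma kT_integral: "has_bochner_integral lborel kT (fker_int (1 - \<alpha>) T)"
  using fker_has_integral[of "1 - \<alpha>" T] \<alpha> T by (simp add: kT_def[abs_def])

abbreviation K1 :: real where "K1 \<equiv> fker_int (1 - \<alpha>) T"

lemma K1_nonneg: "0 \<le> K1" using fker_int_nonneg[of "1 - \<alpha>"] \<alpha> by simp

lemma kT_nn: "(\<integral>\<^sup>+s. ennreal \<bar>kT (s - t)\<bar> \<partial>lborel) \<le> ennreal K1"
  using kT_integral kT_nonneg
  by (simp add: nn_integral_shift[of "\<lambda>s. ennreal (kT s)"] nn_integral_eq_integral has_bochner_integral_iff)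

lemma F_kT: "0 \<le> t \<Longrightarrow> F t x = (\<integral>s. kT (s - t) * \<phi> s x \<partial>lborel)"
  unfolding F_def
proof (intro Bochner_Integration.integral_cong refl)
  fix s assume "0 \<le> t" then show "fker (1 - \<alpha>) (s - t) * \<phi> s x = kT (s - t) * \<phi> s x"
    using \<phi>_supp[of s x] by (cases "s \<in> {0..T}") (auto simp: kT_def indicator_def)
qed

text \<open>Also for negative \<open>t\<close>, hence the cut-off at T + |t|: difference quotients
  are formed with arbitrary steps, and the limit lemma asks for square integrability at each of
  them.\<close>

lemma F_sq: "sq_int M (F t)"
proof -
  let ?k = "\<lambda>s. fker (1 - \<alpha>) (s - t) * indicator {..T + \<bar>t\<bar>} (s - t)"
  have "F t x = (\<integral>s. ?k s * \<phi> s x \<partial>lborel)" for x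
    unfolding F_def
  proof (intro Bochner_Integration.integral_cong refl)
    fix s show "fker (1 - \<alpha>) (s - t) * \<phi> s x = ?k s * \<phi> s x"
      using \<phi>_supp[of s x] by (cases "s \<in> {0..T}") (auto simp: indicator_def)
  qed
  then have eq: "F t = (\<lambda>x. \<integral>s. ?k s * \<phi> s x \<partial>lborel)" by auto
  have "has_bochner_integral lborel (\<lambda>r. fker (1 - \<alpha>) r * indicator {..T + \<bar>t\<bar>} r) (fker_int (1 - \<alpha>) (T + \<bar>t\<bar>))"
    using fker_has_integral[of "1 - \<alpha>" "T + \<bar>t\<bar>"] \<alpha> T by simp
  then have nn: "(\<integral>\<^sup>+s. ennreal \<bar>?k s\<bar> \<partial>lborel) \<le> ennreal (fker_int (1 - \<alpha>) (T + \<bar>t\<bar>))"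
    using fker_nonneg[of "1 - \<alpha>"] \<alpha>
      nn_integral_shift[of "\<lambda>r. ennreal (fker (1 - \<alpha>) r * indicator {..T + \<bar>t\<bar>} r)" t]
      nn_integral_eq_integral[of lborel "\<lambda>r. fker (1 - \<alpha>) r * indicator {..T + \<bar>t\<bar>} r"]
    by (simp add: has_bochner_integral_iff)
  show ?thesis
    unfolding eq using fker_int_nonneg[of "1 - \<alpha>"] \<alpha>
    by (intro weighted_mean_bounded_sq_int[where B=B, OF _ _ nn]) (auto simp: \<phi>_sq \<phi>_bd B)
qed

lemma F_bd: "0 \<le> t \<Longrightarrow> (\<integral>x. (F t x)\<^sup>2 \<partial>M) \<le> K1\<^sup>2 * B"
  unfolding F_kT
  by (intro weighted_mean_bounded_le[where B=B, OF _ _ kT_nn]) (auto simp: \<phi>_sq \<phi>_bd B K1_nonneg)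

text \<open>The substitution s = t + r moves the time dependence from the singular kernel to \<phi>,
  which is what continuity and increments in \<open>t\<close> need.\<close>

lemma F_inner:
  assumes t: "0 \<le> t" and w: "sq_int M w"
  shows "ip (F t) w = (\<integral>r. kT r * ip (\<phi> (t + r)) w \<partial>lborel)"
    and "integrable lborel (\<lambda>r. kT r * ip (\<phi> (t + r)) w)"
proof -
  have "ip (F t) w = (\<integral>s. kT (s - t) * ip (\<phi> s) w \<partial>lborel)"
    unfolding F_kT[OF t]
    by (intro weighted_mean_bounded_inner[where B=B, OF _ _ kT_nn] w) (auto simp: \<phi>_sq \<phi>_bd B K1_nonneg)
  also have "\<dots> = (\<integral>r. kT r * ip (\<phi> (t + r)) w \<partial>lborel)"
    using lborel_integral_shift[of "\<lambda>s. kT (s - t) * ip (\<phi> s) w" t] by (simp add: add.commute)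
  finally show "ip (F t) w = (\<integral>r. kT r * ip (\<phi> (t + r)) w \<partial>lborel)" .
  have "integrable lborel (\<lambda>s. kT (s - t) * ip (\<phi> s) w)"
    by (intro weighted_mean_bounded_inner_integrable[where B=B, OF _ _ kT_nn] w) (auto simp: \<phi>_sq \<phi>_bd B K1_nonneg)
  then show "integrable lborel (\<lambda>r. kT r * ip (\<phi> (t + r)) w)"
    using lborel_integrable_real_affine[of "\<lambda>s. kT (s - t) * ip (\<phi> s) w" 1 t] by simp
qed

lemma Icc_nn: "0 \<le> t \<Longrightarrow> (\<integral>\<^sup>+s. ennreal \<bar>indicator {0..t} s :: real\<bar> \<partial>lborel) \<le> ennreal t"
  by (simp add: ennreal_indicator)

lemma z_sq: "0 \<le> t \<Longrightarrow> sq_int M (z t)"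
  unfolding z_def by (intro weighted_mean_bounded_sq_int[where B=B, OF _ _ Icc_nn]) (auto simp: \<phi>_sq \<phi>_bd B)

lemma E_sq: "0 \<le> t \<Longrightarrow> sq_int M (E t)"
  unfolding E_def by (intro weighted_mean_bounded_sq_int[where B=B, OF _ _ Icc_nn]) (auto simp: \<eta>_sq \<eta>_bd B)

lemma z_inner: "0 \<le> t \<Longrightarrow> sq_int M w \<Longrightarrow> ip (z t) w = (\<integral>s. indicator {0..t} s * ip (\<phi> s) w \<partial>lborel)"
  unfolding z_def by (intro weighted_mean_bounded_inner[where B=B, OF _ _ Icc_nn]) (auto simp: \<phi>_sq \<phi>_bd B)

lemma E_inner: "0 \<le> t \<Longrightarrow> sq_int M w \<Longrightarrow> ip (E t) w = (\<integral>s. indicator {0..t} s * ip (\<eta> s) w \<partial>lborel)"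
  unfolding E_def by (intro weighted_mean_bounded_inner[where B=B, OF _ _ Icc_nn]) (auto simp: \<eta>_sq \<eta>_bd B)

lemma ip_\<phi>_bd: "sq_int M w \<Longrightarrow> \<bar>ip (\<phi> t) w\<bar> \<le> B + ip w w"
  using abs_integral_mult_le[OF \<phi>_sq[of t], of w] \<phi>_bd[of t] by (simp add: power2_eq_square)

lemma \<eta>_cont_weak:
  assumes w: "sq_int M w" shows "continuous_on {0..T} (\<lambda>t. ip (\<eta> t) w)"
  unfolding continuous_on_def using sq_int_tendsto_inner[OF \<eta>_sq \<eta>_sq w \<eta>_cont] by blast

text \<open>The quantity is a primitive of the equation tested with \<open>\<xi>\<close>, so its derivative vanishes.\<close>

lemma weak_equation_const:
  assumes \<xi>: "A \<xi> h" and t: "t \<in> {0..T}"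
  shows "ip (z t) h - ip (F t) \<xi> - ip (E t) \<xi> = ip (z T) h - ip (F T) \<xi> - ip (E T) \<xi>"
proof -
  have \<xi>_sq: "sq_int M \<xi>" and h_sq: "sq_int M h" using A_sq_int[OF \<xi>] by auto
  have [measurable]: "\<xi> \<in> borel_measurable M" "h \<in> borel_measurable M" using \<xi>_sq h_sq by (auto simp: sq_int_def)
  let ?D = "\<lambda>t. (\<integral>s. indicator {0..t} s * ip (\<phi> s) h \<partial>lborel) - ip (F t) \<xi> - (\<integral>s. indicator {0..t} s * ip (\<eta> s) \<xi> \<partial>lborel)"
  have c\<phi>: "continuous_on {0..T} (\<lambda>t. ip (\<phi> t) h)"
    using \<phi>_cont[OF h_sq] by (rule continuous_on_subset) auto
  have "continuous_on {0..} (\<lambda>t. \<integral>r. kT r * ip (\<phi> (t + r)) \<xi> \<partial>lborel)"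
  proof (rule continuous_on_convolution)
    show "integrable lborel kT" using kT_integral by (simp add: has_bochner_integral_iff)
    show "\<bar>ip (\<phi> t) \<xi>\<bar> \<le> B + ip \<xi> \<xi>" for t by (rule ip_\<phi>_bd[OF \<xi>_sq])
  qed (auto simp: kT_def fker_def \<phi>_cont[OF \<xi>_sq])
  then have cF: "continuous_on {0..T} (\<lambda>t. ip (F t) \<xi>)"
  proof -
    assume "continuous_on {0..} (\<lambda>t. \<integral>r. kT r * ip (\<phi> (t + r)) \<xi> \<partial>lborel)"
    then have "continuous_on {0..T} (\<lambda>t. \<integral>r. kT r * ip (\<phi> (t + r)) \<xi> \<partial>lborel)"
      by (rule continuous_on_subset) auto
    then show ?thesis
      by (rule continuous_on_eq) (simp add: F_inner(1)[OF _ \<xi>_sq])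
  qed
  have cont: "continuous_on {0..T} ?D"
    by (rule continuous_on_diff[OF continuous_on_diff[OF indefinite_integral_continuous(1)[OF c\<phi>] cF]
      indefinite_integral_continuous(1)[OF \<eta>_cont_weak[OF \<xi>_sq]]])
  have der: "(?D has_real_derivative 0) (at s)" if s: "0 < s" "s < T" for s
  proof -
    have G_sq: "sq_int M (G s)" using A_sq_int[OF \<phi>_A[OF s]] by auto
    have "((\<lambda>h. ip (\<lambda>x. (F (s + h) x - F s x) / h) \<xi>) \<longlongrightarrow> ip (\<lambda>x. G s x - \<eta> s x) \<xi>) (at 0)"
    proof (rule sq_int_tendsto_inner[OF _ _ \<xi>_sq F_deriv[OF s]])
      show "sq_int M (\<lambda>x. (F (s + h) x - F s x) / h)" for h
        using sq_int_scale[OF sq_int_diff[OF F_sq[of "s + h"] F_sq[of s]], of "inverse h"]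
        by (simp add: divide_inverse mult.commute)
    qed (rule sq_int_diff[OF G_sq \<eta>_sq])
    also have "(\<lambda>h. ip (\<lambda>x. (F (s + h) x - F s x) / h) \<xi>) = (\<lambda>h. (ip (F (s + h)) \<xi> - ip (F s) \<xi>) / h)"
      by (simp add: ip_diff_left[OF F_sq F_sq \<xi>_sq, symmetric])
    finally have "((\<lambda>t. ip (F t) \<xi>) has_real_derivative ip (\<lambda>x. G s x - \<eta> s x) \<xi>) (at s)"
      by (simp add: DERIV_def)
    then have "(?D has_real_derivative ip (\<phi> s) h - ip (\<lambda>x. G s x - \<eta> s x) \<xi> - ip (\<eta> s) \<xi>) (at s)"
      by (rule DERIV_diff[OF DERIV_diff[OF indefinite_integral_continuous(2)[OF c\<phi> s]]
         indefinite_integral_continuous(2)[OF \<eta>_cont_weak[OF \<xi>_sq] s]])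
    moreover have "ip (\<lambda>x. G s x - \<eta> s x) \<xi> = ip (\<phi> s) h - ip (\<eta> s) \<xi>"
      using A_sym[OF \<phi>_A[OF s] \<xi>] by (simp add: ip_diff_left G_sq \<eta>_sq \<xi>_sq)
    ultimately show ?thesis by simp
  qed
  \<comment> \<open>The derivative is known only in the open interval; continuity up to the
    endpoints carries the identity to 0 and \<open>T\<close>.\<close>
  have "?D t = ?D 0" "?D T = ?D 0"
    using DERIV_isconst2[OF T cont der] t T by auto
  then show ?thesis
    using z_inner[OF _ h_sq, of t] z_inner[OF _ h_sq, of T] E_inner[OF _ \<xi>_sq, of t] E_inner[OF _ \<xi>_sq, of T] t T
    by simp
qed

lemma F_beyond: "T \<le> t \<Longrightarrow> F t x = 0"
proof -
  assume "T \<le> t"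
  then have *: "fker (1 - \<alpha>) (s - t) * \<phi> s x = 0" for s
    using \<phi>_supp[of s x] by (cases "s \<in> {0..T}") (auto simp: fker_def)
  show ?thesis unfolding F_def * by simp
qed

lemma z_beyond: "T \<le> t \<Longrightarrow> z t x = z T x" and E_beyond: "T \<le> t \<Longrightarrow> E t x = E T x"
proof -
  assume t: "T \<le> t"
  show "z t x = z T x" unfolding z_def
    using t \<phi>_supp[of _ x] by (intro Bochner_Integration.integral_cong refl) (auto simp: indicator_def)
  show "E t x = E T x" unfolding E_def
    using t \<eta>_supp[of _ x] by (intro Bochner_Integration.integral_cong refl) (auto simp: indicator_def)
qed

text \<open>Integrating A \<phi> = \<eta> + F' from 0 to \<open>t\<close> gives A z(t) = E(t) + F(t)
  - F(0). So \<zeta> is A z up to a constant in time, and its increments are images under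
  \<open>A\<close>.\<close>

definition \<zeta> :: "real \<Rightarrow> 'a \<Rightarrow> real" where
  "\<zeta> t x = F t x + E t x"

lemma \<zeta>_meas [measurable]: "case_prod \<zeta> \<in> borel_measurable (borel \<Otimes>\<^sub>M M)"
  unfolding \<zeta>_def[abs_def] by measurable

lemma \<zeta>_sq: "0 \<le> t \<Longrightarrow> sq_int M (\<zeta> t)"
  unfolding \<zeta>_def by (intro sq_int_add F_sq E_sq)

text \<open>The integrated weak equation identifies the image of an increment of \<open>z\<close>,
  whose membership in the domain is assumed on [0,T]. Both \<open>z\<close> and \<zeta> are constant
  after \<open>T\<close>, so replacing times by their minimum with \<open>T\<close> extends this to
  all t \<ge> 0.\<close>

lemma A_z_diff:
  assumes "0 \<le> s" "0 \<le> t"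
  shows "A (\<lambda>x. z t x - z s x) (\<lambda>x. \<zeta> t x - \<zeta> s x)"
proof -
  have main: "A (\<lambda>x. z t x - z s x) (\<lambda>x. \<zeta> t x - \<zeta> s x)" if st: "s \<in> {0..T}" "t \<in> {0..T}" for s t
  proof -
    obtain g where g: "A (\<lambda>x. z t x - z s x) g" using z_dom[OF st] by auto
    have sq: "sq_int M (\<lambda>x. \<zeta> t x - \<zeta> s x)" using st by (intro sq_int_diff \<zeta>_sq) auto
    have "AE x in M. g x = \<zeta> t x - \<zeta> s x"
    proof (rule A_unique_weak[OF g sq])
      fix \<xi> h assume \<xi>: "A \<xi> h"
      have \<xi>_sq: "sq_int M \<xi>" and h_sq: "sq_int M h" using A_sq_int[OF \<xi>] by auto
      have "ip (\<lambda>x. \<zeta> t x - \<zeta> s x) \<xi> = (ip (F t) \<xi> + ip (E t) \<xi>) - (ip (F s) \<xi> + ip (E s) \<xi>)"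
        using st \<xi>_sq by (simp add: ip_diff_left \<zeta>_sq, simp add: \<zeta>_def ip_add_left F_sq E_sq)
      also have "\<dots> = ip (z t) h - ip (z s) h"
        using weak_equation_const[OF \<xi> st(1)] weak_equation_const[OF \<xi> st(2)] by simp
      also have "\<dots> = ip (\<lambda>x. z t x - z s x) h"
        using st h_sq by (simp add: ip_diff_left z_sq)
      finally show "ip (\<lambda>x. z t x - z s x) h = ip (\<lambda>x. \<zeta> t x - \<zeta> s x) \<xi>" by simp
    qed
    then show ?thesis
      using A_sq_int[OF g] sq by (intro A_cong[OF g]) (auto simp: sq_int_def)
  qed
  have z: "z (min r T) = z r" and \<zeta>: "\<zeta> (min r T) = \<zeta> r" for r
    using z_beyond[of r] E_beyond[of r] F_beyond[of r] F_beyond[of T]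
    by (auto simp: min_def fun_eq_iff \<zeta>_def)
  show ?thesis
    using main[of "min s T" "min t T"] assms T unfolding z \<zeta> by simp
qed

end

lemma integral_swap_bounded:
  fixes k :: "real \<Rightarrow> real" and c :: "real \<Rightarrow> real \<Rightarrow> real"
  assumes k: "integrable lborel k" and [measurable]: "case_prod c \<in> borel_measurable (borel \<Otimes>\<^sub>M borel)"
    and bd: "\<And>t r. a \<le> t \<Longrightarrow> t \<le> b \<Longrightarrow> \<bar>c t r\<bar> \<le> C"
  shows "(\<integral>t. indicator {a..b} t * (\<integral>r. k r * c t r \<partial>lborel) \<partial>lborel)
     = (\<integral>r. k r * (\<integral>t. indicator {a..b} t * c t r \<partial>lborel) \<partial>lborel)"
proof -
  have [measurable]: "k \<in> borel_measurable borel" using borel_measurable_integrable[OF k] by simp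
  have "(\<integral>\<^sup>+r. (\<integral>\<^sup>+t. ennreal \<bar>indicator {a..b} t * (k r * c t r)\<bar> \<partial>lborel) \<partial>lborel)
     \<le> (\<integral>\<^sup>+r. ennreal \<bar>k r\<bar> * (ennreal C * emeasure lborel {a..b}) \<partial>lborel)"
  proof (intro nn_integral_mono)
    fix r
    have "(\<integral>\<^sup>+t. ennreal \<bar>indicator {a..b} t * (k r * c t r)\<bar> \<partial>lborel)
      \<le> (\<integral>\<^sup>+t. (ennreal \<bar>k r\<bar> * ennreal C) * indicator {a..b} t \<partial>lborel)"
    proof (intro nn_integral_mono)
      fix t
      have "ennreal (\<bar>k r\<bar> * \<bar>c t r\<bar>) \<le> ennreal (\<bar>k r\<bar> * C)" if "t \<in> {a..b}"
        using bd[of t r] that by (intro ennreal_leI mult_left_mono) auto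
      then show "ennreal \<bar>indicator {a..b} t * (k r * c t r)\<bar> \<le> (ennreal \<bar>k r\<bar> * ennreal C) * indicator {a..b} t"
        by (cases "t \<in> {a..b}") (simp_all add: abs_mult ennreal_mult')
    qed
    also have "\<dots> = (ennreal \<bar>k r\<bar> * ennreal C) * emeasure lborel {a..b}"
      by (intro nn_integral_cmult_indicator) auto
    finally show "(\<integral>\<^sup>+t. ennreal \<bar>indicator {a..b} t * (k r * c t r)\<bar> \<partial>lborel) \<le> ennreal \<bar>k r\<bar> * (ennreal C * emeasure lborel {a..b})"
      by (simp only: mult.assoc)
  qed
  also have "\<dots> = (\<integral>\<^sup>+r. ennreal \<bar>k r\<bar> \<partial>lborel) * (ennreal C * emeasure lborel {a..b})"
    by (intro nn_integral_multc) measurable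
  also have "\<dots> < \<infinity>"
    using k by (auto simp: integrable_iff_bounded ennreal_mult_less_top emeasure_lborel_Icc_eq)
  finally have fin: "(\<integral>\<^sup>+r. (\<integral>\<^sup>+t. ennreal \<bar>indicator {a..b} t * (k r * c t r)\<bar> \<partial>lborel) \<partial>lborel) < \<infinity>" .
  have "(\<integral>t. indicator {a..b} t * (\<integral>r. k r * c t r \<partial>lborel) \<partial>lborel)
      = (\<integral>t. (\<integral>r. indicator {a..b} t * (k r * c t r) \<partial>lborel) \<partial>lborel)"
    by simp
  also have "\<dots> = (\<integral>r. (\<integral>t. indicator {a..b} t * (k r * c t r) \<partial>lborel) \<partial>lborel)"
    by (rule integral_swap(1)[OF _ fin]) measurable
  also have "\<dots> = (\<integral>r. k r * (\<integral>t. indicator {a..b} t * c t r \<partial>lborel) \<partial>lborel)"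
    unfolding mult.left_commute[of "indicator _ _" "k _"] by simp
  finally show ?thesis .
qed

section \<open>Energy argument for time increments\<close>

definition incr :: "real \<Rightarrow> (real \<Rightarrow> 'a \<Rightarrow> real) \<Rightarrow> real \<Rightarrow> 'a \<Rightarrow> real" where
  "incr h v t x = v (t + h) x - v t x"

lemma incr_meas [measurable]:
  assumes [measurable]: "case_prod v \<in> borel_measurable (borel \<Otimes>\<^sub>M M)"
  shows "case_prod (incr h v) \<in> borel_measurable (borel \<Otimes>\<^sub>M M)"
  unfolding incr_def[abs_def] by measurable

lemma incr_sq:
  "(\<And>s. 0 \<le> s \<Longrightarrow> sq_int M (v s)) \<Longrightarrow> 0 \<le> t \<Longrightarrow> 0 < h \<Longrightarrow> sq_int M (incr h v t)"
  unfolding incr_def[abs_def] by (intro sq_int_diff) auto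

context dual_problem
begin

lemma E_bd: "0 \<le> t \<Longrightarrow> (\<integral>x. (E t x)\<^sup>2 \<partial>M) \<le> T\<^sup>2 * B"
proof -
  assume t: "0 \<le> t"
  have le: "(\<integral>x. (E t x)\<^sup>2 \<partial>M) \<le> t\<^sup>2 * B" if "0 \<le> t" for t
    unfolding E_def using that by (intro weighted_mean_bounded_le[OF _ _ Icc_nn[OF that]]) (auto simp: \<eta>_sq \<eta>_bd B)
  show ?thesis
  proof (cases "t \<le> T")
    case True
    then have "t\<^sup>2 * B \<le> T\<^sup>2 * B" using t B by (intro mult_right_mono power_mono) auto
    then show ?thesis using le[OF t] by simp
  next
    case False
    then have "E t = E T" using E_beyond[of t] by (auto simp: fun_eq_iff)
    then show ?thesis using le[of T] T by simp
  qed
qed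

definition B\<zeta> :: real where "B\<zeta> = 2 * (K1\<^sup>2 * B) + 2 * (T\<^sup>2 * B)"

lemma \<zeta>_bd: "0 \<le> t \<Longrightarrow> (\<integral>x. (\<zeta> t x)\<^sup>2 \<partial>M) \<le> B\<zeta>"
  using sq_int_square_add_le[OF F_sq[of t] E_sq[of t]] F_bd[of t] E_bd[of t] by (simp add: \<zeta>_def B\<zeta>_def)

abbreviation w :: "real \<Rightarrow> real \<Rightarrow> 'a \<Rightarrow> real" where "w h \<equiv> incr h \<zeta>"

lemma w_sq: "0 \<le> t \<Longrightarrow> 0 < h \<Longrightarrow> sq_int M (w h t)"
  by (rule incr_sq[OF \<zeta>_sq])

lemma w_bd:
  assumes "0 \<le> t" "0 < h" shows "(\<integral>x. (w h t x)\<^sup>2 \<partial>M) \<le> 4 * B\<zeta>"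
proof -
  have t: "0 \<le> t + h" using assms by simp
  show ?thesis
    using sq_int_square_diff_le[OF \<zeta>_sq[OF t] \<zeta>_sq[OF assms(1)]] \<zeta>_bd[OF assms(1)] \<zeta>_bd[OF t]
    unfolding incr_def by linarith
qed

lemma incr_z_sq: "0 \<le> t \<Longrightarrow> 0 < h \<Longrightarrow> sq_int M (incr h z t)"
  by (rule incr_sq[OF z_sq])

lemma A_incr: "0 \<le> t \<Longrightarrow> 0 < h \<Longrightarrow> A (incr h z t) (w h t)"
  using A_z_diff[of t "t + h"] by (simp add: incr_def[abs_def])

lemma incr_z_beyond: "T \<le> t \<Longrightarrow> 0 < h \<Longrightarrow> incr h z t x = 0"
  using z_beyond[of t x] z_beyond[of "t + h" x] by (simp add: incr_def)

text \<open>The integrand behind the memory term: averaged over \<open>r\<close> with the fractional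
  kernel it gives the increment of \<open>F\<close> paired with \<open>w h t\<close>, and its
  primitive in \<open>r\<close> is a difference of increments of \<open>z\<close>.\<close>

definition c :: "real \<Rightarrow> real \<Rightarrow> real \<Rightarrow> real" where
  "c h t r = (\<integral>x. (\<phi> (t + r) x - \<phi> (t + h + r) x) * w h t x \<partial>M)"

lemma c_meas [measurable]: "case_prod (c h) \<in> borel_measurable (borel \<Otimes>\<^sub>M borel)"
  unfolding c_def[abs_def] by measurable

lemma c_eq: "0 \<le> t \<Longrightarrow> 0 < h \<Longrightarrow> c h t r = ip (\<phi> (t + r)) (w h t) - ip (\<phi> (t + h + r)) (w h t)"
  unfolding c_def by (intro ip_diff_left \<phi>_sq w_sq)

lemma c_bd:
  assumes "0 \<le> t" "0 < h" shows "\<bar>c h t r\<bar> \<le> 4 * B + 4 * B\<zeta>"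
proof -
  have "\<bar>c h t r\<bar> \<le> (\<integral>x. (\<phi> (t + r) x - \<phi> (t + h + r) x)\<^sup>2 \<partial>M) + (\<integral>x. (w h t x)\<^sup>2 \<partial>M)"
    unfolding c_def using assms by (intro abs_integral_mult_le sq_int_diff \<phi>_sq w_sq)
  also have "(\<integral>x. (\<phi> (t + r) x - \<phi> (t + h + r) x)\<^sup>2 \<partial>M) \<le> 4 * B"
    using sq_int_square_diff_le[OF \<phi>_sq[of "t + r"] \<phi>_sq[of "t + h + r"]] \<phi>_bd[of "t + r"] \<phi>_bd[of "t + h + r"] by linarith
  finally show ?thesis using w_bd[OF assms] by linarith
qed

lemma F_incr_inner:
  assumes "0 \<le> t" "0 < h"
  shows "ip (\<lambda>x. F t x - F (t + h) x) (w h t) = (\<integral>r. kT r * c h t r \<partial>lborel)"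
proof -
  have t': "0 \<le> t + h" using assms by simp
  have "ip (\<lambda>x. F t x - F (t + h) x) (w h t) = ip (F t) (w h t) - ip (F (t + h)) (w h t)"
    using assms by (intro ip_diff_left F_sq w_sq)
  also have "\<dots> = (\<integral>r. kT r * ip (\<phi> (t + r)) (w h t) - kT r * ip (\<phi> (t + h + r)) (w h t) \<partial>lborel)"
    using F_inner[OF assms(1) w_sq[OF assms]] F_inner[OF t' w_sq[OF assms]] by simp
  finally show ?thesis using assms by (simp add: c_eq right_diff_distrib)
qed

lemma z_shift_inner:
  assumes t: "0 \<le> t" "0 \<le> \<rho>" and v: "sq_int M v"
  shows "(\<integral>r. indicator {0..\<rho>} r * ip (\<phi> (t + r)) v \<partial>lborel) = ip (z (t + \<rho>)) v - ip (z t) v"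
    and "integrable lborel (\<lambda>r. indicator {0..\<rho>} r * ip (\<phi> (t + r)) v)"
proof -
  have [measurable]: "v \<in> borel_measurable M" using v by (simp add: sq_int_def)
  let ?p = "\<lambda>s. ip (\<phi> s) v"
  have i: "integrable lborel (\<lambda>s. indicator {0..a} s * ?p s)" for a
    using ip_\<phi>_bd[OF v] by (intro integrable_indicator_Icc_mult[where C="B + ip v v"]) auto
  show "integrable lborel (\<lambda>r. indicator {0..\<rho>} r * ?p (t + r))"
    using ip_\<phi>_bd[OF v] by (intro integrable_indicator_Icc_mult[where C="B + ip v v"]) auto
  have "(\<integral>r. indicator {0..\<rho>} r * ?p (t + r) \<partial>lborel) = (\<integral>s. indicator {0..\<rho>} (s - t) * ?p s \<partial>lborel)"
    using lborel_integral_shift[of "\<lambda>s. indicator {0..\<rho>} (s - t) * ?p s" t] by (simp add: add.commute)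
  also have "\<dots> = (\<integral>s. indicator {0..t + \<rho>} s * ?p s - indicator {0..t} s * ?p s \<partial>lborel)"
  proof (intro integral_cong_AE)
    have "AE s in lborel. s \<noteq> t" by (rule AE_lborel_singleton)
    from this show "AE s in lborel. indicator {0..\<rho>} (s - t) * ?p s = indicator {0..t + \<rho>} s * ?p s - indicator {0..t} s * ?p s"
    proof eventually_elim
      case (elim s)
      then show ?case using t by (auto simp: indicator_def)
    qed
  qed measurable
  also have "\<dots> = ip (z (t + \<rho>)) v - ip (z t) v"
    using t v i by (simp add: z_inner)
  finally show "(\<integral>r. indicator {0..\<rho>} r * ?p (t + r) \<partial>lborel) = ip (z (t + \<rho>)) v - ip (z t) v" .
qed

text \<open>Integrating \<phi> over a window of length \<rho> gives a difference of values of
  \<open>z\<close>; doing so at t and at t + h pairs these values into increments.\<close>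

lemma c_primitive:
  assumes t: "0 \<le> t" "0 < h" "0 \<le> \<rho>"
  shows "(\<integral>r. indicator {0..\<rho>} r * c h t r \<partial>lborel) = ip (\<lambda>x. incr h z t x - incr h z (t + \<rho>) x) (w h t)"
proof -
  have t': "0 \<le> t + h" "0 \<le> t + \<rho>" "0 \<le> t + h + \<rho>" using t by auto
  note w = w_sq[OF t(1,2)]
  have "(\<integral>r. indicator {0..\<rho>} r * c h t r \<partial>lborel)
    = (\<integral>r. indicator {0..\<rho>} r * ip (\<phi> (t + r)) (w h t) - indicator {0..\<rho>} r * ip (\<phi> (t + h + r)) (w h t) \<partial>lborel)"
    using t by (simp add: c_eq right_diff_distrib)
  also have "\<dots> = (ip (z (t + \<rho>)) (w h t) - ip (z t) (w h t)) - (ip (z (t + h + \<rho>)) (w h t) - ip (z (t + h)) (w h t))"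
    using z_shift_inner[OF t(1,3) w] z_shift_inner[OF t'(1) t(3) w] by simp
  also have "\<dots> = ip (incr h z t) (w h t) - ip (incr h z (t + \<rho>)) (w h t)"
  proof -
    have "ip (incr h z s) (w h t) = ip (z (s + h)) (w h t) - ip (z s) (w h t)" if "0 \<le> s" for s
      unfolding incr_def[of h z] using that t by (intro ip_diff_left z_sq w) auto
    from this[OF t(1)] this[OF t'(2)] show ?thesis by (simp add: add_ac)
  qed
  also have "\<dots> = ip (\<lambda>x. incr h z t x - incr h z (t + \<rho>) x) (w h t)"
    using t t' w by (intro ip_diff_left[symmetric] incr_z_sq) auto
  finally show ?thesis .
qed

text \<open>The quadratic form of the operator at the increment of \<open>z\<close>, since
  \<open>w h t\<close> is the image of that increment.\<close>

definition en :: "real \<Rightarrow> real \<Rightarrow> real" where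
  "en h t = (\<integral>x. incr h z t x * w h t x \<partial>M)"

lemma en_meas [measurable]: "en h \<in> borel_measurable borel"
  unfolding en_def[abs_def] by measurable

lemma en_nonneg: "0 \<le> t \<Longrightarrow> 0 < h \<Longrightarrow> 0 \<le> en h t"
  using A_nonneg[OF A_incr[of t h]] by (simp add: en_def mult.commute)

lemma en_beyond: "T \<le> t \<Longrightarrow> 0 < h \<Longrightarrow> en h t = 0"
  by (simp add: en_def incr_z_beyond)

lemma incr_z_bd:
  assumes "0 \<le> t" "0 < h" shows "(\<integral>x. (incr h z t x)\<^sup>2 \<partial>M) \<le> 4 * (T\<^sup>2 * B)"
proof -
  have le: "(\<integral>x. (z t x)\<^sup>2 \<partial>M) \<le> t\<^sup>2 * B" if "0 \<le> t" for t
    unfolding z_def using that by (intro weighted_mean_bounded_le[OF _ _ Icc_nn[OF that]]) (auto simp: \<phi>_sq \<phi>_bd B)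
  have le: "(\<integral>x. (z t x)\<^sup>2 \<partial>M) \<le> T\<^sup>2 * B" if t: "0 \<le> t" for t
  proof (cases "t \<le> T")
    case True
    then have "t\<^sup>2 * B \<le> T\<^sup>2 * B" using t B by (intro mult_right_mono power_mono) auto
    then show ?thesis using le[OF t] by simp
  next
    case False
    then have "z t = z T" using z_beyond[of t] by (auto simp: fun_eq_iff)
    then show ?thesis using le[of T] T by simp
  qed
  show ?thesis
  proof -
    have t: "0 \<le> t + h" using assms by simp
    show ?thesis
      using sq_int_square_diff_le[OF z_sq[OF t] z_sq[OF assms(1)]] le[OF assms(1)] le[OF t]
      unfolding incr_def by linarith
  qed
qed

lemma en_bd: "0 \<le> t \<Longrightarrow> 0 < h \<Longrightarrow> \<bar>en h t\<bar> \<le> 4 * (T\<^sup>2 * B) + 4 * B\<zeta>"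
  unfolding en_def
  by (rule order_trans[OF abs_integral_mult_le[OF incr_z_sq w_sq] add_mono[OF incr_z_bd w_bd]])

text \<open>Symmetry and nonnegativity of \<open>A\<close> applied to the difference of two increments.\<close>

lemma en_diff_le:
  assumes t: "0 \<le> t" "0 < h" "0 \<le> \<rho>"
  shows "(en h t - en h (t + \<rho>)) / 2 \<le> ip (\<lambda>x. incr h z t x - incr h z (t + \<rho>) x) (w h t)"
proof -
  have t': "0 \<le> t + \<rho>" using t by simp
  note a = A_incr[OF t(1,2)] and b = A_incr[OF t' t(2)]
  note sq = incr_z_sq[OF t(1,2)] incr_z_sq[OF t' t(2)] w_sq[OF t(1,2)] w_sq[OF t' t(2)]
  \<comment> \<open>With a and b the increments at t and t + \<rho>, the form at a - b equals 2 <a -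
    b, A a> - (<a, A a> - <b, A b>).\<close>
  have "0 \<le> ip (\<lambda>x. w h t x - w h (t + \<rho>) x) (\<lambda>x. incr h z t x - incr h z (t + \<rho>) x)"
    by (rule A_nonneg[OF A_diff[OF a b]])
  also have "\<dots> = ip (w h t) (\<lambda>x. incr h z t x - incr h z (t + \<rho>) x) - ip (w h (t + \<rho>)) (\<lambda>x. incr h z t x - incr h z (t + \<rho>) x)"
    by (intro ip_diff_left sq sq_int_diff)
  also have "\<dots> = (en h t - ip (incr h z (t + \<rho>)) (w h t)) - (ip (incr h z t) (w h (t + \<rho>)) - en h (t + \<rho>))"
    unfolding ip_commute[of "w _ _"] by (simp add: ip_diff_left sq en_def)
  also have "ip (incr h z t) (w h (t + \<rho>)) = ip (incr h z (t + \<rho>)) (w h t)"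
    using A_sym[OF a b] by (simp add: mult.commute)
  finally show ?thesis
    by (simp add: ip_diff_left sq en_def)
qed

text \<open>Shifting the time window to the right can only lose energy: \<open>en\<close> is
  nonnegative and vanishes after \<open>T\<close>.\<close>

lemma en_shift_integral_le:
  assumes "0 < h" "0 \<le> \<rho>"
  shows "0 \<le> (\<integral>t. indicator {0..T} t * (en h t - en h (t + \<rho>)) \<partial>lborel)"
proof -
  have i: "integrable lborel (\<lambda>t. indicator {0..T} t * en h t)" "integrable lborel (\<lambda>t. indicator {0..T} t * en h (t + \<rho>))"
    using en_bd assms by (auto intro!: integrable_indicator_Icc_mult[where C="4 * (T\<^sup>2 * B) + 4 * B\<zeta>"])
  have "(\<integral>t. indicator {0..T} t * en h (t + \<rho>) \<partial>lborel) = (\<integral>s. indicator {0..T} (s - \<rho>) * en h s \<partial>lborel)"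
    using lborel_integral_shift[of "\<lambda>s. indicator {0..T} (s - \<rho>) * en h s" \<rho>] by simp
  also have "\<dots> \<le> (\<integral>s. indicator {0..T} s * en h s \<partial>lborel)"
  proof (rule integral_mono)
    show "integrable lborel (\<lambda>s. indicator {0..T} (s - \<rho>) * en h s)"
      using i(2) lborel_integrable_real_affine[of "\<lambda>t. indicator {0..T} t * en h (t + \<rho>)" 1 "- \<rho>"]
      by (simp add: add.commute)
    show "indicator {0..T} (s - \<rho>) * en h s \<le> indicator {0..T} s * en h s" for s
      using en_nonneg[of s h] en_beyond[of s h] assms by (cases "T \<le> s") (auto simp: indicator_def)
  qed (rule i)
  finally show ?thesis using i by (simp add: right_diff_distrib)
qed

text \<open>After integration over \<open>t\<close>, the primitive in \<open>r\<close> of the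
  pairing dominates half the loss of energy under a shift, which is nonnegative; positivity of
  decreasing kernels then gives the sign of the memory term. The explicit bounds serve only to
  justify the interchanges of integrals.\<close>

lemma F_incr_nonneg:
  assumes h: "0 < h"
  shows "0 \<le> (\<integral>t. indicator {0..T} t * ip (\<lambda>x. F t x - F (t + h) x) (w h t) \<partial>lborel)"
proof -
  let ?\<Theta> = "\<lambda>r. \<integral>t. indicator {0..T} t * c h t r \<partial>lborel"
  let ?C = "4 * B + 4 * B\<zeta>"
  have "0 \<le> (\<integral>r. kT r * ?\<Theta> r \<partial>lborel)"
    unfolding kT_def
  proof (rule fker_trunc_integral_nonneg)
    show "\<bar>?\<Theta> r\<bar> \<le> ?C * T" for r
    proof -
      have "\<bar>?\<Theta> r\<bar> \<le> (\<integral>t. \<bar>indicator {0..T} t * c h t r\<bar> \<partial>lborel)" by (rule integral_abs_bound)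
      also have "\<dots> \<le> (\<integral>t. ?C * indicator {0..T} t \<partial>lborel)"
      proof (rule integral_mono)
        show "integrable lborel (\<lambda>t. \<bar>indicator {0..T} t * c h t r\<bar>)"
          using c_bd h by (intro integrable_abs integrable_indicator_Icc_mult) auto
        show "integrable lborel (\<lambda>t. ?C * indicator {0..T} t)"
          by (intro integrable_mult_right integrable_real_indicator) (auto simp: emeasure_lborel_Icc_eq)
        show "\<bar>indicator {0..T} t * c h t r\<bar> \<le> ?C * indicator {0..T} t" for t
          using c_bd[of t h r] h by (auto simp: indicator_def)
      qed
      also have "\<dots> = ?C * T" using T by simp
      finally show ?thesis .
    qed
    fix \<rho> assume \<rho>: "0 \<le> \<rho>" "\<rho> \<le> T"
    have k: "integrable lborel (indicator {0..\<rho>} :: real \<Rightarrow> real)"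
      by (intro integrable_real_indicator) (auto simp: emeasure_lborel_Icc_eq)
    have "(\<integral>r. indicator {0..\<rho>} r * ?\<Theta> r \<partial>lborel) = (\<integral>t. indicator {0..T} t * (\<integral>r. indicator {0..\<rho>} r * c h t r \<partial>lborel) \<partial>lborel)"
      using c_bd h by (intro integral_swap_bounded[OF k, symmetric]) auto
    also have "\<dots> \<ge> (\<integral>t. indicator {0..T} t * ((en h t - en h (t + \<rho>)) / 2) \<partial>lborel)"
    proof (rule integral_mono)
      have "\<bar>(en h t - en h (t + \<rho>)) / 2\<bar> \<le> 4 * (T\<^sup>2 * B) + 4 * B\<zeta>" if "0 \<le> t" for t
      proof -
        have "0 \<le> t + \<rho>" using that \<rho> by simp
        from en_bd[OF this h] en_bd[OF that h] show ?thesis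
          using abs_triangle_ineq4[of "en h t" "en h (t + \<rho>)"] by (simp add: abs_divide)
      qed
      then show "integrable lborel (\<lambda>t. indicator {0..T} t * ((en h t - en h (t + \<rho>)) / 2))"
        by (intro integrable_indicator_Icc_mult[where C="4 * (T\<^sup>2 * B) + 4 * B\<zeta>"]) simp_all
      have "\<bar>\<integral>r. indicator {0..\<rho>} r * c h t r \<partial>lborel\<bar> \<le> ?C * \<rho>" if "0 \<le> t" for t
      proof -
        have "\<bar>\<integral>r. indicator {0..\<rho>} r * c h t r \<partial>lborel\<bar> \<le> (\<integral>r. \<bar>indicator {0..\<rho>} r * c h t r\<bar> \<partial>lborel)" by (rule integral_abs_bound)
        also have "\<dots> \<le> (\<integral>r. ?C * indicator {0..\<rho>} r \<partial>lborel)"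
        proof (rule integral_mono)
          show "integrable lborel (\<lambda>r. \<bar>indicator {0..\<rho>} r * c h t r\<bar>)"
            using c_bd that h by (intro integrable_abs integrable_indicator_Icc_mult) auto
          show "integrable lborel (\<lambda>r. ?C * indicator {0..\<rho>} r)" by (intro integrable_mult_right k)
          show "\<bar>indicator {0..\<rho>} r * c h t r\<bar> \<le> ?C * indicator {0..\<rho>} r" for r
            using c_bd[of t h r] h that by (auto simp: indicator_def)
        qed
        also have "\<dots> = ?C * \<rho>" using \<rho> by simp
        finally show ?thesis .
      qed
      then show "integrable lborel (\<lambda>t. indicator {0..T} t * (\<integral>r. indicator {0..\<rho>} r * c h t r \<partial>lborel))"
        by (intro integrable_indicator_Icc_mult) auto
      show "indicator {0..T} t * ((en h t - en h (t + \<rho>)) / 2) \<le> indicator {0..T} t * (\<integral>r. indicator {0..\<rho>} r * c h t r \<partial>lborel)" for t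
        using en_diff_le[of t h \<rho>] c_primitive[of t h \<rho>] h \<rho> by (cases "t \<in> {0..T}") simp_all
    qed
    moreover have "(\<integral>t. indicator {0..T} t * ((en h t - en h (t + \<rho>)) / 2) \<partial>lborel)
       = (\<integral>t. indicator {0..T} t * (en h t - en h (t + \<rho>)) \<partial>lborel) / 2"
      by simp
    ultimately show "0 \<le> (\<integral>r. indicator {0..\<rho>} r * ?\<Theta> r \<partial>lborel)"
      using en_shift_integral_le[OF h \<rho>(1)] by linarith
  qed (use \<alpha> T in auto)
  also have "\<dots> = (\<integral>t. indicator {0..T} t * (\<integral>r. kT r * c h t r \<partial>lborel) \<partial>lborel)"
    using kT_integral c_bd h by (intro integral_swap_bounded[symmetric]) (auto simp: has_bochner_integral_iff)
  also have "\<dots> = (\<integral>t. indicator {0..T} t * ip (\<lambda>x. F t x - F (t + h) x) (w h t) \<partial>lborel)"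
    using h by (intro Bochner_Integration.integral_cong refl) (auto simp: F_incr_inner indicator_def)
  finally show ?thesis .
qed

text \<open>Testing the increment of the equation with \<open>A\<close> applied to the increment of \<open>z\<close>.\<close>

lemma incr_energy_le:
  assumes h: "0 < h"
  shows "(\<integral>t. indicator {0..T} t * (\<integral>x. (w h t x)\<^sup>2 \<partial>M) \<partial>lborel)
    \<le> (\<integral>t. indicator {0..T} t * (\<integral>x. (incr h E t x)\<^sup>2 \<partial>M) \<partial>lborel)"
proof -
  have N_sq: "sq_int M (incr h E t)" if "0 \<le> t" for t
    using that h by (intro incr_sq[OF E_sq])
  have N_bd: "(\<integral>x. (incr h E t x)\<^sup>2 \<partial>M) \<le> 4 * (T\<^sup>2 * B)" if t: "0 \<le> t" for t
  proof -
    have t': "0 \<le> t + h" using t h by simp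
    show ?thesis
      using sq_int_square_diff_le[OF E_sq[OF t'] E_sq[OF t]] E_bd[OF t] E_bd[OF t']
      unfolding incr_def by linarith
  qed
  have D_sq: "sq_int M (\<lambda>x. F t x - F (t + h) x)" for t by (intro sq_int_diff F_sq)
  have D_bd: "(\<integral>x. (F t x - F (t + h) x)\<^sup>2 \<partial>M) \<le> 4 * (K1\<^sup>2 * B)" if t: "0 \<le> t" for t
  proof -
    have t': "0 \<le> t + h" using t h by simp
    show ?thesis
      using sq_int_square_diff_le[OF F_sq[of t] F_sq[of "t + h"]] F_bd[OF t] F_bd[OF t'] by linarith
  qed
  let ?W = "\<lambda>t. \<integral>x. (w h t x)\<^sup>2 \<partial>M" and ?N = "\<lambda>t. \<integral>x. (incr h E t x)\<^sup>2 \<partial>M"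
  let ?D = "\<lambda>t. ip (\<lambda>x. F t x - F (t + h) x) (w h t)"
  \<comment> \<open>The image of the increment is the increment of \<open>E\<close> minus F(t) - F(t
    + h). Pairing with the image itself and splitting the product with \<open>E\<close> evenly
    leaves half of each square.\<close>
  have le: "?W t / 2 + ?D t \<le> ?N t / 2" if t: "0 \<le> t" for t
  proof -
    have "w h t = (\<lambda>x. incr h E t x - (F t x - F (t + h) x))"
      by (simp add: incr_def \<zeta>_def fun_eq_iff)
    then have "ip (w h t) (w h t) = ip (\<lambda>x. incr h E t x - (F t x - F (t + h) x)) (w h t)"
      by metis
    also have "\<dots> = ip (incr h E t) (w h t) - ?D t"
      using t h by (intro ip_diff_left N_sq D_sq w_sq)
    finally have "?W t = ip (incr h E t) (w h t) - ?D t" by (simp add: power2_eq_square)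
    then show ?thesis
      using integral_mult_le_half[OF N_sq[OF t] w_sq[OF t h]] by linarith
  qed
  have iW: "integrable lborel (\<lambda>t. indicator {0..T} t * ?W t)"
    using w_bd h by (intro integrable_indicator_Icc_mult[where C="4 * B\<zeta>"]) auto
  have iN: "integrable lborel (\<lambda>t. indicator {0..T} t * ?N t)"
    using N_bd by (intro integrable_indicator_Icc_mult[where C="4 * (T\<^sup>2 * B)"]) auto
  have iD: "integrable lborel (\<lambda>t. indicator {0..T} t * ?D t)"
  proof (rule integrable_indicator_Icc_mult)
    show "\<bar>?D t\<bar> \<le> 4 * (K1\<^sup>2 * B) + 4 * B\<zeta>" if "0 \<le> t" for t
      by (rule order_trans[OF abs_integral_mult_le[OF D_sq w_sq[OF that h]] add_mono[OF D_bd[OF that] w_bd[OF that h]]])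
  qed measurable
  have "(\<integral>t. indicator {0..T} t * ?W t \<partial>lborel) / 2 + (\<integral>t. indicator {0..T} t * ?D t \<partial>lborel)
     = (\<integral>t. indicator {0..T} t * ?W t / 2 + indicator {0..T} t * ?D t \<partial>lborel)"
    using iW iD by simp
  also have "\<dots> \<le> (\<integral>t. indicator {0..T} t * ?N t / 2 \<partial>lborel)"
  proof (rule integral_mono)
    show "integrable lborel (\<lambda>t. indicator {0..T} t * ?W t / 2 + indicator {0..T} t * ?D t)"
      "integrable lborel (\<lambda>t. indicator {0..T} t * ?N t / 2)"
      using iW iD iN by simp_all
    show "indicator {0..T} t * ?W t / 2 + indicator {0..T} t * ?D t \<le> indicator {0..T} t * ?N t / 2" for t
      using le[of t] by (auto simp: indicator_def)
  qed
  also have "\<dots> = (\<integral>t. indicator {0..T} t * ?N t \<partial>lborel) / 2" by simp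
  finally show ?thesis using F_incr_nonneg[OF h] by linarith
qed

text \<open>The increment of \<open>E\<close> is the convolution of \<eta> with the indicator of
  [-h,0], whose mass is \<open>h\<close>. Young's inequality yields h^2, exactly what the difference
  quotient removes.\<close>

lemma E_incr_le:
  assumes h: "0 < h"
  shows "(\<integral>\<^sup>+t. indicator {0..T} t * (\<integral>\<^sup>+x. ennreal ((incr h E t x)\<^sup>2) \<partial>M) \<partial>lborel)
    \<le> ennreal (h\<^sup>2) * (\<integral>\<^sup>+t. (\<integral>\<^sup>+x. ennreal ((\<eta> t x)\<^sup>2) \<partial>M) \<partial>lborel)"
proof -
  interpret P: pair_sigma_finite lborel M ..
  let ?h = "indicator {-h..0} :: real \<Rightarrow> real"
  have "AE x in M. integrable lborel (\<lambda>s. indicator {0..T} s * \<eta> s x)"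
    using T by (intro weighted_mean_bounded_AE_integrable[where B=B, OF _ _ Icc_nn]) (auto simp: \<eta>_sq \<eta>_bd B)
  then have ae: "AE x in M. integrable lborel (\<lambda>s. \<eta> s x)"
  proof eventually_elim
    case (elim x)
    have "(\<lambda>s. indicator {0..T} s * \<eta> s x) = (\<lambda>s. \<eta> s x)" using \<eta>_supp[of _ x] by (auto simp: indicator_def fun_eq_iff)
    then show ?case using elim by simp
  qed
  have "(\<integral>\<^sup>+t. indicator {0..T} t * (\<integral>\<^sup>+x. ennreal ((incr h E t x)\<^sup>2) \<partial>M) \<partial>lborel)
     = (\<integral>\<^sup>+t. (\<integral>\<^sup>+x. indicator {0..T} t * ennreal ((incr h E t x)\<^sup>2) \<partial>M) \<partial>lborel)"
    by (intro nn_integral_cong, subst nn_integral_cmult) auto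
  also have "\<dots> = (\<integral>\<^sup>+x. (\<integral>\<^sup>+t. indicator {0..T} t * ennreal ((incr h E t x)\<^sup>2) \<partial>lborel) \<partial>M)"
    by (rule P.Fubini'[symmetric]) measurable
  also have "\<dots> \<le> (\<integral>\<^sup>+x. ennreal (h\<^sup>2) * (\<integral>\<^sup>+t. ennreal ((\<eta> t x)\<^sup>2) \<partial>lborel) \<partial>M)"
  proof (intro nn_integral_mono_AE, use ae in \<open>rule AE_mp\<close>, intro AE_I2 impI)
    fix x assume [measurable]: "x \<in> space M" and i: "integrable lborel (\<lambda>s. \<eta> s x)"
    have ind: "integrable lborel (\<lambda>s. indicator {0..a} s * \<eta> s x)" for a
      using integrable_real_mult_indicator[OF _ i, of "{0..a}"] by (simp add: mult.commute)
    have "(\<integral>\<^sup>+t. indicator {0..T} t * ennreal ((incr h E t x)\<^sup>2) \<partial>lborel)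
       \<le> (\<integral>\<^sup>+t. (\<integral>\<^sup>+s. ennreal \<bar>?h (t - s) * \<eta> s x\<bar> \<partial>lborel)\<^sup>2 \<partial>lborel)"
    proof (intro nn_integral_mono)
      fix t
      show "indicator {0..T} t * ennreal ((incr h E t x)\<^sup>2) \<le> (\<integral>\<^sup>+s. ennreal \<bar>?h (t - s) * \<eta> s x\<bar> \<partial>lborel)\<^sup>2"
      proof (cases "t \<in> {0..T}")
        case True
        have "incr h E t x = (\<integral>s. indicator {0..t+h} s * \<eta> s x - indicator {0..t} s * \<eta> s x \<partial>lborel)"
          using ind by (simp add: incr_def E_def)
        then have "ennreal \<bar>incr h E t x\<bar> \<le> (\<integral>\<^sup>+s. ennreal \<bar>indicator {0..t+h} s * \<eta> s x - indicator {0..t} s * \<eta> s x\<bar> \<partial>lborel)"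
          using integral_norm_bound_ennreal[OF Bochner_Integration.integrable_diff[OF ind ind], of "t + h" t] by simp
        also have "\<dots> \<le> (\<integral>\<^sup>+s. ennreal \<bar>?h (t - s) * \<eta> s x\<bar> \<partial>lborel)"
          using True h by (intro nn_integral_mono ennreal_leI) (auto simp: indicator_def)
        finally have "(ennreal \<bar>incr h E t x\<bar>)\<^sup>2 \<le> (\<integral>\<^sup>+s. ennreal \<bar>?h (t - s) * \<eta> s x\<bar> \<partial>lborel)\<^sup>2"
          by (intro power_mono) auto
        then show ?thesis using True by (simp add: ennreal_power)
      qed simp
    qed
    also have "\<dots> \<le> (\<integral>\<^sup>+r. ennreal \<bar>?h r\<bar> \<partial>lborel)\<^sup>2 * (\<integral>\<^sup>+s. ennreal ((\<eta> s x)\<^sup>2) \<partial>lborel)"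
      by (rule Young_L2) measurable
    also have "(\<integral>\<^sup>+r. ennreal \<bar>?h r\<bar> \<partial>lborel) = ennreal h"
      using h by (simp add: ennreal_indicator)
    finally show "(\<integral>\<^sup>+t. indicator {0..T} t * ennreal ((incr h E t x)\<^sup>2) \<partial>lborel) \<le> ennreal (h\<^sup>2) * (\<integral>\<^sup>+t. ennreal ((\<eta> t x)\<^sup>2) \<partial>lborel)"
      using h by (simp add: ennreal_power)
  qed
  also have "\<dots> = ennreal (h\<^sup>2) * (\<integral>\<^sup>+x. (\<integral>\<^sup>+t. ennreal ((\<eta> t x)\<^sup>2) \<partial>lborel) \<partial>M)"
    by (intro nn_integral_cmult) measurable
  also have "(\<integral>\<^sup>+x. (\<integral>\<^sup>+t. ennreal ((\<eta> t x)\<^sup>2) \<partial>lborel) \<partial>M) = (\<integral>\<^sup>+t. (\<integral>\<^sup>+x. ennreal ((\<eta> t x)\<^sup>2) \<partial>M) \<partial>lborel)"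
    by (rule P.Fubini') measurable
  finally show ?thesis .
qed

lemma w_le:
  assumes h: "0 < h"
  shows "(\<integral>\<^sup>+t. indicator {0..T} t * ennreal (\<integral>x. (w h t x / h)\<^sup>2 \<partial>M) \<partial>lborel)
    \<le> (\<integral>\<^sup>+t. (\<integral>\<^sup>+x. ennreal ((\<eta> t x)\<^sup>2) \<partial>M) \<partial>lborel)"
proof -
  let ?W = "\<lambda>t. \<integral>x. (w h t x)\<^sup>2 \<partial>M" and ?N = "\<lambda>t. \<integral>x. (incr h E t x)\<^sup>2 \<partial>M"
  let ?R = "\<integral>\<^sup>+t. (\<integral>\<^sup>+x. ennreal ((\<eta> t x)\<^sup>2) \<partial>M) \<partial>lborel"
  have N_sq: "sq_int M (incr h E t)" if "0 \<le> t" for t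
    using that h by (intro incr_sq[OF E_sq])
  have iW: "integrable lborel (\<lambda>t. indicator {0..T} t * ?W t)"
    using w_bd h by (intro integrable_indicator_Icc_mult[where C="4 * B\<zeta>"]) auto
  have "ennreal (\<integral>t. indicator {0..T} t * ?W t \<partial>lborel) \<le> ennreal (\<integral>t. indicator {0..T} t * ?N t \<partial>lborel)"
    by (rule ennreal_leI[OF incr_energy_le[OF h]])
  also have "\<dots> \<le> (\<integral>\<^sup>+t. ennreal (indicator {0..T} t * ?N t) \<partial>lborel)"
    by (cases "integrable lborel (\<lambda>t. indicator {0..T} t * ?N t)")
       (auto simp: nn_integral_eq_integral not_integrable_integral_eq)
  also have "\<dots> = (\<integral>\<^sup>+t. indicator {0..T} t * (\<integral>\<^sup>+x. ennreal ((incr h E t x)\<^sup>2) \<partial>M) \<partial>lborel)"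
    using nn_integral_sq_int[OF N_sq] by (intro nn_integral_cong) (auto simp: indicator_def)
  also have "\<dots> \<le> ennreal (h\<^sup>2) * ?R" by (rule E_incr_le[OF h])
  finally have le: "ennreal (\<integral>t. indicator {0..T} t * ?W t \<partial>lborel) \<le> ennreal (h\<^sup>2) * ?R" .
  have "(\<integral>\<^sup>+t. indicator {0..T} t * ennreal (\<integral>x. (w h t x / h)\<^sup>2 \<partial>M) \<partial>lborel)
     = (\<integral>\<^sup>+t. ennreal (inverse (h\<^sup>2)) * ennreal (indicator {0..T} t * ?W t) \<partial>lborel)"
    by (intro nn_integral_cong) (simp add: indicator_def power_divide divide_inverse[of _ "h\<^sup>2"] ennreal_mult'[symmetric] mult.commute)
  also have "\<dots> = ennreal (inverse (h\<^sup>2)) * ennreal (\<integral>t. indicator {0..T} t * ?W t \<partial>lborel)"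
    using iW by (subst nn_integral_cmult) (auto simp: nn_integral_eq_integral)
  also have "\<dots> \<le> ennreal (inverse (h\<^sup>2)) * (ennreal (h\<^sup>2) * ?R)"
    by (intro mult_left_mono le) auto
  also have "\<dots> = ?R"
    using h by (simp add: mult.assoc[symmetric] ennreal_mult'[symmetric])
  finally show ?thesis .
qed

text \<open>The quotient minus \<eta>(t) is the mean of \<eta>(s) - \<eta>(t) over (t,t+h], and the
  norm of a mean is bounded by the norms over that short interval only.\<close>

lemma E_incr_tendsto:
  assumes t: "0 < t" "t < T"
  shows "((\<lambda>h. \<integral>x. (incr h E t x / h - \<eta> t x)\<^sup>2 \<partial>M) \<longlongrightarrow> 0) (at_right 0)"
proof (rule tendstoI)
  fix e :: real assume e: "0 < e"
  have "\<forall>\<^sub>F s in at t within {0..T}. dist (\<integral>x. (\<eta> s x - \<eta> t x)\<^sup>2 \<partial>M) 0 < e / 2"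
    using \<eta>_cont[of t] t e by (intro tendstoD) auto
  then obtain d where d: "0 < d" and
    *: "\<And>s. s \<in> {0..T} \<Longrightarrow> s \<noteq> t \<Longrightarrow> dist s t < d \<Longrightarrow> (\<integral>x. (\<eta> s x - \<eta> t x)\<^sup>2 \<partial>M) < e / 2"
    by (auto simp: eventually_at)
  have le: "(\<integral>x. (incr h E t x / h - \<eta> t x)\<^sup>2 \<partial>M) \<le> e / 2" if h: "0 < h" "h < d" "h < T - t" for h
  proof -
    let ?k = "\<lambda>s. inverse h * indicator {t<..t+h} s"
    let ?v = "\<lambda>s x. \<eta> s x - \<eta> t x"
    have [measurable]: "\<eta> t \<in> borel_measurable M" using \<eta>_sq[of t] by (simp add: sq_int_def)
    have k1: "(\<integral>\<^sup>+s. ennreal \<bar>?k s\<bar> \<partial>lborel) \<le> ennreal 1"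
      using h by (simp add: abs_mult ennreal_mult' nn_integral_cmult ennreal_indicator ennreal_mult'[symmetric])
    have vB: "(\<integral>x. (?v s x)\<^sup>2 \<partial>M) \<le> e / 2" if "?k s \<noteq> 0" for s
      using *[of s] that h t by (auto simp: indicator_def dist_real_def less_imp_le split: if_splits)
    have vm: "case_prod ?v \<in> borel_measurable (borel \<Otimes>\<^sub>M M)" by measurable
    have wm: "(\<integral>x. (\<integral>s. ?k s * ?v s x \<partial>lborel)\<^sup>2 \<partial>M) \<le> 1\<^sup>2 * (e / 2)"
      using e by (intro weighted_mean_bounded_le[OF vm _ k1] sq_int_diff \<eta>_sq vB) auto
    have ae: "AE x in M. integrable lborel (\<lambda>s. indicator {0..t+h} s * \<eta> s x)" "AE x in M. integrable lborel (\<lambda>s. indicator {0..t} s * \<eta> s x)"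
      using h t by (auto intro!: weighted_mean_bounded_AE_integrable[where B=B, OF _ _ Icc_nn] simp: \<eta>_sq \<eta>_bd B)
    have "AE x in M. incr h E t x / h - \<eta> t x = (\<integral>s. ?k s * ?v s x \<partial>lborel)"
      using ae
    proof eventually_elim
      case (elim x)
      have ki: "integrable lborel ?k"
        using h by (intro integrable_mult_right integrable_real_indicator) auto
      have k_int: "(\<integral>s. ?k s \<partial>lborel) = 1" using h by simp
      have "AE s in lborel. s \<noteq> t" by (rule AE_lborel_singleton)
      have "incr h E t x = (\<integral>s. indicator {0..t+h} s * \<eta> s x - indicator {0..t} s * \<eta> s x \<partial>lborel)"
        using elim by (simp add: incr_def E_def)
      also have "(\<lambda>s. indicator {0..t+h} s * \<eta> s x - indicator {0..t} s * \<eta> s x) = (\<lambda>s. indicator {t<..t+h} s * \<eta> s x)"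
        using t h by (auto simp: indicator_def fun_eq_iff)
      finally have inc: "incr h E t x = (\<integral>s. indicator {t<..t+h} s * \<eta> s x \<partial>lborel)" .
      have "integrable lborel (\<lambda>s. indicator {0..t+h} s * \<eta> s x - indicator {0..t} s * \<eta> s x)"
        using elim by simp
      also have "(\<lambda>s. indicator {0..t+h} s * \<eta> s x - indicator {0..t} s * \<eta> s x) = (\<lambda>s. indicator {t<..t+h} s * \<eta> s x)"
        using t h by (auto simp: indicator_def fun_eq_iff)
      finally have i: "integrable lborel (\<lambda>s. ?k s * \<eta> s x)"
        by (simp add: mult.assoc)
      have "(\<integral>s. ?k s * ?v s x \<partial>lborel) = (\<integral>s. ?k s * \<eta> s x - ?k s * \<eta> t x \<partial>lborel)"
        by (simp add: right_diff_distrib)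
      also have "\<dots> = (\<integral>s. ?k s * \<eta> s x \<partial>lborel) - (\<integral>s. ?k s * \<eta> t x \<partial>lborel)"
        by (intro Bochner_Integration.integral_diff i integrable_mult_left ki)
      also have "\<dots> = incr h E t x / h - \<eta> t x"
      proof -
        have "(\<integral>s. ?k s * \<eta> s x \<partial>lborel) = inverse h * incr h E t x"
          unfolding inc mult.assoc by (rule integral_mult_right_zero)
        moreover have "(\<integral>s. ?k s * \<eta> t x \<partial>lborel) = 1 * \<eta> t x"
          unfolding k_int[symmetric] by (rule integral_mult_left_zero)
        ultimately show ?thesis by (simp add: divide_inverse mult.commute)
      qed
      finally show ?case by simp
    qed
    then have "(\<integral>x. (incr h E t x / h - \<eta> t x)\<^sup>2 \<partial>M) = (\<integral>x. (\<integral>s. ?k s * ?v s x \<partial>lborel)\<^sup>2 \<partial>M)"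
      by (intro integral_cong_AE) auto
    then show ?thesis using wm by simp
  qed
  have "\<forall>\<^sub>F h in at_right 0. h \<in> {0<..<min d (T - t)}"
    using d t by (intro eventually_at_right_real) auto
  then show "\<forall>\<^sub>F h in at_right 0. dist (\<integral>x. (incr h E t x / h - \<eta> t x)\<^sup>2 \<partial>M) 0 < e"
    by eventually_elim (use le e in force)
qed

text \<open>The quotient of \<zeta> splits into those of \<open>F\<close> and \<open>E\<close>, with
  limits G - \<eta> and \<eta>. Only increments with h > 0 were set up, hence the one-sided
  limit.\<close>

lemma w_tendsto:
  assumes t: "0 < t" "t < T"
  shows "((\<lambda>h. \<integral>x. (w h t x / h - G t x)\<^sup>2 \<partial>M) \<longlongrightarrow> 0) (at_right 0)"
proof -
  let ?a = "\<lambda>h x. (F (t + h) x - F t x) / h - (G t x - \<eta> t x)"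
  let ?b = "\<lambda>h x. incr h E t x / h - \<eta> t x"
  have G_sq: "sq_int M (G t)" using A_sq_int[OF \<phi>_A[OF t]] by auto
  have a_sq: "sq_int M (?a h)" for h
    using sq_int_scale[OF sq_int_diff[OF F_sq[of "t + h"] F_sq[of t]], of "inverse h"]
    by (intro sq_int_diff G_sq \<eta>_sq) (simp add: divide_inverse mult.commute)
  have b_sq: "sq_int M (?b h)" if "0 < h" for h
    using sq_int_scale[OF incr_sq[of M E, OF E_sq], of t h "inverse h"] t that
    by (intro sq_int_diff \<eta>_sq) (simp add: divide_inverse mult.commute)
  have lim: "((\<lambda>h. 2 * (\<integral>x. (?a h x)\<^sup>2 \<partial>M) + 2 * (\<integral>x. (?b h x)\<^sup>2 \<partial>M)) \<longlongrightarrow> 2 * 0 + 2 * 0) (at_right 0)"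
    using tendsto_mono[OF at_le[OF subset_UNIV] F_deriv[OF t]] E_incr_tendsto[OF t]
    by (intro tendsto_intros) auto
  have ev: "\<forall>\<^sub>F h in at_right 0. (\<integral>x. (w h t x / h - G t x)\<^sup>2 \<partial>M) \<le> 2 * (\<integral>x. (?a h x)\<^sup>2 \<partial>M) + 2 * (\<integral>x. (?b h x)\<^sup>2 \<partial>M)"
  proof (rule eventually_mono[OF eventually_at_right_less[of 0]])
    fix h :: real assume h: "0 < h"
    have eq: "w h t x / h - G t x = ?a h x + ?b h x" for x
      unfolding incr_def \<zeta>_def by (simp add: add_divide_distrib diff_divide_distrib)
    show "(\<integral>x. (w h t x / h - G t x)\<^sup>2 \<partial>M) \<le> 2 * (\<integral>x. (?a h x)\<^sup>2 \<partial>M) + 2 * (\<integral>x. (?b h x)\<^sup>2 \<partial>M)"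
      unfolding eq by (rule sq_int_square_add_le[OF a_sq b_sq[OF h]])
  qed
  show ?thesis
    by (rule tendsto_sandwich[OF _ ev tendsto_const lim[unfolded mult_zero_right add_0]]) simp
qed

text \<open>Fatou's lemma along the steps 1/(n+1). Measurability of \<open>G\<close> in time is not
  known; the left side is bounded by the integral of the lower limit of measurable functions, for
  which monotonicity of the nonnegative integral suffices.\<close>

theorem stability:
  "(\<integral>\<^sup>+t. indicator {0<..<T} t * ennreal (\<integral>x. (G t x)\<^sup>2 \<partial>M) \<partial>lborel)
    \<le> (\<integral>\<^sup>+t. (\<integral>\<^sup>+x. ennreal ((\<eta> t x)\<^sup>2) \<partial>M) \<partial>lborel)"
proof -
  define u where "u n t = indicator {0..T} t * ennreal (\<integral>x. (w (inverse (Suc n)) t x / inverse (Suc n))\<^sup>2 \<partial>M)" for n t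
  have [measurable]: "u n \<in> borel_measurable borel" for n
    unfolding u_def by measurable
  have lim: "indicator {0<..<T} t * ennreal (\<integral>x. (G t x)\<^sup>2 \<partial>M) \<le> liminf (\<lambda>n. u n t)" for t
  proof (cases "t \<in> {0<..<T}")
    case True
    then have t: "0 < t" "t < T" by auto
    have G_sq: "sq_int M (G t)" using A_sq_int[OF \<phi>_A[OF t]] by auto
    have "filterlim (\<lambda>n. inverse (real (Suc n))) (at_right 0) sequentially"
      unfolding filterlim_at using LIMSEQ_inverse_real_of_nat by auto
    from filterlim_compose[OF w_tendsto[OF t] this]
    have "(\<lambda>n. \<integral>x. (w (inverse (Suc n)) t x / inverse (Suc n) - G t x)\<^sup>2 \<partial>M) \<longlonglongrightarrow> 0" .
    then have "(\<lambda>n. \<integral>x. (w (inverse (Suc n)) t x / inverse (Suc n))\<^sup>2 \<partial>M) \<longlonglongrightarrow> (\<integral>x. (G t x)\<^sup>2 \<partial>M)"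
    proof (rule sq_int_tendsto_norm[rotated 2])
      show "sq_int M (\<lambda>x. w (inverse (Suc n)) t x / inverse (Suc n))" for n
        using sq_int_scale[OF w_sq[of t "inverse (Suc n)"], of "Suc n"] t by (simp add: divide_inverse mult.commute)
    qed (rule G_sq)
    then have "(\<lambda>n. ennreal (\<integral>x. (w (inverse (Suc n)) t x / inverse (Suc n))\<^sup>2 \<partial>M)) \<longlonglongrightarrow> ennreal (\<integral>x. (G t x)\<^sup>2 \<partial>M)"
      by (rule tendsto_ennrealI)
    then have "(\<lambda>n. u n t) \<longlonglongrightarrow> ennreal (\<integral>x. (G t x)\<^sup>2 \<partial>M)"
      using t by (simp add: u_def)
    from lim_imp_Liminf[OF _ this] show ?thesis using True by simp
  qed simp
  have "(\<integral>\<^sup>+t. indicator {0<..<T} t * ennreal (\<integral>x. (G t x)\<^sup>2 \<partial>M) \<partial>lborel) \<le> (\<integral>\<^sup>+t. liminf (\<lambda>n. u n t) \<partial>lborel)"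
    by (intro nn_integral_mono lim)
  also have "\<dots> \<le> liminf (\<lambda>n. \<integral>\<^sup>+t. u n t \<partial>lborel)"
    by (rule nn_integral_liminf) measurable
  also have "\<dots> \<le> liminf (\<lambda>n. (\<integral>\<^sup>+t. (\<integral>\<^sup>+x. ennreal ((\<eta> t x)\<^sup>2) \<partial>M) \<partial>lborel))"
    unfolding u_def using w_le[of "inverse (Suc _)"] by (intro Liminf_mono always_eventually allI) simp
  also have "\<dots> = (\<integral>\<^sup>+t. (\<integral>\<^sup>+x. ennreal ((\<eta> t x)\<^sup>2) \<partial>M) \<partial>lborel)"
    by (simp add: Liminf_const)
  finally show ?thesis .
qed

end

section \<open>The error estimate for an abstract operator\<close>

text \<open>Operator identities hold for almost every \<open>x\<close> at fixed \<open>t\<close>,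
  whereas the one-dimensional mesh lemmas fix \<open>x\<close>. Joint measurability permits
  exchanging the two.\<close>

lemma (in sigma_finite_measure) AE_AE_commute:
  assumes [measurable]: "case_prod f \<in> borel_measurable (borel \<Otimes>\<^sub>M M)" "case_prod g \<in> borel_measurable (borel \<Otimes>\<^sub>M M)"
    and "AE t in lborel. AE x in M. (f t x :: real) = g t x"
  shows "AE x in M. AE t in lborel. f t x = g t x"
proof -
  interpret P: pair_sigma_finite lborel M ..
  have "Measurable.pred (lborel \<Otimes>\<^sub>M M) (\<lambda>p. f (fst p) (snd p) = g (fst p) (snd p))"
    by measurable
  then have "{p \<in> space (lborel \<Otimes>\<^sub>M M). f (fst p) (snd p) = g (fst p) (snd p)} \<in> sets (lborel \<Otimes>\<^sub>M M)"
    by (simp add: pred_def)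
  from P.AE_commute[OF this] assms(3) show ?thesis by simp
qed

lemma ennreal_le_of_power2_le:
  fixes x y :: ennreal
  assumes "x\<^sup>2 \<le> y\<^sup>2" shows "x \<le> y"
proof (cases y)
  case (real b)
  show ?thesis
  proof (cases x)
    case (real a)
    then show ?thesis
      using assms \<open>y = ennreal b\<close> \<open>0 \<le> b\<close> by (auto simp: ennreal_power intro!: ennreal_leI power2_le_imp_le)
  next
    case top
    then show ?thesis using assms real by (simp add: ennreal_power top_unique)
  qed
qed simp

text \<open>Both factors are measured by multiples of the same \<open>R\<close>, so Cauchy-Schwarz
  returns \<open>R\<close> itself to the first power.\<close>

lemma nn_integral_abs_mult_le_of_squares:
  fixes f g :: "real \<Rightarrow> real"
  assumes [measurable]: "f \<in> borel_measurable borel" "g \<in> borel_measurable borel"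
    and f: "(\<integral>\<^sup>+t. ennreal ((f t)\<^sup>2) \<partial>lborel) \<le> ennreal (a\<^sup>2) * R"
    and g: "(\<integral>\<^sup>+t. ennreal ((g t)\<^sup>2) \<partial>lborel) \<le> ennreal (b\<^sup>2) * R"
    and ab: "0 \<le> a" "0 \<le> b"
  shows "(\<integral>\<^sup>+t. ennreal \<bar>f t * g t\<bar> \<partial>lborel) \<le> ennreal (a * b) * R"
proof (cases "R = top \<and> a * b \<noteq> 0")
  case True
  then have "ennreal (a * b) * R = top" using ab by (auto simp: ennreal_mult_top)
  then show ?thesis by simp
next
  case False
  have "(\<integral>\<^sup>+t. ennreal \<bar>f t * g t\<bar> \<partial>lborel)\<^sup>2 \<le> (\<integral>\<^sup>+t. ennreal ((f t)\<^sup>2) \<partial>lborel) * (\<integral>\<^sup>+t. ennreal ((g t)\<^sup>2) \<partial>lborel)"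
    by (rule nn_Cauchy_Schwarz) measurable
  also have "\<dots> \<le> (ennreal (a\<^sup>2) * R) * (ennreal (b\<^sup>2) * R)" by (intro mult_mono f g) auto
  also have "\<dots> = (ennreal (a * b) * R)\<^sup>2"
    using ab by (simp add: power2_eq_square ennreal_mult mult_ac)
  finally have "(\<integral>\<^sup>+t. ennreal \<bar>f t * g t\<bar> \<partial>lborel)\<^sup>2 \<le> (ennreal (a * b) * R)\<^sup>2" .
  then show ?thesis
    by (rule ennreal_le_of_power2_le)
qed

text \<open>\<open>avg n\<close> is at once the mean of \<phi> over the n-th interval and the slope
  of the nodal interpolant of \<open>z\<close>. Thus the argument in \<open>AY_A\<close> is the
  interpolation error, and \<open>Yp\<close> is its time derivative.\<close>

locale mesh_dual = dual_problem M A \<alpha> T B \<phi> \<eta> G z E F + time_mesh tn N k T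
  for M :: "'a measure" and A \<alpha> T B \<phi> \<eta> G z E F tn N k +
  fixes Yp AY AYp :: "real \<Rightarrow> 'a \<Rightarrow> real" and avg :: "nat \<Rightarrow> 'a \<Rightarrow> real"
  defines avg_def: "avg n x \<equiv> (z (tn (Suc n)) x - z (tn n) x) / (tn (Suc n) - tn n)"
  assumes Yp_meas [measurable]: "case_prod Yp \<in> borel_measurable (borel \<Otimes>\<^sub>M M)"
    and AY_meas [measurable]: "case_prod AY \<in> borel_measurable (borel \<Otimes>\<^sub>M M)"
    and AYp_meas [measurable]: "case_prod AYp \<in> borel_measurable (borel \<Otimes>\<^sub>M M)"
    and Yp_supp: "t \<notin> {0..T} \<Longrightarrow> Yp t x = 0" and AY_supp: "t \<notin> {0..T} \<Longrightarrow> AY t x = 0"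
    and AYp_supp: "t \<notin> {0..T} \<Longrightarrow> AYp t x = 0"
    and Yp_A: "n < N \<Longrightarrow> tn n < t \<Longrightarrow> t < tn (Suc n) \<Longrightarrow> A (Yp t) (AYp t)"
    and Yp_eq: "n < N \<Longrightarrow> tn n < t \<Longrightarrow> t < tn (Suc n) \<Longrightarrow> AE x in M. Yp t x = \<phi> t x - avg n x"
    and AY_A: "n < N \<Longrightarrow> tn n \<le> t \<Longrightarrow> t \<le> tn (Suc n) \<Longrightarrow>
      A (\<lambda>x. z t x - z (tn n) x - (t - tn n) * avg n x) (AY t)"
begin

definition Aavg :: "nat \<Rightarrow> 'a \<Rightarrow> real" where
  "Aavg n x = (\<zeta> (tn (Suc n)) x - \<zeta> (tn n) x) / (tn (Suc n) - tn n)"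

text \<open>A jointly measurable representative of \<open>A \<phi>\<close>.\<close>

definition G' :: "real \<Rightarrow> 'a \<Rightarrow> real" where
  "G' t x = (\<Sum>n<N. indicator {tn n<..<tn (Suc n)} t * (AYp t x + Aavg n x))"

lemma tn_nonneg': "n < N \<Longrightarrow> 0 \<le> tn n" "n < N \<Longrightarrow> 0 \<le> tn (Suc n)"
  using tn_nonneg[of n] tn_nonneg[of "Suc n"] by auto

lemma Aavg_sq: "n < N \<Longrightarrow> sq_int M (Aavg n)"
  using sq_int_scale[OF sq_int_diff[OF \<zeta>_sq \<zeta>_sq], of "tn (Suc n)" "tn n" "inverse (tn (Suc n) - tn n)"] tn_nonneg'[of n]
  by (simp add: Aavg_def[abs_def] divide_inverse mult.commute)

lemma A_avg: "n < N \<Longrightarrow> A (avg n) (Aavg n)"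
proof -
  assume n: "n < N"
  let ?c = "inverse (tn (Suc n) - tn n)"
  have d: "A (\<lambda>x. z (tn (Suc n)) x - z (tn n) x) (\<lambda>x. \<zeta> (tn (Suc n)) x - \<zeta> (tn n) x)"
    using n tn_nonneg'[of n] by (intro A_z_diff) auto
  show ?thesis
    using A_lin[OF d d, of ?c 0]
    by (simp add: avg_def[abs_def] Aavg_def[abs_def] divide_inverse mult.commute)
qed

lemma G'_eq:
  assumes "n < N" "tn n < t" "t < tn (Suc n)"
  shows "G' t x = AYp t x + Aavg n x"
proof -
  have "G' t x = (\<Sum>j<N. if j = n then AYp t x + Aavg n x else 0)"
    unfolding G'_def
  proof (intro sum.cong refl)
    fix j assume "j \<in> {..<N}"
    then have "j = n" if "tn j \<le> t" "t < tn (Suc j)"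
      using mesh_disjoint[OF that, of n] assms by simp
    then show "indicator {tn j<..<tn (Suc j)} t * (AYp t x + Aavg j x) = (if j = n then AYp t x + Aavg n x else 0)"
      using assms by (cases "j = n") (auto simp: indicator_def)
  qed
  then show ?thesis using assms by simp
qed

lemma G'_zero: "t \<notin> {0..T} \<Longrightarrow> G' t x = 0"
  unfolding G'_def
proof (intro sum.neutral ballI)
  fix n assume "t \<notin> {0..T}" "n \<in> {..<N}"
  then have "t \<notin> {tn n<..<tn (Suc n)}"
    using tn_nonneg'[of n] tn_le_T[of "Suc n"] by auto
  then show "indicator {tn n<..<tn (Suc n)} t * (AYp t x + Aavg n x) = 0" by simp
qed

lemma G'_meas [measurable]: "case_prod G' \<in> borel_measurable (borel \<Otimes>\<^sub>M M)"
proof -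
  have [measurable]: "Aavg n \<in> borel_measurable M" if "n \<in> {..<N}" for n
    using Aavg_sq[of n] that by (simp add: sq_int_def)
  show ?thesis
    unfolding G'_def[abs_def] split_beta' by measurable
qed

lemma mesh_AE: "AE t in lborel. t \<in> {0..T} \<longrightarrow> (\<exists>n<N. tn n < t \<and> t < tn (Suc n))"
proof -
  have "AE t in lborel. \<forall>n\<in>{..N}. t \<noteq> tn n"
    by (intro AE_finite_allI AE_lborel_singleton) auto
  then show ?thesis
  proof eventually_elim
    case (elim t)
    show ?case
    proof
      assume "t \<in> {0..T}"
      then have "0 < t" "t \<le> T" using elim[rule_format, of 0] by (auto simp: tn_0)
      then obtain n where "n < N" "tn n < t" "t \<le> tn (Suc n)" using mesh_cover_Ioc[of t] by auto
      moreover have "t \<noteq> tn (Suc n)" using elim \<open>n < N\<close> by auto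
      ultimately show "\<exists>n<N. tn n < t \<and> t < tn (Suc n)" by auto
    qed
  qed
qed

lemma inside:
  assumes "n < N" "tn n < t" "t < tn (Suc n)" shows "0 < t" "t < T"
  using assms tn_nonneg'[of n] tn_le_T[of "Suc n"] by auto

text \<open>Inside an interval \<open>AYp\<close> and G - \<open>Aavg\<close> are both images of
  \<phi> minus its mean, so they agree almost everywhere for that \<open>t\<close>.\<close>

lemma G_eq_G':
  assumes n: "n < N" "tn n < t" "t < tn (Suc n)"
  shows "AE x in M. G t x = G' t x"
proof -
  have "A (\<lambda>x. \<phi> t x - avg n x) (\<lambda>x. G t x - Aavg n x)"
    using inside[OF n] n by (intro A_diff \<phi>_A A_avg) auto
  then have "AE x in M. G t x - Aavg n x = AYp t x"
  proof (rule A_unique_weak)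
    show "sq_int M (AYp t)" using A_sq_int[OF Yp_A[OF n]] by auto
    fix \<xi> h assume \<xi>: "A \<xi> h"
    have "ip (\<lambda>x. \<phi> t x - avg n x) h = ip (Yp t) h"
      using A_sq_int[OF \<xi>] A_sq_int[OF A_avg[OF n(1)]] \<phi>_sq[of t] A_sq_int[OF Yp_A[OF n]] Yp_eq[OF n]
      by (intro integral_cong_AE) (auto simp: sq_int_def)
    then show "ip (\<lambda>x. \<phi> t x - avg n x) h = ip (AYp t) \<xi>"
      using A_sym[OF Yp_A[OF n] \<xi>] by simp
  qed
  then show ?thesis by eventually_elim (simp add: G'_eq[OF n])
qed

abbreviation R :: ennreal where
  "R \<equiv> \<integral>\<^sup>+t. (\<integral>\<^sup>+x. ennreal ((\<eta> t x)\<^sup>2) \<partial>M) \<partial>lborel"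

lemma R_finite: "R < \<infinity>"
proof -
  have "R \<le> (\<integral>\<^sup>+t. ennreal B * indicator {0..T} t \<partial>lborel)"
  proof (intro nn_integral_mono)
    fix t show "(\<integral>\<^sup>+x. ennreal ((\<eta> t x)\<^sup>2) \<partial>M) \<le> ennreal B * indicator {0..T} t"
      using \<eta>_bd[of t] \<eta>_supp[of t] by (cases "t \<in> {0..T}") (auto simp: nn_integral_sq_int[OF \<eta>_sq] intro: ennreal_leI)
  qed
  also have "\<dots> < \<infinity>" by (simp add: nn_integral_cmult ennreal_mult_less_top emeasure_lborel_Icc_eq)
  finally show ?thesis .
qed

lemma G'_le: "(\<integral>\<^sup>+t. (\<integral>\<^sup>+x. ennreal ((G' t x)\<^sup>2) \<partial>M) \<partial>lborel) \<le> R"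
proof -
  have "(\<integral>\<^sup>+t. (\<integral>\<^sup>+x. ennreal ((G' t x)\<^sup>2) \<partial>M) \<partial>lborel) = (\<integral>\<^sup>+t. indicator {0<..<T} t * ennreal (\<integral>x. (G t x)\<^sup>2 \<partial>M) \<partial>lborel)"
  proof (intro nn_integral_cong_AE, use mesh_AE in eventually_elim)
    case (elim t)
    show ?case
    proof (cases "t \<in> {0..T}")
      case True
      then obtain n where n: "n < N" "tn n < t" "t < tn (Suc n)" using elim by auto
      have "(\<integral>\<^sup>+x. ennreal ((G' t x)\<^sup>2) \<partial>M) = (\<integral>\<^sup>+x. ennreal ((G t x)\<^sup>2) \<partial>M)"
        by (intro nn_integral_cong_AE) (use G_eq_G'[OF n] in eventually_elim, simp)
      also have "\<dots> = ennreal (\<integral>x. (G t x)\<^sup>2 \<partial>M)"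
        using A_sq_int[OF \<phi>_A[OF inside[OF n]]] by (intro nn_integral_sq_int) auto
      finally show ?thesis using inside[OF n] by simp
    next
      case False
      then show ?thesis by (auto simp: G'_zero)
    qed
  qed
  then show ?thesis using stability by simp
qed

text \<open>The operator commutes with time integration. Instead of closedness, the identity is
  tested: symmetry moves the operator onto the test element, where Fubini applies, and weak
  uniqueness finishes.\<close>

lemma G'_integral:
  assumes st: "0 \<le> s" "s \<le> t" "t \<le> T"
  shows "AE x in M. \<zeta> t x - \<zeta> s x = (\<integral>r. indicator {s..t} r * G' r x \<partial>lborel)"
    and "AE x in M. integrable lborel (\<lambda>r. indicator {s..t} r * G' r x)"
proof -
  let ?k = "indicator {s..t} :: real \<Rightarrow> real"
  have k: "(\<integral>\<^sup>+r. ennreal \<bar>?k r\<bar> \<partial>lborel) < \<infinity>"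
    by (simp add: ennreal_indicator emeasure_lborel_Icc_eq)
  have "(\<integral>\<^sup>+r. ennreal \<bar>?k r\<bar> * (\<integral>\<^sup>+x. ennreal ((G' r x)\<^sup>2) \<partial>M) \<partial>lborel) \<le> (\<integral>\<^sup>+t. (\<integral>\<^sup>+x. ennreal ((G' t x)\<^sup>2) \<partial>M) \<partial>lborel)"
    by (intro nn_integral_mono) (auto simp: indicator_def)
  then have kv: "(\<integral>\<^sup>+r. ennreal \<bar>?k r\<bar> * (\<integral>\<^sup>+x. ennreal ((G' r x)\<^sup>2) \<partial>M) \<partial>lborel) < \<infinity>"
    using G'_le R_finite by (auto intro: le_less_trans)
  note wm = weighted_mean[OF G'_meas _ k kv]
  show "AE x in M. integrable lborel (\<lambda>r. ?k r * G' r x)" by (rule wm(5)) measurable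
  have 0: "0 \<le> t" using st by simp
  have A0: "A (\<lambda>x. z t x - z s x) (\<lambda>x. \<zeta> t x - \<zeta> s x)" using st by (intro A_z_diff) auto
  show "AE x in M. \<zeta> t x - \<zeta> s x = (\<integral>r. ?k r * G' r x \<partial>lborel)"
  proof (rule A_unique_weak[OF A0 wm(1)])
    fix \<xi> h assume \<xi>: "A \<xi> h"
    have \<xi>_sq: "sq_int M \<xi>" and h_sq: "sq_int M h" using A_sq_int[OF \<xi>] by auto
    have [measurable]: "\<xi> \<in> borel_measurable M" "h \<in> borel_measurable M" using \<xi>_sq h_sq by (auto simp: sq_int_def)
    have "ip (\<lambda>x. z t x - z s x) h = ip (z (s + (t - s))) h - ip (z s) h"
      using st h_sq by (simp add: ip_diff_left z_sq)
    also have "\<dots> = (\<integral>r. indicator {0..t - s} r * ip (\<phi> (s + r)) h \<partial>lborel)"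
      using z_shift_inner(1)[OF st(1) _ h_sq, of "t - s"] st by simp
    also have "\<dots> = (\<integral>r. indicator {0..t - s} (r - s) * ip (\<phi> r) h \<partial>lborel)"
      using lborel_integral_shift[of "\<lambda>r. indicator {0..t - s} (r - s) * ip (\<phi> r) h" s] by (simp add: add.commute)
    also have "\<dots> = (\<integral>r. ?k r * ip (G' r) \<xi> \<partial>lborel)"
    proof (intro integral_cong_AE, measurable, use mesh_AE in eventually_elim)
      case (elim r)
      show ?case
      proof (cases "r \<in> {s..t}")
        case True
        then obtain n where n: "n < N" "tn n < r" "r < tn (Suc n)" using elim st by auto
        have "ip (\<phi> r) h = ip (G r) \<xi>" using A_sym[OF \<phi>_A[OF inside[OF n]] \<xi>] by simp
        also have "\<dots> = ip (G' r) \<xi>"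
          using A_sq_int[OF \<phi>_A[OF inside[OF n]]]
          by (intro integral_cong_AE) (use G_eq_G'[OF n] in \<open>auto simp: sq_int_def\<close>)
        finally show ?thesis using True by (simp add: indicator_def)
      qed (auto simp: indicator_def)
    qed
    also have "\<dots> = ip (\<lambda>x. \<integral>r. ?k r * G' r x \<partial>lborel) \<xi>"
      by (rule wm(3)[OF _ \<xi>_sq, symmetric]) measurable
    finally show "ip (\<lambda>x. z t x - z s x) h = ip (\<lambda>x. \<integral>r. ?k r * G' r x \<partial>lborel) \<xi>" .
  qed measurable
qed

text \<open>The negative time derivative of \<open>F\<close> according to the dual equation, in a
  jointly measurable version.\<close>

definition \<psi> :: "real \<Rightarrow> 'a \<Rightarrow> real" where
  "\<psi> t x = \<eta> t x - G' t x"

lemma \<psi>_meas [measurable]: "case_prod \<psi> \<in> borel_measurable (borel \<Otimes>\<^sub>M M)"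
  unfolding \<psi>_def[abs_def] by measurable

text \<open>From (a - b)^2 \<le> 2 a^2 + 2 b^2 and stability with constant 1; this is the origin of
  the factor 4 in the final constant.\<close>

lemma \<psi>_le: "(\<integral>\<^sup>+t. (\<integral>\<^sup>+x. ennreal ((\<psi> t x)\<^sup>2) \<partial>M) \<partial>lborel) \<le> 4 * R"
proof -
  have sq: "ennreal ((\<psi> t x)\<^sup>2) \<le> 2 * ennreal ((\<eta> t x)\<^sup>2) + 2 * ennreal ((G' t x)\<^sup>2)" for t x
  proof -
    have "(a - b)\<^sup>2 + (a + b)\<^sup>2 = 2 * a\<^sup>2 + 2 * b\<^sup>2" for a b :: real
      by (simp add: power2_eq_square algebra_simps)
    then have "(\<psi> t x)\<^sup>2 \<le> 2 * (\<eta> t x)\<^sup>2 + 2 * (G' t x)\<^sup>2"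
      unfolding \<psi>_def by (metis le_add_same_cancel1 zero_le_power2)
    then have "ennreal ((\<psi> t x)\<^sup>2) \<le> ennreal (2 * (\<eta> t x)\<^sup>2 + 2 * (G' t x)\<^sup>2)" by (rule ennreal_leI)
    then show ?thesis by (simp add: ennreal_mult)
  qed
  have "(\<integral>\<^sup>+t. (\<integral>\<^sup>+x. ennreal ((\<psi> t x)\<^sup>2) \<partial>M) \<partial>lborel)
    \<le> (\<integral>\<^sup>+t. 2 * (\<integral>\<^sup>+x. ennreal ((\<eta> t x)\<^sup>2) \<partial>M) + 2 * (\<integral>\<^sup>+x. ennreal ((G' t x)\<^sup>2) \<partial>M) \<partial>lborel)"
  proof (intro nn_integral_mono)
    fix t
    have "(\<integral>\<^sup>+x. ennreal ((\<psi> t x)\<^sup>2) \<partial>M) \<le> (\<integral>\<^sup>+x. 2 * ennreal ((\<eta> t x)\<^sup>2) + 2 * ennreal ((G' t x)\<^sup>2) \<partial>M)"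
      by (intro nn_integral_mono sq)
    also have "\<dots> = 2 * (\<integral>\<^sup>+x. ennreal ((\<eta> t x)\<^sup>2) \<partial>M) + 2 * (\<integral>\<^sup>+x. ennreal ((G' t x)\<^sup>2) \<partial>M)"
      by (subst nn_integral_add) (auto simp: nn_integral_cmult)
    finally show "(\<integral>\<^sup>+x. ennreal ((\<psi> t x)\<^sup>2) \<partial>M) \<le> 2 * (\<integral>\<^sup>+x. ennreal ((\<eta> t x)\<^sup>2) \<partial>M) + 2 * (\<integral>\<^sup>+x. ennreal ((G' t x)\<^sup>2) \<partial>M)" .
  qed
  also have "\<dots> = 2 * R + 2 * (\<integral>\<^sup>+t. (\<integral>\<^sup>+x. ennreal ((G' t x)\<^sup>2) \<partial>M) \<partial>lborel)"
    by (subst nn_integral_add) (auto simp: nn_integral_cmult)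
  also have "\<dots> \<le> 2 * R + 2 * R" by (intro add_left_mono mult_left_mono G'_le) auto
  also have "\<dots> = 4 * R" by (simp add: distrib_right[symmetric])
  finally show ?thesis .
qed

text \<open>\<open>F\<close> vanishes at \<open>T\<close> and \<zeta> = F + E, so F(t) is the
  increment of \<open>E\<close> from t to \<open>T\<close> minus that of \<zeta>; both are
  integrals. This is the hypothesis of the Abel inversion.\<close>

lemma F_\<psi>:
  assumes t: "t \<in> {0..T}"
  shows "AE x in M. F t x = (\<integral>s. \<psi> s x * indicator {t<..} s \<partial>lborel)"
proof -
  have ae: "AE x in M. integrable lborel (\<lambda>s. indicator {0..t} s * \<eta> s x)" "AE x in M. integrable lborel (\<lambda>s. indicator {0..T} s * \<eta> s x)"
    using t T by (auto intro!: weighted_mean_bounded_AE_integrable[where B=B, OF _ _ Icc_nn] simp: \<eta>_sq \<eta>_bd B)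
  have t': "0 \<le> t" "t \<le> T" using t by auto
  from G'_integral[OF t' order_refl] ae AE_space show ?thesis
  proof eventually_elim
    case (elim x)
    note [measurable] = elim(5)
    have "F t x = (E T x - E t x) - (\<zeta> T x - \<zeta> t x)"
      using F_beyond[of T x] by (simp add: \<zeta>_def)
    also have "\<dots> = (\<integral>s. (indicator {0..T} s * \<eta> s x - indicator {0..t} s * \<eta> s x) - indicator {t..T} s * G' s x \<partial>lborel)"
      using elim by (simp add: E_def)
    also have "\<dots> = (\<integral>s. \<psi> s x * indicator {t<..} s \<partial>lborel)"
    proof (intro integral_cong_AE)
      have "AE s in lborel. s \<noteq> t" by (rule AE_lborel_singleton)
      then show "AE s in lborel. (indicator {0..T} s * \<eta> s x - indicator {0..t} s * \<eta> s x) - indicator {t..T} s * G' s x = \<psi> s x * indicator {t<..} s"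
      proof eventually_elim
        case (elim s)
        then show ?case
          using t G'_zero[of s x] \<eta>_supp[of s x] by (auto simp: indicator_def \<psi>_def)
      qed
    qed measurable
    finally show ?case .
  qed
qed

abbreviation m :: "real \<Rightarrow> real" where "m \<beta> \<equiv> 2 * fker_int \<beta> k"

lemma m_nonneg: "0 < \<beta> \<Longrightarrow> 0 \<le> m \<beta>"
  using fker_int_nonneg[of \<beta> k] by simp

text \<open>Both \<open>AY\<close> and the primitive of \<open>AYp\<close> from the left node equal
  the increment of \<zeta> minus its linear part, the former by weak uniqueness and the latter by
  integrating \<open>G'\<close>.\<close>

lemma AYp_integral:
  assumes n: "n < N" "tn n \<le> t" "t \<le> tn (Suc n)"
  shows "AE x in M. AY t x = (\<integral>s. AYp s x * indicator {tn n..t} s \<partial>lborel)"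
    and "AE x in M. \<zeta> t x - \<zeta> (tn n) x - (t - tn n) * Aavg n x = (\<integral>s. AYp s x * indicator {tn n..t} s \<partial>lborel)"
proof -
  have st: "0 \<le> tn n" "tn n \<le> t" "t \<le> T" using n tn_nonneg'[of n] tn_le_T[of "Suc n"] by auto
  show 1: "AE x in M. \<zeta> t x - \<zeta> (tn n) x - (t - tn n) * Aavg n x = (\<integral>s. AYp s x * indicator {tn n..t} s \<partial>lborel)"
    using G'_integral[OF st] AE_space
  proof eventually_elim
    case (elim x)
    note [measurable] = elim(3)
    have i: "integrable lborel (\<lambda>s. indicator {tn n..t} s * Aavg n x)"
      by (intro integrable_mult_left integrable_real_indicator) (auto simp: emeasure_lborel_Icc_eq)
    have "(\<integral>s. AYp s x * indicator {tn n..t} s \<partial>lborel) = (\<integral>s. indicator {tn n..t} s * G' s x - indicator {tn n..t} s * Aavg n x \<partial>lborel)"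
    proof (intro integral_cong_AE)
      have "AE s in lborel. s \<noteq> tn n" "AE s in lborel. s \<noteq> tn (Suc n)" by (rule AE_lborel_singleton)+
      then show "AE s in lborel. AYp s x * indicator {tn n..t} s = indicator {tn n..t} s * G' s x - indicator {tn n..t} s * Aavg n x"
      proof eventually_elim
        case (elim s)
        then show ?case using G'_eq[OF n(1), of s x] n by (auto simp: indicator_def)
      qed
    qed measurable
    also have "\<dots> = (\<integral>s. indicator {tn n..t} s * G' s x \<partial>lborel) - (\<integral>s. indicator {tn n..t} s * Aavg n x \<partial>lborel)"
      by (rule Bochner_Integration.integral_diff[OF elim(2) i])
    also have "(\<integral>s. indicator {tn n..t} s * Aavg n x \<partial>lborel) = (t - tn n) * Aavg n x"
      using n by simp
    finally show ?case using elim(1) by simp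
  qed
  have z: "A (\<lambda>x. z t x - z (tn n) x) (\<lambda>x. \<zeta> t x - \<zeta> (tn n) x)" using st by (intro A_z_diff) auto
  have "A (\<lambda>x. z t x - z (tn n) x - (t - tn n) * avg n x) (\<lambda>x. \<zeta> t x - \<zeta> (tn n) x - (t - tn n) * Aavg n x)"
    using A_lin[OF z A_avg[OF n(1)], of 1 "- (t - tn n)"] by (simp add: algebra_simps)
  from A_unique_weak[OF AY_A[OF n], of "\<lambda>x. \<zeta> t x - \<zeta> (tn n) x - (t - tn n) * Aavg n x"] A_sq_int[OF this] A_sym[OF this]
  have "AE x in M. AY t x = \<zeta> t x - \<zeta> (tn n) x - (t - tn n) * Aavg n x"
    by (auto simp: mult.commute)
  with 1 show "AE x in M. AY t x = (\<integral>s. AYp s x * indicator {tn n..t} s \<partial>lborel)"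
    by eventually_elim simp
qed

lemma AE_sq_int_lborel:
  assumes [measurable]: "case_prod v \<in> borel_measurable (borel \<Otimes>\<^sub>M M)"
    and fin: "(\<integral>\<^sup>+t. (\<integral>\<^sup>+x. ennreal ((v t x)\<^sup>2) \<partial>M) \<partial>lborel) < \<infinity>"
  shows "AE x in M. sq_int lborel (\<lambda>t. v t x)"
proof -
  interpret P: pair_sigma_finite lborel M ..
  have "(\<integral>\<^sup>+x. (\<integral>\<^sup>+t. ennreal ((v t x)\<^sup>2) \<partial>lborel) \<partial>M) \<noteq> \<infinity>"
    using fin by (subst P.Fubini') auto
  then have "AE x in M. (\<integral>\<^sup>+t. ennreal ((v t x)\<^sup>2) \<partial>lborel) \<noteq> \<infinity>"
    by (intro nn_integral_PInf_AE) auto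
  with AE_space show ?thesis
    by eventually_elim (auto simp: sq_int_iff_nn top.not_eq_extremum)
qed

lemma sq_int_indicator_const: "sq_int lborel (\<lambda>t::real. indicator {a..<b} t * (r::real))"
proof -
  have "(\<lambda>t::real. (indicator {a..<b} t * r)\<^sup>2) = (\<lambda>t. indicator {a..<b} t * r\<^sup>2)"
    by (auto simp: indicator_def)
  then show ?thesis
    by (auto simp: sq_int_def intro!: integrable_mult_left integrable_real_indicator)
       (metis emeasure_lborel_Ico ennreal_less_top linorder_le_cases atLeastLessThan_empty emeasure_empty ennreal_zero_less_top)
qed

lemma sq_int_step: "sq_int lborel (\<lambda>t. \<Sum>n<j. r n * indicator {tn n..<tn (Suc n)} t)"
proof (induction j)
  case (Suc j)
  then show ?case using sq_int_add[OF Suc sq_int_indicator_const[of "tn j" "tn (Suc j)" "r j"]] by (simp add: mult.commute)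
qed simp

text \<open>Everything the mesh lemmas ask of the time slice at \<open>x\<close>, outside one null
  set of \<open>x\<close>. The means vanish because \<open>avg n\<close> is the mean of
  \<phi>.\<close>

lemma Yp_facts:
  "AE x in M. sq_int lborel (\<lambda>t. \<phi> t x) \<and> sq_int lborel (\<lambda>t. Yp t x) \<and>
     (\<forall>n<N. (AE t in lborel. t \<in> {tn n..<tn (Suc n)} \<longrightarrow> Yp t x = \<phi> t x - avg n x) \<and>
        (\<integral>s. Yp s x * indicator {tn n..<tn (Suc n)} s \<partial>lborel) = 0)"
proof -
  have [measurable]: "avg n \<in> borel_measurable M" if "n \<in> {..<N}" for n
    using A_sq_int[OF A_avg[of n]] that by (simp add: sq_int_def)
  let ?s = "\<lambda>t x. (\<Sum>n<N. avg n x * indicator {tn n..<tn (Suc n)} t)"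
  have "(\<integral>\<^sup>+t. (\<integral>\<^sup>+x. ennreal ((\<phi> t x)\<^sup>2) \<partial>M) \<partial>lborel) \<le> (\<integral>\<^sup>+t. ennreal B * indicator {0..T} t \<partial>lborel)"
  proof (intro nn_integral_mono)
    fix t show "(\<integral>\<^sup>+x. ennreal ((\<phi> t x)\<^sup>2) \<partial>M) \<le> ennreal B * indicator {0..T} t"
      using \<phi>_bd[of t] \<phi>_supp[of t] by (cases "t \<in> {0..T}") (auto simp: nn_integral_sq_int[OF \<phi>_sq] intro: ennreal_leI)
  qed
  also have "\<dots> < \<infinity>" by (simp add: nn_integral_cmult ennreal_mult_less_top emeasure_lborel_Icc_eq)
  finally have "AE x in M. sq_int lborel (\<lambda>t. \<phi> t x)" by (intro AE_sq_int_lborel) auto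
  moreover have "AE t in lborel. AE x in M. Yp t x = \<phi> t x - ?s t x"
    using mesh_AE
  proof eventually_elim
    case (elim t)
    show ?case
    proof (cases "t \<in> {0..T}")
      case True
      then obtain n where n: "n < N" "tn n < t" "t < tn (Suc n)" using elim by auto
      have "?s t x = avg n x" for x using n by (intro mesh_sum_indicator) auto
      then show ?thesis using Yp_eq[OF n] by simp
    next
      case False
      then have "t \<notin> {tn n..<tn (Suc n)}" if "n < N" for n
        using tn_nonneg'[of n] tn_le_T[of "Suc n"] that by auto
      then have "?s t x = 0" for x by (intro sum.neutral) auto
      then show ?thesis using False by (simp add: Yp_supp \<phi>_supp)
    qed
  qed
  then have "AE x in M. AE t in lborel. Yp t x = \<phi> t x - ?s t x"
    by (intro AE_AE_commute) measurable
  ultimately show ?thesis using AE_space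
  proof eventually_elim
    case (elim x)
    note [measurable] = elim(3)
    have sq: "sq_int lborel (\<lambda>t. Yp t x)"
      by (rule sq_int_cong_AE[OF sq_int_diff[OF elim(1) sq_int_step[of "\<lambda>n. avg n x" N]]])
         (measurable, use elim(2) in auto)
    have ae: "AE t in lborel. t \<in> {tn n..<tn (Suc n)} \<longrightarrow> Yp t x = \<phi> t x - avg n x" if n: "n < N" for n
      using elim(2)
    proof eventually_elim
      case (elim t)
      then show ?case using mesh_sum_indicator[OF n, of t "\<lambda>n. avg n x"] by auto
    qed
    have \<phi>i: "integrable lborel (\<lambda>t. \<phi> t x)" using \<phi>_supp by (intro integrable_of_sq_int_supp elim(1)) auto
    have mean: "(\<integral>s. Yp s x * indicator {tn n..<tn (Suc n)} s \<partial>lborel) = 0" if n: "n < N" for n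
    proof -
      have l: "tn n < tn (Suc n)" by (rule tn_less[OF n])
      have i: "integrable lborel (\<lambda>s. indicator {0..a} s * \<phi> s x)" for a
        using integrable_real_mult_indicator[OF _ \<phi>i, of "{0..a}"] by (simp add: mult.commute)
      have c: "integrable lborel (\<lambda>s. indicator {tn n..<tn (Suc n)} s * avg n x)"
        using l by (intro integrable_mult_left integrable_real_indicator) auto
      have "(\<integral>s. Yp s x * indicator {tn n..<tn (Suc n)} s \<partial>lborel)
        = (\<integral>s. (indicator {0..tn (Suc n)} s * \<phi> s x - indicator {0..tn n} s * \<phi> s x) - indicator {tn n..<tn (Suc n)} s * avg n x \<partial>lborel)"
      proof (intro integral_cong_AE)
        have "AE s in lborel. s \<noteq> tn n" "AE s in lborel. s \<noteq> tn (Suc n)" by (rule AE_lborel_singleton)+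
        with ae[OF n] show "AE s in lborel. Yp s x * indicator {tn n..<tn (Suc n)} s
           = (indicator {0..tn (Suc n)} s * \<phi> s x - indicator {0..tn n} s * \<phi> s x) - indicator {tn n..<tn (Suc n)} s * avg n x"
        proof eventually_elim
          case (elim s)
          then show ?case using l tn_nonneg'[OF n] by (auto simp: indicator_def)
        qed
      qed measurable
      also have "\<dots> = (z (tn (Suc n)) x - z (tn n) x) - (tn (Suc n) - tn n) * avg n x"
        using i c l by (simp add: z_def)
      also have "\<dots> = 0" using l by (simp add: avg_def)
      finally show ?thesis .
    qed
    show ?case using elim(1) sq ae mean by auto
  qed
qed

text \<open>The same for the images under the operator, with \<open>G'\<close> in the role of
  \<phi>; in addition \<open>AY\<close> is a primitive of \<open>AYp\<close> from the left node of
  each interval.\<close>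

lemma AYp_facts:
  "AE x in M. sq_int lborel (\<lambda>t. G' t x) \<and> sq_int lborel (\<lambda>t. AYp t x) \<and>
     (\<forall>n<N. (AE t in lborel. t \<in> {tn n..<tn (Suc n)} \<longrightarrow> AYp t x = G' t x - Aavg n x) \<and>
        (\<integral>s. AYp s x * indicator {tn n..<tn (Suc n)} s \<partial>lborel) = 0 \<and>
        (AE t in lborel. t \<in> {tn n..<tn (Suc n)} \<longrightarrow> AY t x = (\<integral>s. AYp s x * indicator {tn n..t} s \<partial>lborel)))"
proof -
  let ?s = "\<lambda>t x. (\<Sum>n<N. Aavg n x * indicator {tn n..<tn (Suc n)} t)"
  have "AE x in M. sq_int lborel (\<lambda>t. G' t x)"
    using G'_le R_finite by (intro AE_sq_int_lborel) (auto intro: le_less_trans)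
  \<comment> \<open>At the right node the linear part of \<zeta> is removed completely, so this
    primitive of \<open>AYp\<close> vanishes there: the mean of \<open>AYp\<close> is zero.\<close>
  moreover have "AE x in M. \<forall>n\<in>{..<N}. \<zeta> (tn (Suc n)) x - \<zeta> (tn n) x - (tn (Suc n) - tn n) * Aavg n x
      = (\<integral>s. AYp s x * indicator {tn n..tn (Suc n)} s \<partial>lborel)"
    using tn_less by (intro AE_finite_allI AYp_integral(2)) (auto intro: less_imp_le)
  moreover have "AE x in M. \<forall>n\<in>{..<N}. AE t in lborel. AY t x * indicator {tn n..<tn (Suc n)} t
      = (\<integral>s. AYp s x * indicator {tn n..t} s \<partial>lborel) * indicator {tn n..<tn (Suc n)} t"
  proof (intro AE_finite_allI)
    fix n assume "n \<in> {..<N}"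
    then have n: "n < N" by simp
    have "(\<lambda>(t, x). (\<integral>s. AYp s x * (if tn n \<le> s \<and> s \<le> t then 1 else 0) \<partial>lborel) * indicator {tn n..<tn (Suc n)} t) \<in> borel_measurable (borel \<Otimes>\<^sub>M M)"
      by measurable
    then have mm: "(\<lambda>(t, x). (\<integral>s. AYp s x * indicator {tn n..t} s \<partial>lborel) * indicator {tn n..<tn (Suc n)} t) \<in> borel_measurable (borel \<Otimes>\<^sub>M M)"
      by (simp add: indicator_def of_bool_def)
    have aa: "AE t in lborel. AE x in M. AY t x * indicator {tn n..<tn (Suc n)} t
      = (\<integral>s. AYp s x * indicator {tn n..t} s \<partial>lborel) * indicator {tn n..<tn (Suc n)} t"
    proof (rule AE_I2)
      fix t :: real show "AE x in M. AY t x * indicator {tn n..<tn (Suc n)} t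
        = (\<integral>s. AYp s x * indicator {tn n..t} s \<partial>lborel) * indicator {tn n..<tn (Suc n)} t"
        using AYp_integral(1)[OF n, of t] by (cases "t \<in> {tn n..<tn (Suc n)}") auto
    qed
    show "AE x in M. AE t in lborel. AY t x * indicator {tn n..<tn (Suc n)} t
      = (\<integral>s. AYp s x * indicator {tn n..t} s \<partial>lborel) * indicator {tn n..<tn (Suc n)} t"
      by (rule AE_AE_commute[OF _ mm aa]) measurable
  qed simp
  ultimately show ?thesis using AE_space
  proof eventually_elim
    case (elim x)
    note [measurable] = elim(4)
    have "AE t in lborel. AYp t x = G' t x - ?s t x"
      using mesh_AE
    proof eventually_elim
      case (elim t)
      show ?case
      proof (cases "t \<in> {0..T}")
        case True
        then obtain n where n: "n < N" "tn n < t" "t < tn (Suc n)" using elim by auto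
        have "?s t x = Aavg n x" using n by (intro mesh_sum_indicator) auto
        then show ?thesis using G'_eq[OF n] by simp
      next
        case False
        then have "t \<notin> {tn n..<tn (Suc n)}" if "n < N" for n
          using tn_nonneg'[of n] tn_le_T[of "Suc n"] that by auto
        then have "?s t x = 0" by (intro sum.neutral) auto
        then show ?thesis using False by (simp add: AYp_supp G'_zero)
      qed
    qed
    note ae' = this
    have sq: "sq_int lborel (\<lambda>t. AYp t x)"
      by (rule sq_int_cong_AE[OF sq_int_diff[OF elim(1) sq_int_step[of "\<lambda>n. Aavg n x" N]]])
         (measurable, use ae' in auto)
    have ae: "AE t in lborel. t \<in> {tn n..<tn (Suc n)} \<longrightarrow> AYp t x = G' t x - Aavg n x" if n: "n < N" for n
      using ae'
    proof eventually_elim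
      case (elim t)
      then show ?case using mesh_sum_indicator[OF n, of t "\<lambda>n. Aavg n x"] by auto
    qed
    have mean: "(\<integral>s. AYp s x * indicator {tn n..<tn (Suc n)} s \<partial>lborel) = 0" if n: "n < N" for n
    proof -
      have "(\<integral>s. AYp s x * indicator {tn n..<tn (Suc n)} s \<partial>lborel) = (\<integral>s. AYp s x * indicator {tn n..tn (Suc n)} s \<partial>lborel)"
      proof (intro integral_cong_AE)
        have "AE s in lborel. s \<noteq> tn (Suc n)" by (rule AE_lborel_singleton)
        then show "AE s in lborel. AYp s x * indicator {tn n..<tn (Suc n)} s = AYp s x * indicator {tn n..tn (Suc n)} s"
          by eventually_elim (auto simp: indicator_def)
      qed measurable
      also have "\<dots> = \<zeta> (tn (Suc n)) x - \<zeta> (tn n) x - (tn (Suc n) - tn n) * Aavg n x" using elim(2) n by simp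
      also have "\<dots> = 0" using tn_less[OF n] by (simp add: Aavg_def)
      finally show ?thesis .
    qed
    have "AE t in lborel. t \<in> {tn n..<tn (Suc n)} \<longrightarrow> AY t x = (\<integral>s. AYp s x * indicator {tn n..t} s \<partial>lborel)" if n: "n < N" for n
    proof -
      have "AE t in lborel. AY t x * indicator {tn n..<tn (Suc n)} t
        = (\<integral>s. AYp s x * indicator {tn n..t} s \<partial>lborel) * indicator {tn n..<tn (Suc n)} t"
        using elim(3) n by auto
      then show ?thesis by eventually_elim (auto simp: indicator_def)
    qed
    then show ?case using elim(1) sq ae mean by auto
  qed
qed

text \<open>At fixed \<open>x\<close> each product is split by Cauchy-Schwarz. The first uses the
  gain of order 1 - \<alpha> once and the duality bound for \<open>Yp\<close>; the second uses one
  factor \<open>k\<close> for the primitive and one gain of order \<alpha>.\<close>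

lemma pointwise_estimate:
  "AE x in M. (\<integral>\<^sup>+t. ennreal \<bar>Yp t x * (indicator {0..T} t * (\<integral>s. fker (1 - \<alpha>) (t - s) * Yp s x \<partial>lborel))\<bar> \<partial>lborel)
      \<le> ennreal (m (1 - \<alpha>) * (m \<alpha>)\<^sup>2) * (\<integral>\<^sup>+t. ennreal ((\<psi> t x)\<^sup>2) \<partial>lborel) \<and>
    (\<integral>\<^sup>+t. ennreal \<bar>AY t x * (indicator {0..T} t * (\<integral>s. fker \<alpha> (t - s) * AYp s x \<partial>lborel))\<bar> \<partial>lborel)
      \<le> ennreal (k * m \<alpha>) * (\<integral>\<^sup>+t. ennreal ((G' t x)\<^sup>2) \<partial>lborel)"
proof -
  have "AE x in M. sq_int lborel (\<lambda>t. \<psi> t x)"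
    using \<psi>_le R_finite by (intro AE_sq_int_lborel) (auto intro: le_less_trans simp: ennreal_mult_less_top)
  moreover have "AE x in M. AE t in lborel. indicator {0..T} t * F t x = indicator {0..T} t * (\<integral>s. \<psi> s x * indicator {t<..} s \<partial>lborel)"
  proof (rule AE_AE_commute)
    have "(\<lambda>(t, x). indicator {0..T} t * (\<integral>s. \<psi> s x * (if t < s then 1 else 0) \<partial>lborel)) \<in> borel_measurable (borel \<Otimes>\<^sub>M M)"
      by measurable
    then show "(\<lambda>(t, x). indicator {0..T} t * (\<integral>s. \<psi> s x * indicator {t<..} s \<partial>lborel)) \<in> borel_measurable (borel \<Otimes>\<^sub>M M)"
      by (simp add: indicator_def of_bool_def)
    show "AE t in lborel. AE x in M. indicator {0..T} t * F t x = indicator {0..T} t * (\<integral>s. \<psi> s x * indicator {t<..} s \<partial>lborel)"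
    proof (rule AE_I2)
      fix t :: real show "AE x in M. indicator {0..T} t * F t x = indicator {0..T} t * (\<integral>s. \<psi> s x * indicator {t<..} s \<partial>lborel)"
        using F_\<psi>[of t] by (cases "t \<in> {0..T}") auto
    qed
  qed measurable
  ultimately show ?thesis using Yp_facts AYp_facts AE_space
  proof eventually_elim
    case (elim x)
    note [measurable] = elim(5)
    have \<phi>: "sq_int lborel (\<lambda>t. \<phi> t x)" and Yp: "sq_int lborel (\<lambda>t. Yp t x)"
      and proj: "\<And>n. n < N \<Longrightarrow> AE t in lborel. t \<in> {tn n..<tn (Suc n)} \<longrightarrow> Yp t x = \<phi> t x - avg n x"
      and mean: "\<And>n. n < N \<Longrightarrow> (\<integral>s. Yp s x * indicator {tn n..<tn (Suc n)} s \<partial>lborel) = 0"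
      using elim(3) by auto
    have G': "sq_int lborel (\<lambda>t. G' t x)" and AYp: "sq_int lborel (\<lambda>t. AYp t x)"
      and Aproj: "\<And>n. n < N \<Longrightarrow> AE t in lborel. t \<in> {tn n..<tn (Suc n)} \<longrightarrow> AYp t x = G' t x - Aavg n x"
      and Amean: "\<And>n. n < N \<Longrightarrow> (\<integral>s. AYp s x * indicator {tn n..<tn (Suc n)} s \<partial>lborel) = 0"
      and prim: "\<And>n. n < N \<Longrightarrow> AE t in lborel. t \<in> {tn n..<tn (Suc n)} \<longrightarrow> AY t x = (\<integral>s. AYp s x * indicator {tn n..t} s \<partial>lborel)"
      using elim(4) by auto
    have eq: "AE r in lborel. r \<in> {0..T} \<longrightarrow> (\<integral>s. fker (1 - \<alpha>) (s - r) * \<phi> s x \<partial>lborel) = (\<integral>s. \<psi> s x * indicator {r<..} s \<partial>lborel)"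
      using elim(2) by eventually_elim (auto simp: F_def)
    have \<psi>_supp: "\<psi> t x = 0" if "t \<notin> {0..T}" for t using that by (simp add: \<psi>_def \<eta>_supp G'_zero)
    let ?P = "\<integral>\<^sup>+t. ennreal ((\<psi> t x)\<^sup>2) \<partial>lborel" and ?Y = "\<integral>\<^sup>+t. ennreal ((Yp t x)\<^sup>2) \<partial>lborel"
    let ?A = "\<integral>\<^sup>+t. ennreal ((AYp t x)\<^sup>2) \<partial>lborel" and ?G = "\<integral>\<^sup>+t. ennreal ((G' t x)\<^sup>2) \<partial>lborel"
    have Y: "?Y \<le> ennreal ((m \<alpha>)\<^sup>2) * ?P"
      by (rule projection_error_le[OF \<alpha> \<phi> elim(1) Yp \<phi>_supp \<psi>_supp Yp_supp eq proj mean])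
    have "(\<integral>\<^sup>+t. ennreal \<bar>Yp t x * (indicator {0..T} t * (\<integral>s. fker (1 - \<alpha>) (t - s) * Yp s x \<partial>lborel))\<bar> \<partial>lborel)
      \<le> ennreal (1 * m (1 - \<alpha>)) * ?Y"
    proof (rule nn_integral_abs_mult_le_of_squares)
      show "(\<integral>\<^sup>+t. ennreal ((indicator {0..T} t * (\<integral>s. fker (1 - \<alpha>) (t - s) * Yp s x \<partial>lborel))\<^sup>2) \<partial>lborel) \<le> ennreal ((m (1 - \<alpha>))\<^sup>2) * ?Y"
        using \<alpha> by (intro fractional_integral_mean_zero Yp Yp_supp mean) auto
    qed (use m_nonneg \<alpha> in auto)
    also have "\<dots> \<le> ennreal (1 * m (1 - \<alpha>)) * (ennreal ((m \<alpha>)\<^sup>2) * ?P)"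
      by (intro mult_left_mono Y) auto
    also have "\<dots> = ennreal (m (1 - \<alpha>) * (m \<alpha>)\<^sup>2) * ?P"
    proof -
      have "ennreal (m (1 - \<alpha>) * (m \<alpha>)\<^sup>2) = ennreal (m (1 - \<alpha>)) * ennreal ((m \<alpha>)\<^sup>2)"
        using m_nonneg[of "1 - \<alpha>"] \<alpha> by (intro ennreal_mult) auto
      then show ?thesis by (simp only: mult.assoc mult_1_left)
    qed
    finally have 1: "(\<integral>\<^sup>+t. ennreal \<bar>Yp t x * (indicator {0..T} t * (\<integral>s. fker (1 - \<alpha>) (t - s) * Yp s x \<partial>lborel))\<bar> \<partial>lborel)
      \<le> ennreal (m (1 - \<alpha>) * (m \<alpha>)\<^sup>2) * ?P" .
    \<comment> \<open>\<open>AYp\<close> is \<open>G'\<close> minus a step function orthogonal to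
      \<open>AYp\<close>, so its norm cannot exceed that of \<open>G'\<close>.\<close>
    have A_G: "?A \<le> ?G"
    proof -
      let ?s = "\<lambda>t. (\<Sum>n<N. Aavg n x * indicator {tn n..<tn (Suc n)} t)"
      have s0: "(\<integral>t. ?s t * AYp t x \<partial>lborel) = 0" "integrable lborel (\<lambda>t. ?s t * AYp t x)"
        using integral_mult_mean_zero[OF AYp AYp_supp Amean, of "\<lambda>n. Aavg n x"] by auto
      have "AE t in lborel. \<forall>n\<in>{..<N}. t \<in> {tn n..<tn (Suc n)} \<longrightarrow> AYp t x = G' t x - Aavg n x"
        using Aproj by (intro AE_finite_allI) auto
      with mesh_AE have "AE t in lborel. (AYp t x)\<^sup>2 = AYp t x * G' t x - ?s t * AYp t x"
      proof eventually_elim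
        case (elim t)
        show ?case
        proof (cases "t \<in> {0..T}")
          case True
          then obtain n where n: "n < N" "tn n < t" "t < tn (Suc n)" using elim(1) by auto
          have s: "?s t = Aavg n x" using n by (intro mesh_sum_indicator) auto
          have "AYp t x = G' t x - Aavg n x" using elim(2) n by auto
          then have "AYp t x * AYp t x = AYp t x * (G' t x - Aavg n x)" by simp
          then show ?thesis unfolding s by (simp add: power2_eq_square right_diff_distrib mult.commute)
        qed (simp add: AYp_supp)
      qed
      then have "(\<integral>t. (AYp t x)\<^sup>2 \<partial>lborel) = (\<integral>t. AYp t x * G' t x - ?s t * AYp t x \<partial>lborel)"
        by (intro integral_cong_AE) measurable
      also have "\<dots> = (\<integral>t. AYp t x * G' t x \<partial>lborel)"
        using s0 sq_int_mult[OF AYp G'] by simp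
      finally have "(\<integral>t. (AYp t x)\<^sup>2 \<partial>lborel) \<le> (\<integral>t. (G' t x)\<^sup>2 \<partial>lborel)"
        using integral_mult_le_half[OF AYp G'] by simp
      then show ?thesis using nn_integral_sq_int[OF AYp] nn_integral_sq_int[OF G'] by (simp add: ennreal_leI)
    qed
    have "(\<integral>\<^sup>+t. ennreal \<bar>AY t x * (indicator {0..T} t * (\<integral>s. fker \<alpha> (t - s) * AYp s x \<partial>lborel))\<bar> \<partial>lborel)
      \<le> ennreal (k * m \<alpha>) * ?A"
    proof (rule nn_integral_abs_mult_le_of_squares)
      show "(\<integral>\<^sup>+t. ennreal ((AY t x)\<^sup>2) \<partial>lborel) \<le> ennreal (k\<^sup>2) * ?A"
        by (rule primitive_mean_zero_le[OF AYp AYp_supp AY_supp _ prim]) measurable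
      show "(\<integral>\<^sup>+t. ennreal ((indicator {0..T} t * (\<integral>s. fker \<alpha> (t - s) * AYp s x \<partial>lborel))\<^sup>2) \<partial>lborel) \<le> ennreal ((m \<alpha>)\<^sup>2) * ?A"
        by (intro fractional_integral_mean_zero AYp AYp_supp Amean \<alpha>)
    qed (use m_nonneg \<alpha> k_pos in auto)
    also have "\<dots> \<le> ennreal (k * m \<alpha>) * ?G" by (intro mult_left_mono A_G) auto
    finally show ?case using 1 by auto
  qed
qed

text \<open>Integration of the slice estimates over \<open>x\<close>. The absolute values stay
  inside the double integral, so neither sign nor convergence of the signed integrals has to be
  discussed here.\<close>

theorem error_estimate:
  "(\<integral>\<^sup>+t. (\<integral>\<^sup>+x. ennreal \<bar>Yp t x * (indicator {0..T} t * (\<integral>s. fker (1 - \<alpha>) (t - s) * Yp s x \<partial>lborel))\<bar> \<partial>M) \<partial>lborel)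
      \<le> ennreal (4 * m (1 - \<alpha>) * (m \<alpha>)\<^sup>2) * R"
  "(\<integral>\<^sup>+t. (\<integral>\<^sup>+x. ennreal \<bar>AY t x * (indicator {0..T} t * (\<integral>s. fker \<alpha> (t - s) * AYp s x \<partial>lborel))\<bar> \<partial>M) \<partial>lborel)
      \<le> ennreal (k * m \<alpha>) * R"
proof -
  interpret P: pair_sigma_finite lborel M ..
  have "(\<integral>\<^sup>+t. (\<integral>\<^sup>+x. ennreal \<bar>Yp t x * (indicator {0..T} t * (\<integral>s. fker (1 - \<alpha>) (t - s) * Yp s x \<partial>lborel))\<bar> \<partial>M) \<partial>lborel)
     = (\<integral>\<^sup>+x. (\<integral>\<^sup>+t. ennreal \<bar>Yp t x * (indicator {0..T} t * (\<integral>s. fker (1 - \<alpha>) (t - s) * Yp s x \<partial>lborel))\<bar> \<partial>lborel) \<partial>M)"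
    by (rule P.Fubini'[symmetric]) measurable
  also have "\<dots> \<le> (\<integral>\<^sup>+x. ennreal (m (1 - \<alpha>) * (m \<alpha>)\<^sup>2) * (\<integral>\<^sup>+t. ennreal ((\<psi> t x)\<^sup>2) \<partial>lborel) \<partial>M)"
    by (intro nn_integral_mono_AE) (use pointwise_estimate in eventually_elim, simp)
  also have "\<dots> = ennreal (m (1 - \<alpha>) * (m \<alpha>)\<^sup>2) * (\<integral>\<^sup>+x. (\<integral>\<^sup>+t. ennreal ((\<psi> t x)\<^sup>2) \<partial>lborel) \<partial>M)"
    by (intro nn_integral_cmult) measurable
  also have "(\<integral>\<^sup>+x. (\<integral>\<^sup>+t. ennreal ((\<psi> t x)\<^sup>2) \<partial>lborel) \<partial>M) = (\<integral>\<^sup>+t. (\<integral>\<^sup>+x. ennreal ((\<psi> t x)\<^sup>2) \<partial>M) \<partial>lborel)"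
    by (rule P.Fubini') measurable
  also have "ennreal (m (1 - \<alpha>) * (m \<alpha>)\<^sup>2) * \<dots> \<le> ennreal (m (1 - \<alpha>) * (m \<alpha>)\<^sup>2) * (4 * R)"
    by (intro mult_left_mono \<psi>_le) auto
  also have "\<dots> = ennreal (4 * m (1 - \<alpha>) * (m \<alpha>)\<^sup>2) * R"
    using m_nonneg \<alpha> by (simp add: ennreal_mult mult_ac)
  finally show "(\<integral>\<^sup>+t. (\<integral>\<^sup>+x. ennreal \<bar>Yp t x * (indicator {0..T} t * (\<integral>s. fker (1 - \<alpha>) (t - s) * Yp s x \<partial>lborel))\<bar> \<partial>M) \<partial>lborel)
      \<le> ennreal (4 * m (1 - \<alpha>) * (m \<alpha>)\<^sup>2) * R" .
  have "(\<integral>\<^sup>+t. (\<integral>\<^sup>+x. ennreal \<bar>AY t x * (indicator {0..T} t * (\<integral>s. fker \<alpha> (t - s) * AYp s x \<partial>lborel))\<bar> \<partial>M) \<partial>lborel)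
     = (\<integral>\<^sup>+x. (\<integral>\<^sup>+t. ennreal \<bar>AY t x * (indicator {0..T} t * (\<integral>s. fker \<alpha> (t - s) * AYp s x \<partial>lborel))\<bar> \<partial>lborel) \<partial>M)"
    by (rule P.Fubini'[symmetric]) measurable
  also have "\<dots> \<le> (\<integral>\<^sup>+x. ennreal (k * m \<alpha>) * (\<integral>\<^sup>+t. ennreal ((G' t x)\<^sup>2) \<partial>lborel) \<partial>M)"
    by (intro nn_integral_mono_AE) (use pointwise_estimate in eventually_elim, simp)
  also have "\<dots> = ennreal (k * m \<alpha>) * (\<integral>\<^sup>+x. (\<integral>\<^sup>+t. ennreal ((G' t x)\<^sup>2) \<partial>lborel) \<partial>M)"
    by (intro nn_integral_cmult) measurable
  also have "(\<integral>\<^sup>+x. (\<integral>\<^sup>+t. ennreal ((G' t x)\<^sup>2) \<partial>lborel) \<partial>M) = (\<integral>\<^sup>+t. (\<integral>\<^sup>+x. ennreal ((G' t x)\<^sup>2) \<partial>M) \<partial>lborel)"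
    by (rule P.Fubini') measurable
  also have "ennreal (k * m \<alpha>) * \<dots> \<le> ennreal (k * m \<alpha>) * R"
    by (intro mult_left_mono G'_le) auto
  finally show "(\<integral>\<^sup>+t. (\<integral>\<^sup>+x. ennreal \<bar>AY t x * (indicator {0..T} t * (\<integral>s. fker \<alpha> (t - s) * AYp s x \<partial>lborel))\<bar> \<partial>M) \<partial>lborel)
      \<le> ennreal (k * m \<alpha>) * R" .
qed

end

section \<open>Twice continuously differentiable test functions\<close>

text \<open>\<open>test_fun\<close> provides only one derivative, but A \<xi> involves the
  divergence of \<kappa> grad \<xi>. \<open>D\<close> is the gradient, and \<open>H x h\<close> its
  derivative in direction h.\<close>

definition C2 :: "('d::euclidean_space \<Rightarrow> real) \<Rightarrow> ('d \<Rightarrow> 'd) \<Rightarrow> ('d \<Rightarrow> 'd \<Rightarrow> 'd) \<Rightarrow> bool" where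
  "C2 f D H \<longleftrightarrow> (\<forall>x. (f has_derivative (\<lambda>h. D x \<bullet> h)) (at x)) \<and>
     (\<forall>x. (D has_derivative H x) (at x)) \<and> (\<forall>h. continuous_on UNIV (\<lambda>x. H x h))"

lemma C2_continuous:
  assumes "C2 f D H" shows "continuous_on UNIV f" "continuous_on UNIV D"
  using assms unfolding C2_def
  by (meson continuous_at_imp_continuous_on has_derivative_continuous)+

lemma C2_compose:
  assumes f: "C2 f D H" and q: "\<And>s. (q has_real_derivative q' s) (at s)" "\<And>s. (q' has_real_derivative q'' s) (at s)"
    and q'': "continuous_on UNIV q''"
  shows "C2 (\<lambda>x. q (f x)) (\<lambda>x. q' (f x) *\<^sub>R D x)
    (\<lambda>x h. (q'' (f x) * (D x \<bullet> h)) *\<^sub>R D x + q' (f x) *\<^sub>R H x h)"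
proof -
  have fd: "(f has_derivative (\<lambda>h. D x \<bullet> h)) (at x)" and Dd: "(D has_derivative H x) (at x)" for x
    using f by (auto simp: C2_def)
  have 1: "((\<lambda>x. q (f x)) has_derivative (\<lambda>h. (q' (f x) *\<^sub>R D x) \<bullet> h)) (at x)" for x
    using has_derivative_compose[OF fd q(1)[unfolded has_field_derivative_def]] by simp
  have 2: "((\<lambda>x. q' (f x)) has_derivative (\<lambda>h. q'' (f x) * (D x \<bullet> h))) (at x)" for x
    using has_derivative_compose[OF fd q(2)[unfolded has_field_derivative_def]] by simp
  have 3: "((\<lambda>x. q' (f x) *\<^sub>R D x) has_derivative (\<lambda>h. q' (f x) *\<^sub>R H x h + (q'' (f x) * (D x \<bullet> h)) *\<^sub>R D x)) (at x)" for x
    by (rule has_derivative_scaleR[OF 2 Dd])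
  have q'c: "continuous_on UNIV q'"
    using q(2) by (meson DERIV_isCont continuous_at_imp_continuous_on)
  have c: "continuous_on UNIV (\<lambda>x. (q'' (f x) * (D x \<bullet> h)) *\<^sub>R D x + q' (f x) *\<^sub>R H x h)" for h
    using f C2_continuous[OF f]
    by (intro continuous_intros continuous_on_compose2[OF q''] continuous_on_compose2[OF q'c]) (auto simp: C2_def)
  show ?thesis
    unfolding C2_def using 1 3[unfolded add.commute[of "q' _ *\<^sub>R H _ _"]] c by blast
qed

lemma C2_mult:
  assumes f: "C2 f D H" and g: "C2 g D' H'"
  shows "C2 (\<lambda>x. f x * g x) (\<lambda>x. f x *\<^sub>R D' x + g x *\<^sub>R D x)
    (\<lambda>x h. (f x *\<^sub>R H' x h + (D x \<bullet> h) *\<^sub>R D' x) + (g x *\<^sub>R H x h + (D' x \<bullet> h) *\<^sub>R D x))"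
proof -
  have fd: "(f has_derivative (\<lambda>h. D x \<bullet> h)) (at x)" "(D has_derivative H x) (at x)"
    and gd: "(g has_derivative (\<lambda>h. D' x \<bullet> h)) (at x)" "(D' has_derivative H' x) (at x)" for x
    using f g by (auto simp: C2_def)
  have 1: "((\<lambda>x. f x * g x) has_derivative (\<lambda>h. (f x *\<^sub>R D' x + g x *\<^sub>R D x) \<bullet> h)) (at x)" for x
    using has_derivative_mult[OF fd(1) gd(1)] by (simp add: inner_add_left mult.commute)
  have 2: "((\<lambda>x. f x *\<^sub>R D' x + g x *\<^sub>R D x) has_derivative
      (\<lambda>h. (f x *\<^sub>R H' x h + (D x \<bullet> h) *\<^sub>R D' x) + (g x *\<^sub>R H x h + (D' x \<bullet> h) *\<^sub>R D x))) (at x)" for x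
    by (intro has_derivative_add has_derivative_scaleR fd gd)
  have c: "continuous_on UNIV (\<lambda>x. (f x *\<^sub>R H' x h + (D x \<bullet> h) *\<^sub>R D' x) + (g x *\<^sub>R H x h + (D' x \<bullet> h) *\<^sub>R D x))" for h
    using f g C2_continuous[OF f] C2_continuous[OF g]
    by (intro continuous_intros) (auto simp: C2_def)
  show ?thesis
    unfolding C2_def using 1 2 c by auto
qed

lemma C2_linear: "C2 (\<lambda>x. x \<bullet> i - a) (\<lambda>x. i) (\<lambda>x h. 0)"
  unfolding C2_def by (auto intro!: derivative_eq_intros simp: inner_commute)

lemma C2_const: "C2 (\<lambda>x. a) (\<lambda>x. 0) (\<lambda>x h. 0)"
  unfolding C2_def by (auto intro!: derivative_eq_intros)

lemma C2_radial: "C2 (\<lambda>x. r - (x - c) \<bullet> (x - c)) (\<lambda>x. (-2) *\<^sub>R (x - c)) (\<lambda>x h. (-2) *\<^sub>R h)"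
  unfolding C2_def
proof (intro conjI allI)
  show "((\<lambda>x. r - (x - c) \<bullet> (x - c)) has_derivative (\<bullet>) ((- 2) *\<^sub>R (x - c))) (at x)" for x
    by (auto intro!: derivative_eq_intros simp: inner_commute fun_eq_iff)
  show "((\<lambda>x. (- 2) *\<^sub>R (x - c)) has_derivative (*\<^sub>R) (- 2)) (at x)" for x
    by (rule has_derivative_eq_rhs, (rule derivative_intros)+, simp add: fun_eq_iff)
qed (auto intro: continuous_intros)

lemma DERIV_pos_part_power:
  "((\<lambda>s::real. (max 0 s) ^ (n + 2)) has_real_derivative (n + 2) * (max 0 s) ^ (n + 1)) (at s)"
proof -
  consider "s < 0" | "s = 0" | "0 < s" by linarith
  then show ?thesis
  proof cases
    case 1
    have "((\<lambda>s::real. 0) has_real_derivative 0) (at s)" by simp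
    then have "((\<lambda>s::real. (max 0 s) ^ (n + 2)) has_real_derivative 0) (at s)"
      by (rule has_field_derivative_transform_within_open[where S="{..<0}"]) (use 1 in auto)
    then show ?thesis using 1 by simp
  next
    case 2
    have "(\<lambda>h::real. (max 0 h) ^ (n + 1)) \<midarrow>0\<rightarrow> (max 0 0) ^ (n + 1)"
      by (intro tendsto_intros)
    then have "(\<lambda>h::real. (max 0 h) ^ (n + 1)) \<midarrow>0\<rightarrow> 0" by simp
    then have "(\<lambda>h::real. ((max 0 (0 + h)) ^ (n + 2) - (max 0 0) ^ (n + 2)) / h) \<midarrow>0\<rightarrow> 0"
      by (rule Lim_transform_eventually) (auto simp: eventually_at_filter max_def intro!: always_eventually)
    then show ?thesis using 2 by (simp add: DERIV_def)
  next
    case 3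
    have "((\<lambda>s::real. s ^ (n + 2)) has_real_derivative (n + 2) * s ^ (n + 1)) (at s)"
      using DERIV_pow[of "n + 2" s] by simp
    then have "((\<lambda>s::real. (max 0 s) ^ (n + 2)) has_real_derivative (n + 2) * s ^ (n + 1)) (at s)"
      by (rule has_field_derivative_transform_within_open[where S="{0<..}"]) (use 3 in auto)
    then show ?thesis using 3 by (simp add: add.commute)
  qed
qed

text \<open>The cube is the smallest power of the positive part with a continuous second derivative;
  it produces bumps and half-spaces without smooth cut-off functions.\<close>

lemma C2_pos_part:
  assumes "C2 f D H"
  shows "\<exists>D' H'. C2 (\<lambda>x. (max 0 (f x)) ^ 3) D' H'"
proof -
  have "C2 (\<lambda>x. (max 0 (f x)) ^ 3) (\<lambda>x. (3 * (max 0 (f x))\<^sup>2) *\<^sub>R D x)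
    (\<lambda>x h. (3 * (2 * (max 0 (f x))) * (D x \<bullet> h)) *\<^sub>R D x + (3 * (max 0 (f x))\<^sup>2) *\<^sub>R H x h)"
  proof (rule C2_compose[OF assms])
    show "((\<lambda>s::real. (max 0 s) ^ 3) has_real_derivative 3 * (max 0 s)\<^sup>2) (at s)" for s
      using DERIV_pos_part_power[of 1 s] by (simp add: numeral_3_eq_3 numeral_2_eq_2)
    show "((\<lambda>s::real. 3 * (max 0 s)\<^sup>2) has_real_derivative 3 * (2 * (max 0 s))) (at s)" for s
      using DERIV_cmult[OF DERIV_pos_part_power[of 0 s], of 3] by (simp add: numeral_2_eq_2)
    show "continuous_on UNIV (\<lambda>s::real. 3 * (2 * (max 0 s)))" by (intro continuous_intros)
  qed
  then show ?thesis by blast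
qed

text \<open>For nonnegative \<open>f\<close> and growing \<open>k\<close> these functions tend to
  the indicator of the set where f > 0, stay between 0 and 1, and vanish wherever \<open>f\<close>
  does.\<close>

lemma C2_one_minus_exp:
  assumes "C2 f D H"
  shows "\<exists>D' H'. C2 (\<lambda>x. 1 - exp (- (k * f x))) D' H'"
proof -
  have "C2 (\<lambda>x. 1 - exp (- (k * f x))) (\<lambda>x. (k * exp (- (k * f x))) *\<^sub>R D x)
    (\<lambda>x h. (- (k * k * exp (- (k * f x))) * (D x \<bullet> h)) *\<^sub>R D x + (k * exp (- (k * f x))) *\<^sub>R H x h)"
    by (rule C2_compose[OF assms]) (auto intro!: derivative_eq_intros continuous_intros)
  then show ?thesis by blast
qed

definition supp_in :: "'d::euclidean_space set \<Rightarrow> ('d \<Rightarrow> real) \<Rightarrow> bool" where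
  "supp_in \<Omega> f \<longleftrightarrow> compact (closure {x. f x \<noteq> 0}) \<and> closure {x. f x \<noteq> 0} \<subseteq> \<Omega>"

lemma supp_in_subset:
  assumes "supp_in \<Omega> f" "\<And>x. f x = 0 \<Longrightarrow> g x = 0" shows "supp_in \<Omega> g"
proof -
  have "closure {x. g x \<noteq> 0} \<subseteq> closure {x. f x \<noteq> 0}"
    using assms(2) by (intro closure_mono) auto
  then show ?thesis using assms(1) unfolding supp_in_def
    by (meson closed_closure compact_closure compact_imp_bounded bounded_subset order_trans closure_closure compact_eq_bounded_closed)
qed

lemma test_fun_iff:
  "test_fun \<Omega> f D \<longleftrightarrow> (\<forall>x. (f has_derivative (\<lambda>h. D x \<bullet> h)) (at x)) \<and> continuous_on UNIV D \<and> supp_in \<Omega> f"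
  by (simp add: test_fun_def supp_in_def)

lemma C2_test_fun: "C2 f D H \<Longrightarrow> supp_in \<Omega> f \<Longrightarrow> test_fun \<Omega> f D"
  using C2_continuous(2)[of f D H] by (auto simp: test_fun_iff C2_def)

lemma grad_zero_outside:
  assumes f: "\<And>x. (f has_derivative (\<lambda>h. D x \<bullet> h)) (at x)" and x: "x \<notin> closure {x. f x \<noteq> 0}"
  shows "D x = (0 :: 'd::euclidean_space)"
proof -
  have "((\<lambda>x. 0) has_derivative (\<lambda>h. 0)) (at x)" by simp
  then have "(f has_derivative (\<lambda>h. 0)) (at x)"
  proof (rule has_derivative_transform_within_open[where s="- closure {x. f x \<noteq> 0}"])
    show "0 = f y" if "y \<in> - closure {x. f x \<noteq> 0}" for y
      using that closure_subset[of "{x. f x \<noteq> 0}"] by auto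
  qed (use x in auto)
  from has_derivative_unique[OF f this] have "D x \<bullet> D x = 0" by metis
  then show ?thesis by simp
qed

section \<open>The fundamental lemma of the calculus of variations\<close>

text \<open>The sets of positivity of nonnegative \<open>C2\<close> functions form a generator of
  the Borel sets stable under intersection: products give intersections, and cubes of positive parts
  give half-spaces. So the positive and negative parts of \<open>r\<close> define the same
  measure.\<close>

lemma AE_zero_of_C2_positive_sets:
  fixes r :: "'d::euclidean_space \<Rightarrow> real"
  assumes r: "integrable lborel r"
    and zero: "\<And>f D H. C2 f D H \<Longrightarrow> (\<And>x. 0 \<le> f x) \<Longrightarrow> (\<integral>x. indicator {x. 0 < f x} x * r x \<partial>lborel) = 0"
  shows "AE x in lborel. r x = 0"
proof -
  have [measurable]: "r \<in> borel_measurable borel" using borel_measurable_integrable[OF r] by simp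
  define PP where "PP = {{x. 0 < f x} | f :: 'd \<Rightarrow> real. (\<exists>D H. C2 f D H) \<and> (\<forall>x. 0 \<le> f x)}"
  let ?p = "\<lambda>x. max 0 (r x)" and ?n = "\<lambda>x. max 0 (- r x)"
  have ip: "integrable lborel ?p" and i_n: "integrable lborel ?n" using r by auto
  have open_PP: "open X" if X_in: "X \<in> PP" for X
  proof -
    obtain f D H where f: "C2 f D H" and X: "X = {x. 0 < f x}"
      using X_in unfolding PP_def by blast
    show ?thesis unfolding X using C2_continuous(1)[OF f] by (intro open_Collect_less continuous_on_const)
  qed
  have PP_I: "X \<in> PP" if "C2 f D H" "\<forall>x. 0 \<le> f x" "X = {x. 0 < f x}" for X f D H
    unfolding PP_def using that by blast
  \<comment> \<open>The constant 1 supplies the exhausting sequence of the uniqueness theorem for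
    measures.\<close>
  have UNIV: "UNIV \<in> PP" by (rule PP_I[OF C2_const[of 1]]) auto
  have "density lborel (\<lambda>x. ennreal (?p x)) = density lborel (\<lambda>x. ennreal (?n x))"
  proof (rule measure_eqI_generator_eq[where E=PP and \<Omega>=UNIV and A="\<lambda>_. UNIV"])
    show "Int_stable PP"
      unfolding Int_stable_def
    proof (intro ballI)
      fix X Y assume "X \<in> PP" "Y \<in> PP"
      then obtain f D H g D' H' where fg: "C2 f D H" "\<forall>x. 0 \<le> f x" "X = {x. 0 < f x}" "C2 g D' H'" "\<forall>x. 0 \<le> g x" "Y = {x. 0 < g x}"
        unfolding PP_def by blast
      have "X \<inter> Y = {x. 0 < f x * g x}"
      proof -
        have "0 < f x * g x \<longleftrightarrow> 0 < f x \<and> 0 < g x" for x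
          using fg(2)[rule_format, of x] fg(5)[rule_format, of x] by (auto simp: zero_less_mult_iff)
        then show ?thesis unfolding fg(3,6) by auto
      qed
      moreover have "\<forall>x. 0 \<le> f x * g x" using fg(2,5) by simp
      ultimately show "X \<inter> Y \<in> PP" by (intro PP_I[OF C2_mult[OF fg(1,4)]])
    qed
    have "sigma_sets UNIV PP = sets borel"
    proof (rule antisym)
      show "sigma_sets UNIV PP \<subseteq> sets borel"
      proof -
        have "PP \<subseteq> sets borel" using open_PP by (auto intro: borel_open)
        then show ?thesis using sets.sigma_sets_subset[of PP borel] by simp
      qed
      have "(\<lambda>(a, i). {x::'d. a < x \<bullet> i}) ` (UNIV \<times> Basis) \<subseteq> PP"
      proof clarify
        fix a :: real and i :: 'd
        obtain D H where DH: "C2 (\<lambda>x. (max 0 (x \<bullet> i - a)) ^ 3) D H" using C2_pos_part[OF C2_linear[of i a]] by auto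
        have "{x. a < x \<bullet> i} = {x. 0 < (max 0 (x \<bullet> i - a)) ^ 3}"
          by (auto simp: zero_less_power_eq max_def)
        then show "{x. a < x \<bullet> i} \<in> PP" by (intro PP_I[OF DH]) auto
      qed
      then show "sets borel \<subseteq> sigma_sets UNIV PP"
        unfolding borel_eq_halfspace_greater by (auto intro: sigma_sets_mono' simp: sigma_sets_subseteq)
    qed
    then show "sets (density lborel (\<lambda>x. ennreal (?p x))) = sigma_sets UNIV PP"
      "sets (density lborel (\<lambda>x. ennreal (?n x))) = sigma_sets UNIV PP" by simp_all
    fix X assume X: "X \<in> PP"
    have [measurable]: "X \<in> sets borel" using open_PP[OF X] by simp
    obtain f D H where f: "C2 f D H" "\<forall>x. 0 \<le> f x" "X = {x. 0 < f x}" using X unfolding PP_def by blast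
    have i1: "integrable lborel (\<lambda>x. ?p x * indicator X x)" and i2: "integrable lborel (\<lambda>x. ?n x * indicator X x)"
      by (intro integrable_real_mult_indicator ip i_n; simp)+
    have "(\<integral>x. ?p x * indicator X x \<partial>lborel) - (\<integral>x. ?n x * indicator X x \<partial>lborel) = (\<integral>x. indicator X x * r x \<partial>lborel)"
      unfolding Bochner_Integration.integral_diff[OF i1 i2, symmetric]
      by (intro Bochner_Integration.integral_cong) (auto simp: max_def indicator_def)
    also have "\<dots> = 0" unfolding f(3) using f(2) by (intro zero[OF f(1)]) auto
    finally have "(\<integral>x. ?p x * indicator X x \<partial>lborel) = (\<integral>x. ?n x * indicator X x \<partial>lborel)" by simp
    then show "emeasure (density lborel (\<lambda>x. ennreal (?p x))) X = emeasure (density lborel (\<lambda>x. ennreal (?n x))) X"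
      using nn_integral_eq_integral[OF i1] nn_integral_eq_integral[OF i2]
      by (simp add: emeasure_density ennreal_mult' ennreal_indicator)
  next
    fix i :: nat
    have "(\<integral>\<^sup>+x. ennreal (?p x) \<partial>lborel) < \<infinity>" using ip by (simp add: integrable_iff_bounded)
    then show "emeasure (density lborel (\<lambda>x. ennreal (?p x))) UNIV \<noteq> \<infinity>"
      by (simp add: emeasure_density)
  qed (use UNIV in auto)
  then have "AE x in lborel. ennreal (?p x) = ennreal (?n x)"
    by (intro sigma_finite_measure.density_unique[OF sigma_finite_lborel]) auto
  then show ?thesis by eventually_elim (auto simp: max_def split: if_splits)
qed

text \<open>Localize to a ball and test with 1 - exp(-k b f), where \<open>b\<close> is a bump
  positive exactly on the ball. As k grows, dominated convergence gives vanishing integrals over all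
  sets of positivity; countably many balls then cover \<Omega>.\<close>

lemma fundamental_lemma:
  fixes r :: "'d::euclidean_space \<Rightarrow> real"
  assumes \<Omega>: "open \<Omega>" and r: "loc_int \<Omega> r"
    and zero: "\<And>f D H. C2 f D H \<Longrightarrow> supp_in \<Omega> f \<Longrightarrow> (LINT x:\<Omega>|lebesgue. f x * r x) = 0"
  shows "AE x in lebesgue. x \<in> \<Omega> \<longrightarrow> r x = 0"
proof -
  have abs_less_square_iff: "\<bar>n\<bar> < \<bar>e\<bar> \<longleftrightarrow> n\<^sup>2 < e\<^sup>2" for e n :: real
    using abs_le_square_iff[of e n] by linarith
  have ball: "AE x in lebesgue. x \<in> ball c e \<longrightarrow> r x = 0" if e: "0 < e" "cball c e \<subseteq> \<Omega>" for c e
  proof -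
    have "set_integrable lebesgue (cball c e) r" using r e by (auto simp: loc_int_def)
    then have "set_integrable lebesgue (ball c e) r"
      by (rule set_integrable_subset) (auto simp: ball_subset_cball)
    then have ri: "integrable lebesgue (\<lambda>x. indicator (ball c e) x * r x)" (is "integrable _ ?r")
      by (simp add: set_integrable_def)
    \<comment> \<open>The generator argument is about Borel sets, while \<open>r\<close> is only
      Lebesgue measurable; a Borel version of its restriction to the ball is used.\<close>
    then obtain r' where r'm [measurable]: "r' \<in> borel_measurable lborel" and "AE x in lborel. ?r x = r' x"
      using completion_ex_borel_measurable_real[of ?r lborel] borel_measurable_integrable by blast
    then have ae: "AE x in lebesgue. ?r x = r' x" by (simp add: AE_completion)
    have "integrable lebesgue r'"
      using ri ae r'm by (subst integrable_cong_AE[where g="?r"]) (auto intro: measurable_completion borel_measurable_integrable)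
    then have r'i: "integrable lborel r'" by (simp add: integrable_completion)
    define b where "b x = (max 0 (e\<^sup>2 - (x - c) \<bullet> (x - c))) ^ 3" for x
    have ball_iff: "x \<in> ball c e \<longleftrightarrow> 0 < e\<^sup>2 - (x - c) \<bullet> (x - c)" for x
    proof -
      have "dist c x < e \<longleftrightarrow> (norm (x - c))\<^sup>2 < e\<^sup>2"
        using e abs_less_square_iff[of "norm (x - c)" e] by (simp add: dist_norm norm_minus_commute)
      then show ?thesis by (simp add: power2_norm_eq_inner)
    qed
    have b_pos: "0 < b x \<longleftrightarrow> x \<in> ball c e" and b0: "0 \<le> b x" for x
      unfolding ball_iff by (auto simp: b_def zero_less_power_eq max_def)
    obtain Db Hb where b: "C2 b Db Hb"
      unfolding b_def[abs_def] using C2_pos_part[OF C2_radial[of "e\<^sup>2" c]] by auto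
    have b_zero: "b x = 0" if "x \<notin> ball c e" for x using that b_pos[of x] b0[of x] by linarith
    have b_supp: "supp_in \<Omega> b"
    proof -
      have "closure {x. b x \<noteq> 0} \<subseteq> closure (ball c e)" using b_zero by (intro closure_mono) blast
      then have "closure {x. b x \<noteq> 0} \<subseteq> cball c e" using e by simp
      then show ?thesis using e bounded_subset[OF bounded_cball]
        unfolding supp_in_def compact_eq_bounded_closed by auto
    qed
    have "AE x in lborel. r' x = 0"
    proof (rule AE_zero_of_C2_positive_sets[OF r'i])
      fix f :: "'d \<Rightarrow> real" and D H assume f: "C2 f D H" and f0: "\<And>x. 0 \<le> f x"
      \<comment> \<open>Multiplication by the bump keeps the set of positivity inside the ball, and
        the support of the test function in \<Omega>.\<close>
      define g where "g x = b x * f x" for x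
      obtain Dg Hg where g: "C2 g Dg Hg" unfolding g_def[abs_def] using C2_mult[OF b f] by blast
      have g0: "0 \<le> g x" for x using b0 f0 by (simp add: g_def)
      have [measurable]: "g \<in> borel_measurable borel" "f \<in> borel_measurable borel"
        using C2_continuous(1)[OF g] C2_continuous(1)[OF f] by (auto intro: borel_measurable_continuous_onI)
      have zk: "(\<integral>x. (1 - exp (- (real k * g x))) * r' x \<partial>lborel) = 0" for k
      proof -
        obtain D' H' where k: "C2 (\<lambda>x. 1 - exp (- (real k * g x))) D' H'" using C2_one_minus_exp[OF g] by blast
        have sk: "supp_in \<Omega> (\<lambda>x. 1 - exp (- (real k * g x)))"
          by (rule supp_in_subset[OF b_supp]) (simp add: g_def)
        have "(\<integral>x. (1 - exp (- (real k * g x))) * r' x \<partial>lborel) = (\<integral>x. (1 - exp (- (real k * g x))) * r' x \<partial>lebesgue)"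
          by (rule integral_completion[symmetric]) measurable
        also have "\<dots> = (\<integral>x. (1 - exp (- (real k * g x))) * ?r x \<partial>lebesgue)"
        proof (intro integral_cong_AE)
          have m: "(\<lambda>x. 1 - exp (- (real k * g x))) \<in> borel_measurable lebesgue"
            by (intro measurable_completion) measurable
          show "(\<lambda>x. (1 - exp (- (real k * g x))) * r' x) \<in> borel_measurable lebesgue"
            by (intro borel_measurable_times m measurable_completion r'm)
          show "(\<lambda>x. (1 - exp (- (real k * g x))) * ?r x) \<in> borel_measurable lebesgue"
            by (intro borel_measurable_times[OF m] borel_measurable_integrable ri)
          show "AE x in lebesgue. (1 - exp (- (real k * g x))) * r' x = (1 - exp (- (real k * g x))) * ?r x"
            using ae by eventually_elim simp
        qed
        also have "\<dots> = (LINT x:\<Omega>|lebesgue. (1 - exp (- (real k * g x))) * r x)"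
          unfolding set_lebesgue_integral_def
        proof (intro Bochner_Integration.integral_cong refl)
          fix x
          show "(1 - exp (- (real k * g x))) * ?r x = indicator \<Omega> x *\<^sub>R ((1 - exp (- (real k * g x))) * r x)"
          proof (cases "x \<in> ball c e")
            case True
            then have "x \<in> \<Omega>" using e(2) ball_subset_cball[of c e] by (meson subsetD)
            then show ?thesis using True by simp
          next
            case False
            then show ?thesis using b_zero[of x] by (simp add: g_def)
          qed
        qed
        also have "\<dots> = 0" by (rule zero[OF k sk])
        finally show ?thesis .
      qed
      have "(\<lambda>k. \<integral>x. (1 - exp (- (real k * g x))) * r' x \<partial>lborel) \<longlonglongrightarrow> (\<integral>x. indicator {x. 0 < g x} x * r' x \<partial>lborel)"
      proof (rule integral_dominated_convergence[where w="\<lambda>x. \<bar>r' x\<bar>"])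
        show "integrable lborel (\<lambda>x. \<bar>r' x\<bar>)" using r'i by auto
        show "AE x in lborel. norm ((1 - exp (- (real k * g x))) * r' x) \<le> \<bar>r' x\<bar>" for k
        proof (intro AE_I2)
          fix x
          have "\<bar>1 - exp (- (real k * g x))\<bar> \<le> 1" using g0[of x] by (simp add: abs_le_iff add_increasing)
          then show "norm ((1 - exp (- (real k * g x))) * r' x) \<le> \<bar>r' x\<bar>"
            using mult_right_mono[of _ 1 "\<bar>r' x\<bar>"] by (simp add: abs_mult)
        qed
        show "AE x in lborel. (\<lambda>k. (1 - exp (- (real k * g x))) * r' x) \<longlonglongrightarrow> indicator {x. 0 < g x} x * r' x"
        proof (intro AE_I2 tendsto_mult tendsto_const)
          fix x
          show "(\<lambda>k. 1 - exp (- (real k * g x))) \<longlonglongrightarrow> indicator {x. 0 < g x} x"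
          proof (cases "0 < g x")
            case True
            have "(\<lambda>k. exp (- g x) ^ k) \<longlonglongrightarrow> 0" using True by (intro LIMSEQ_realpow_zero) auto
            then have "(\<lambda>k. 1 - exp (- (real k * g x))) \<longlonglongrightarrow> 1 - 0"
              by (intro tendsto_diff tendsto_const) (simp add: exp_of_nat_mult[symmetric])
            then show ?thesis using True by simp
          next
            case False
            then have "g x = 0" using g0[of x] by linarith
            then show ?thesis by simp
          qed
        qed
      qed measurable
      then have "(\<integral>x. indicator {x. 0 < g x} x * r' x \<partial>lborel) = 0"
        unfolding zk by (simp add: LIMSEQ_const_iff)
      moreover have "(\<integral>x. indicator {x. 0 < f x} x * r' x \<partial>lborel) = (\<integral>x. indicator {x. 0 < g x} x * r' x \<partial>lborel)"
      proof (intro integral_cong_AE)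
        have "AE x in lborel. ?r x = r' x" using ae by (simp add: AE_completion_iff)
        then show "AE x in lborel. indicator {x. 0 < f x} x * r' x = indicator {x. 0 < g x} x * r' x"
        proof eventually_elim
          case (elim x)
          show ?case
          proof (cases "x \<in> ball c e")
            case True
            then have "0 < g x \<longleftrightarrow> 0 < f x" using b_pos[of x] by (simp add: g_def zero_less_mult_iff)
            then show ?thesis by (simp add: indicator_def)
          next
            case False
            then have "r' x = 0" using elim by simp
            then show ?thesis by simp
          qed
        qed
      qed measurable
      ultimately show "(\<integral>x. indicator {x. 0 < f x} x * r' x \<partial>lborel) = 0" by simp
    qed
    then have "AE x in lebesgue. r' x = 0" by (rule AE_completion)
    with ae show ?thesis by eventually_elim auto
  qed
  obtain rad where rad: "\<And>x. x \<in> \<Omega> \<Longrightarrow> 0 < rad x \<and> cball x (rad x) \<subseteq> \<Omega>"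
    using \<Omega> unfolding open_contains_cball by metis
  obtain F' where F': "F' \<subseteq> (\<lambda>x. ball x (rad x)) ` \<Omega>" "countable F'" "\<Union>F' = \<Union>((\<lambda>x. ball x (rad x)) ` \<Omega>)"
    using Lindelof[of "(\<lambda>x. ball x (rad x)) ` \<Omega>"] by auto
  have "AE x in lebesgue. \<forall>b\<in>F'. x \<in> b \<longrightarrow> r x = 0"
    unfolding AE_ball_countable[OF F'(2)]
  proof
    fix b assume "b \<in> F'"
    then obtain c where "c \<in> \<Omega>" "b = ball c (rad c)" using F'(1) by auto
    then show "AE x in lebesgue. x \<in> b \<longrightarrow> r x = 0" using ball[of "rad c" c] rad[of c] by auto
  qed
  then show ?thesis
  proof eventually_elim
    case (elim x)
    show ?case
    proof
      assume "x \<in> \<Omega>"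
      then have "x \<in> \<Union>F'" unfolding F'(3) using rad[of x] by (intro UnionI[of "ball x (rad x)"]) auto
      then show "r x = 0" using elim by auto
    qed
  qed
qed

section \<open>The elliptic operator\<close>

locale elliptic =
  fixes \<Omega> :: "'d::euclidean_space set" and \<kappa> :: "'d \<Rightarrow> real"
  assumes \<Omega>_open: "open \<Omega>" and \<Omega>_bounded: "bounded \<Omega>" and \<kappa>_W: "W1inf \<Omega> \<kappa>"
    and \<kappa>_nonneg: "AE x in lebesgue. x \<in> \<Omega> \<longrightarrow> 0 \<le> \<kappa> x"
begin

abbreviation M :: "'d measure" where "M \<equiv> lebesgue_on \<Omega>"

lemma \<Omega>_sets [measurable]: "\<Omega> \<in> sets lebesgue"
  using \<Omega>_open by simp

lemma AE_M: "(AE x in M. P x) \<longleftrightarrow> (AE x in lebesgue. x \<in> \<Omega> \<longrightarrow> P x)"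
  by (simp add: AE_restrict_space_iff)

lemma LINT_M: "(LINT x:\<Omega>|lebesgue. f x) = (\<integral>x. f x \<partial>M)" for f :: "'d \<Rightarrow> 'b::{banach, second_countable_topology}"
  by (simp add: set_lebesgue_integral_def integral_restrict_space)

lemma set_integrable_M: "set_integrable lebesgue \<Omega> f \<longleftrightarrow> integrable M f" for f :: "'d \<Rightarrow> 'b::{banach, second_countable_topology}"
  by (simp add: set_integrable_def integrable_restrict_space)

lemma set_borel_measurable_M: "set_borel_measurable lebesgue \<Omega> f \<longleftrightarrow> f \<in> borel_measurable M" for f :: "'d \<Rightarrow> real"
  unfolding set_borel_measurable_def by (subst borel_measurable_restrict_space_iff) auto

lemma L2_M: "L2 \<Omega> v \<longleftrightarrow> sq_int M v"
  by (simp add: L2_def sq_int_def set_integrable_M set_borel_measurable_M)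

sublocale finite_measure M
proof (rule finite_measureI)
  have "\<Omega> \<in> lmeasurable" using \<Omega>_bounded \<Omega>_open by (rule lmeasurable_open)
  then show "emeasure M (space M) \<noteq> \<infinity>"
    by (simp add: emeasure_restrict_space fmeasurable_def)
qed

lemma continuous_M [measurable_dest]: "continuous_on UNIV f \<Longrightarrow> f \<in> borel_measurable M" for f :: "'d \<Rightarrow> 'b::{second_countable_topology, banach}"
  by (intro measurable_restrict_space1 measurable_completion) (simp add: borel_measurable_continuous_onI)

lemma bounded_sq_int:
  assumes "f \<in> borel_measurable M" "AE x in M. \<bar>f x\<bar> \<le> C" shows "sq_int M f"
  unfolding sq_int_def
proof (intro conjI integrable_const_bound[where B="C\<^sup>2"])
  show "AE x in M. norm ((f x)\<^sup>2) \<le> C\<^sup>2"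
    using assms(2) by eventually_elim (auto simp: abs_le_square_iff[symmetric] intro: order_trans[OF _ abs_ge_self])
qed (use assms in auto)

lemma sq_int_integrable_self: "sq_int M f \<Longrightarrow> integrable M f"
  using sq_int_mult[of M f "\<lambda>_. 1"] bounded_sq_int[of "\<lambda>_. 1" 1] by simp

lemma sq_int_bounded_mult:
  assumes "sq_int M v" "f \<in> borel_measurable M" "AE x in M. \<bar>f x\<bar> \<le> C"
  shows "sq_int M (\<lambda>x. f x * v x)"
proof -
  have "integrable M (\<lambda>x. (f x * v x)\<^sup>2)"
  proof (rule Bochner_Integration.integrable_bound[where f="\<lambda>x. C\<^sup>2 * (v x)\<^sup>2"])
    show "integrable M (\<lambda>x. C\<^sup>2 * (v x)\<^sup>2)" using assms(1) by (auto simp: sq_int_def)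
    show "AE x in M. norm ((f x * v x)\<^sup>2) \<le> norm (C\<^sup>2 * (v x)\<^sup>2)"
      using assms(3)
    proof eventually_elim
      case (elim x)
      then have "(f x)\<^sup>2 \<le> C\<^sup>2" by (auto simp: abs_le_square_iff[symmetric])
      then show ?case by (simp add: power_mult_distrib mult_right_mono)
    qed
  qed (use assms in \<open>auto simp: sq_int_def\<close>)
  then show ?thesis using assms by (auto simp: sq_int_def)
qed

lemma \<kappa>_bounded:
  obtains C where "\<kappa> \<in> borel_measurable M" "AE x in M. \<bar>\<kappa> x\<bar> \<le> C"
  using \<kappa>_W unfolding W1inf_def Linf_def by (auto simp: set_borel_measurable_M AE_M)

lemma \<kappa>_mult_sq: "sq_int M v \<Longrightarrow> sq_int M (\<lambda>x. \<kappa> x * v x)"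
  by (rule \<kappa>_bounded) (rule sq_int_bounded_mult)

lemma continuous_supp_bounded:
  fixes f :: "'d \<Rightarrow> 'b::real_normed_vector"
  assumes "continuous_on UNIV f" "compact K" "\<And>x. x \<notin> K \<Longrightarrow> f x = 0"
  shows "\<exists>C. \<forall>x. norm (f x) \<le> C"
proof -
  have "bounded (f ` K)"
    using assms by (intro compact_imp_bounded compact_continuous_image continuous_on_subset[OF assms(1)]) auto
  then obtain C where C: "\<And>x. x \<in> K \<Longrightarrow> norm (f x) \<le> C" by (auto simp: bounded_iff)
  have "norm (f x) \<le> max C 0" for x using C[of x] assms(3)[of x] by (cases "x \<in> K") auto
  then show ?thesis by blast
qed

lemma test_fun_facts:
  assumes "test_fun \<Omega> \<psi> D"
  shows "\<exists>K C. compact K \<and> K \<subseteq> \<Omega> \<and> (\<forall>x. x \<notin> K \<longrightarrow> \<psi> x = 0) \<and> (\<forall>x. x \<notin> K \<longrightarrow> D x = 0) \<and>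
    (\<forall>x. \<bar>\<psi> x\<bar> \<le> C) \<and> (\<forall>x. norm (D x) \<le> C) \<and> continuous_on UNIV \<psi> \<and> continuous_on UNIV D"
proof -
  let ?K = "closure {x. \<psi> x \<noteq> 0}"
  have d: "(\<psi> has_derivative (\<lambda>h. D x \<bullet> h)) (at x)" for x using assms by (auto simp: test_fun_def)
  have K: "compact ?K" "?K \<subseteq> \<Omega>" and D: "continuous_on UNIV D" using assms by (auto simp: test_fun_def)
  have \<psi>: "continuous_on UNIV \<psi>"
    by (intro continuous_at_imp_continuous_on ballI has_derivative_continuous[OF d])
  have z1: "\<psi> x = 0" if "x \<notin> ?K" for x
    using that closure_subset[of "{x. \<psi> x \<noteq> 0}"] by blast
  have z2: "D x = 0" if "x \<notin> ?K" for x
    by (rule grad_zero_outside[OF d that])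
  obtain C1 where C1: "\<forall>x. norm (\<psi> x) \<le> C1" using continuous_supp_bounded[OF \<psi> K(1) z1] by auto
  obtain C2 where C2: "\<forall>x. norm (D x) \<le> C2" using continuous_supp_bounded[OF D K(1) z2] by auto
  show ?thesis
  proof (intro exI[of _ ?K] exI[of _ "max C1 C2"] conjI allI impI K \<psi> D z1 z2)
    show "\<bar>\<psi> x\<bar> \<le> max C1 C2" "norm (D x) \<le> max C1 C2" for x
      using C1[rule_format, of x] C2[rule_format, of x] by auto
  qed
qed

lemma test_fun_sq:
  assumes "test_fun \<Omega> \<psi> D" shows "sq_int M \<psi>" "sq_int M (\<lambda>x. D x \<bullet> i)"
proof -
  obtain C where C: "\<forall>x. \<bar>\<psi> x\<bar> \<le> C" "\<forall>x. norm (D x) \<le> C" "continuous_on UNIV \<psi>" "continuous_on UNIV D"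
    using test_fun_facts[OF assms] by blast
  show "sq_int M \<psi>" using C by (intro bounded_sq_int[where C=C] continuous_M) auto
  have "\<bar>D x \<bullet> i\<bar> \<le> C * norm i" for x
    using Cauchy_Schwarz_ineq2[of "D x" i] mult_right_mono[OF C(2)[rule_format, of x], of "norm i"] by simp
  then show "sq_int M (\<lambda>x. D x \<bullet> i)"
    using C by (intro bounded_sq_int[where C="C * norm i"] continuous_M continuous_intros) auto
qed

lemma loc_int_mult_integrable:
  fixes w :: "'d \<Rightarrow> 'b::{banach, second_countable_topology}" and f :: "'d \<Rightarrow> real"
  assumes w: "loc_int \<Omega> w" and K: "compact K" "K \<subseteq> \<Omega>" and f: "continuous_on UNIV f" "\<And>x. x \<notin> K \<Longrightarrow> f x = 0"
  shows "integrable M (\<lambda>x. f x *\<^sub>R w x)"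
proof -
  obtain C where C: "\<forall>x. norm (f x) \<le> C" using continuous_supp_bounded[OF f(1) K(1) f(2)] by auto
  have i: "integrable lebesgue (\<lambda>x. indicator K x *\<^sub>R w x)" using w K by (auto simp: loc_int_def set_integrable_def)
  have "integrable lebesgue (\<lambda>x. f x *\<^sub>R (indicator K x *\<^sub>R w x))"
  proof (rule Bochner_Integration.integrable_bound)
    show "integrable lebesgue (\<lambda>x. C *\<^sub>R (indicator K x *\<^sub>R w x))" using i by (rule integrable_scaleR_right)
    show "(\<lambda>x. f x *\<^sub>R (indicator K x *\<^sub>R w x)) \<in> borel_measurable lebesgue"
      using f(1) i by (intro borel_measurable_scaleR borel_measurable_integrable[OF i] measurable_completion)
        (simp add: borel_measurable_continuous_onI)
    show "AE x in lebesgue. norm (f x *\<^sub>R (indicator K x *\<^sub>R w x)) \<le> norm (C *\<^sub>R (indicator K x *\<^sub>R w x))"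
    proof (rule AE_I2)
      fix x
      have "\<bar>f x\<bar> \<le> \<bar>C\<bar>" using C[rule_format, of x] by auto
      then show "norm (f x *\<^sub>R (indicator K x *\<^sub>R w x)) \<le> norm (C *\<^sub>R (indicator K x *\<^sub>R w x))"
        unfolding norm_scaleR[of "f x"] norm_scaleR[of C] by (rule mult_right_mono) simp
    qed
  qed
  moreover have "f x *\<^sub>R (indicator K x *\<^sub>R w x) = indicator \<Omega> x *\<^sub>R (f x *\<^sub>R w x)" for x
    using f(2)[of x] K by (cases "x \<in> K") auto
  ultimately have "integrable lebesgue (\<lambda>x. indicator \<Omega> x *\<^sub>R (f x *\<^sub>R w x))" by (simp only:)
  then show ?thesis unfolding set_integrable_M[symmetric] set_integrable_def .
qed

text \<open>The weak form of A v = g with an explicit gradient \<open>G\<close>, the L2 limit of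
  gradients of test functions. Working by components keeps every limit inside the scalar L2
  calculus.\<close>

definition opDG :: "('d \<Rightarrow> real) \<Rightarrow> ('d \<Rightarrow> real) \<Rightarrow> ('d \<Rightarrow> 'd) \<Rightarrow> bool" where
  "opDG v g G \<longleftrightarrow> sq_int M v \<and> sq_int M g \<and> (\<forall>i\<in>Basis. sq_int M (\<lambda>x. G x \<bullet> i)) \<and>
    (\<exists>\<psi>s D\<psi>s. (\<forall>k::nat. test_fun \<Omega> (\<psi>s k) (D\<psi>s k)) \<and> (\<lambda>k. \<integral>x. (\<psi>s k x - v x)\<^sup>2 \<partial>M) \<longlonglongrightarrow> 0 \<and>
       (\<forall>i\<in>Basis. (\<lambda>k. \<integral>x. (D\<psi>s k x \<bullet> i - G x \<bullet> i)\<^sup>2 \<partial>M) \<longlonglongrightarrow> 0)) \<and>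
    (\<forall>\<psi> D\<psi>. test_fun \<Omega> \<psi> D\<psi> \<longrightarrow>
       (\<Sum>i\<in>Basis. \<integral>x. (\<kappa> x * (G x \<bullet> i)) * (D\<psi> x \<bullet> i) \<partial>M) = (\<integral>x. g x * \<psi> x \<partial>M))"

text \<open>The operator without the requirement that the limit of the approximating gradients is a weak
  gradient; unlike \<open>opA\<close> it is visibly invariant under changes on null sets.\<close>

definition opD :: "('d \<Rightarrow> real) \<Rightarrow> ('d \<Rightarrow> real) \<Rightarrow> bool" where
  "opD v g \<longleftrightarrow> (\<exists>G. opDG v g G)"

text \<open>In \<open>opA\<close> the membership in H10 and the divergence clause each come with
  their own weak gradient; the fundamental lemma, applied to each component of the difference,
  identifies them.\<close>

lemma weak_grad_unique:
  assumes G: "weak_grad \<Omega> w G" "weak_grad \<Omega> w G'"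
  shows "AE x in M. G x = G' x"
proof -
  have l: "loc_int \<Omega> w" "loc_int \<Omega> G" "loc_int \<Omega> G'" using G by (auto simp: weak_grad_def)
  have "AE x in lebesgue. x \<in> \<Omega> \<longrightarrow> G x \<bullet> i - G' x \<bullet> i = 0" for i
  proof (rule fundamental_lemma[OF \<Omega>_open])
    show "loc_int \<Omega> (\<lambda>x. G x \<bullet> i - G' x \<bullet> i)"
      unfolding loc_int_def set_integrable_def
    proof (intro allI impI)
      fix K assume "compact K \<and> K \<subseteq> \<Omega>"
      then have "integrable lebesgue (\<lambda>x. indicator K x *\<^sub>R G x)" "integrable lebesgue (\<lambda>x. indicator K x *\<^sub>R G' x)"
        using l unfolding loc_int_def set_integrable_def by auto
      then have "integrable lebesgue (\<lambda>x. (indicator K x *\<^sub>R G x - indicator K x *\<^sub>R G' x) \<bullet> i)"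
        by (intro integrable_inner_left Bochner_Integration.integrable_diff)
      then show "integrable lebesgue (\<lambda>x. indicator K x *\<^sub>R (G x \<bullet> i - G' x \<bullet> i))"
        by (simp add: inner_diff_left right_diff_distrib)
    qed
    fix f D H assume f: "C2 f D H" "supp_in \<Omega> f"
    have t: "test_fun \<Omega> f D" by (rule C2_test_fun[OF f])
    obtain K where K: "compact K" "K \<subseteq> \<Omega>" "\<forall>x. x \<notin> K \<longrightarrow> f x = 0" "continuous_on UNIV f"
      using test_fun_facts[OF t] by blast
    have i: "integrable M (\<lambda>x. f x *\<^sub>R G x)" "integrable M (\<lambda>x. f x *\<^sub>R G' x)"
      using loc_int_mult_integrable[OF l(2) K(1,2,4) K(3)[rule_format]] loc_int_mult_integrable[OF l(3) K(1,2,4) K(3)[rule_format]] by auto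
    have "(\<integral>x. f x *\<^sub>R G x \<partial>M) = (\<integral>x. f x *\<^sub>R G' x \<partial>M)"
    proof -
      have "(\<integral>x. w x *\<^sub>R D x \<partial>M) = - (\<integral>x. f x *\<^sub>R G x \<partial>M)" "(\<integral>x. w x *\<^sub>R D x \<partial>M) = - (\<integral>x. f x *\<^sub>R G' x \<partial>M)"
        using G t unfolding weak_grad_def LINT_M by blast+
      then show ?thesis by simp
    qed
    then have "(\<integral>x. f x *\<^sub>R G x \<partial>M) \<bullet> i - (\<integral>x. f x *\<^sub>R G' x \<partial>M) \<bullet> i = 0" by simp
    then have "(\<integral>x. f x *\<^sub>R G x \<bullet> i - f x *\<^sub>R G' x \<bullet> i \<partial>M) = 0"
    proof -
      have "(\<integral>x. f x *\<^sub>R G x \<bullet> i - f x *\<^sub>R G' x \<bullet> i \<partial>M) = (\<integral>x. f x *\<^sub>R G x \<bullet> i \<partial>M) - (\<integral>x. f x *\<^sub>R G' x \<bullet> i \<partial>M)"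
        by (intro Bochner_Integration.integral_diff integrable_inner_left i)
      moreover have "(\<integral>x. f x *\<^sub>R G x \<bullet> i \<partial>M) = (\<integral>x. f x *\<^sub>R G x \<partial>M) \<bullet> i" "(\<integral>x. f x *\<^sub>R G' x \<bullet> i \<partial>M) = (\<integral>x. f x *\<^sub>R G' x \<partial>M) \<bullet> i"
        by (intro integral_inner_left i)+
      ultimately show ?thesis
        using \<open>(\<integral>x. f x *\<^sub>R G x \<partial>M) \<bullet> i - (\<integral>x. f x *\<^sub>R G' x \<partial>M) \<bullet> i = 0\<close> by (simp only:)
    qed
    then show "(LINT x:\<Omega>|lebesgue. f x * (G x \<bullet> i - G' x \<bullet> i)) = 0"
      by (simp add: LINT_M right_diff_distrib)
  qed
  then have "AE x in M. \<forall>i\<in>Basis. G x \<bullet> i = G' x \<bullet> i"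
    unfolding AE_M[symmetric] by (intro AE_finite_allI) auto
  then show ?thesis by eventually_elim (auto intro: euclidean_eqI)
qed

lemma opA_imp_opD:
  assumes "opA \<Omega> \<kappa> v g" shows "opD v g"
proof -
  have g: "sq_int M g" and v: "sq_int M v" using assms by (auto simp: opA_def H10_def L2_M)
  obtain G0 where G0: "weak_grad \<Omega> v G0" "weak_div \<Omega> (\<lambda>x. \<kappa> x *\<^sub>R G0 x) (\<lambda>x. - g x)"
    using assms by (auto simp: opA_def)
  obtain G \<psi>s D\<psi>s where G: "weak_grad \<Omega> v G" and G_sq: "\<forall>i\<in>Basis. sq_int M (\<lambda>x. G x \<bullet> i)"
    and t0: "\<forall>k::nat. test_fun \<Omega> (\<psi>s k) (D\<psi>s k)"
    and lim: "(\<lambda>k. (\<integral>x. (\<psi>s k x - v x)\<^sup>2 \<partial>M) + (\<integral>x. (norm (D\<psi>s k x - G x))\<^sup>2 \<partial>M)) \<longlonglongrightarrow> 0"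
    using assms unfolding opA_def H10_def L2_M LINT_M by blast
  note t = t0[rule_format] and G2 = G_sq[rule_format]
  have GG: "AE x in M. G0 x = G x" by (rule weak_grad_unique[OF G0(1) G])
  have lim1: "(\<lambda>k. \<integral>x. (\<psi>s k x - v x)\<^sup>2 \<partial>M) \<longlonglongrightarrow> 0"
    by (rule tendsto_sandwich[OF _ _ tendsto_const lim]) (auto intro!: always_eventually)
  have lim2: "(\<lambda>k. \<integral>x. (D\<psi>s k x \<bullet> i - G x \<bullet> i)\<^sup>2 \<partial>M) \<longlonglongrightarrow> 0" if i: "i \<in> Basis" for i
  proof (rule tendsto_sandwich[OF _ _ tendsto_const lim])
    have sq: "sq_int M (\<lambda>x. (D\<psi>s k x - G x) \<bullet> j)" if "j \<in> Basis" for j k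
      using sq_int_diff[OF test_fun_sq(2)[OF t[of k]] G2[OF that]] by (simp add: inner_diff_left)
    have n: "(norm (D\<psi>s k x - G x))\<^sup>2 = (\<Sum>j\<in>Basis. ((D\<psi>s k x - G x) \<bullet> j)\<^sup>2)" for k x
      unfolding power2_norm_eq_inner by (subst euclidean_inner) (simp add: power2_eq_square)
    have "(\<integral>x. (D\<psi>s k x \<bullet> i - G x \<bullet> i)\<^sup>2 \<partial>M) \<le> (\<integral>x. (norm (D\<psi>s k x - G x))\<^sup>2 \<partial>M)" for k
    proof (rule integral_mono)
      show "integrable M (\<lambda>x. (D\<psi>s k x \<bullet> i - G x \<bullet> i)\<^sup>2)"
        using sq[OF i, of k] by (simp add: sq_int_def inner_diff_left)
      show "integrable M (\<lambda>x. (norm (D\<psi>s k x - G x))\<^sup>2)"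
        unfolding n using sq by (intro Bochner_Integration.integrable_sum) (auto simp: sq_int_def)
      show "(D\<psi>s k x \<bullet> i - G x \<bullet> i)\<^sup>2 \<le> (norm (D\<psi>s k x - G x))\<^sup>2" for x
        unfolding n using i member_le_sum[of i Basis "\<lambda>j. ((D\<psi>s k x - G x) \<bullet> j)\<^sup>2"] by (simp add: inner_diff_left)
    qed
    moreover have "0 \<le> (\<integral>x. (\<psi>s k x - v x)\<^sup>2 \<partial>M)" for k by simp
    ultimately show "\<forall>\<^sub>F k in sequentially. (\<integral>x. (D\<psi>s k x \<bullet> i - G x \<bullet> i)\<^sup>2 \<partial>M)
        \<le> (\<integral>x. (\<psi>s k x - v x)\<^sup>2 \<partial>M) + (\<integral>x. (norm (D\<psi>s k x - G x))\<^sup>2 \<partial>M)"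
      by (intro always_eventually allI) (meson add_increasing)
  qed auto
  have weak: "(\<Sum>i\<in>Basis. \<integral>x. (\<kappa> x * (G x \<bullet> i)) * (D\<psi> x \<bullet> i) \<partial>M) = (\<integral>x. g x * \<psi> x \<partial>M)"
    if \<psi>: "test_fun \<Omega> \<psi> D\<psi>" for \<psi> D\<psi>
  proof -
    have i: "integrable M (\<lambda>x. (\<kappa> x * (G x \<bullet> i)) * (D\<psi> x \<bullet> i))" if "i \<in> Basis" for i
      by (intro sq_int_mult \<kappa>_mult_sq G2 that test_fun_sq(2)[OF \<psi>])
    have ae: "AE x in M. (\<Sum>i\<in>Basis. (\<kappa> x * (G x \<bullet> i)) * (D\<psi> x \<bullet> i)) = (\<kappa> x *\<^sub>R G0 x) \<bullet> D\<psi> x"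
      using GG by eventually_elim (simp add: euclidean_inner[of _ "D\<psi> _"] mult.assoc)
    have m: "(\<lambda>x. \<Sum>i\<in>Basis. (\<kappa> x * (G x \<bullet> i)) * (D\<psi> x \<bullet> i)) \<in> borel_measurable M"
      using i by (intro borel_measurable_sum borel_measurable_integrable) auto
    have "loc_int \<Omega> (\<lambda>x. \<kappa> x *\<^sub>R G0 x)" using G0 by (simp add: weak_div_def)
    note F = this
    obtain K where K: "compact K" "K \<subseteq> \<Omega>" "\<forall>x. x \<notin> K \<longrightarrow> D\<psi> x = 0" "continuous_on UNIV D\<psi>"
      using test_fun_facts[OF \<psi>] by blast
    have "integrable M (\<lambda>x. (D\<psi> x \<bullet> i) *\<^sub>R (\<kappa> x *\<^sub>R G0 x))" for i
      using K by (intro loc_int_mult_integrable[OF F K(1,2)] continuous_intros) auto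
    then have "integrable M (\<lambda>x. ((D\<psi> x \<bullet> i) *\<^sub>R (\<kappa> x *\<^sub>R G0 x)) \<bullet> i)" for i
      by (rule integrable_inner_left)
    then have "integrable M (\<lambda>x. \<Sum>i\<in>Basis. ((D\<psi> x \<bullet> i) *\<^sub>R (\<kappa> x *\<^sub>R G0 x)) \<bullet> i)"
      by (intro Bochner_Integration.integrable_sum)
    moreover have "(\<Sum>i\<in>Basis. ((D\<psi> x \<bullet> i) *\<^sub>R (\<kappa> x *\<^sub>R G0 x)) \<bullet> i) = (\<kappa> x *\<^sub>R G0 x) \<bullet> D\<psi> x" for x
      by (simp add: euclidean_inner[of _ "D\<psi> x"] mult_ac sum_distrib_left)
    ultimately have m0: "(\<lambda>x. (\<kappa> x *\<^sub>R G0 x) \<bullet> D\<psi> x) \<in> borel_measurable M"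
      by (auto dest: borel_measurable_integrable)
    have "(\<Sum>i\<in>Basis. \<integral>x. (\<kappa> x * (G x \<bullet> i)) * (D\<psi> x \<bullet> i) \<partial>M) = (\<integral>x. (\<Sum>i\<in>Basis. (\<kappa> x * (G x \<bullet> i)) * (D\<psi> x \<bullet> i)) \<partial>M)"
      using i by (subst Bochner_Integration.integral_sum) auto
    also have "\<dots> = (\<integral>x. (\<kappa> x *\<^sub>R G0 x) \<bullet> D\<psi> x \<partial>M)"
      by (rule integral_cong_AE[OF m m0 ae])
    also have "\<dots> = - (\<integral>x. \<psi> x * - g x \<partial>M)"
      using G0(2) \<psi> unfolding weak_div_def LINT_M by blast
    finally show ?thesis by (simp add: mult.commute)
  qed
  have "opDG v g G"
    unfolding opDG_def
    by (intro conjI exI[of _ \<psi>s] exI[of _ D\<psi>s] allI ballI impI v g G2 t lim1 lim2 weak)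
  then show ?thesis unfolding opD_def by blast
qed

text \<open>The weak form extends from test functions to \<open>w\<close> by approximation: both
  sides are continuous along test functions converging to \<open>w\<close> together with their
  gradients. Symmetry and nonnegativity are read off the right side.\<close>

lemma opD_energy:
  assumes v: "opDG v g G" and w: "opDG w h G'"
  shows "(\<integral>x. g x * w x \<partial>M) = (\<Sum>i\<in>Basis. \<integral>x. (\<kappa> x * (G x \<bullet> i)) * (G' x \<bullet> i) \<partial>M)"
proof -
  have sq: "sq_int M g" "sq_int M w" "\<And>i. i \<in> Basis \<Longrightarrow> sq_int M (\<lambda>x. G x \<bullet> i)" "\<And>i. i \<in> Basis \<Longrightarrow> sq_int M (\<lambda>x. G' x \<bullet> i)"
    using v w by (auto simp: opDG_def)
  obtain \<psi>s D\<psi>s where t0: "\<forall>k::nat. test_fun \<Omega> (\<psi>s k) (D\<psi>s k)"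
    and lim1: "(\<lambda>k. \<integral>x. (\<psi>s k x - w x)\<^sup>2 \<partial>M) \<longlonglongrightarrow> 0"
    and lim20: "\<forall>i\<in>Basis. (\<lambda>k. \<integral>x. (D\<psi>s k x \<bullet> i - G' x \<bullet> i)\<^sup>2 \<partial>M) \<longlonglongrightarrow> 0"
    using w unfolding opDG_def by blast
  note t = t0[rule_format] and lim2 = lim20[rule_format]
  have eq: "(\<Sum>i\<in>Basis. \<integral>x. (D\<psi>s k x \<bullet> i) * (\<kappa> x * (G x \<bullet> i)) \<partial>M) = (\<integral>x. \<psi>s k x * g x \<partial>M)" for k
  proof -
    have "(\<Sum>i\<in>Basis. \<integral>x. (\<kappa> x * (G x \<bullet> i)) * (D\<psi>s k x \<bullet> i) \<partial>M) = (\<integral>x. g x * \<psi>s k x \<partial>M)"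
      using v t[of k] unfolding opDG_def by blast
    then show ?thesis unfolding mult.commute[of "D\<psi>s k _ \<bullet> _"] mult.commute[of "\<psi>s k _"] .
  qed
  have l1: "(\<lambda>k. \<Sum>i\<in>Basis. \<integral>x. (D\<psi>s k x \<bullet> i) * (\<kappa> x * (G x \<bullet> i)) \<partial>M)
    \<longlonglongrightarrow> (\<Sum>i\<in>Basis. \<integral>x. (G' x \<bullet> i) * (\<kappa> x * (G x \<bullet> i)) \<partial>M)"
    by (intro tendsto_sum sq_int_tendsto_inner test_fun_sq[OF t] sq \<kappa>_mult_sq lim2)
  have l2: "(\<lambda>k. \<integral>x. \<psi>s k x * g x \<partial>M) \<longlonglongrightarrow> (\<integral>x. w x * g x \<partial>M)"
    by (intro sq_int_tendsto_inner test_fun_sq(1)[OF t] sq lim1)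
  have "(\<integral>x. w x * g x \<partial>M) = (\<Sum>i\<in>Basis. \<integral>x. (G' x \<bullet> i) * (\<kappa> x * (G x \<bullet> i)) \<partial>M)"
    by (rule LIMSEQ_unique[OF l2 l1[unfolded eq]])
  then show ?thesis unfolding mult.commute[of "G' _ \<bullet> _"] mult.commute[of "w _"] .
qed

lemma sq_int_lin: "sq_int M v \<Longrightarrow> sq_int M w \<Longrightarrow> sq_int M (\<lambda>x. a * v x + b * w x)"
  by (intro sq_int_add sq_int_scale)

lemma tendsto_sq_lin:
  assumes sq: "\<And>k::nat. sq_int M (v k)" "sq_int M v'" "\<And>k. sq_int M (w k)" "sq_int M w'"
    and lim: "(\<lambda>k. \<integral>x. (v k x - v' x)\<^sup>2 \<partial>M) \<longlonglongrightarrow> 0" "(\<lambda>k. \<integral>x. (w k x - w' x)\<^sup>2 \<partial>M) \<longlonglongrightarrow> 0"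
  shows "(\<lambda>k. \<integral>x. ((a * v k x + b * w k x) - (a * v' x + b * w' x))\<^sup>2 \<partial>M) \<longlonglongrightarrow> 0"
proof -
  have le: "(\<integral>x. ((a * v k x + b * w k x) - (a * v' x + b * w' x))\<^sup>2 \<partial>M)
    \<le> 2 * (a\<^sup>2 * (\<integral>x. (v k x - v' x)\<^sup>2 \<partial>M)) + 2 * (b\<^sup>2 * (\<integral>x. (w k x - w' x)\<^sup>2 \<partial>M))" for k
  proof -
    have e: "(a * v k x + b * w k x) - (a * v' x + b * w' x) = a * (v k x - v' x) + b * (w k x - w' x)" for x
      by (simp add: algebra_simps)
    have "(\<integral>x. (a * (v k x - v' x) + b * (w k x - w' x))\<^sup>2 \<partial>M)
      \<le> 2 * (\<integral>x. (a * (v k x - v' x))\<^sup>2 \<partial>M) + 2 * (\<integral>x. (b * (w k x - w' x))\<^sup>2 \<partial>M)"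
      by (intro sq_int_square_add_le sq_int_scale sq_int_diff sq)
    then show ?thesis unfolding e by (simp add: power_mult_distrib)
  qed
  have "(\<lambda>k. 2 * (a\<^sup>2 * (\<integral>x. (v k x - v' x)\<^sup>2 \<partial>M)) + 2 * (b\<^sup>2 * (\<integral>x. (w k x - w' x)\<^sup>2 \<partial>M))) \<longlonglongrightarrow> 2 * (a\<^sup>2 * 0) + 2 * (b\<^sup>2 * 0)"
    by (intro tendsto_intros lim)
  then have "(\<lambda>k. 2 * (a\<^sup>2 * (\<integral>x. (v k x - v' x)\<^sup>2 \<partial>M)) + 2 * (b\<^sup>2 * (\<integral>x. (w k x - w' x)\<^sup>2 \<partial>M))) \<longlonglongrightarrow> 0" by simp
  from tendsto_sandwich[OF _ _ tendsto_const this] le show ?thesis by simp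
qed

lemma test_fun_lin:
  assumes "test_fun \<Omega> \<psi> D" "test_fun \<Omega> \<psi>' D'"
  shows "test_fun \<Omega> (\<lambda>x. a * \<psi> x + b * \<psi>' x) (\<lambda>x. a *\<^sub>R D x + b *\<^sub>R D' x)"
proof -
  have d: "(\<psi> has_derivative (\<lambda>h. D x \<bullet> h)) (at x)" "(\<psi>' has_derivative (\<lambda>h. D' x \<bullet> h)) (at x)" for x
    using assms by (auto simp: test_fun_def)
  have 1: "((\<lambda>x. a * \<psi> x + b * \<psi>' x) has_derivative (\<lambda>h. (a *\<^sub>R D x + b *\<^sub>R D' x) \<bullet> h)) (at x)" for x
    by (rule has_derivative_eq_rhs[OF has_derivative_add[OF has_derivative_mult_right[OF d(1)] has_derivative_mult_right[OF d(2)]]])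
       (simp add: inner_add_left)
  have 2: "continuous_on UNIV (\<lambda>x. a *\<^sub>R D x + b *\<^sub>R D' x)"
    using assms by (intro continuous_intros) (auto simp: test_fun_def)
  let ?K = "closure {x. \<psi> x \<noteq> 0} \<union> closure {x. \<psi>' x \<noteq> 0}"
  have K: "compact ?K" "?K \<subseteq> \<Omega>" using assms by (auto simp: test_fun_def)
  have "closure {x. a * \<psi> x + b * \<psi>' x \<noteq> 0} \<subseteq> ?K"
    unfolding closure_Un[symmetric] by (intro closure_mono) auto
  moreover from this K have "compact (closure {x. a * \<psi> x + b * \<psi>' x \<noteq> 0})"
    by (meson bounded_subset closed_closure compact_eq_bounded_closed)
  ultimately show ?thesis
    using 1 2 K unfolding test_fun_def by blast
qed

lemma opD_lin:
  assumes "opD v g" "opD w h"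
  shows "opD (\<lambda>x. a * v x + b * w x) (\<lambda>x. a * g x + b * h x)"
proof -
  obtain G G' where v: "opDG v g G" and w: "opDG w h G'" using assms by (auto simp: opD_def)
  have sq: "sq_int M v" "sq_int M g" "sq_int M w" "sq_int M h"
    and sqG: "\<And>i. i \<in> Basis \<Longrightarrow> sq_int M (\<lambda>x. G x \<bullet> i)" "\<And>i. i \<in> Basis \<Longrightarrow> sq_int M (\<lambda>x. G' x \<bullet> i)"
    using v w by (auto simp: opDG_def)
  obtain \<psi>s D\<psi>s where t0: "\<forall>k::nat. test_fun \<Omega> (\<psi>s k) (D\<psi>s k)"
    and lim1: "(\<lambda>k. \<integral>x. (\<psi>s k x - v x)\<^sup>2 \<partial>M) \<longlonglongrightarrow> 0"
    and lim20: "\<forall>i\<in>Basis. (\<lambda>k. \<integral>x. (D\<psi>s k x \<bullet> i - G x \<bullet> i)\<^sup>2 \<partial>M) \<longlonglongrightarrow> 0"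
    using v unfolding opDG_def by blast
  note t = t0[rule_format] and lim2 = lim20[rule_format]
  obtain \<psi>s' D\<psi>s' where t0': "\<forall>k::nat. test_fun \<Omega> (\<psi>s' k) (D\<psi>s' k)"
    and lim1': "(\<lambda>k. \<integral>x. (\<psi>s' k x - w x)\<^sup>2 \<partial>M) \<longlonglongrightarrow> 0"
    and lim20': "\<forall>i\<in>Basis. (\<lambda>k. \<integral>x. (D\<psi>s' k x \<bullet> i - G' x \<bullet> i)\<^sup>2 \<partial>M) \<longlonglongrightarrow> 0"
    using w unfolding opDG_def by blast
  note t' = t0'[rule_format] and lim2' = lim20'[rule_format]
  have "opDG (\<lambda>x. a * v x + b * w x) (\<lambda>x. a * g x + b * h x) (\<lambda>x. a *\<^sub>R G x + b *\<^sub>R G' x)"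
    unfolding opDG_def
  proof (intro conjI ballI exI[of _ "\<lambda>k x. a * \<psi>s k x + b * \<psi>s' k x"]
      exI[of _ "\<lambda>k x. a *\<^sub>R D\<psi>s k x + b *\<^sub>R D\<psi>s' k x"] allI impI)
    show "sq_int M (\<lambda>x. a * v x + b * w x)" "sq_int M (\<lambda>x. a * g x + b * h x)" by (intro sq_int_lin sq)+
    show "sq_int M (\<lambda>x. (a *\<^sub>R G x + b *\<^sub>R G' x) \<bullet> i)" if "i \<in> Basis" for i
      using sq_int_lin[OF sqG(1)[OF that] sqG(2)[OF that]] by (simp add: inner_add_left)
    show "test_fun \<Omega> (\<lambda>x. a * \<psi>s k x + b * \<psi>s' k x) (\<lambda>x. a *\<^sub>R D\<psi>s k x + b *\<^sub>R D\<psi>s' k x)" for k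
      by (rule test_fun_lin[OF t t'])
    show "(\<lambda>k. \<integral>x. (a * \<psi>s k x + b * \<psi>s' k x - (a * v x + b * w x))\<^sup>2 \<partial>M) \<longlonglongrightarrow> 0"
      by (rule tendsto_sq_lin[OF test_fun_sq(1)[OF t] sq(1) test_fun_sq(1)[OF t'] sq(3) lim1 lim1'])
    show "(\<lambda>k. \<integral>x. ((a *\<^sub>R D\<psi>s k x + b *\<^sub>R D\<psi>s' k x) \<bullet> i - (a *\<^sub>R G x + b *\<^sub>R G' x) \<bullet> i)\<^sup>2 \<partial>M) \<longlonglongrightarrow> 0" if i: "i \<in> Basis" for i
      using tendsto_sq_lin[OF test_fun_sq(2)[OF t] sqG(1)[OF i] test_fun_sq(2)[OF t'] sqG(2)[OF i] lim2[OF i] lim2'[OF i], of a b]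
      by (simp add: inner_add_left)
    fix \<psi> D\<psi> assume \<psi>: "test_fun \<Omega> \<psi> D\<psi>"
    have i: "integrable M (\<lambda>x. (\<kappa> x * (G x \<bullet> i)) * (D\<psi> x \<bullet> i))" "integrable M (\<lambda>x. (\<kappa> x * (G' x \<bullet> i)) * (D\<psi> x \<bullet> i))" if "i \<in> Basis" for i
      by (intro sq_int_mult \<kappa>_mult_sq sqG that test_fun_sq(2)[OF \<psi>])+
    have eq: "(\<integral>x. (\<kappa> x * ((a *\<^sub>R G x + b *\<^sub>R G' x) \<bullet> i)) * (D\<psi> x \<bullet> i) \<partial>M)
       = a * (\<integral>x. (\<kappa> x * (G x \<bullet> i)) * (D\<psi> x \<bullet> i) \<partial>M) + b * (\<integral>x. (\<kappa> x * (G' x \<bullet> i)) * (D\<psi> x \<bullet> i) \<partial>M)" if "i \<in> Basis" for i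
    proof -
      have "(\<integral>x. (\<kappa> x * ((a *\<^sub>R G x + b *\<^sub>R G' x) \<bullet> i)) * (D\<psi> x \<bullet> i) \<partial>M)
        = (\<integral>x. a * ((\<kappa> x * (G x \<bullet> i)) * (D\<psi> x \<bullet> i)) + b * ((\<kappa> x * (G' x \<bullet> i)) * (D\<psi> x \<bullet> i)) \<partial>M)"
        by (intro Bochner_Integration.integral_cong refl) (simp add: inner_add_left algebra_simps)
      then show ?thesis using i[OF that] by simp
    qed
    have "(\<Sum>i\<in>Basis. \<integral>x. (\<kappa> x * ((a *\<^sub>R G x + b *\<^sub>R G' x) \<bullet> i)) * (D\<psi> x \<bullet> i) \<partial>M)
      = a * (\<Sum>i\<in>Basis. \<integral>x. (\<kappa> x * (G x \<bullet> i)) * (D\<psi> x \<bullet> i) \<partial>M) + b * (\<Sum>i\<in>Basis. \<integral>x. (\<kappa> x * (G' x \<bullet> i)) * (D\<psi> x \<bullet> i) \<partial>M)"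
      by (simp add: eq sum.distrib sum_distrib_left)
    also have "\<dots> = a * (\<integral>x. g x * \<psi> x \<partial>M) + b * (\<integral>x. h x * \<psi> x \<partial>M)"
    proof -
      have "(\<Sum>i\<in>Basis. \<integral>x. (\<kappa> x * (G x \<bullet> i)) * (D\<psi> x \<bullet> i) \<partial>M) = (\<integral>x. g x * \<psi> x \<partial>M)"
        "(\<Sum>i\<in>Basis. \<integral>x. (\<kappa> x * (G' x \<bullet> i)) * (D\<psi> x \<bullet> i) \<partial>M) = (\<integral>x. h x * \<psi> x \<partial>M)"
        using v w \<psi> unfolding opDG_def by blast+
      then show ?thesis by simp
    qed
    also have "\<dots> = (\<integral>x. (a * g x + b * h x) * \<psi> x \<partial>M)"
      using sq_int_mult[OF sq(2) test_fun_sq(1)[OF \<psi>]] sq_int_mult[OF sq(4) test_fun_sq(1)[OF \<psi>]]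
      by (simp add: distrib_right mult.assoc)
    finally show "(\<Sum>i\<in>Basis. \<integral>x. (\<kappa> x * ((a *\<^sub>R G x + b *\<^sub>R G' x) \<bullet> i)) * (D\<psi> x \<bullet> i) \<partial>M) = (\<integral>x. (a * g x + b * h x) * \<psi> x \<partial>M)" .
  qed
  then show ?thesis by (auto simp: opD_def)
qed

end

context elliptic
begin

lemma continuous_sq:
  fixes f :: "'d \<Rightarrow> real"
  assumes f: "continuous_on UNIV f" shows "sq_int M f"
proof -
  have "compact (f ` closure \<Omega>)"
    using \<Omega>_bounded by (intro compact_continuous_image continuous_on_subset[OF f]) (auto simp: compact_closure)
  then obtain C where C: "\<forall>y\<in>f ` closure \<Omega>. norm y \<le> C"
    using compact_imp_bounded bounded_iff by metis
  have "\<bar>f x\<bar> \<le> C" if "x \<in> \<Omega>" for x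
  proof -
    have "x \<in> closure \<Omega>" using that closure_subset[of \<Omega>] by blast
    then show ?thesis using C by auto
  qed
  then show ?thesis
    by (intro bounded_sq_int[where C=C] continuous_M f AE_I2) auto
qed

lemma opD_sym:
  assumes "opD v g" "opD w h" shows "(\<integral>x. g x * w x \<partial>M) = (\<integral>x. v x * h x \<partial>M)"
proof -
  obtain G G' where v: "opDG v g G" and w: "opDG w h G'" using assms by (auto simp: opD_def)
  have "(\<integral>x. g x * w x \<partial>M) = (\<Sum>i\<in>Basis. \<integral>x. (\<kappa> x * (G x \<bullet> i)) * (G' x \<bullet> i) \<partial>M)" by (rule opD_energy[OF v w])
  also have "\<dots> = (\<Sum>i\<in>Basis. \<integral>x. (\<kappa> x * (G' x \<bullet> i)) * (G x \<bullet> i) \<partial>M)"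
    by (intro sum.cong refl Bochner_Integration.integral_cong) simp
  also have "\<dots> = (\<integral>x. h x * v x \<partial>M)" by (rule opD_energy[OF w v, symmetric])
  finally show ?thesis by (simp add: mult.commute)
qed

lemma opD_nonneg:
  assumes "opD v g" shows "0 \<le> (\<integral>x. g x * v x \<partial>M)"
proof -
  obtain G where v: "opDG v g G" using assms by (auto simp: opD_def)
  show ?thesis
    unfolding opD_energy[OF v v]
  proof (intro sum_nonneg integral_nonneg_AE)
    fix i :: 'd
    show "AE x in M. 0 \<le> (\<kappa> x * (G x \<bullet> i)) * (G x \<bullet> i)"
      using \<kappa>_nonneg unfolding AE_M[symmetric] by eventually_elim (simp add: mult.assoc)
  qed
qed

lemma opD_cong:
  assumes "opD v g" "AE x in M. v x = v' x" "AE x in M. g x = g' x"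
    "v' \<in> borel_measurable M" "g' \<in> borel_measurable M"
  shows "opD v' g'"
proof -
  obtain G where G: "opDG v g G" using assms by (auto simp: opD_def)
  have sq: "sq_int M v" "sq_int M g" using G by (auto simp: opDG_def)
  have [measurable]: "v \<in> borel_measurable M" "g \<in> borel_measurable M" using sq by (auto simp: sq_int_def)
  note [measurable] = assms(4,5)
  obtain \<psi>s D\<psi>s where t0: "\<forall>k::nat. test_fun \<Omega> (\<psi>s k) (D\<psi>s k)"
    and lim1: "(\<lambda>k. \<integral>x. (\<psi>s k x - v x)\<^sup>2 \<partial>M) \<longlonglongrightarrow> 0"
    and lim20: "\<forall>i\<in>Basis. (\<lambda>k. \<integral>x. (D\<psi>s k x \<bullet> i - G x \<bullet> i)\<^sup>2 \<partial>M) \<longlonglongrightarrow> 0"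
    using G unfolding opDG_def by blast
  have "(\<integral>x. (\<psi>s k x - v x)\<^sup>2 \<partial>M) = (\<integral>x. (\<psi>s k x - v' x)\<^sup>2 \<partial>M)" for k
  proof -
    have [measurable]: "\<psi>s k \<in> borel_measurable M" using test_fun_sq(1)[OF t0[rule_format, of k]] by (simp add: sq_int_def)
    show ?thesis using assms(2) by (intro integral_cong_AE) (measurable, auto)
  qed
  then have lim1': "(\<lambda>k. \<integral>x. (\<psi>s k x - v' x)\<^sup>2 \<partial>M) \<longlonglongrightarrow> 0" using lim1 by simp
  have gg: "(\<integral>x. g x * \<psi> x \<partial>M) = (\<integral>x. g' x * \<psi> x \<partial>M)" if "test_fun \<Omega> \<psi> D" for \<psi> D
  proof -
    have [measurable]: "\<psi> \<in> borel_measurable M" using test_fun_sq(1)[OF that] by (simp add: sq_int_def)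
    show ?thesis using assms(3) by (intro integral_cong_AE) (measurable, auto)
  qed
  have "opDG v' g' G"
    unfolding opDG_def
  proof (intro conjI exI[of _ \<psi>s] exI[of _ D\<psi>s] lim1' lim20 t0)
    show "sq_int M v'" "sq_int M g'"
      by (rule sq_int_cong_AE[OF sq(1) assms(4,2)], rule sq_int_cong_AE[OF sq(2) assms(5,3)])
    show "\<forall>i\<in>Basis. sq_int M (\<lambda>x. G x \<bullet> i)" using G by (simp add: opDG_def)
    show "\<forall>\<psi> D\<psi>. test_fun \<Omega> \<psi> D\<psi> \<longrightarrow>
       (\<Sum>i\<in>Basis. \<integral>x. (\<kappa> x * (G x \<bullet> i)) * (D\<psi> x \<bullet> i) \<partial>M) = (\<integral>x. g' x * \<psi> x \<partial>M)"
    proof (intro allI impI)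
      fix \<psi> D\<psi> assume t: "test_fun \<Omega> \<psi> D\<psi>"
      have "(\<Sum>i\<in>Basis. \<integral>x. (\<kappa> x * (G x \<bullet> i)) * (D\<psi> x \<bullet> i) \<partial>M) = (\<integral>x. g x * \<psi> x \<partial>M)"
        using G t unfolding opDG_def by blast
      then show "(\<Sum>i\<in>Basis. \<integral>x. (\<kappa> x * (G x \<bullet> i)) * (D\<psi> x \<bullet> i) \<partial>M) = (\<integral>x. g' x * \<psi> x \<partial>M)"
        using gg[OF t] by (rule trans)
    qed
  qed
  then show ?thesis by (auto simp: opD_def)
qed

text \<open>Since \<open>\<kappa>\<close> is Lipschitz, \<open>C\<^sup>2\<close> functions of compact support lie in the domain of the operator.\<close>

lemma C2_opD:
  assumes \<xi>: "C2 \<xi> D H" "supp_in \<Omega> \<xi>"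
  shows "\<exists>g. opD \<xi> g"
proof -
  have t: "test_fun \<Omega> \<xi> D" by (rule C2_test_fun[OF \<xi>])
  have Dd: "(D has_derivative H x) (at x)" and Hc: "continuous_on UNIV (\<lambda>x. H x h)" for x h
    using \<xi>(1) by (auto simp: C2_def)
  have Dc: "continuous_on UNIV D" by (rule C2_continuous[OF \<xi>(1)])
  obtain K where K: "weak_grad \<Omega> \<kappa> K" "\<forall>i\<in>Basis. Linf \<Omega> (\<lambda>x. K x \<bullet> i)"
    using \<kappa>_W by (auto simp: W1inf_def)
  have KD: "sq_int M (\<lambda>x. (K x \<bullet> i) * f x)" if i: "i \<in> Basis" and f: "sq_int M f" for i f
  proof -
    obtain C where "(\<lambda>x. K x \<bullet> i) \<in> borel_measurable M" "AE x in M. \<bar>K x \<bullet> i\<bar> \<le> C"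
      using K(2) i unfolding Linf_def by (auto simp: set_borel_measurable_M AE_M)
    then show ?thesis by (rule sq_int_bounded_mult[OF f])
  qed
  \<comment> \<open>The product rule for -div(\<kappa> grad \<xi>): \<kappa> times the Laplacian of
    \<xi>, plus the weak gradient \<open>K\<close> of \<kappa> paired with grad \<xi>, with a minus
    sign.\<close>
  define g where "g x = - ((\<Sum>i\<in>Basis. \<kappa> x * (H x i \<bullet> i)) + (\<Sum>i\<in>Basis. (K x \<bullet> i) * (D x \<bullet> i)))" for x
  have sq1: "sq_int M (\<lambda>x. \<kappa> x * (H x i \<bullet> i))" for i
    by (intro \<kappa>_mult_sq continuous_sq continuous_intros Hc)
  have sq2: "sq_int M (\<lambda>x. (K x \<bullet> i) * (D x \<bullet> i))" if "i \<in> Basis" for i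
    by (intro KD that continuous_sq continuous_intros Dc)
  have sum_sq: "sq_int M (\<lambda>x. \<Sum>i\<in>I. f i x)" if "finite I" "\<And>i. i \<in> I \<Longrightarrow> sq_int M (f i)" for I :: "'d set" and f
    using that by (induction I) (auto intro: sq_int_add)
  have g_sq: "sq_int M g"
  proof -
    have "sq_int M (\<lambda>x. (-1) * ((\<Sum>i\<in>Basis. \<kappa> x * (H x i \<bullet> i)) + (\<Sum>i\<in>Basis. (K x \<bullet> i) * (D x \<bullet> i))))"
      by (intro sq_int_scale sq_int_add sum_sq sq1 sq2) auto
    then show ?thesis by (simp add: g_def[abs_def])
  qed
  have weak: "(\<Sum>i\<in>Basis. \<integral>x. (\<kappa> x * (D x \<bullet> i)) * (D\<psi> x \<bullet> i) \<partial>M) = (\<integral>x. g x * \<psi> x \<partial>M)"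
    if \<psi>: "test_fun \<Omega> \<psi> D\<psi>" for \<psi> D\<psi>
  proof -
    have \<psi>d: "(\<psi> has_derivative (\<lambda>h. D\<psi> x \<bullet> h)) (at x)" for x using \<psi> by (auto simp: test_fun_def)
    obtain S where S: "compact S" "S \<subseteq> \<Omega>" "\<forall>x. x \<notin> S \<longrightarrow> \<psi> x = 0" "\<forall>x. x \<notin> S \<longrightarrow> D\<psi> x = 0"
      and c: "continuous_on UNIV \<psi>" "continuous_on UNIV D\<psi>"
      using test_fun_facts[OF \<psi>] by blast
    note \<psi>sq = test_fun_sq[OF \<psi>]
    have int1: "integrable M (\<lambda>x. (\<kappa> x * (D x \<bullet> i)) * (D\<psi> x \<bullet> i))" for i
      by (intro sq_int_mult \<kappa>_mult_sq \<psi>sq continuous_sq continuous_intros Dc)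
    have int2: "integrable M (\<lambda>x. (\<kappa> x * (H x i \<bullet> i)) * \<psi> x)" for i
      by (intro sq_int_mult sq1 \<psi>sq)
    have int3: "integrable M (\<lambda>x. ((K x \<bullet> i) * (D x \<bullet> i)) * \<psi> x)" if "i \<in> Basis" for i
      by (intro sq_int_mult sq2 that \<psi>sq)
    have comp: "(\<integral>x. (\<kappa> x * (D x \<bullet> i)) * (D\<psi> x \<bullet> i) \<partial>M)
      = - (\<integral>x. (\<kappa> x * (H x i \<bullet> i)) * \<psi> x \<partial>M) - (\<integral>x. ((K x \<bullet> i) * (D x \<bullet> i)) * \<psi> x \<partial>M)"
      if i: "i \<in> Basis" for i
    proof -
      \<comment> \<open>\<psi> times the i-th partial derivative of \<xi> is an admissible test
        function for the weak gradient of \<kappa>; the i-th component of that identity is the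
        product rule in weak form.\<close>
      define f where "f x = \<psi> x * (D x \<bullet> i)" for x
      define W where "W x = (D x \<bullet> i) *\<^sub>R D\<psi> x + \<psi> x *\<^sub>R (\<Sum>j\<in>Basis. (H x j \<bullet> i) *\<^sub>R j)" for x
      have Hi: "H x h \<bullet> i = (\<Sum>j\<in>Basis. (H x j \<bullet> i) *\<^sub>R j) \<bullet> h" for x h
      proof -
        have lin: "linear (H x)" using Dd[of x] has_derivative_linear by blast
        have "H x h = H x (\<Sum>j\<in>Basis. (h \<bullet> j) *\<^sub>R j)" by (simp add: euclidean_representation)
        also have "\<dots> = (\<Sum>j\<in>Basis. (h \<bullet> j) *\<^sub>R H x j)"
          by (simp add: linear_sum[OF lin] linear_scale[OF lin])
        finally have "H x h \<bullet> i = (\<Sum>j\<in>Basis. (h \<bullet> j) * (H x j \<bullet> i))"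
          by (simp only: inner_sum_left inner_scaleR_left)
        also have "\<dots> = (\<Sum>j\<in>Basis. (H x j \<bullet> i) *\<^sub>R j) \<bullet> h"
          unfolding inner_sum_left inner_scaleR_left by (intro sum.cong refl) (simp add: inner_commute[of h])
        finally show ?thesis .
      qed
      have fd: "(f has_derivative (\<lambda>h. W x \<bullet> h)) (at x)" for x
      proof -
        have "((\<lambda>x. D x \<bullet> i) has_derivative (\<lambda>h. H x h \<bullet> i)) (at x)"
          by (rule has_derivative_inner_left[OF Dd])
        from has_derivative_mult[OF \<psi>d this]
        have "((\<lambda>x. \<psi> x * (D x \<bullet> i)) has_derivative (\<lambda>h. \<psi> x * (H x h \<bullet> i) + (D\<psi> x \<bullet> h) * (D x \<bullet> i))) (at x)" .
        moreover have "(\<lambda>h. \<psi> x * (H x h \<bullet> i) + (D\<psi> x \<bullet> h) * (D x \<bullet> i)) = (\<lambda>h. W x \<bullet> h)"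
        proof
          fix h
          show "\<psi> x * (H x h \<bullet> i) + (D\<psi> x \<bullet> h) * (D x \<bullet> i) = W x \<bullet> h"
            unfolding Hi[of x h] W_def inner_add_left inner_scaleR_left by simp
        qed
        ultimately show ?thesis by (simp add: f_def[abs_def])
      qed
      have Wc: "continuous_on UNIV W"
        unfolding W_def[abs_def] by (intro continuous_intros c Dc Hc)
      have "supp_in \<Omega> \<psi>" using \<psi> by (simp add: test_fun_iff)
      then have "supp_in \<Omega> f" by (rule supp_in_subset) (simp add: f_def)
      then have ft: "test_fun \<Omega> f W" using fd Wc by (simp add: test_fun_iff)
      have "W x = 0" if "x \<notin> S" for x using S that by (simp add: W_def)
      then obtain C where C: "\<forall>x. norm (W x) \<le> C" using continuous_supp_bounded[OF Wc S(1)] by blast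
      have \<kappa>_sq: "sq_int M (\<lambda>x. \<kappa> x * 1)" by (intro \<kappa>_mult_sq continuous_sq continuous_intros)
      then have \<kappa>_int: "integrable M \<kappa>" using sq_int_integrable_self by simp
      have iW: "integrable M (\<lambda>x. \<kappa> x *\<^sub>R W x)"
      proof (rule Bochner_Integration.integrable_bound[where f="\<lambda>x. \<kappa> x * C"])
        show "(\<lambda>x. \<kappa> x *\<^sub>R W x) \<in> borel_measurable M"
          using \<kappa>_int continuous_M[OF Wc] by (intro borel_measurable_scaleR) auto
        show "AE x in M. norm (\<kappa> x *\<^sub>R W x) \<le> norm (\<kappa> x * C)"
        proof (rule AE_I2)
          fix x
          have "norm (W x) \<le> \<bar>C\<bar>" using C[rule_format, of x] by auto
          then show "norm (\<kappa> x *\<^sub>R W x) \<le> norm (\<kappa> x * C)" by (simp add: abs_mult mult_left_mono)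
        qed
      qed (use \<kappa>_int in auto)
      have fS: "f x = 0" if "x \<notin> S" for x using S that by (simp add: f_def)
      have fc: "continuous_on UNIV f" unfolding f_def[abs_def] by (intro continuous_intros c Dc)
      have lK: "loc_int \<Omega> K" using K(1) by (simp add: weak_grad_def)
      have iK: "integrable M (\<lambda>x. f x *\<^sub>R K x)"
        by (rule loc_int_mult_integrable[OF lK S(1,2) fc fS])
      have "(\<integral>x. \<kappa> x *\<^sub>R W x \<partial>M) = - (\<integral>x. f x *\<^sub>R K x \<partial>M)"
        using K(1) ft unfolding weak_grad_def LINT_M by blast
      then have "(\<integral>x. \<kappa> x *\<^sub>R W x \<partial>M) \<bullet> i = - ((\<integral>x. f x *\<^sub>R K x \<partial>M) \<bullet> i)" by simp
      then have "(\<integral>x. \<kappa> x *\<^sub>R W x \<bullet> i \<partial>M) = - (\<integral>x. f x *\<^sub>R K x \<bullet> i \<partial>M)"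
        using integral_inner_left[OF iW, of i] integral_inner_left[OF iK, of i] by simp
      moreover have "\<kappa> x *\<^sub>R W x \<bullet> i = (\<kappa> x * (D x \<bullet> i)) * (D\<psi> x \<bullet> i) + (\<kappa> x * (H x i \<bullet> i)) * \<psi> x" for x
      proof -
        have "W x \<bullet> i = (D x \<bullet> i) * (D\<psi> x \<bullet> i) + \<psi> x * (H x i \<bullet> i)"
          unfolding Hi[of x i] W_def inner_add_left inner_scaleR_left by simp
        then show ?thesis by (simp add: distrib_left mult_ac)
      qed
      moreover have "f x *\<^sub>R K x \<bullet> i = ((K x \<bullet> i) * (D x \<bullet> i)) * \<psi> x" for x
        by (simp add: f_def mult_ac)
      ultimately have "(\<integral>x. (\<kappa> x * (D x \<bullet> i)) * (D\<psi> x \<bullet> i) + (\<kappa> x * (H x i \<bullet> i)) * \<psi> x \<partial>M)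
        = - (\<integral>x. ((K x \<bullet> i) * (D x \<bullet> i)) * \<psi> x \<partial>M)" by (simp only:)
      then show ?thesis using Bochner_Integration.integral_add[OF int1 int2, of i i] by linarith
    qed
    have "(\<integral>x. g x * \<psi> x \<partial>M) = (\<integral>x. (\<Sum>i\<in>Basis. - ((\<kappa> x * (H x i \<bullet> i)) * \<psi> x) - ((K x \<bullet> i) * (D x \<bullet> i)) * \<psi> x) \<partial>M)"
      by (intro Bochner_Integration.integral_cong refl)
         (simp add: g_def sum_subtractf sum_negf sum_distrib_right[symmetric] left_diff_distrib)
    also have "\<dots> = (\<Sum>i\<in>Basis. \<integral>x. - ((\<kappa> x * (H x i \<bullet> i)) * \<psi> x) - ((K x \<bullet> i) * (D x \<bullet> i)) * \<psi> x \<partial>M)"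
      by (intro Bochner_Integration.integral_sum Bochner_Integration.integrable_diff Bochner_Integration.integrable_minus int2 int3)
    also have "\<dots> = (\<Sum>i\<in>Basis. \<integral>x. (\<kappa> x * (D x \<bullet> i)) * (D\<psi> x \<bullet> i) \<partial>M)"
    proof (intro sum.cong refl)
      fix i :: 'd assume i: "i \<in> Basis"
      show "(\<integral>x. - ((\<kappa> x * (H x i \<bullet> i)) * \<psi> x) - ((K x \<bullet> i) * (D x \<bullet> i)) * \<psi> x \<partial>M) = (\<integral>x. (\<kappa> x * (D x \<bullet> i)) * (D\<psi> x \<bullet> i) \<partial>M)"
        unfolding comp[OF i]
        by (subst Bochner_Integration.integral_diff[OF Bochner_Integration.integrable_minus[OF int2] int3[OF i]]) simp
    qed
    finally show ?thesis by simp
  qed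
  \<comment> \<open>\<xi> is itself a test function, so the constant sequence approximates
    it.\<close>
  have "opDG \<xi> g D"
    unfolding opDG_def
    by (intro conjI exI[of _ "\<lambda>_. \<xi>"] exI[of _ "\<lambda>_. D"] allI ballI impI g_sq weak test_fun_sq[OF t] t) simp_all
  then show ?thesis by (auto simp: opD_def)
qed

text \<open>Density follows because \<open>C2\<close> functions of compact support lie in the domain
  and already separate L2 by the fundamental lemma.\<close>

sublocale symmetric_operator M opD
proof
  show "sq_int M v \<and> sq_int M g" if "opD v g" for v g using that by (auto simp: opD_def opDG_def)
  show "AE x in M. r x = 0" if r: "sq_int M r" and z: "\<And>v g. opD v g \<Longrightarrow> (\<integral>x. r x * v x \<partial>M) = 0" for r
    unfolding AE_M
  proof (rule fundamental_lemma[OF \<Omega>_open])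
    have "set_integrable lebesgue \<Omega> r" unfolding set_integrable_M by (rule sq_int_integrable_self[OF r])
    then show "loc_int \<Omega> r"
      unfolding loc_int_def by (intro allI impI) (rule set_integrable_subset, auto intro: lmeasurable_compact fmeasurableD)
    fix f D H assume "C2 f D H" "supp_in \<Omega> f"
    then obtain g where "opD f g" using C2_opD by blast
    then show "(LINT x:\<Omega>|lebesgue. f x * r x) = 0" using z by (simp add: LINT_M mult.commute)
  qed
qed (auto intro: opD_lin opD_sym opD_nonneg opD_cong)

end

section \<open>The graded mesh and its interpolant\<close>

lemma powr_diff_le:
  fixes a b \<gamma> :: real
  assumes "0 \<le> a" "a < b" "1 \<le> \<gamma>"
  shows "b powr \<gamma> - a powr \<gamma> \<le> \<gamma> * b powr (\<gamma> - 1) * (b - a)"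
proof (cases "a = 0")
  case True
  have "b powr \<gamma> = b powr (\<gamma> - 1) * b" using assms powr_add[of b "\<gamma> - 1" 1] by simp
  moreover have "b powr (\<gamma> - 1) * b \<le> \<gamma> * (b powr (\<gamma> - 1) * b)"
    using assms mult_right_mono[of 1 \<gamma> "b powr (\<gamma> - 1) * b"] by simp
  ultimately show ?thesis using True by (simp add: mult.assoc)
next
  case False
  then have a: "0 < a" using assms by simp
  have "\<exists>z>a. z < b \<and> b powr \<gamma> - a powr \<gamma> = (b - a) * (\<gamma> * z powr (\<gamma> - 1))"
    using assms a by (intro MVT2) (auto intro!: has_real_derivative_powr)
  then obtain z where z: "a < z" "z < b" "b powr \<gamma> - a powr \<gamma> = (b - a) * (\<gamma> * z powr (\<gamma> - 1))" by auto
  have "z powr (\<gamma> - 1) \<le> b powr (\<gamma> - 1)" using z a assms by (intro powr_mono2) auto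
  then have "(b - a) * (\<gamma> * z powr (\<gamma> - 1)) \<le> (b - a) * (\<gamma> * b powr (\<gamma> - 1))"
    using assms by (intro mult_left_mono) auto
  then show ?thesis using z by (simp add: mult_ac)
qed

text \<open>By the mean value theorem a step from n \<tau> to (n + 1) \<tau> has image of length at
  most \<gamma> ((n + 1) \<tau>) powr (\<gamma> - 1) times \<tau>, and (n + 1) \<tau> is at most T
  powr (1/\<gamma>). This fixes the width \<open>k\<close> as a multiple of \<tau>.\<close>

lemma tnode_mesh:
  assumes T: "0 < T" and \<gamma>: "1 \<le> \<gamma>" and N: "1 \<le> N"
  shows "time_mesh (tnode T \<gamma> N) N (\<gamma> * T powr ((\<gamma> - 1) / \<gamma>) * mesh_tau T \<gamma> N) T"
    and "tnode T \<gamma> N i < tnode T \<gamma> N (Suc i)"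
proof -
  let ?\<tau> = "mesh_tau T \<gamma> N"
  have \<tau>: "0 < ?\<tau>" using T N by (simp add: mesh_tau_def)
  show less: "tnode T \<gamma> N i < tnode T \<gamma> N (Suc i)" for i
    unfolding tnode_def using \<tau> \<gamma> by (intro powr_less_mono2) (auto simp: mult_strict_right_mono)
  have N\<tau>: "real N * ?\<tau> = T powr (1 / \<gamma>)" using N by (simp add: mesh_tau_def)
  show "time_mesh (tnode T \<gamma> N) N (\<gamma> * T powr ((\<gamma> - 1) / \<gamma>) * ?\<tau>) T"
  proof
    show "tnode T \<gamma> N 0 = 0" by (simp add: tnode_def)
    show "tnode T \<gamma> N N = T" unfolding tnode_def N\<tau> using T \<gamma> by (simp add: powr_powr)
    fix n assume n: "n < N"
    have le: "real (Suc n) * ?\<tau> \<le> T powr (1 / \<gamma>)"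
      unfolding N\<tau>[symmetric] using n \<tau> by (intro mult_right_mono) auto
    have "tnode T \<gamma> N (Suc n) - tnode T \<gamma> N n \<le> \<gamma> * (real (Suc n) * ?\<tau>) powr (\<gamma> - 1) * (real (Suc n) * ?\<tau> - real n * ?\<tau>)"
      unfolding tnode_def using \<tau> \<gamma> by (intro powr_diff_le) (auto simp: mult_strict_right_mono)
    also have "real (Suc n) * ?\<tau> - real n * ?\<tau> = ?\<tau>" by (simp add: distrib_right)
    also have "\<gamma> * (real (Suc n) * ?\<tau>) powr (\<gamma> - 1) * ?\<tau> \<le> \<gamma> * (T powr (1 / \<gamma>)) powr (\<gamma> - 1) * ?\<tau>"
      using \<gamma> \<tau> le by (intro mult_right_mono mult_left_mono powr_mono2) auto
    also have "(T powr (1 / \<gamma>)) powr (\<gamma> - 1) = T powr ((\<gamma> - 1) / \<gamma>)" by (simp add: powr_powr)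
    finally show "tnode T \<gamma> N (Suc n) - tnode T \<gamma> N n \<le> \<gamma> * T powr ((\<gamma> - 1) / \<gamma>) * ?\<tau>" .
  qed (use less N in auto)
qed

text \<open>At an interior node the least index selects the interval on the left. The formula for
  the interval on the right gives the same nodal value, so it may be used on closed intervals; at t
  = 0 the first interval is selected.\<close>

lemma interp_eq:
  assumes T: "0 < T" and \<gamma>: "1 \<le> \<gamma>" and N: "1 \<le> N"
    and t: "tnode T \<gamma> N n \<le> t" "t \<le> tnode T \<gamma> N (Suc n)"
  shows "interp T \<gamma> N v t x = ((tnode T \<gamma> N (Suc n) - t) * v (tnode T \<gamma> N n) x
     + (t - tnode T \<gamma> N n) * v (tnode T \<gamma> N (Suc n)) x) / (tnode T \<gamma> N (Suc n) - tnode T \<gamma> N n)"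
proof -
  let ?t = "tnode T \<gamma> N"
  have less: "?t i < ?t (Suc i)" for i by (rule tnode_mesh(2)[OF T \<gamma> N])
  then have mono: "?t i < ?t j \<longleftrightarrow> i < j" for i j
    using lift_Suc_mono_less_iff[of ?t i j] by simp
  show ?thesis
  proof (cases "?t n < t \<or> n = 0")
    case True
    have "(LEAST j. 1 \<le> j \<and> t \<le> ?t j) = Suc n"
    proof (rule Least_equality)
      fix j assume j: "1 \<le> j \<and> t \<le> ?t j"
      show "Suc n \<le> j"
      proof (cases "n = 0")
        case False
        then have "?t n < ?t j" using True j by auto
        then show ?thesis unfolding mono by simp
      qed (use j in auto)
    qed (use t in auto)
    then show ?thesis by (simp add: interp_def Let_def)
  next
    case False
    then obtain m where m: "n = Suc m" and tn: "t = ?t n" using t by (cases n) auto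
    have "(LEAST j. 1 \<le> j \<and> t \<le> ?t j) = n"
    proof (rule Least_equality)
      fix j assume j: "1 \<le> j \<and> t \<le> ?t j"
      then show "n \<le> j" using mono[of j n] tn by linarith
    qed (use tn m in auto)
    then show ?thesis using less[of m] less[of n] by (simp add: interp_def Let_def m tn)
  qed
qed

section \<open>From the given functions to the abstract problem\<close>

context elliptic
begin

lemma st_meas_M:
  assumes "st_meas v" shows "case_prod v \<in> borel_measurable (borel \<Otimes>\<^sub>M M)"
proof -
  have [measurable]: "(\<lambda>x. x) \<in> M \<rightarrow>\<^sub>M borel"
    by (intro measurable_restrict_space1 measurable_completion) simp
  have "(\<lambda>p. v (fst p) (snd p)) \<in> borel_measurable (borel \<Otimes>\<^sub>M borel)"
    using assms by (simp add: st_meas_def borel_prod)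
  moreover have "(\<lambda>p. (fst p, snd p)) \<in> borel \<Otimes>\<^sub>M M \<rightarrow>\<^sub>M borel \<Otimes>\<^sub>M borel"
    by measurable
  ultimately have "(\<lambda>p. v (fst p) (snd p)) \<circ> (\<lambda>p. (fst p, snd p)) \<in> borel_measurable (borel \<Otimes>\<^sub>M M)"
    by (rule measurable_comp[rotated])
  then show ?thesis by (simp add: comp_def case_prod_unfold)
qed

lemma l2_norm_M: "(l2_norm \<Omega> v)\<^sup>2 = (\<integral>x. (v x)\<^sup>2 \<partial>M)"
  by (simp add: l2_norm_def LINT_M)

lemma l2_norm_tendsto_0: "((\<lambda>i. l2_norm \<Omega> (v i)) \<longlongrightarrow> 0) F \<Longrightarrow> ((\<lambda>i. \<integral>x. (v i x)\<^sup>2 \<partial>M) \<longlongrightarrow> 0) F"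
  using tendsto_power[of "\<lambda>i. l2_norm \<Omega> (v i)" 0 F 2] by (simp add: l2_norm_M)

lemma bounded_of_continuous:
  assumes sq: "\<And>t. sq_int M (v t)"
    and c: "\<And>t. t \<in> {0..T} \<Longrightarrow> ((\<lambda>s. \<integral>x. (v s x - v t x)\<^sup>2 \<partial>M) \<longlongrightarrow> 0) (at t within {0..T})"
  shows "\<exists>B\<ge>0. \<forall>t\<in>{0..T::real}. (\<integral>x. (v t x)\<^sup>2 \<partial>M) \<le> B"
proof -
  have "continuous_on {0..T} (\<lambda>t. \<integral>x. (v t x)\<^sup>2 \<partial>M)"
    unfolding continuous_on_def by (intro ballI sq_int_tendsto_norm sq c)
  then have "bounded ((\<lambda>t. \<integral>x. (v t x)\<^sup>2 \<partial>M) ` {0..T})"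
    by (intro compact_imp_bounded compact_continuous_image) auto
  then obtain B where "\<forall>t\<in>{0..T}. \<bar>\<integral>x. (v t x)\<^sup>2 \<partial>M\<bar> \<le> B" by (auto simp: bounded_iff)
  then have "\<forall>t\<in>{0..T}. (\<integral>x. (v t x)\<^sup>2 \<partial>M) \<le> max B 0" by fastforce
  then show ?thesis by (intro exI[of _ "max B 0"]) auto
qed

end

text \<open>Strong differentiability provides square-integrable quotients only for small steps; at
  the other indices the limit itself is substituted.\<close>

lemma sq_int_tendsto_inner_eventually:
  assumes v: "\<forall>\<^sub>F i in F. sq_int M (v i)" and w: "sq_int M w" and u: "sq_int M u"
    and lim: "((\<lambda>i. \<integral>x. (v i x - w x)\<^sup>2 \<partial>M) \<longlongrightarrow> 0) F"
  shows "((\<lambda>i. \<integral>x. v i x * u x \<partial>M) \<longlongrightarrow> (\<integral>x. w x * u x \<partial>M)) F"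
proof -
  define v' where "v' i = (if sq_int M (v i) then v i else w)" for i
  have ev: "\<forall>\<^sub>F i in F. v' i = v i" using v by eventually_elim (simp add: v'_def)
  have "((\<lambda>i. \<integral>x. (v' i x - w x)\<^sup>2 \<partial>M) \<longlongrightarrow> 0) F"
    by (rule Lim_transform_eventually[OF lim]) (use ev in eventually_elim, simp)
  then have "((\<lambda>i. \<integral>x. v' i x * u x \<partial>M) \<longlongrightarrow> (\<integral>x. w x * u x \<partial>M)) F"
    by (intro sq_int_tendsto_inner w u) (auto simp: v'_def w)
  then show ?thesis
    by (rule Lim_transform_eventually) (use ev in eventually_elim, simp)
qed

text \<open>\<eta>, \<open>y\<close>, \<open>Y\<close> and the nodes are parameters tied down by
  equations, so that the expressions of the final statement can be inserted literally.\<close>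

locale discrete_dual = elliptic \<Omega> \<kappa> for \<Omega> :: "'d::euclidean_space set" and \<kappa> +
  fixes T \<gamma> \<alpha> :: real and N :: nat and u0 :: "'d \<Rightarrow> real"
    and u U \<phi> dJ Yp AY AYp \<eta> y Y :: "real \<Rightarrow> 'd \<Rightarrow> real" and tn :: "nat \<Rightarrow> real"
  assumes T: "0 < T" and \<gamma>: "1 \<le> \<gamma>" and \<alpha>: "0 < \<alpha>" "\<alpha> < 1" and N: "1 \<le> N"
    and tn_eq: "tn = tnode T \<gamma> N" and \<eta>_eq: "\<eta> = (\<lambda>t x. u t x - U t x)"
    and y_eq: "y = (\<lambda>t x. \<phi> 0 x + (LINT s:{0..t}|lborel. \<phi> s x))"
    and Y_eq: "Y = (\<lambda>t x. y t x - interp T \<gamma> N y t x)"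
    and u0: "L2 \<Omega> u0" and u_meas: "st_meas u" and u_cont: "l2_cont_on \<Omega> {0..T} u"
    and U0: "U 0 = u0"
    and U_lin: "\<forall>n\<in>{1..N}. \<forall>t\<in>{tn (n - 1)..tn n}.
         U t = (\<lambda>x. ((tn n - t) * U (tn (n - 1)) x + (t - tn (n - 1)) * U (tn n) x)
                     / (tn n - tn (n - 1)))"
    and U_avg: "\<forall>n\<in>{1..N}. \<exists>g. opA \<Omega> \<kappa> (\<lambda>x. (U (tn n) x + U (tn (n - 1)) x) / 2) g"
    and \<phi>_meas: "st_meas \<phi>" and \<phi>_cont: "l2_cont_on \<Omega> {0..T} \<phi>" and \<phi>_T: "ae_eq \<Omega> (\<phi> T) (\<lambda>x. 0)"
    and dual: "\<forall>t\<in>{0<..<T}. has_l2_deriv \<Omega> {0..T} (frac_J T (1 - \<alpha>) \<phi>) (dJ t) t \<and>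
         (\<exists>g. opA \<Omega> \<kappa> (\<phi> t) g \<and> ae_eq \<Omega> (\<lambda>x. - dJ t x + g x) (\<eta> t))"
    and Yp_meas: "st_meas Yp" and AY_meas: "st_meas AY" and AYp_meas: "st_meas AYp"
    and Yp: "\<forall>t\<in>{0<..<T} - tn ` {0..N}. has_l2_deriv \<Omega> {0..T} Y (Yp t) t \<and> opA \<Omega> \<kappa> (Yp t) (AYp t)"
    and AY: "\<forall>t\<in>{0..T}. opA \<Omega> \<kappa> (Y t) (AY t)"
begin

definition k :: real where "k = \<gamma> * T powr ((\<gamma> - 1) / \<gamma>) * mesh_tau T \<gamma> N"

sublocale mesh: time_mesh tn N k T
  unfolding tn_eq k_def by (rule tnode_mesh(1)[OF T \<gamma> N])

lemma tn_strict: "tn i < tn j \<longleftrightarrow> i < j"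
  using lift_Suc_mono_less_iff[of tn i j] tnode_mesh(2)[OF T \<gamma> N] by (simp add: tn_eq)

text \<open>Values outside [0,T] are not constrained by the hypotheses; extension by zero makes
  whole-line convolutions meaningful.\<close>

definition ext :: "(real \<Rightarrow> 'd \<Rightarrow> real) \<Rightarrow> real \<Rightarrow> 'd \<Rightarrow> real" where
  "ext v t x = indicator {0..T} t * v t x"

lemma ext_in: "t \<in> {0..T} \<Longrightarrow> ext v t = v t"
  and ext_out: "t \<notin> {0..T} \<Longrightarrow> ext v t x = 0"
  by (auto simp: ext_def fun_eq_iff)

lemma ext_meas: "case_prod v \<in> borel_measurable (borel \<Otimes>\<^sub>M M) \<Longrightarrow> case_prod (ext v) \<in> borel_measurable (borel \<Otimes>\<^sub>M M)"
proof -
  assume [measurable]: "case_prod v \<in> borel_measurable (borel \<Otimes>\<^sub>M M)"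
  show ?thesis unfolding ext_def[abs_def] by measurable
qed

lemma ext_sq: "(\<And>t. t \<in> {0..T} \<Longrightarrow> sq_int M (v t)) \<Longrightarrow> sq_int M (ext v t)"
proof -
  assume sq: "\<And>t. t \<in> {0..T} \<Longrightarrow> sq_int M (v t)"
  show ?thesis
  proof (cases "t \<in> {0..T}")
    case False
    then have "ext v t = (\<lambda>x. 0)" by (simp add: fun_eq_iff ext_out)
    then show ?thesis by simp
  qed (simp add: ext_in sq)
qed

lemma ext_tendsto:
  assumes t: "t \<in> {0..T}" and lim: "((\<lambda>s. \<integral>x. (v s x - v t x)\<^sup>2 \<partial>M) \<longlongrightarrow> 0) (at t within {0..T})"
  shows "((\<lambda>s. \<integral>x. (ext v s x - ext v t x)\<^sup>2 \<partial>M) \<longlongrightarrow> 0) (at t within {0..T})"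
proof (rule Lim_transform_eventually[OF lim])
  have "\<forall>\<^sub>F s in at t within {0..T}. s \<in> {0..T}" by (auto simp: eventually_at_filter)
  then show "\<forall>\<^sub>F s in at t within {0..T}. (\<integral>x. (v s x - v t x)\<^sup>2 \<partial>M) = (\<integral>x. (ext v s x - ext v t x)\<^sup>2 \<partial>M)"
    by eventually_elim (use t in \<open>simp only: ext_in\<close>)
qed

lemma l2_cont_M:
  assumes "l2_cont_on \<Omega> {0..T} v" "t \<in> {0..T}"
  shows "sq_int M (v t)" "((\<lambda>s. \<integral>x. (v s x - v t x)\<^sup>2 \<partial>M) \<longlongrightarrow> 0) (at t within {0..T})"
proof -
  show "sq_int M (v t)" using assms by (auto simp: l2_cont_on_def L2_M)
  have "((\<lambda>s. l2_norm \<Omega> (\<lambda>x. v s x - v t x)) \<longlongrightarrow> 0) (at t within {0..T})"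
    using assms by (auto simp: l2_cont_on_def)
  then show "((\<lambda>s. \<integral>x. (v s x - v t x)\<^sup>2 \<partial>M) \<longlongrightarrow> 0) (at t within {0..T})"
    by (rule l2_norm_tendsto_0)
qed

text \<open>The scheme controls midpoints, which lie in the domain and so in L2. Nodal values follow
  by induction from the initial value, each being twice a midpoint minus the preceding node.\<close>

lemma U_node_sq: "n \<le> N \<Longrightarrow> sq_int M (U (tn n))"
proof (induction n)
  case 0
  then show ?case using u0 U0 by (simp add: mesh.tn_0 L2_M)
next
  case (Suc n)
  then obtain g where "opA \<Omega> \<kappa> (\<lambda>x. (U (tn (Suc n)) x + U (tn n) x) / 2) g"
    using U_avg[rule_format, of "Suc n"] by auto
  then have a: "sq_int M (\<lambda>x. (U (tn (Suc n)) x + U (tn n) x) / 2)"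
    by (auto simp: opA_def H10_def L2_M)
  have "sq_int M (\<lambda>x. 2 * ((U (tn (Suc n)) x + U (tn n) x) / 2) + (-1) * U (tn n) x)"
    using Suc by (intro sq_int_add sq_int_scale a) auto
  also have "(\<lambda>x. 2 * ((U (tn (Suc n)) x + U (tn n) x) / 2) + (-1) * U (tn n) x) = U (tn (Suc n))"
    by (simp add: fun_eq_iff field_simps)
  finally show ?case .
qed

text \<open>Only nodal square integrability of \<open>U\<close> is available, so its joint measurability and continuity
  are read off from an expansion in fixed functions with continuous coefficients.\<close>

definition ramp :: "nat \<Rightarrow> real \<Rightarrow> real" where
  "ramp n t = max 0 (min 1 ((t - tn n) / (tn (Suc n) - tn n)))"

definition dU :: "nat \<Rightarrow> 'd \<Rightarrow> real" where
  "dU n x = U (tn (Suc n)) x - U (tn n) x"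

lemma ramp_cont: "continuous_on UNIV (ramp n)"
  unfolding ramp_def[abs_def] using mesh.tn_less tn_strict[of n "Suc n"] by (intro continuous_intros) auto

lemma dU_sq: "n < N \<Longrightarrow> sq_int M (dU n)"
  unfolding dU_def[abs_def] by (intro sq_int_diff U_node_sq) auto

text \<open>Ramps of intervals already passed equal 1 and their jumps telescope to the last node;
  ramps of later intervals are 0.\<close>

lemma U_ramp:
  assumes t: "t \<in> {0..T}"
  shows "U t x = u0 x + (\<Sum>n<N. ramp n t * dU n x)"
proof -
  obtain m where m: "m < N" "tn m \<le> t" "t \<le> tn (Suc m)"
  proof (cases "t = 0")
    case True
    then show ?thesis using that[of 0] N mesh.tn_less[of 0] by (auto simp: mesh.tn_0)
  next
    case False
    then show ?thesis using that mesh.mesh_cover_Ioc[of t] t by (auto intro: less_imp_le)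
  qed
  have l: "tn m < tn (Suc m)" by (simp add: tn_strict)
  have r1: "ramp n t = 1" if "n < m" for n
  proof -
    have "tn (Suc n) \<le> tn m" using mesh.tn_mono[of "Suc n" m] that m by simp
    then have "1 \<le> (t - tn n) / (tn (Suc n) - tn n)" using m tn_strict[of n "Suc n"] by (simp add: le_divide_eq)
    then show ?thesis by (simp add: ramp_def)
  qed
  have r0: "ramp n t = 0" if "m < n" "n < N" for n
  proof -
    have "tn (Suc m) \<le> tn n" using mesh.tn_mono[of "Suc m" n] that by simp
    then have "(t - tn n) / (tn (Suc n) - tn n) \<le> 0" using m tn_strict[of n "Suc n"] by (simp add: divide_le_0_iff)
    then show ?thesis by (simp add: ramp_def)
  qed
  have rm: "ramp m t = (t - tn m) / (tn (Suc m) - tn m)"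
    using m l by (simp add: ramp_def divide_le_eq)
  have "(\<Sum>n<N. ramp n t * dU n x) = (\<Sum>n<Suc m. ramp n t * dU n x)"
    using m r0 by (intro sum.mono_neutral_right) auto
  also have "\<dots> = (\<Sum>n<m. dU n x) + ramp m t * dU m x"
    using r1 by simp
  also have "(\<Sum>n<m. dU n x) = U (tn m) x - u0 x"
    using sum_lessThan_telescope[of "\<lambda>n. U (tn n) x" m] by (simp add: dU_def mesh.tn_0 U0)
  finally have eq: "u0 x + (\<Sum>n<N. ramp n t * dU n x) = U (tn m) x + (t - tn m) / (tn (Suc m) - tn m) * (U (tn (Suc m)) x - U (tn m) x)"
    by (simp add: rm dU_def)
  have "U t x = ((tn (Suc m) - t) * U (tn m) x + (t - tn m) * U (tn (Suc m)) x) / (tn (Suc m) - tn m)"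
    using U_lin[rule_format, of "Suc m" t] m by simp
  also have "\<dots> = U (tn m) x + (t - tn m) / (tn (Suc m) - tn m) * (U (tn (Suc m)) x - U (tn m) x)"
    using l by (simp add: field_simps)
  finally show ?thesis using eq by simp
qed

definition U' :: "real \<Rightarrow> 'd \<Rightarrow> real" where
  "U' t x = u0 x + (\<Sum>n<N. ramp n t * dU n x)"

lemma U'_eq: "t \<in> {0..T} \<Longrightarrow> U' t = U t"
  using U_ramp by (auto simp: U'_def fun_eq_iff)

lemma sum_sq: "finite I \<Longrightarrow> (\<And>i. i \<in> I \<Longrightarrow> sq_int M (f i)) \<Longrightarrow> sq_int M (\<lambda>x. \<Sum>i\<in>I. f i x)"
  by (induction I rule: finite_induct) (auto intro: sq_int_add)

lemma U'_sq: "sq_int M (U' t)"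
  unfolding U'_def[abs_def] using u0 by (intro sq_int_add sum_sq sq_int_scale dU_sq) (auto simp: L2_M)

lemma U'_meas: "case_prod U' \<in> borel_measurable (borel \<Otimes>\<^sub>M M)"
proof -
  have [measurable]: "u0 \<in> borel_measurable M" using u0 by (simp add: L2_M sq_int_def)
  have [measurable]: "dU n \<in> borel_measurable M" if "n \<in> {..<N}" for n using dU_sq[of n] that by (simp add: sq_int_def)
  have [measurable]: "ramp n \<in> borel_measurable borel" for n by (rule borel_measurable_continuous_onI[OF ramp_cont])
  show ?thesis unfolding U'_def[abs_def] by measurable
qed

text \<open>Only the finitely many scalar coefficients vary with time; the factor \<open>N\<close>
  is Cauchy-Schwarz for a sum of \<open>N\<close> terms.\<close>

lemma U'_cont: "((\<lambda>s. \<integral>x. (U' s x - U' t x)\<^sup>2 \<partial>M) \<longlongrightarrow> 0) (at t within S)"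
proof -
  have le: "(\<integral>x. (U' s x - U' t x)\<^sup>2 \<partial>M) \<le> N * (\<Sum>n<N. (ramp n s - ramp n t)\<^sup>2 * (\<integral>x. (dU n x)\<^sup>2 \<partial>M))" for s
  proof -
    have i: "integrable M (\<lambda>x. (ramp n s - ramp n t)\<^sup>2 * (dU n x)\<^sup>2)" if "n \<in> {..<N}" for n
      using dU_sq[of n] that by (auto simp: sq_int_def)
    have "(\<integral>x. (U' s x - U' t x)\<^sup>2 \<partial>M) \<le> (\<integral>x. N * (\<Sum>n<N. (ramp n s - ramp n t)\<^sup>2 * (dU n x)\<^sup>2) \<partial>M)"
    proof (rule integral_mono)
      show "integrable M (\<lambda>x. (U' s x - U' t x)\<^sup>2)" using sq_int_diff[OF U'_sq U'_sq] by (auto simp: sq_int_def)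
      show "integrable M (\<lambda>x. N * (\<Sum>n<N. (ramp n s - ramp n t)\<^sup>2 * (dU n x)\<^sup>2))"
        using i by (intro integrable_mult_right Bochner_Integration.integrable_sum) auto
      fix x
      have "U' s x - U' t x = (\<Sum>n<N. (ramp n s - ramp n t) * dU n x)"
        by (simp add: U'_def sum_subtractf left_diff_distrib)
      then show "(U' s x - U' t x)\<^sup>2 \<le> N * (\<Sum>n<N. (ramp n s - ramp n t)\<^sup>2 * (dU n x)\<^sup>2)"
        using Cauchy_Schwarz_ineq_sum[of "\<lambda>_. 1" "\<lambda>n. (ramp n s - ramp n t) * dU n x" "{..<N}"]
        by (simp add: power_mult_distrib)
    qed
    also have "\<dots> = N * (\<Sum>n<N. (ramp n s - ramp n t)\<^sup>2 * (\<integral>x. (dU n x)\<^sup>2 \<partial>M))"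
      using i by (simp add: Bochner_Integration.integral_sum)
    finally show ?thesis .
  qed
  have "((\<lambda>s. N * (\<Sum>n<N. (ramp n s - ramp n t)\<^sup>2 * (\<integral>x. (dU n x)\<^sup>2 \<partial>M))) \<longlongrightarrow> N * (\<Sum>n<N. (ramp n t - ramp n t)\<^sup>2 * (\<integral>x. (dU n x)\<^sup>2 \<partial>M))) (at t within S)"
  proof (intro tendsto_intros)
    have "isCont (ramp n) t" for n using ramp_cont by (simp add: continuous_on_eq_continuous_at)
    then show "(ramp n \<longlongrightarrow> ramp n t) (at t within S)" for n
      unfolding isCont_def by (rule tendsto_within_subset[where S=UNIV]) auto
  qed
  then have "((\<lambda>s. N * (\<Sum>n<N. (ramp n s - ramp n t)\<^sup>2 * (\<integral>x. (dU n x)\<^sup>2 \<partial>M))) \<longlongrightarrow> 0) (at t within S)" by simp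
  from tendsto_sandwich[OF _ _ tendsto_const this] show ?thesis using le by simp
qed

definition \<eta>' :: "real \<Rightarrow> 'd \<Rightarrow> real" where "\<eta>' = ext (\<lambda>t x. u t x - U' t x)"

definition \<phi>' :: "real \<Rightarrow> 'd \<Rightarrow> real" where "\<phi>' = ext \<phi>"

lemma \<eta>'_eq: "t \<in> {0..T} \<Longrightarrow> \<eta>' t = \<eta> t"
  by (simp add: \<eta>'_def ext_in U'_eq \<eta>_eq)

lemma \<phi>'_eq: "t \<in> {0..T} \<Longrightarrow> \<phi>' t = \<phi> t"
  by (simp add: \<phi>'_def ext_in)

lemma \<eta>'_meas: "case_prod \<eta>' \<in> borel_measurable (borel \<Otimes>\<^sub>M M)"
proof -
  have [measurable]: "case_prod U' \<in> borel_measurable (borel \<Otimes>\<^sub>M M)" by (rule U'_meas)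
  have [measurable]: "case_prod u \<in> borel_measurable (borel \<Otimes>\<^sub>M M)" by (rule st_meas_M[OF u_meas])
  show ?thesis unfolding \<eta>'_def by (rule ext_meas) measurable
qed

lemma \<phi>'_meas [measurable]: "case_prod \<phi>' \<in> borel_measurable (borel \<Otimes>\<^sub>M M)"
  unfolding \<phi>'_def by (rule ext_meas[OF st_meas_M[OF \<phi>_meas]])

lemma \<eta>'_sq: "sq_int M (\<eta>' t)"
  unfolding \<eta>'_def by (intro ext_sq sq_int_diff U'_sq l2_cont_M(1)[OF u_cont])

lemma \<phi>'_sq: "sq_int M (\<phi>' t)"
  unfolding \<phi>'_def by (intro ext_sq l2_cont_M(1)[OF \<phi>_cont])

lemma \<phi>'_tendsto: "t \<in> {0..T} \<Longrightarrow> ((\<lambda>s. \<integral>x. (\<phi>' s x - \<phi>' t x)\<^sup>2 \<partial>M) \<longlongrightarrow> 0) (at t within {0..T})"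
  unfolding \<phi>'_def by (intro ext_tendsto l2_cont_M(2)[OF \<phi>_cont])

lemma \<eta>'_tendsto:
  assumes t: "t \<in> {0..T}" shows "((\<lambda>s. \<integral>x. (\<eta>' s x - \<eta>' t x)\<^sup>2 \<partial>M) \<longlongrightarrow> 0) (at t within {0..T})"
proof -
  let ?u = "ext u"
  have sq: "sq_int M (?u s)" for s by (intro ext_sq l2_cont_M(1)[OF u_cont])
  have lim: "((\<lambda>s. 2 * (\<integral>x. (?u s x - ?u t x)\<^sup>2 \<partial>M) + 2 * (\<integral>x. (U' s x - U' t x)\<^sup>2 \<partial>M)) \<longlongrightarrow> 2 * 0 + 2 * 0) (at t within {0..T})"
    by (intro tendsto_add tendsto_mult tendsto_const ext_tendsto t l2_cont_M(2)[OF u_cont] U'_cont)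
  have "\<forall>\<^sub>F s in at t within {0..T}. s \<in> {0..T}" by (auto simp: eventually_at_filter)
  then have ev: "\<forall>\<^sub>F s in at t within {0..T}. (\<integral>x. (\<eta>' s x - \<eta>' t x)\<^sup>2 \<partial>M)
      \<le> 2 * (\<integral>x. (?u s x - ?u t x)\<^sup>2 \<partial>M) + 2 * (\<integral>x. (U' s x - U' t x)\<^sup>2 \<partial>M)"
  proof eventually_elim
    case (elim s)
    have e: "\<eta>' s x - \<eta>' t x = (?u s x - ?u t x) - (U' s x - U' t x)" for x
      using elim t by (simp add: \<eta>'_def ext_def)
    show ?case unfolding e by (intro sq_int_square_diff_le sq_int_diff sq U'_sq)
  qed
  show ?thesis
    by (rule tendsto_sandwich[OF _ ev tendsto_const lim[unfolded mult_zero_right add_0]]) simp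
qed

text \<open>The extension by zero is glued to \<phi> at \<open>T\<close>, where \<phi> vanishes
  almost everywhere.\<close>

lemma \<phi>'_weak_cont:
  assumes w: "sq_int M w"
  shows "continuous_on {0..} (\<lambda>t. ip (\<phi>' t) w)"
proof -
  have 1: "continuous_on {0..T} (\<lambda>t. ip (\<phi>' t) w)"
    unfolding continuous_on_def by (intro ballI sq_int_tendsto_inner \<phi>'_sq w \<phi>'_tendsto)
  have z: "ip (\<phi>' t) w = 0" if "T \<le> t" for t
  proof (cases "t = T")
    case True
    have "AE x in M. \<phi> T x = 0" using \<phi>_T unfolding ae_eq_def AE_M[symmetric] .
    then have "AE x in M. \<phi>' T x * w x = 0"
      by eventually_elim (use T in \<open>simp add: \<phi>'_eq\<close>)
    then show ?thesis using True by (simp add: integral_eq_zero_AE)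
  next
    case False
    then show ?thesis using that by (simp add: \<phi>'_def ext_out)
  qed
  have "continuous_on {T..} (\<lambda>t::real. 0::real)" by simp
  then have 2: "continuous_on {T..} (\<lambda>t. ip (\<phi>' t) w)"
    by (rule continuous_on_eq) (simp add: z)
  have "continuous_on ({0..T} \<union> {T..}) (\<lambda>t. ip (\<phi>' t) w)"
    by (intro continuous_on_closed_Un 1 2) auto
  moreover have "{0..T} \<union> {T..} = {0..}" using T by auto
  ultimately show ?thesis by simp
qed

lemma bound: "\<exists>B\<ge>0. (\<forall>t. (\<integral>x. (\<phi>' t x)\<^sup>2 \<partial>M) \<le> B) \<and> (\<forall>t. (\<integral>x. (\<eta>' t x)\<^sup>2 \<partial>M) \<le> B)"
proof -
  obtain B1 where B1: "0 \<le> B1" "\<forall>t\<in>{0..T}. (\<integral>x. (\<phi>' t x)\<^sup>2 \<partial>M) \<le> B1"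
    using bounded_of_continuous[OF \<phi>'_sq \<phi>'_tendsto] by auto
  obtain B2 where B2: "0 \<le> B2" "\<forall>t\<in>{0..T}. (\<integral>x. (\<eta>' t x)\<^sup>2 \<partial>M) \<le> B2"
    using bounded_of_continuous[OF \<eta>'_sq \<eta>'_tendsto] by auto
  have "(\<integral>x. (\<phi>' t x)\<^sup>2 \<partial>M) \<le> max B1 B2 \<and> (\<integral>x. (\<eta>' t x)\<^sup>2 \<partial>M) \<le> max B1 B2" for t
  proof (cases "t \<in> {0..T}")
    case True
    then show ?thesis using B1(2)[rule_format, of t] B2(2)[rule_format, of t] by auto
  next
    case False
    then show ?thesis using B1 by (simp add: \<phi>'_def \<eta>'_def ext_out)
  qed
  then show ?thesis using B1 by (intro exI[of _ "max B1 B2"]) auto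
qed

definition zz :: "real \<Rightarrow> 'd \<Rightarrow> real" where
  "zz t x = (\<integral>s. indicator {0..t} s * \<phi>' s x \<partial>lborel)"

lemma zz_sq: "0 \<le> t \<Longrightarrow> sq_int M (zz t)"
  and zz_inner: "0 \<le> t \<Longrightarrow> sq_int M w \<Longrightarrow> ip (zz t) w = (\<integral>s. indicator {0..t} s * ip (\<phi>' s) w \<partial>lborel)"
proof -
  assume t: "0 \<le> t"
  obtain B where B: "0 \<le> B" "\<forall>t. (\<integral>x. (\<phi>' t x)\<^sup>2 \<partial>M) \<le> B" using bound by auto
  have k: "(\<integral>\<^sup>+s. ennreal \<bar>indicator {0..t} s :: real\<bar> \<partial>lborel) \<le> ennreal t" using t by (simp add: ennreal_indicator)
  show "sq_int M (zz t)" unfolding zz_def[abs_def]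
    by (rule weighted_mean_bounded_sq_int[OF \<phi>'_meas _ k t \<phi>'_sq B(2)[rule_format] B(1)]) simp
  show "sq_int M w \<Longrightarrow> ip (zz t) w = (\<integral>s. indicator {0..t} s * ip (\<phi>' s) w \<partial>lborel)" unfolding zz_def[abs_def]
    by (rule weighted_mean_bounded_inner[OF \<phi>'_meas _ k t \<phi>'_sq B(2)[rule_format] B(1)]) simp
qed

lemma y_zz: "t \<in> {0..T} \<Longrightarrow> y t x = \<phi> 0 x + zz t x"
  unfolding y_eq zz_def set_lebesgue_integral_def
  by (simp, intro Bochner_Integration.integral_cong refl) (auto simp: indicator_def \<phi>'_eq)

definition avg' :: "nat \<Rightarrow> 'd \<Rightarrow> real" where
  "avg' n x = (zz (tn (Suc n)) x - zz (tn n) x) / (tn (Suc n) - tn n)"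

lemma node_in: "n < N \<Longrightarrow> tn n \<in> {0..T}" "n < N \<Longrightarrow> tn (Suc n) \<in> {0..T}"
  using mesh.tn_nonneg[of n] mesh.tn_nonneg[of "Suc n"] mesh.tn_le_T[of n] mesh.tn_le_T[of "Suc n"] by auto

lemma avg'_sq: "n < N \<Longrightarrow> sq_int M (avg' n)"
  using sq_int_scale[OF sq_int_diff[OF zz_sq zz_sq], of "tn (Suc n)" "tn n" "inverse (tn (Suc n) - tn n)"] node_in[of n]
  by (simp add: avg'_def[abs_def] divide_inverse mult.commute)

text \<open>Linear interpolation reproduces constants, so the initial value \<phi>(0) in
  \<open>y\<close> cancels and only the primitive of \<phi> remains.\<close>

lemma Y_zz:
  assumes n: "n < N" and t: "tn n \<le> t" "t \<le> tn (Suc n)"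
  shows "Y t x = zz t x - zz (tn n) x - (t - tn n) * avg' n x"
proof -
  have l: "tn n < tn (Suc n)" by (simp add: tn_strict)
  have t': "t \<in> {0..T}" using node_in[OF n] t by auto
  have "Y t x = y t x - ((tn (Suc n) - t) * y (tn n) x + (t - tn n) * y (tn (Suc n)) x) / (tn (Suc n) - tn n)"
    using interp_eq[OF T \<gamma> N, of n t y x] t by (simp add: Y_eq tn_eq)
  also have "\<dots> = y t x - (y (tn n) x + (t - tn n) * ((y (tn (Suc n)) x - y (tn n) x) / (tn (Suc n) - tn n)))"
    using l by (simp add: field_simps)
  finally show ?thesis using node_in[OF n] t' by (simp add: y_zz avg'_def)
qed

lemma not_node: "n < N \<Longrightarrow> tn n < t \<Longrightarrow> t < tn (Suc n) \<Longrightarrow> t \<in> {0<..<T} - tn ` {0..N}"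
proof -
  assume n: "n < N" and t: "tn n < t" "t < tn (Suc n)"
  have "t \<noteq> tn j" for j using t tn_strict[of n j] tn_strict[of j "Suc n"] by auto
  then show ?thesis using node_in[OF n] t by auto
qed

text \<open>Tested with an element of the domain, the difference quotients of \<open>Y\<close> have
  limits given both by \<open>Yp\<close> and by differentiating the scalar primitive of \<phi>. The
  comparison is weak, and density yields equality almost everywhere.\<close>

lemma Yp_avg:
  assumes n: "n < N" and t: "tn n < t" "t < tn (Suc n)"
  shows "AE x in M. Yp t x = \<phi>' t x - avg' n x"
proof (rule AE_eq_of_inner_eq)
  have tT: "0 < t" "t < T" using not_node[OF n t] by auto
  have L: "has_l2_deriv \<Omega> {0..T} Y (Yp t) t" using Yp not_node[OF n t] by blast
  show Yp_sq: "sq_int M (Yp t)" using L by (simp add: has_l2_deriv_def L2_M)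
  show "sq_int M (\<lambda>x. \<phi>' t x - avg' n x)" by (intro sq_int_diff \<phi>'_sq avg'_sq n)
  fix \<xi> h assume \<xi>: "opD \<xi> h"
  have \<xi>_sq: "sq_int M \<xi>" using A_sq_int[OF \<xi>] by simp
  have at0: "at 0 within {h. t + h \<in> {0..T}} = (at 0 :: real filter)"
  proof (rule at_within_open_subset)
    show "{-t<..<T-t} \<subseteq> {h. t + h \<in> {0..T}}" by auto
  qed (use tT in auto)
  have "((\<lambda>h. ip (\<lambda>x. (Y (t + h) x - Y t x) / h) \<xi>) \<longlongrightarrow> ip (Yp t) \<xi>) (at 0)"
  proof (rule sq_int_tendsto_inner_eventually[OF _ Yp_sq \<xi>_sq l2_norm_tendsto_0])
    show "\<forall>\<^sub>F h in at 0. sq_int M (\<lambda>x. (Y (t + h) x - Y t x) / h)"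
      using L unfolding has_l2_deriv_def at0 by (simp add: L2_M)
    show "((\<lambda>h. l2_norm \<Omega> (\<lambda>x. (Y (t + h) x - Y t x) / h - Yp t x)) \<longlongrightarrow> 0) (at 0)"
      using L unfolding has_l2_deriv_def at0 by simp
  qed
  moreover have "((\<lambda>h. ip (\<lambda>x. (Y (t + h) x - Y t x) / h) \<xi>) \<longlongrightarrow> ip (\<lambda>x. \<phi>' t x - avg' n x) \<xi>) (at 0)"
  proof -
    let ?I = "\<lambda>t. \<integral>s. indicator {0..t} s * ip (\<phi>' s) \<xi> \<partial>lborel"
    have "continuous_on {0..T} (\<lambda>t. ip (\<phi>' t) \<xi>)"
      by (rule continuous_on_subset[OF \<phi>'_weak_cont[OF \<xi>_sq]]) auto
    from indefinite_integral_continuous(2)[OF this tT]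
    have "((\<lambda>t. ?I t - t * ip (avg' n) \<xi>) has_real_derivative ip (\<phi>' t) \<xi> - 1 * ip (avg' n) \<xi>) (at t)"
      by (intro DERIV_diff DERIV_cmult_right DERIV_ident)
    then have lim: "((\<lambda>h. ((?I (t + h) - (t + h) * ip (avg' n) \<xi>) - (?I t - t * ip (avg' n) \<xi>)) / h)
        \<longlongrightarrow> ip (\<phi>' t) \<xi> - ip (avg' n) \<xi>) (at 0)"
      by (simp add: DERIV_def)
    have "\<forall>\<^sub>F h in at 0. h \<in> {tn n - t<..<tn (Suc n) - t}"
      using t by (intro eventually_at_in_open') auto
    then have ev: "\<forall>\<^sub>F h in at 0. ((?I (t + h) - (t + h) * ip (avg' n) \<xi>) - (?I t - t * ip (avg' n) \<xi>)) / h
       = ip (\<lambda>x. (Y (t + h) x - Y t x) / h) \<xi>"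
    proof eventually_elim
      case (elim h)
      then have th: "tn n \<le> t + h" "t + h \<le> tn (Suc n)" "0 \<le> t + h" using node_in[OF n] by auto
      have sq: "sq_int M (zz (t + h))" "sq_int M (zz t)" "sq_int M (avg' n)"
        using th tT by (auto intro: zz_sq avg'_sq n)
      have eq: "Y (t + h) x - Y t x = zz (t + h) x - zz t x - h * avg' n x" for x
        using Y_zz[OF n th(1,2), of x] Y_zz[OF n, of t x] t by (simp add: algebra_simps)
      have "ip (\<lambda>x. (Y (t + h) x - Y t x) / h) \<xi> = ip (\<lambda>x. zz (t + h) x - zz t x - h * avg' n x) \<xi> / h"
        unfolding eq by simp
      also have "ip (\<lambda>x. zz (t + h) x - zz t x - h * avg' n x) \<xi> = ip (zz (t + h)) \<xi> - ip (zz t) \<xi> - h * ip (avg' n) \<xi>"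
        by (simp add: ip_diff_left sq sq_int_diff sq_int_scale \<xi>_sq mult.assoc)
      also have "ip (zz (t + h)) \<xi> = ?I (t + h)" by (rule zz_inner[OF th(3) \<xi>_sq])
      also have "ip (zz t) \<xi> = ?I t" using tT by (intro zz_inner \<xi>_sq) simp
      finally show ?case by (simp only:) (simp add: distrib_right)
    qed
    have "ip (\<lambda>x. \<phi>' t x - avg' n x) \<xi> = ip (\<phi>' t) \<xi> - ip (avg' n) \<xi>"
      by (intro ip_diff_left \<phi>'_sq avg'_sq n \<xi>_sq)
    then show ?thesis using Lim_transform_eventually[OF lim ev] by simp
  qed
  ultimately show "ip (Yp t) \<xi> = ip (\<lambda>x. \<phi>' t x - avg' n x) \<xi>"
    by (rule LIM_unique)
qed

text \<open>At an interior time, here the midpoint, both \<phi> and Y' lie in the domain, and their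
  difference is the mean over the interval. No closedness of the operator is invoked.\<close>

lemma avg'_dom: assumes n: "n < N" shows "\<exists>g. opD (avg' n) g"
proof -
  define t where "t = (tn n + tn (Suc n)) / 2"
  have l: "tn n < tn (Suc n)" by (simp add: tn_strict)
  have t: "tn n < t" "t < tn (Suc n)" using l by (auto simp: t_def)
  have tT: "t \<in> {0<..<T} - tn ` {0..N}" by (rule not_node[OF n t])
  have "t \<in> {0<..<T}" using tT by simp
  then obtain g where "opA \<Omega> \<kappa> (\<phi> t) g" using dual by blast
  then have g: "opD (\<phi>' t) g" using opA_imp_opD tT by (simp add: \<phi>'_eq)
  have "opD (Yp t) (AYp t)" using Yp tT opA_imp_opD by blast
  from A_diff[OF g this] have d: "opD (\<lambda>x. \<phi>' t x - Yp t x) (\<lambda>x. g x - AYp t x)" .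
  have "opD (avg' n) (\<lambda>x. g x - AYp t x)"
  proof (rule opD_cong[OF d])
    show "AE x in M. \<phi>' t x - Yp t x = avg' n x" using Yp_avg[OF n t] by eventually_elim simp
    show "avg' n \<in> borel_measurable M" using avg'_sq[OF n] by (simp add: sq_int_def)
    show "(\<lambda>x. g x - AYp t x) \<in> borel_measurable M" using A_sq_int[OF d] by (simp add: sq_int_def)
  qed simp
  then show ?thesis by blast
qed

lemma zz_step:
  assumes n: "n < N" and t: "tn n \<le> t" "t \<le> tn (Suc n)"
  shows "\<exists>g. opD (\<lambda>x. zz t x - zz (tn n) x) g"
proof -
  have "t \<in> {0..T}" using node_in[OF n] t by auto
  then have Y: "opD (Y t) (AY t)" using AY opA_imp_opD by blast
  obtain b where b: "opD (avg' n) b" using avg'_dom[OF n] by blast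
  have "opD (\<lambda>x. 1 * Y t x + (t - tn n) * avg' n x) (\<lambda>x. 1 * AY t x + (t - tn n) * b x)" by (rule A_lin[OF Y b])
  moreover have "(\<lambda>x. 1 * Y t x + (t - tn n) * avg' n x) = (\<lambda>x. zz t x - zz (tn n) x)"
    using Y_zz[OF n t] by auto
  ultimately show ?thesis by auto
qed

lemma zz_0: "zz 0 x = 0"
proof -
  have "zz 0 x = (\<integral>s. 0 \<partial>(lborel :: real measure))"
    unfolding zz_def
  proof (intro integral_cong_AE)
    have "AE s in lborel. s \<noteq> (0::real)" by (rule AE_lborel_singleton)
    then show "AE s in lborel. indicator {0..0} s * \<phi>' s x = 0" by eventually_elim (simp add: indicator_def)
    have "(\<lambda>s. indicator {0..0} s * \<phi>' s x) = (\<lambda>s. indicator {0} s * \<phi>' 0 x)" by (auto simp: indicator_def)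
    then show "(\<lambda>s. indicator {0..0} s * \<phi>' s x) \<in> borel_measurable lborel" by simp
  qed simp
  then show ?thesis by simp
qed

text \<open>\<open>Y\<close> and the interval means lie in the domain, hence so does the increment
  of the primitive from the left node; adding the increments over the preceding intervals reaches
  any time.\<close>

lemma zz_dom: assumes t: "t \<in> {0..T}" shows "\<exists>g. opD (zz t) g"
proof -
  have node: "\<exists>g. opD (zz (tn n)) g" if "n \<le> N" for n
    using that
  proof (induction n)
    case 0
    obtain b where "opD (avg' 0) b" using avg'_dom[of 0] N by auto
    from A_lin[OF this this, of 0 0] have "opD (\<lambda>x. 0) (\<lambda>x. 0)" by simp
    moreover have "zz (tn 0) = (\<lambda>x. 0)" by (auto simp: mesh.tn_0 zz_0)
    ultimately show ?case by auto
  next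
    case (Suc n)
    then obtain g where g: "opD (zz (tn n)) g" by auto
    obtain g' where g': "opD (\<lambda>x. zz (tn (Suc n)) x - zz (tn n) x) g'"
      using zz_step[of n "tn (Suc n)"] Suc mesh.tn_less[of n] by auto
    show ?case using A_lin[OF g g', of 1 1] by auto
  qed
  obtain n where n: "n < N" "tn n \<le> t" "t \<le> tn (Suc n)"
  proof (cases "t = 0")
    case True
    then show ?thesis using that[of 0] N mesh.tn_less[of 0] by (auto simp: mesh.tn_0)
  next
    case False
    then show ?thesis using that mesh.mesh_cover_Ioc[of t] t by (auto intro: less_imp_le)
  qed
  obtain g where g: "opD (zz (tn n)) g" using node[of n] n by auto
  obtain g' where g': "opD (\<lambda>x. zz t x - zz (tn n) x) g'" using zz_step[OF n] by auto
  show ?thesis using A_lin[OF g g', of 1 1] by auto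
qed

definition FF :: "real \<Rightarrow> 'd \<Rightarrow> real" where
  "FF t x = (\<integral>s. fker (1 - \<alpha>) (s - t) * \<phi>' s x \<partial>lborel)"

lemma fker_omega: "0 \<le> r \<Longrightarrow> fker \<beta> r = omega \<beta> r"
  by (auto simp: fker_def omega_def)

lemma FF_eq:
  assumes t: "t \<in> {0..T}" shows "frac_J T (1 - \<alpha>) \<phi> t x = FF t x"
  unfolding frac_J_def FF_def set_lebesgue_integral_def
proof (intro Bochner_Integration.integral_cong refl)
  fix s show "indicator {t..T} s *\<^sub>R (omega (1 - \<alpha>) (s - t) * \<phi> s x) = fker (1 - \<alpha>) (s - t) * \<phi>' s x"
  proof (cases "s \<in> {t..T}")
    case True
    then show ?thesis using t by (simp add: fker_omega \<phi>'_eq)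
  next
    case False
    then have "fker (1 - \<alpha>) (s - t) = 0 \<or> \<phi>' s x = 0" using t by (auto simp: fker_def \<phi>'_def ext_out)
    then show ?thesis using False by auto
  qed
qed

text \<open>A choice of the image of \<phi>(t) for each \<open>t\<close> on its own, without any
  claim of measurability in time.\<close>

definition GG :: "real \<Rightarrow> 'd \<Rightarrow> real" where
  "GG t = (SOME g. opA \<Omega> \<kappa> (\<phi> t) g \<and> ae_eq \<Omega> (\<lambda>x. - dJ t x + g x) (\<eta> t))"

lemma GG:
  assumes "0 < t" "t < T"
  shows "opD (\<phi>' t) (GG t)" "AE x in M. dJ t x = GG t x - \<eta>' t x"
proof -
  have "\<exists>g. opA \<Omega> \<kappa> (\<phi> t) g \<and> ae_eq \<Omega> (\<lambda>x. - dJ t x + g x) (\<eta> t)" using dual assms by simp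
  from someI_ex[OF this] have g: "opA \<Omega> \<kappa> (\<phi> t) (GG t)" "ae_eq \<Omega> (\<lambda>x. - dJ t x + GG t x) (\<eta> t)"
    unfolding GG_def by auto
  show "opD (\<phi>' t) (GG t)" using opA_imp_opD[OF g(1)] assms by (simp add: \<phi>'_eq)
  have "AE x in M. - dJ t x + GG t x = \<eta> t x" using g(2) unfolding ae_eq_def AE_M[symmetric] .
  then show "AE x in M. dJ t x = GG t x - \<eta>' t x"
    by eventually_elim (use assms in \<open>simp add: \<eta>'_eq\<close>)
qed

lemma FF_deriv:
  assumes t: "0 < t" "t < T"
  shows "((\<lambda>h. \<integral>x. ((FF (t + h) x - FF t x) / h - (GG t x - \<eta>' t x))\<^sup>2 \<partial>M) \<longlongrightarrow> 0) (at 0)"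
proof -
  let ?J = "frac_J T (1 - \<alpha>) \<phi>"
  have L: "has_l2_deriv \<Omega> {0..T} ?J (dJ t) t" using dual t by simp
  have at0: "at 0 within {h. t + h \<in> {0..T}} = (at 0 :: real filter)"
  proof (rule at_within_open_subset)
    show "{-t<..<T-t} \<subseteq> {h. t + h \<in> {0..T}}" by auto
  qed (use t in auto)
  have lim: "((\<lambda>h. \<integral>x. ((?J (t + h) x - ?J t x) / h - dJ t x)\<^sup>2 \<partial>M) \<longlongrightarrow> 0) (at 0)"
    using L unfolding has_l2_deriv_def at0 by (intro l2_norm_tendsto_0) simp
  have sq: "\<forall>\<^sub>F h in at 0. sq_int M (\<lambda>x. (?J (t + h) x - ?J t x) / h)"
    using L unfolding has_l2_deriv_def at0 by (simp add: L2_M)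
  have dJ: "dJ t \<in> borel_measurable M" using L by (simp add: has_l2_deriv_def L2_M sq_int_def)
  have G: "(\<lambda>x. GG t x - \<eta>' t x) \<in> borel_measurable M"
    using A_sq_int[OF GG(1)[OF t]] \<eta>'_sq[of t] by (auto simp: sq_int_def)
  have "\<forall>\<^sub>F h in at 0. h \<in> {-t<..<T-t}" using t by (intro eventually_at_in_open') auto
  with sq have "\<forall>\<^sub>F h in at 0. (\<integral>x. ((?J (t + h) x - ?J t x) / h - dJ t x)\<^sup>2 \<partial>M)
     = (\<integral>x. ((FF (t + h) x - FF t x) / h - (GG t x - \<eta>' t x))\<^sup>2 \<partial>M)"
  proof eventually_elim
    case (elim h)
    have e: "FF (t + h) x = ?J (t + h) x" "FF t x = ?J t x" for x using elim(2) t by (auto simp: FF_eq)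
    have m: "(\<lambda>x. (?J (t + h) x - ?J t x) / h) \<in> borel_measurable M" using elim(1) by (simp add: sq_int_def)
    show ?case unfolding e
    proof (rule integral_cong_AE)
      show "(\<lambda>x. ((?J (t + h) x - ?J t x) / h - dJ t x)\<^sup>2) \<in> borel_measurable M"
        "(\<lambda>x. ((?J (t + h) x - ?J t x) / h - (GG t x - \<eta>' t x))\<^sup>2) \<in> borel_measurable M"
        by (intro borel_measurable_power borel_measurable_diff[OF m] dJ G)+
      show "AE x in M. ((?J (t + h) x - ?J t x) / h - dJ t x)\<^sup>2 = ((?J (t + h) x - ?J t x) / h - (GG t x - \<eta>' t x))\<^sup>2"
        using GG(2)[OF t] by eventually_elim simp
    qed
  qed
  from Lim_transform_eventually[OF lim this] show ?thesis .
qed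

definition EE :: "real \<Rightarrow> 'd \<Rightarrow> real" where
  "EE t x = (\<integral>s. indicator {0..t} s * \<eta>' s x \<partial>lborel)"

end

section \<open>Transfer of the abstract estimate\<close>

context discrete_dual
begin

lemma mesh_dual_bound:
  obtains B where "mesh_dual M opD \<alpha> T B \<phi>' \<eta>' GG tn N k (ext Yp) (ext AY) (ext AYp)"
proof -
  obtain B where B: "0 \<le> B" "\<forall>t. (\<integral>x. (\<phi>' t x)\<^sup>2 \<partial>M) \<le> B" "\<forall>t. (\<integral>x. (\<eta>' t x)\<^sup>2 \<partial>M) \<le> B" using bound by auto
  have "mesh_dual M opD \<alpha> T B \<phi>' \<eta>' GG tn N k (ext Yp) (ext AY) (ext AYp)"
  proof (unfold_locales, unfold zz_def[symmetric] FF_def[symmetric] avg'_def[symmetric])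
    show "0 < \<alpha>" "\<alpha> < 1" "0 < T" "0 \<le> B" by (fact \<alpha> T B(1))+
    show "case_prod \<phi>' \<in> borel_measurable (borel \<Otimes>\<^sub>M M)" "case_prod \<eta>' \<in> borel_measurable (borel \<Otimes>\<^sub>M M)"
      by (fact \<phi>'_meas \<eta>'_meas)+
    show "case_prod (ext Yp) \<in> borel_measurable (borel \<Otimes>\<^sub>M M)"
      "case_prod (ext AY) \<in> borel_measurable (borel \<Otimes>\<^sub>M M)"
      "case_prod (ext AYp) \<in> borel_measurable (borel \<Otimes>\<^sub>M M)"
      by (intro ext_meas st_meas_M Yp_meas AY_meas AYp_meas)+
  next
    fix t x
    show "sq_int M (\<phi>' t)" "sq_int M (\<eta>' t)" by (fact \<phi>'_sq \<eta>'_sq)+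
    show "(\<integral>x. (\<phi>' t x)\<^sup>2 \<partial>M) \<le> B" "(\<integral>x. (\<eta>' t x)\<^sup>2 \<partial>M) \<le> B" using B by blast+
    assume "t \<notin> {0..T}"
    then show "\<phi>' t x = 0" "\<eta>' t x = 0" "ext Yp t x = 0" "ext AY t x = 0" "ext AYp t x = 0"
      by (simp_all add: \<phi>'_def \<eta>'_def ext_out)
  next
    fix w assume "sq_int M w"
    then show "continuous_on {0..} (\<lambda>t. ip (\<phi>' t) w)" by (rule \<phi>'_weak_cont)
  next
    fix t assume "t \<in> {0..T}"
    then show "((\<lambda>s. \<integral>x. (\<eta>' s x - \<eta>' t x)\<^sup>2 \<partial>M) \<longlongrightarrow> 0) (at t within {0..T})" by (rule \<eta>'_tendsto)
  next
    fix s t assume "s \<in> {0..T}" "t \<in> {0..T}"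
    then obtain g g' where "opD (zz s) g" "opD (zz t) g'" using zz_dom by blast
    then show "\<exists>g. opD (\<lambda>x. zz t x - zz s x) g" using A_diff by blast
  next
    fix t assume t: "0 < t" "t < T"
    show "opD (\<phi>' t) (GG t)" by (rule GG(1)[OF t])
    show "((\<lambda>h. \<integral>x. ((FF (t + h) x - FF t x) / h - (GG t x - \<eta>' t x))\<^sup>2 \<partial>M) \<longlongrightarrow> 0) (at 0)"
      by (rule FF_deriv[OF t])
  next
    fix n t assume n: "n < N" and t: "tn n < t" "t < tn (Suc n)"
    have tT: "t \<in> {0<..<T} - tn ` {0..N}" by (rule not_node[OF n t])
    then have tT': "t \<in> {0..T}" by auto
    show "opD (ext Yp t) (ext AYp t)" using Yp tT opA_imp_opD unfolding ext_in[OF tT'] by blast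
    show "AE x in M. ext Yp t x = \<phi>' t x - avg' n x"
      unfolding ext_in[OF tT'] by (rule Yp_avg[OF n t])
  next
    fix n t assume n: "n < N" and t: "tn n \<le> t" "t \<le> tn (Suc n)"
    have tT: "t \<in> {0..T}" using node_in[OF n] t by auto
    have "opD (Y t) (AY t)" using AY tT opA_imp_opD by blast
    also have "Y t = (\<lambda>x. zz t x - zz (tn n) x - (t - tn n) * avg' n x)" using Y_zz[OF n t] by auto
    finally show "opD (\<lambda>x. zz t x - zz (tn n) x - (t - tn n) * avg' n x) (ext AY t)"
      unfolding ext_in[OF tT] .
  qed
  then show thesis by (rule that)
qed

lemma frac_I_ext:
  assumes t: "t \<in> {0..T}"
  shows "frac_I \<beta> v t x = (\<integral>s. fker \<beta> (t - s) * ext v s x \<partial>lborel)"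
  unfolding frac_I_def set_lebesgue_integral_def
proof (intro Bochner_Integration.integral_cong refl)
  fix s show "indicator {0..t} s *\<^sub>R (omega \<beta> (t - s) * v s x) = fker \<beta> (t - s) * ext v s x"
  proof (cases "s \<in> {0..t}")
    case True
    then show ?thesis using t by (simp add: fker_omega ext_in)
  next
    case False
    then have "fker \<beta> (t - s) = 0 \<or> ext v s x = 0" by (auto simp: fker_def ext_out)
    then show ?thesis using False by auto
  qed
qed

definition R :: real where "R = (LINT t:{0..T}|lborel. (l2_norm \<Omega> (\<eta> t))\<^sup>2)"

lemma R_nonneg: "0 \<le> R"
  unfolding R_def set_lebesgue_integral_def by (rule Bochner_Integration.integral_nonneg) simp

lemma nn_R: "(\<integral>\<^sup>+t. (\<integral>\<^sup>+x. ennreal ((\<eta>' t x)\<^sup>2) \<partial>M) \<partial>lborel) = ennreal R"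
proof -
  obtain B where B: "0 \<le> B" "\<forall>t. (\<integral>x. (\<eta>' t x)\<^sup>2 \<partial>M) \<le> B" using bound by auto
  have [measurable]: "case_prod \<eta>' \<in> borel_measurable (borel \<Otimes>\<^sub>M M)" by (rule \<eta>'_meas)
  have "(\<integral>\<^sup>+t. (\<integral>\<^sup>+x. ennreal ((\<eta>' t x)\<^sup>2) \<partial>M) \<partial>lborel) = (\<integral>\<^sup>+t. ennreal (\<integral>x. (\<eta>' t x)\<^sup>2 \<partial>M) \<partial>lborel)"
    by (simp add: nn_integral_sq_int[OF \<eta>'_sq])
  also have "\<dots> = ennreal (\<integral>t. (\<integral>x. (\<eta>' t x)\<^sup>2 \<partial>M) \<partial>lborel)"
  proof (rule nn_integral_eq_integral)
    show "integrable lborel (\<lambda>t. \<integral>x. (\<eta>' t x)\<^sup>2 \<partial>M)"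
    proof (rule Bochner_Integration.integrable_bound[where f="\<lambda>t. indicator {0..T} t * B"])
      show "integrable lborel (\<lambda>t. indicator {0..T} t * B)"
        by (intro integrable_mult_left integrable_real_indicator) (auto simp: emeasure_lborel_Icc_eq)
      show "AE t in lborel. norm (\<integral>x. (\<eta>' t x)\<^sup>2 \<partial>M) \<le> norm (indicator {0..T} t * B)"
      proof (rule AE_I2)
        fix t show "norm (\<integral>x. (\<eta>' t x)\<^sup>2 \<partial>M) \<le> norm (indicator {0..T} t * B)"
          using B by (cases "t \<in> {0..T}") (auto simp: \<eta>'_def ext_out)
      qed
    qed measurable
  qed simp
  also have "(\<integral>t. (\<integral>x. (\<eta>' t x)\<^sup>2 \<partial>M) \<partial>lborel) = R"
    unfolding R_def set_lebesgue_integral_def l2_norm_M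
  proof (intro Bochner_Integration.integral_cong refl)
    fix t show "(\<integral>x. (\<eta>' t x)\<^sup>2 \<partial>M) = indicator {0..T} t *\<^sub>R (\<integral>x. (\<eta> t x)\<^sup>2 \<partial>M)"
      by (cases "t \<in> {0..T}") (simp_all add: \<eta>'_eq, simp add: \<eta>'_def ext_out)
  qed
  finally show ?thesis .
qed

text \<open>The iterated absolute integral bounds the signed one; integrals that do not converge
  have value 0 and respect the bound as well.\<close>

lemma int0_le:
  assumes C: "0 \<le> C"
    and le: "(\<integral>\<^sup>+t. (\<integral>\<^sup>+x. ennreal \<bar>ext v t x * (indicator {0..T} t * (\<integral>s. fker \<beta> (t - s) * ext w s x \<partial>lborel))\<bar> \<partial>M) \<partial>lborel) \<le> ennreal C"
  shows "int0 (\<lambda>t. l2_inner \<Omega> (v t) (frac_I \<beta> w t)) T \<le> C"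
proof -
  let ?f = "\<lambda>t x. ext v t x * (indicator {0..T} t * (\<integral>s. fker \<beta> (t - s) * ext w s x \<partial>lborel))"
  have eq: "indicator {0..T} t *\<^sub>R l2_inner \<Omega> (v t) (frac_I \<beta> w t) = (\<integral>x. ?f t x \<partial>M)" for t
    by (cases "t \<in> {0..T}") (simp_all add: l2_inner_def LINT_M frac_I_ext ext_in ext_out)
  have abs: "ennreal \<bar>\<integral>x. g x \<partial>L\<bar> \<le> (\<integral>\<^sup>+x. ennreal \<bar>g x\<bar> \<partial>L)" for g :: "'z \<Rightarrow> real" and L
    using integral_norm_bound_ennreal[of L g] by (cases "integrable L g") (auto simp: not_integrable_integral_eq)
  have "ennreal \<bar>\<integral>t. (\<integral>x. ?f t x \<partial>M) \<partial>lborel\<bar> \<le> (\<integral>\<^sup>+t. ennreal \<bar>\<integral>x. ?f t x \<partial>M\<bar> \<partial>lborel)" by (rule abs)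
  also have "\<dots> \<le> (\<integral>\<^sup>+t. (\<integral>\<^sup>+x. ennreal \<bar>?f t x\<bar> \<partial>M) \<partial>lborel)" by (intro nn_integral_mono abs)
  also have "\<dots> \<le> ennreal C" by (rule le)
  finally have "(\<integral>t. (\<integral>x. ?f t x \<partial>M) \<partial>lborel) \<le> C" using C by simp
  then show ?thesis unfolding int0_def set_lebesgue_integral_def eq .
qed

lemma k_pos: "0 < k"
  using T \<gamma> N by (simp add: k_def mesh_tau_def)

lemma estimate:
  "int0 (\<lambda>t. l2_inner \<Omega> (Yp t) (frac_I (1 - \<alpha>) Yp t)) T
      + int0 (\<lambda>t. l2_inner \<Omega> (AY t) (frac_I \<alpha> AYp t)) T
    \<le> (4 * (2 * fker_int (1 - \<alpha>) k) * (2 * fker_int \<alpha> k)\<^sup>2 + k * (2 * fker_int \<alpha> k)) * R"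
proof -
  obtain B where "mesh_dual M opD \<alpha> T B \<phi>' \<eta>' GG tn N k (ext Yp) (ext AY) (ext AYp)"
    by (rule mesh_dual_bound)
  then interpret md: mesh_dual M opD \<alpha> T B \<phi>' \<eta>' GG zz EE FF tn N k "ext Yp" "ext AY" "ext AYp" avg'
    by - (assumption, (rule eq_reflection, rule zz_def EE_def FF_def avg'_def)+)
  have nonneg: "0 \<le> fker_int (1 - \<alpha>) k" "0 \<le> fker_int \<alpha> k" using \<alpha> by (auto intro: fker_int_nonneg)
  have "int0 (\<lambda>t. l2_inner \<Omega> (Yp t) (frac_I (1 - \<alpha>) Yp t)) T \<le> 4 * (2 * fker_int (1 - \<alpha>) k) * (2 * fker_int \<alpha> k)\<^sup>2 * R"
  proof (rule int0_le)
    show "0 \<le> 4 * (2 * fker_int (1 - \<alpha>) k) * (2 * fker_int \<alpha> k)\<^sup>2 * R" using nonneg R_nonneg by simp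
  qed (use md.error_estimate(1) nonneg R_nonneg in \<open>simp only: nn_R ennreal_mult'[symmetric] ennreal_mult''[symmetric]\<close>)
  moreover have "int0 (\<lambda>t. l2_inner \<Omega> (AY t) (frac_I \<alpha> AYp t)) T \<le> k * (2 * fker_int \<alpha> k) * R"
  proof (rule int0_le)
    show "0 \<le> k * (2 * fker_int \<alpha> k) * R" using nonneg R_nonneg k_pos by simp
  qed (use md.error_estimate(2) nonneg R_nonneg in \<open>simp only: nn_R ennreal_mult'[symmetric] ennreal_mult''[symmetric]\<close>)
  ultimately show ?thesis by (simp add: distrib_right)
qed

end

section \<open>Constants uniform in the fractional order\<close>

lemma mult_powr_le_max:
  fixes c \<tau> \<alpha> :: real
  assumes "0 < c" "0 < \<tau>" "0 < \<alpha>" "\<alpha> < 1"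
  shows "(c * \<tau>) powr (1 + \<alpha>) \<le> (max 1 c)\<^sup>2 * \<tau> powr (1 + \<alpha>)"
proof -
  \<comment> \<open>The exponent lies between 1 and 2, so raising the base to at least 1 permits
    replacing the exponent by 2 for all \<alpha> at once.\<close>
  have "c powr (1 + \<alpha>) \<le> (max 1 c) powr (1 + \<alpha>)" using assms by (intro powr_mono2) auto
  also have "\<dots> \<le> (max 1 c) powr 2" using assms by (intro powr_mono) auto
  finally have "c powr (1 + \<alpha>) \<le> (max 1 c)\<^sup>2" by simp
  then show ?thesis using assms by (simp add: powr_mult mult_right_mono)
qed

text \<open>Compactness of [1,2] gives one bound for every \<alpha>, since \<alpha> + 1 and (1 -
  \<alpha>) + 1 both lie there.\<close>

lemma Gamma_lower_bound: "\<exists>g>0. \<forall>x\<in>{1..2::real}. g \<le> Gamma x"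
proof -
  have "continuous_on {1..2::real} Gamma" by (intro continuous_intros) (auto elim!: nonpos_Ints_cases)
  then obtain x where x: "x \<in> {1..2::real}" "\<forall>y\<in>{1..2}. Gamma x \<le> Gamma y"
    using continuous_attains_inf[of "{1..2::real}" Gamma] by auto
  then show ?thesis by (intro exI[of _ "Gamma x"]) (auto intro: Gamma_real_pos)
qed

lemma fker_int_le:
  assumes g: "0 < g" "\<forall>x\<in>{1..2::real}. g \<le> Gamma x" and \<beta>: "0 < \<beta>" "\<beta> < 1"
  shows "fker_int \<beta> k \<le> k powr \<beta> / g"
  unfolding fker_int_def using assms by (intro divide_left_mono mult_pos_pos Gamma_real_pos) auto

text \<open>The exponents combine as (1 - \<alpha>) + 2 \<alpha> = 1 + \<alpha> in the first term
  and directly in the second; 32 is 4 * 2 * 4, the squared factor 2 included.\<close>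

lemma error_constant_le:
  assumes g: "0 < g" "\<forall>x\<in>{1..2::real}. g \<le> Gamma x" and \<alpha>: "0 < \<alpha>" "\<alpha> < 1" and k: "0 < k"
  shows "4 * (2 * fker_int (1 - \<alpha>) k) * (2 * fker_int \<alpha> k)\<^sup>2 + k * (2 * fker_int \<alpha> k)
     \<le> (32 / g ^ 3 + 2 / g) * k powr (1 + \<alpha>)"
proof -
  have k1: "k powr (1 + \<alpha>) = k * k powr \<alpha>" using k by (simp add: powr_add)
  have k2: "k powr (1 - \<alpha>) * k powr \<alpha> = k" using k by (simp add: powr_add[symmetric])
  have le: "fker_int (1 - \<alpha>) k \<le> k powr (1 - \<alpha>) / g" "fker_int \<alpha> k \<le> k powr \<alpha> / g"
    using \<alpha> by (auto intro!: fker_int_le[OF g])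
  have nn: "0 \<le> fker_int (1 - \<alpha>) k" "0 \<le> fker_int \<alpha> k" using \<alpha> by (auto intro: fker_int_nonneg)
  have "fker_int (1 - \<alpha>) k * (fker_int \<alpha> k)\<^sup>2 \<le> (k powr (1 - \<alpha>) / g) * (k powr \<alpha> / g)\<^sup>2"
    using le nn g by (intro mult_mono power_mono) auto
  also have "\<dots> = (k powr (1 - \<alpha>) * k powr \<alpha>) * k powr \<alpha> / g ^ 3"
    by (simp add: power2_eq_square power3_eq_cube)
  finally have 1: "fker_int (1 - \<alpha>) k * (fker_int \<alpha> k)\<^sup>2 \<le> k powr (1 + \<alpha>) / g ^ 3" by (simp add: k1 k2)
  have 2: "k * fker_int \<alpha> k \<le> k powr (1 + \<alpha>) / g"
    using mult_left_mono[OF le(2), of k] k by (simp add: k1)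
  show ?thesis using 1 2 by (simp add: power_mult_distrib distrib_right)
qed

theorem theorem4p5:
  fixes \<Omega> :: "'d::euclidean_space set" and \<kappa> :: "'d \<Rightarrow> real" and T \<gamma> :: real
  assumes dim: "DIM('d) \<le> 3"
    and dom: "\<exists>P. polytope P \<and> \<Omega> = interior P \<and> \<Omega> \<noteq> {}"
    and kappa: "W1inf \<Omega> \<kappa>" "\<exists>\<kappa>min>0. AE x in lebesgue. x \<in> \<Omega> \<longrightarrow> \<kappa>min \<le> \<kappa> x"
    and T: "T > 0" and gamma: "\<gamma> \<ge> 1"
  shows "\<exists>C::real. \<forall>(\<alpha>::real) (N::nat) u0 f u up U Up \<phi> dJ Yp AY AYp.
    (let \<tau> = mesh_tau T \<gamma> N; tn = tnode T \<gamma> N;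
         \<eta> = (\<lambda>t x. u t x - U t x);
         y = (\<lambda>t x. \<phi> 0 x + (LINT s:{0..t}|lborel. \<phi> s x));
         Y = (\<lambda>t x. y t x - interp T \<gamma> N y t x)
     in
      0 < \<alpha> \<and> \<alpha> < 1 \<and> N \<ge> 1 \<and>
      \<comment> \<open>data\<close>
      L2 \<Omega> u0 \<and> st_meas f \<and> (\<forall>t\<in>{0..T}. L2 \<Omega> (f t)) \<and>
      set_integrable lborel {0..T} (\<lambda>t. (l2_norm \<Omega> (f t))\<^sup>2) \<and>
      \<comment> \<open>u solves the fractional PDE\<close>
      st_meas u \<and> st_meas up \<and> l2_cont_on \<Omega> {0..T} u \<and> ae_eq \<Omega> (u 0) u0 \<and>
      (\<forall>t\<in>{0<..T}. has_l2_deriv \<Omega> {0..T} u (up t) t \<and>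
         (AE x in lebesgue. x \<in> \<Omega> \<longrightarrow>
            set_integrable lborel {0..t} (\<lambda>s. omega (1 - \<alpha>) (t - s) * up s x)) \<and>
         (\<exists>g. opA \<Omega> \<kappa> (u t) g \<and> ae_eq \<Omega> (\<lambda>x. frac_I (1 - \<alpha>) up t x + g x) (f t))) \<and>
      \<comment> \<open>U is the continuous piecewise-linear numerical solution\<close>
      st_meas Up \<and> U 0 = u0 \<and>
      (\<forall>n\<in>{1..N}. \<forall>t\<in>{tn (n - 1)..tn n}.
         U t = (\<lambda>x. ((tn n - t) * U (tn (n - 1)) x + (t - tn (n - 1)) * U (tn n) x)
                     / (tn n - tn (n - 1)))) \<and>
      (\<forall>t\<in>{0<..<T} - tn ` {0..N}. has_l2_deriv \<Omega> {0..T} U (Up t) t) \<and>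
      (\<forall>n\<in>{1..N}. \<exists>g. opA \<Omega> \<kappa> (\<lambda>x. (U (tn n) x + U (tn (n - 1)) x) / 2) g \<and>
         ae_eq \<Omega>
           (\<lambda>x. (LINT s:{tn (n - 1)..tn n}|lborel. frac_I (1 - \<alpha>) Up s x) / (tn n - tn (n - 1)) + g x)
           (\<lambda>x. (LINT s:{tn (n - 1)..tn n}|lborel. f s x) / (tn n - tn (n - 1)))) \<and>
      \<comment> \<open>phi solves the dual problem\<close>
      st_meas \<phi> \<and> l2_cont_on \<Omega> {0..T} \<phi> \<and> ae_eq \<Omega> (\<phi> T) (\<lambda>x. 0) \<and>
      (\<forall>t\<in>{0..<T}. AE x in lebesgue. x \<in> \<Omega> \<longrightarrow>
            set_integrable lborel {t..T} (\<lambda>s. omega (1 - \<alpha>) (s - t) * \<phi> s x)) \<and>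
      (\<forall>t\<in>{0<..<T}. has_l2_deriv \<Omega> {0..T} (frac_J T (1 - \<alpha>) \<phi>) (dJ t) t \<and>
         (\<exists>g. opA \<Omega> \<kappa> (\<phi> t) g \<and> ae_eq \<Omega> (\<lambda>x. - dJ t x + g x) (\<eta> t))) \<and>
      \<comment> \<open>Y', A Y, A Y'\<close>
      st_meas Yp \<and> st_meas AY \<and> st_meas AYp \<and>
      (\<forall>t\<in>{0<..<T} - tn ` {0..N}. has_l2_deriv \<Omega> {0..T} Y (Yp t) t \<and> opA \<Omega> \<kappa> (Yp t) (AYp t)) \<and>
      (\<forall>t\<in>{0..T}. opA \<Omega> \<kappa> (Y t) (AY t))
     \<longrightarrow>
      int0 (\<lambda>t. l2_inner \<Omega> (Yp t) (frac_I (1 - \<alpha>) Yp t)) T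
        + int0 (\<lambda>t. l2_inner \<Omega> (AY t) (frac_I \<alpha> AYp t)) T
      \<le> C * \<tau> powr (1 + \<alpha>) * (LINT t:{0..T}|lborel. (l2_norm \<Omega> (\<eta> t))\<^sup>2))"
proof -
  have el: "elliptic \<Omega> \<kappa>"
  proof
    show "open \<Omega>" using dom by auto
    show "bounded \<Omega>" using dom by (auto intro: bounded_subset[OF _ interior_subset] simp: polytope_imp_bounded)
    obtain \<kappa>min where "0 < \<kappa>min" "AE x in lebesgue. x \<in> \<Omega> \<longrightarrow> \<kappa>min \<le> \<kappa> x" using kappa(2) by auto
    from this(2) show "AE x in lebesgue. x \<in> \<Omega> \<longrightarrow> 0 \<le> \<kappa> x"
      by eventually_elim (use \<open>0 < \<kappa>min\<close> in auto)
  qed (rule kappa(1))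
  define c where "c = \<gamma> * T powr ((\<gamma> - 1) / \<gamma>)"
  have c: "0 < c" using T gamma by (simp add: c_def)
  obtain g where g: "0 < g" "\<forall>x\<in>{1..2::real}. g \<le> Gamma x" using Gamma_lower_bound by auto
  show ?thesis
    unfolding Let_def
  \<comment> \<open>The first factor bounds the constants in terms of \<open>k\<close>; the second
    pays for passing from \<open>k\<close> = c \<tau> to \<tau>. Neither depends on \<alpha> or
    \<open>N\<close>.\<close>
  proof (rule exI[of _ "(32 / g ^ 3 + 2 / g) * (max 1 c)\<^sup>2"], intro allI impI, elim conjE, goal_cases)
    case (1 \<alpha> N u0 f u up U Up \<phi> dJ Yp AY AYp)
    interpret discrete_dual \<Omega> \<kappa> T \<gamma> \<alpha> N u0 u U \<phi> dJ Yp AY AYp "\<lambda>t x. u t x - U t x"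
      "\<lambda>t x. \<phi> 0 x + (LINT s:{0..t}|lborel. \<phi> s x)"
      "\<lambda>t x. \<phi> 0 x + (LINT s:{0..t}|lborel. \<phi> s x) - interp T \<gamma> N (\<lambda>t x. \<phi> 0 x + (LINT s:{0..t}|lborel. \<phi> s x)) t x"
      "tnode T \<gamma> N"
    proof (intro discrete_dual.intro discrete_dual_axioms.intro el T gamma refl)
      show "\<forall>n\<in>{1..N}. \<exists>g. opA \<Omega> \<kappa> (\<lambda>x. (U (tnode T \<gamma> N n) x + U (tnode T \<gamma> N (n - 1)) x) / 2) g"
        using 1 by blast
    qed (fact 1)+
    have \<tau>: "0 < mesh_tau T \<gamma> N" using T N by (simp add: mesh_tau_def)
    note estimate
    also have "(4 * (2 * fker_int (1 - \<alpha>) k) * (2 * fker_int \<alpha> k)\<^sup>2 + k * (2 * fker_int \<alpha> k)) * R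
      \<le> ((32 / g ^ 3 + 2 / g) * k powr (1 + \<alpha>)) * R"
      by (intro mult_right_mono error_constant_le g \<alpha> k_pos R_nonneg)
    also have "\<dots> \<le> ((32 / g ^ 3 + 2 / g) * ((max 1 c)\<^sup>2 * mesh_tau T \<gamma> N powr (1 + \<alpha>))) * R"
      using mult_powr_le_max[OF c \<tau> \<alpha>] g
      by (intro mult_right_mono mult_left_mono R_nonneg) (auto simp: k_def c_def)
    finally show ?case by (simp only: R_def mult.assoc)
  qed
qed

end
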